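(* Let $\mathscr B$ be a mixed quasi-norm space on $\mathbf R^{2d}$, and for given $s,t$ set $$\omega_r(x,\xi)=e^{r(|x|^{1/t}+|\xi|^{1/s})},\qquad r\in\mathbf R.$$ Then the following is true: (1) if $s,t\ge\frac12$, then $$\bigcup_{r>0}M(\omega_r,\mathscr B)=\mathcal S_t^s(\mathbf R^d)\quad\text{and}\quad\bigcap_{r<0}M(\omega_r,\mathscr B)=(\mathcal S_t^s)'(\mathbf R^d);$$ (2) if $s,t>\frac12$, then $$\bigcap_{r>0}M(\omega_r,\mathscr B)=\Sigma_t^s(\mathbf R^d)\quad\text{and}\quad\bigcup_{r<0}M(\omega_r,\mathscr B)=(\Sigma_t^s)'(\mathbf R^d).$$
   Context: Gelfand–Shilov spaces: for $h,s,t>0$, $\mathcal S_{t,h}^s(\mathbf R^d)$ is the Banach space of $f\in C^\infty(\mathbf R^d)$ with $\sup_{\alpha,\beta,x}\frac{|x^\beta\partial^\alpha f(x)|}{h^{|\alpha+\beta|}\alpha!^s\beta!^t}<\infty$. $\mathcal S_t^s=\bigcup_{h>0}\mathcal S_{t,h}^s$ and $\Sigma_t^s=\bigcap_{h>0}\mathcal S_{t,h}^s$ with inductive and projective limit topologies; $(\mathcal S_t^s)'$ and $(\Sigma_t^s)'$ are their duals; $\mathcal S_{1/2}'=(\mathcal S_{1/2}^{1/2})'$. $\mathscr B$ is a mixed quasi-norm space on $\mathbf R^{2d}$ if there are $p_1,\dots,p_n\in(0,\infty]$ and subspaces with $V_1\oplus\cdots\oplus V_n=\mathbf R^{2d}$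 such that $\mathscr B=\mathscr B_n$, where $\mathscr B_1=L^{p_1}(V_1)$ and $\mathscr B_j=L^{p_j}(V_j;\mathscr B_{j-1})$, $j=2,\dots,n$. Let $\phi(x)=\pi^{-d/4}e^{-|x|^2/2}$. For $f\in\mathcal S_{1/2}'(\mathbf R^d)$, $V_\phi f(x,\xi)=\mathscr F(f\,\overline{\phi(\cdot-x)})(\xi)$ with $\mathscr Fg(\xi)=(2\pi)^{-d/2}\int g(y)e^{-i\langle y,\xi\rangle}dy$ (in the distribution sense). For a weight $\omega$ on $\mathbf R^{2d}$ (a positive function with $\omega,1/\omega\in L^\infty_{loc}$), $M(\omega,\mathscr B)$ is the set of all $f\in\mathcal S_{1/2}'(\mathbf R^d)$ such that $\|V_\phi f\cdot\omega\|_{\mathscr B}<\infty$. *)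

theory Defs
  imports "HOL-Probability.Essential_Supremum"
begin

section \<open>Gelfand--Shilov spaces\<close>

definition partial_deriv :: "'d::finite \<Rightarrow> (real^'d \<Rightarrow> complex) \<Rightarrow> real^'d \<Rightarrow> complex" where
  "partial_deriv i f x = vector_derivative (\<lambda>r. f (x + r *\<^sub>R axis i 1)) (at 0)"

definition partial_derivs :: "'d::finite list \<Rightarrow> (real^'d \<Rightarrow> complex) \<Rightarrow> real^'d \<Rightarrow> complex" where
  "partial_derivs is f = foldr partial_deriv is f"

definition smooth_fun :: "(real^'d::finite \<Rightarrow> complex) \<Rightarrow> bool" where
  "smooth_fun f \<longleftrightarrow> (\<forall>is. continuous_on UNIV (partial_derivs is f) \<and>
     (\<forall>i x. (\<lambda>r. partial_derivs is f (x + r *\<^sub>R axis i 1)) differentiable (at 0)))"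

lemma count_list_exists: "\<exists>is. \<forall>i. count_list is i = (\<alpha> i :: nat)" for \<alpha> :: "'d::finite \<Rightarrow> nat"
proof -
  have "\<exists>is. \<forall>i. count_list is i = (if i \<in> A then \<alpha> i else 0)" if "finite A" for A :: "'d set"
    using that
  proof (induction A)
    case empty
    show ?case by (rule exI[of _ "[]"]) simp
  next
    case (insert j A)
    then obtain "is" where "\<forall>i. count_list is i = (if i \<in> A then \<alpha> i else 0)" by blast
    moreover have "count_list (replicate n j) i = (if i = j then n else 0)" for n i
      by (induction n) auto
    ultimately show ?case
      using insert.hyps by (intro exI[of _ "replicate (\<alpha> j) j @ is"]) auto
  qed
  from this[of UNIV] show ?thesis by simp
qed

text \<open>The index type carries no order, so the order in which the partial derivatives are
  taken is left to the choice operator; by Schwarz' theorem it is irrelevant for smooth functions.\<close>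

definition multi_deriv :: "('d::finite \<Rightarrow> nat) \<Rightarrow> (real^'d \<Rightarrow> complex) \<Rightarrow> real^'d \<Rightarrow> complex" where
  "multi_deriv \<alpha> f = partial_derivs (SOME is. \<forall>i. count_list is i = \<alpha> i) f"

definition multi_pow :: "real^'d::finite \<Rightarrow> ('d \<Rightarrow> nat) \<Rightarrow> real" where
  "multi_pow x \<beta> = (\<Prod>i\<in>UNIV. (x $ i) ^ \<beta> i)"

definition multi_fact :: "('d::finite \<Rightarrow> nat) \<Rightarrow> real" where
  "multi_fact \<alpha> = (\<Prod>i\<in>UNIV. fact (\<alpha> i))"

definition gs_quot :: "real \<Rightarrow> real \<Rightarrow> real \<Rightarrow> (real^'d::finite \<Rightarrow> complex) \<Rightarrow>
    ('d \<Rightarrow> nat) \<times> ('d \<Rightarrow> nat) \<times> (real^'d) \<Rightarrow> real" where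
  "gs_quot s t h f = (\<lambda>(\<alpha>, \<beta>, x).
     cmod (of_real (multi_pow x \<beta>) * multi_deriv \<alpha> f x) /
     (h ^ (\<Sum>i\<in>UNIV. \<alpha> i + \<beta> i) * multi_fact \<alpha> powr s * multi_fact \<beta> powr t))"

definition gs_norm :: "real \<Rightarrow> real \<Rightarrow> real \<Rightarrow> (real^'d::finite \<Rightarrow> complex) \<Rightarrow> real" where
  "gs_norm s t h f = (SUP \<alpha>\<beta>x. gs_quot s t h f \<alpha>\<beta>x)"

text \<open>In all of the following, \<open>s\<close> governs the derivatives and \<open>t\<close> the decay: the arguments
  \<open>s t h\<close> stand for the upper index \<open>s\<close> and the lower indices \<open>t, h\<close>.\<close>

definition gs_banach :: "real \<Rightarrow> real \<Rightarrow> real \<Rightarrow> (real^'d::finite \<Rightarrow> complex) set" where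
  "gs_banach s t h = {f. smooth_fun f \<and> bdd_above (range (gs_quot s t h f))}"

text \<open>The value \<open>0\<close> outside the space serves only to meet the requirement of \<open>Metric_space\<close> that
  a distance be symmetric and nonnegative on the whole type.\<close>

definition gs_dist :: "real \<Rightarrow> real \<Rightarrow> real \<Rightarrow> (real^'d::finite \<Rightarrow> complex) \<Rightarrow>
    (real^'d \<Rightarrow> complex) \<Rightarrow> real" where
  "gs_dist s t h f g =
     (if f \<in> gs_banach s t h \<and> g \<in> gs_banach s t h then gs_norm s t h (\<lambda>x. f x - g x) else 0)"

definition gs_banach_top :: "real \<Rightarrow> real \<Rightarrow> real \<Rightarrow> (real^'d::finite \<Rightarrow> complex) topology" where
  "gs_banach_top s t h = Metric_space.mtopology (gs_banach s t h) (gs_dist s t h)"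

lemma partial_derivs_lin:
  assumes "smooth_fun f" "smooth_fun g"
  shows "partial_derivs is (\<lambda>x. a * f x + b * g x) = (\<lambda>x. a * partial_derivs is f x + b * partial_derivs is g x)"
proof (induction "is")
  case Nil
  show ?case by (simp add: partial_derivs_def)
next
  case (Cons i "is")
  have st: "partial_derivs (i # is) h = partial_deriv i (partial_derivs is h)" for h :: "real^'a \<Rightarrow> complex"
    by (simp add: partial_derivs_def)
  have "(\<lambda>r. partial_derivs is f (x + r *\<^sub>R axis i 1)) differentiable (at 0)"
       "(\<lambda>r. partial_derivs is g (x + r *\<^sub>R axis i 1)) differentiable (at 0)" for x
    using assms by (auto simp: smooth_fun_def)
  then have "((\<lambda>r. a * partial_derivs is f (x + r *\<^sub>R axis i 1) + b * partial_derivs is g (x + r *\<^sub>R axis i 1))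
     has_vector_derivative (a * partial_deriv i (partial_derivs is f) x + b * partial_deriv i (partial_derivs is g) x)) (at 0)" for x
    unfolding partial_deriv_def
    by (intro has_vector_derivative_add has_vector_derivative_mult_right) (simp_all add: vector_derivative_works[symmetric])
  then show ?case
    unfolding st Cons.IH by (subst (1) partial_deriv_def) (auto intro!: vector_derivative_at)
qed

lemma smooth_fun_lin:
  assumes "smooth_fun f" "smooth_fun g"
  shows "smooth_fun (\<lambda>x. a * f x + b * g x)"
  using assms unfolding smooth_fun_def partial_derivs_lin[OF assms]
  by (auto intro!: continuous_intros derivative_intros)

lemma gs_quot_lin:
  assumes "smooth_fun f" "smooth_fun g" "h > 0"
  shows "gs_quot s t h (\<lambda>x. a * f x + b * g x) z \<le> cmod a * gs_quot s t h f z + cmod b * gs_quot s t h g z"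
proof -
  obtain \<alpha> \<beta> x where z: "z = (\<alpha>, \<beta>, x)" by (cases z)
  define D where "D = h ^ (\<Sum>i\<in>UNIV. \<alpha> i + \<beta> i) * multi_fact \<alpha> powr s * multi_fact \<beta> powr t"
  have D: "D \<ge> 0" using assms(3) by (simp add: D_def)
  let ?m = "complex_of_real (multi_pow x \<beta>)"
  have "cmod (?m * (a * multi_deriv \<alpha> f x + b * multi_deriv \<alpha> g x)) \<le>
     cmod a * cmod (?m * multi_deriv \<alpha> f x) + cmod b * cmod (?m * multi_deriv \<alpha> g x)"
    using norm_triangle_ineq[of "?m * a * multi_deriv \<alpha> f x" "?m * b * multi_deriv \<alpha> g x"]
    by (simp add: norm_mult algebra_simps)
  then have "cmod (?m * (a * multi_deriv \<alpha> f x + b * multi_deriv \<alpha> g x)) / D \<le>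
     (cmod a * cmod (?m * multi_deriv \<alpha> f x) + cmod b * cmod (?m * multi_deriv \<alpha> g x)) / D"
    using D by (rule divide_right_mono)
  then show ?thesis
    unfolding z gs_quot_def prod.case D_def[symmetric]
    by (simp add: multi_deriv_def partial_derivs_lin[OF assms(1,2)] add_divide_distrib)
qed

lemma gs_banach_lin:
  assumes "f \<in> gs_banach s t h" "g \<in> gs_banach s t h" "h > 0"
  shows "(\<lambda>x. a * f x + b * g x) \<in> gs_banach s t h"
    and "gs_norm s t h (\<lambda>x. a * f x + b * g x) \<le> cmod a * gs_norm s t h f + cmod b * gs_norm s t h g"
proof -
  have sm: "smooth_fun f" "smooth_fun g"
    and bd: "bdd_above (range (gs_quot s t h f))" "bdd_above (range (gs_quot s t h g))"
    using assms by (auto simp: gs_banach_def)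
  have le: "gs_quot s t h (\<lambda>x. a * f x + b * g x) z \<le> cmod a * gs_norm s t h f + cmod b * gs_norm s t h g" for z
    by (rule order_trans[OF gs_quot_lin[OF sm assms(3)]], unfold gs_norm_def)
       (intro add_mono mult_left_mono cSUP_upper bd; simp)
  show "(\<lambda>x. a * f x + b * g x) \<in> gs_banach s t h"
    using le smooth_fun_lin[OF sm] by (auto simp: gs_banach_def intro!: bdd_aboveI2)
  show "gs_norm s t h (\<lambda>x. a * f x + b * g x) \<le> cmod a * gs_norm s t h f + cmod b * gs_norm s t h g"
    unfolding gs_norm_def[of _ _ _ "\<lambda>x. a * f x + b * g x"] by (intro cSUP_least le) simp
qed

lemma norm_le_gs_norm:
  assumes "f \<in> gs_banach s t h"
  shows "cmod (f x) \<le> gs_norm s t h f"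
proof -
  have *: "(\<forall>i::'a. count_list is i = 0) \<longleftrightarrow> is = []" for "is"
    by (cases "is") auto
  have "gs_quot s t h f (\<lambda>_. 0, \<lambda>_. 0, x) = cmod (f x)"
    by (simp add: gs_quot_def multi_pow_def multi_fact_def multi_deriv_def * partial_derivs_def)
  moreover have "gs_quot s t h f (\<lambda>_. 0, \<lambda>_. 0, x) \<le> gs_norm s t h f"
    unfolding gs_norm_def using assms by (intro cSUP_upper) (auto simp: gs_banach_def)
  ultimately show ?thesis by simp
qed

lemma Metric_space_gs_banach:
  assumes h: "h > 0"
  shows "Metric_space (gs_banach s t h :: (real^'d::finite \<Rightarrow> complex) set) (gs_dist s t h)"
proof
  have diff: "(\<lambda>x. f x - g x) \<in> gs_banach s t h"
    if "f \<in> gs_banach s t h" "g \<in> gs_banach s t h" for f g :: "real^'d \<Rightarrow> complex"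
    using gs_banach_lin(1)[OF that h, of 1 "-1"] by simp
  fix f g k :: "real^'d \<Rightarrow> complex"
  show "0 \<le> gs_dist s t h f g"
    using order_trans[OF norm_ge_zero norm_le_gs_norm[OF diff, of f g 0]] by (simp add: gs_dist_def)
  have le: "gs_norm s t h (\<lambda>x. f x - g x) \<le> gs_norm s t h (\<lambda>x. g x - f x)"
    if "f \<in> gs_banach s t h" "g \<in> gs_banach s t h" for f g :: "real^'d \<Rightarrow> complex"
    using gs_banach_lin(2)[OF diff[OF that(2,1)] diff[OF that(2,1)] h, of "-1" 0] by simp
  show "gs_dist s t h f g = gs_dist s t h g f"
    by (auto simp: gs_dist_def intro!: antisym le)
  show "gs_dist s t h f g = 0 \<longleftrightarrow> f = g" if fg: "f \<in> gs_banach s t h" "g \<in> gs_banach s t h"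
  proof
    assume "gs_dist s t h f g = 0"
    then have "cmod (f x - g x) \<le> 0" for x
      using norm_le_gs_norm[OF diff[OF fg], of x] fg by (simp add: gs_dist_def)
    then show "f = g" by (auto simp: fun_eq_iff)
  next
    assume "f = g"
    have "gs_norm s t h (\<lambda>x. 0 * f x + 0 * f x) \<le> 0"
      using gs_banach_lin(2)[OF fg(1) fg(1) h, of 0 0] by simp
    moreover have "0 \<le> gs_norm s t h (\<lambda>x. f x - f x)"
      using norm_le_gs_norm[OF diff[OF fg(1) fg(1)], of 0] by simp
    ultimately show "gs_dist s t h f g = 0"
      using \<open>f = g\<close> fg by (simp add: gs_dist_def)
  qed
  show "gs_dist s t h f k \<le> gs_dist s t h f g + gs_dist s t h g k"
    if "f \<in> gs_banach s t h" "g \<in> gs_banach s t h" "k \<in> gs_banach s t h"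
    using gs_banach_lin(2)[OF diff[OF that(1,2)] diff[OF that(2,3)] h, of 1 1] that
    by (simp add: gs_dist_def)
qed

lemma topspace_gs_banach_top: "h > 0 \<Longrightarrow> topspace (gs_banach_top s t h) = gs_banach s t h"
  by (simp add: gs_banach_top_def Metric_space.topspace_mtopology[OF Metric_space_gs_banach])

definition gs_roumieu :: "real \<Rightarrow> real \<Rightarrow> (real^'d::finite \<Rightarrow> complex) set" where
  "gs_roumieu s t = (\<Union>h\<in>{0<..}. gs_banach s t h)"

definition gs_beurling :: "real \<Rightarrow> real \<Rightarrow> (real^'d::finite \<Rightarrow> complex) set" where
  "gs_beurling s t = (\<Inter>h\<in>{0<..}. gs_banach s t h)"

definition absolutely_convex :: "('x \<Rightarrow> complex) set \<Rightarrow> bool" where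
  "absolutely_convex W \<longleftrightarrow> (\<forall>f\<in>W. \<forall>g\<in>W. \<forall>a b. cmod a + cmod b \<le> 1 \<longrightarrow>
     (\<lambda>x. a * f x + b * g x) \<in> W)"

text \<open>The inductive limit is the one of locally convex spaces: the absolutely convex sets whose
  trace on each step is a neighbourhood of zero there form a base of neighbourhoods of zero.\<close>

definition gs_roumieu_nhd0 :: "real \<Rightarrow> real \<Rightarrow> (real^'d::finite \<Rightarrow> complex) set \<Rightarrow> bool" where
  "gs_roumieu_nhd0 s t W \<longleftrightarrow> W \<subseteq> gs_roumieu s t \<and> absolutely_convex W \<and>
     (\<forall>h>0. \<exists>e>0. {f \<in> gs_banach s t h. gs_norm s t h f < e} \<subseteq> W)"

definition gs_roumieu_open :: "real \<Rightarrow> real \<Rightarrow> (real^'d::finite \<Rightarrow> complex) set \<Rightarrow> bool" where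
  "gs_roumieu_open s t U \<longleftrightarrow> U \<subseteq> gs_roumieu s t \<and>
     (\<forall>f\<in>U. \<exists>W. gs_roumieu_nhd0 s t W \<and> (\<lambda>g x. f x + g x) ` W \<subseteq> U)"

definition gs_roumieu_top :: "real \<Rightarrow> real \<Rightarrow> (real^'d::finite \<Rightarrow> complex) topology" where
  "gs_roumieu_top s t = topology (gs_roumieu_open s t)"

text \<open>The projective limit topology is the coarsest one for which all inclusions into the
  steps are continuous.\<close>

definition gs_beurling_top :: "real \<Rightarrow> real \<Rightarrow> (real^'d::finite \<Rightarrow> complex) topology" where
  "gs_beurling_top s t =
     topology_generated_by {U \<inter> gs_beurling s t | U h. 0 < h \<and> openin (gs_banach_top s t h) U}"

lemma istopology_gs_roumieu_open: "istopology (gs_roumieu_open s t)"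
proof -
  have inter: "gs_roumieu_open s t (U \<inter> V)"
    if U: "gs_roumieu_open s t U" and V: "gs_roumieu_open s t V"
    for U V :: "(real^'d \<Rightarrow> complex) set"
    unfolding gs_roumieu_open_def
  proof (intro conjI ballI)
    show "U \<inter> V \<subseteq> gs_roumieu s t"
      using U by (auto simp: gs_roumieu_open_def)
    fix f assume f: "f \<in> U \<inter> V"
    obtain W where W: "gs_roumieu_nhd0 s t W" "(\<lambda>g x. f x + g x) ` W \<subseteq> U"
      using U f by (auto simp: gs_roumieu_open_def)
    obtain X where X: "gs_roumieu_nhd0 s t X" "(\<lambda>g x. f x + g x) ` X \<subseteq> V"
      using V f by (auto simp: gs_roumieu_open_def)
    have "\<exists>e>0. {f \<in> gs_banach s t h. gs_norm s t h f < e} \<subseteq> W \<inter> X" if h: "h > 0" for h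
    proof -
      obtain e where "e > 0" "{f \<in> gs_banach s t h. gs_norm s t h f < e} \<subseteq> W"
        using W(1) h by (auto simp: gs_roumieu_nhd0_def)
      moreover obtain e' where "e' > 0" "{f \<in> gs_banach s t h. gs_norm s t h f < e'} \<subseteq> X"
        using X(1) h by (auto simp: gs_roumieu_nhd0_def)
      ultimately show ?thesis
        by (intro exI[of _ "min e e'"]) auto
    qed
    moreover have "absolutely_convex (W \<inter> X)"
      using W(1) X(1) by (auto simp: gs_roumieu_nhd0_def absolutely_convex_def)
    ultimately have "gs_roumieu_nhd0 s t (W \<inter> X)"
      using W(1) by (auto simp: gs_roumieu_nhd0_def)
    then show "\<exists>W. gs_roumieu_nhd0 s t W \<and> (\<lambda>g x. f x + g x) ` W \<subseteq> U \<inter> V"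
      using W(2) X(2) by (intro exI[of _ "W \<inter> X"]) auto
  qed
  have Un: "gs_roumieu_open s t (\<Union>K)" if "\<forall>U\<in>K. gs_roumieu_open s t U"
    for K :: "(real^'d \<Rightarrow> complex) set set"
    using that unfolding gs_roumieu_open_def by (meson Sup_le_iff UnionE Union_upper order_trans)
  show ?thesis
    unfolding istopology_def using inter Un by blast
qed

lemma topspace_gs_beurling_top: "topspace (gs_beurling_top s t) = gs_beurling s t"
proof -
  have "openin (gs_banach_top s t 1) (gs_banach s t 1)"
    using openin_topspace[of "gs_banach_top s t 1"] by (simp add: topspace_gs_banach_top)
  then have "gs_banach s t 1 \<inter> gs_beurling s t \<in>
      {U \<inter> gs_beurling s t | U h. 0 < h \<and> openin (gs_banach_top s t h) U}"
    by (intro CollectI exI[of _ "gs_banach s t 1"] exI[of _ 1]) simp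
  moreover have "gs_banach s t 1 \<inter> gs_beurling s t = gs_beurling s t"
    by (auto simp: gs_beurling_def)
  ultimately show ?thesis
    unfolding gs_beurling_top_def topology_generated_by_topspace
    by (intro antisym Union_least) auto
qed


section \<open>Duals\<close>

text \<open>A functional on a space \<open>X\<close> of functions is a HOL function that is \<open>undefined\<close> outside \<open>X\<close>,
  so that distinct elements of the dual differ on \<open>X\<close>.\<close>

definition continuous_dual :: "('x \<Rightarrow> complex) topology \<Rightarrow> (('x \<Rightarrow> complex) \<Rightarrow> complex) set" where
  "continuous_dual T = {u \<in> extensional (topspace T).
     (\<forall>f\<in>topspace T. \<forall>g\<in>topspace T. u (\<lambda>x. f x + g x) = u f + u g) \<and>
     (\<forall>c. \<forall>f\<in>topspace T. u (\<lambda>x. c * f x) = c * u f) \<and>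
     continuous_map T euclidean u}"

definition gs_roumieu_dual :: "real \<Rightarrow> real \<Rightarrow> ((real^'d::finite \<Rightarrow> complex) \<Rightarrow> complex) set" where
  "gs_roumieu_dual s t = continuous_dual (gs_roumieu_top s t)"

definition gs_beurling_dual :: "real \<Rightarrow> real \<Rightarrow> ((real^'d::finite \<Rightarrow> complex) \<Rightarrow> complex) set" where
  "gs_beurling_dual s t = continuous_dual (gs_beurling_top s t)"

abbreviation S_half :: "(real^'d::finite \<Rightarrow> complex) set" where
  "S_half \<equiv> gs_roumieu (1/2) (1/2)"

abbreviation S_half_dual :: "((real^'d::finite \<Rightarrow> complex) \<Rightarrow> complex) set" where
  "S_half_dual \<equiv> gs_roumieu_dual (1/2) (1/2)"

text \<open>The embeddings by which functions, respectively functionals on larger test function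
  spaces, are regarded as elements of \<open>S_half_dual\<close>. The pairing is bilinear.\<close>

definition distr_of_fun ::
    "(real^'d::finite \<Rightarrow> complex) \<Rightarrow> (real^'d \<Rightarrow> complex) \<Rightarrow> complex" where
  "distr_of_fun f = restrict (\<lambda>g. LINT y|lborel. f y * g y) S_half"

definition distr_of_dual ::
    "((real^'d::finite \<Rightarrow> complex) \<Rightarrow> complex) \<Rightarrow> (real^'d \<Rightarrow> complex) \<Rightarrow> complex" where
  "distr_of_dual u = restrict u S_half"


section \<open>Mixed quasi-norm spaces\<close>

definition subspace_basis :: "'v::euclidean_space set \<Rightarrow> 'v set" where
  "subspace_basis V = (SOME B. B \<subseteq> V \<and> pairwise orthogonal B \<and> (\<forall>b\<in>B. norm b = 1) \<and> span B = V)"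

text \<open>Lebesgue measure on a subspace, as a measure on the ambient space: the image of the
  product of one-dimensional Lebesgue measures under the isometry given by an orthonormal basis
  (the choice of which is immaterial). On the zero subspace it is the point mass.\<close>

definition subspace_lebesgue :: "'v::euclidean_space set \<Rightarrow> 'v measure" where
  "subspace_lebesgue V = distr (\<Pi>\<^sub>M b\<in>subspace_basis V. (lborel :: real measure)) borel
     (\<lambda>c. \<Sum>b\<in>subspace_basis V. c b *\<^sub>R b)"

definition ennreal_rpow :: "ennreal \<Rightarrow> real \<Rightarrow> ennreal" where
  "ennreal_rpow x r = (if x = \<infinity> then \<infinity> else ennreal (enn2real x powr r))"

definition Lp_qnorm :: "ennreal \<Rightarrow> 'v measure \<Rightarrow> ('v \<Rightarrow> ennreal) \<Rightarrow> ennreal" where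
  "Lp_qnorm p M F = (if p = \<infinity> then esssup M F
     else ennreal_rpow (\<integral>\<^sup>+ v. ennreal_rpow (F v) (enn2real p) \<partial>M) (1 / enn2real p))"

text \<open>The list \<open>[(p\<^sub>1, V\<^sub>1), \<dots>, (p\<^sub>n, V\<^sub>n)]\<close> encodes the space obtained from the exponents \<open>p\<^sub>j\<close> and
  the subspaces \<open>V\<^sub>j\<close>, where \<open>(p\<^sub>1, V\<^sub>1)\<close> is innermost.\<close>

definition mixed_qnorm_space :: "(ennreal \<times> 'v::euclidean_space set) list \<Rightarrow> bool" where
  "mixed_qnorm_space B \<longleftrightarrow>
     (\<forall>(p, V)\<in>set B. 0 < p \<and> subspace V) \<and>
     (\<forall>x. \<exists>!vs. length vs = length B \<and> (\<forall>j<length B. vs ! j \<in> snd (B ! j)) \<and> sum_list vs = x)"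

fun mixed_qnorm :: "(ennreal \<times> 'v::euclidean_space set) list \<Rightarrow> ('v \<Rightarrow> ennreal) \<Rightarrow> ennreal" where
  "mixed_qnorm [] F = F 0"
| "mixed_qnorm ((p, V) # B) F =
     mixed_qnorm B (\<lambda>y. Lp_qnorm p (subspace_lebesgue V) (\<lambda>v. F (v + y)))"


section \<open>Modulation spaces\<close>

definition gauss_window :: "real^'d::finite \<Rightarrow> complex" where
  "gauss_window x = of_real (pi powr (- real CARD('d) / 4) * exp (- (norm x)\<^sup>2 / 2))"

definition distr_mult :: "((real^'d::finite \<Rightarrow> complex) \<Rightarrow> complex) \<Rightarrow> (real^'d \<Rightarrow> complex) \<Rightarrow>
    (real^'d \<Rightarrow> complex) \<Rightarrow> complex" where
  "distr_mult u \<psi> = (\<lambda>g. u (\<lambda>y. \<psi> y * g y))"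

text \<open>The Fourier integral in the distribution sense, i.e. with the integral over \<open>y\<close> replaced by
  the pairing. It is used only for products \<open>u \<cdot> \<psi>\<close> with \<open>\<psi>\<close> a translated Gaussian, for which
  the exponential is an admissible test function.\<close>

definition distr_fourier ::
    "((real^'d::finite \<Rightarrow> complex) \<Rightarrow> complex) \<Rightarrow> real^'d \<Rightarrow> complex" where
  "distr_fourier u \<xi> =
     of_real ((2 * pi) powr (- real CARD('d) / 2)) * u (\<lambda>y. exp (- \<i> * of_real (y \<bullet> \<xi>)))"

definition stft :: "((real^'d::finite \<Rightarrow> complex) \<Rightarrow> complex) \<Rightarrow> (real^'d) \<times> (real^'d) \<Rightarrow> complex" where
  "stft u = (\<lambda>(x, \<xi>). distr_fourier (distr_mult u (\<lambda>y. cnj (gauss_window (y - x)))) \<xi>)"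

definition modulation_space :: "((real^'d::finite) \<times> (real^'d) \<Rightarrow> real) \<Rightarrow>
    (ennreal \<times> ((real^'d) \<times> (real^'d)) set) list \<Rightarrow> ((real^'d \<Rightarrow> complex) \<Rightarrow> complex) set" where
  "modulation_space \<omega> B =
     {u \<in> S_half_dual. mixed_qnorm B (\<lambda>z. ennreal (cmod (stft u z * of_real (\<omega> z)))) < \<infinity>}"

definition exp_weight :: "real \<Rightarrow> real \<Rightarrow> real \<Rightarrow> (real^'d::finite) \<times> (real^'d) \<Rightarrow> real" where
  "exp_weight s t r = (\<lambda>(x, \<xi>). exp (r * (norm x powr (1 / t) + norm \<xi> powr (1 / s))))"

end

theory Submission
  imports Defs "HOL-Probability.Probability" "HOL-Complex_Analysis.Complex_Analysis"
begin

text \<open>Up to a constant, \<open>stft u z\<close> is the value of \<open>u\<close> at the Gaussian wave packet \<open>atom z\<close>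
  (\<open>stft_eq_atom\<close>), and everything is read off from the size of this function of \<open>z\<close>.

  Two estimates connect the levels \<open>h\<close> of the Gelfand--Shilov norms with the rates \<open>r\<close> of the weights.
  A function bounded at level \<open>h\<close> has a transform that decays like the weight of some rate \<open>- r < 0\<close>
  (\<open>stft_fun_decay\<close>), and the level \<open>h\<close> norm of \<open>atom z\<close> grows at most like the weight of some rate
  \<open>r\<close> in \<open>z\<close> (\<open>gs_quot_atom_bound\<close>), so that functionals bounded at level \<open>h\<close> have transforms of this
  growth. For \<open>s, t \<ge> 1/2\<close> the second rate can be made arbitrarily small by a large \<open>h\<close>; for
  \<open>s, t > 1/2\<close> it is finite for every \<open>h\<close>, and the first one becomes arbitrarily large as \<open>h\<close> tends to
  \<open>0\<close>. The Gaussian itself has order exactly \<open>1/2\<close>, which is why the cases \<open>1/2\<close> and \<open>> 1/2\<close> differ.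

  Conversely, a bound on the transform determines the space. A function is the superposition
  \<open>synth\<close> of atoms with its own transform as coefficients (\<open>stft_inversion\<close>), and such a superposition is
  bounded at level \<open>h\<close> as soon as the coefficients decay faster than the atoms grow
  (\<open>synth_in_gs\<close>). A functional may be applied under the integral of a superposition
  (\<open>functional_of_synth\<close>), which gives the pairing identity: \<open>u g\<close> is the integral of the
  product of the transforms of \<open>u\<close> and of \<open>g\<close>, with a reflected frequency (\<open>pairing_identity\<close>). The
  identity shows that elements of the duals are determined by their transforms, extends functionals
  from the smallest test space to the larger ones, and identifies a functional of rapidly decaying
  transform with the function synthesised from this transform.

  The mixed quasi-norm enters only through the size of the transform. Sufficiently fast polynomial
  decay makes it finite (\<open>mixed_qnorm_finite_of_decay\<close>). For the reverse direction,
  \<open>stft u\<close> is a Gaussian times an entire function of \<open>x - \<i>\<xi>\<close>; an entire function stays comparable with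
  its value at a near maximum on a ball around that point (\<open>near_maximum\<close>), and a quasi-norm is bounded below
  by a power of the radius times the minimum over a ball (\<open>mixed_qnorm_ge_on_ball\<close>). This gives a pointwise
  bound with a polynomial loss and a loss of a constant factor in the rate
  (\<open>stft_bound_of_mixed_qnorm\<close>). Both losses disappear in the unions and intersections over all \<open>r\<close>, and
  this is also why the spaces do not depend on the quasi-norm.\<close>

section \<open>Mixed quasi-norms\<close>

lemma subspace_basis_props:
  fixes V :: "'v::euclidean_space set"
  assumes "subspace V"
  shows "subspace_basis V \<subseteq> V" "pairwise orthogonal (subspace_basis V)"
    "\<And>b. b \<in> subspace_basis V \<Longrightarrow> norm b = 1" "span (subspace_basis V) = V"
    "finite (subspace_basis V)"
proof -
  obtain B where "B \<subseteq> V" "pairwise orthogonal B" "\<And>x. x \<in> B \<Longrightarrow> norm x = 1" "span B = V"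
    apply (rule orthonormal_basis_subspace[OF assms])
    subgoal premises prems by (rule prems(1)[OF prems(2,3,4,7)])
    done
  then have ex: "\<exists>B. B \<subseteq> V \<and> pairwise orthogonal B \<and> (\<forall>b\<in>B. norm b = 1) \<and> span B = V"
    by blast
  have *: "subspace_basis V \<subseteq> V \<and> pairwise orthogonal (subspace_basis V) \<and>
      (\<forall>b\<in>subspace_basis V. norm b = 1) \<and> span (subspace_basis V) = V"
    unfolding subspace_basis_def by (rule someI_ex[OF ex])
  then show "subspace_basis V \<subseteq> V" and o: "pairwise orthogonal (subspace_basis V)" and
    n: "\<And>b. b \<in> subspace_basis V \<Longrightarrow> norm b = 1" and "span (subspace_basis V) = V" by auto
  have "0 \<notin> subspace_basis V" using n[of 0] by auto
  then show "finite (subspace_basis V)"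
    using pairwise_orthogonal_independent[OF o] finiteI_independent by blast
qed

lemma subspace_lebesgue_simps [simp]:
  "space (subspace_lebesgue V) = UNIV" "sets (subspace_lebesgue V) = sets borel"
  by (simp_all add: subspace_lebesgue_def)

lemma coord_sum_measurable:
  fixes S :: "'v::euclidean_space set"
  shows "(\<lambda>c. \<Sum>b\<in>S. c b *\<^sub>R b) \<in> (\<Pi>\<^sub>M b\<in>S. (lborel :: real measure)) \<rightarrow>\<^sub>M borel"
  by measurable

lemma coord_sum_mem:
  fixes V :: "'v::euclidean_space set"
  assumes "subspace V"
  shows "(\<Sum>b\<in>subspace_basis V. c b *\<^sub>R b) \<in> V"
  using subspace_basis_props(1)[OF assms]
  by (intro subspace_sum[OF assms] subspace_scale[OF assms]) auto

lemma AE_subspace_lebesgue: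
  fixes V :: "'v::euclidean_space set"
  assumes "subspace V"
  shows "AE v in subspace_lebesgue V. v \<in> V"
  unfolding subspace_lebesgue_def
  by (subst AE_distr_iff[OF coord_sum_measurable])
     (use closed_subspace[OF assms] coord_sum_mem[OF assms] in auto)

text \<open>In coordinates the ball contains the cube of half side \<open>\<rho> / (n + 1)\<close>. The denominator \<open>n + 1\<close> instead
  of \<open>n\<close> covers the zero subspace, whose measure is a point mass.\<close>

lemma emeasure_subspace_ball:
  fixes V :: "'v::euclidean_space set"
  assumes V: "subspace V" and a: "a \<in> V" and \<rho>: "0 < \<rho>"
  defines "n \<equiv> card (subspace_basis V)"
  shows "ennreal ((2 * (\<rho> / (n + 1))) ^ n) \<le> emeasure (subspace_lebesgue V) (ball a \<rho> \<inter> V)"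
proof -
  define S where "S = subspace_basis V"
  note S = subspace_basis_props[OF V, folded S_def]
  interpret product_sigma_finite "\<lambda>b::'v. lborel :: real measure" ..
  obtain c where c: "a = (\<Sum>b\<in>S. c b *\<^sub>R b)"
    using a S(4) span_finite[OF S(5)] by auto
  define e where "e = \<rho> / (n + 1)"
  have e: "0 < e" using \<rho> by (simp add: e_def add_nonneg_pos)
  let ?f = "\<lambda>c. \<Sum>b\<in>S. c b *\<^sub>R b"
  let ?P = "\<Pi>\<^sub>M b\<in>S. (lborel :: real measure)"
  have "ennreal ((2 * e) ^ n) = (\<Prod>b\<in>S. emeasure lborel {c b - e <..< c b + e})"
    using e by (simp add: n_def S_def ennreal_power)
  also have "\<dots> = emeasure ?P (Pi\<^sub>E S (\<lambda>b. {c b - e <..< c b + e}))"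
    by (subst emeasure_PiM) (auto simp: S(5))
  also have "\<dots> \<le> emeasure ?P (?f -` (ball a \<rho> \<inter> V) \<inter> space ?P)"
  proof (rule emeasure_mono)
    show "?f -` (ball a \<rho> \<inter> V) \<inter> space ?P \<in> sets ?P"
      using closed_subspace[OF V] by (intro measurable_sets[OF coord_sum_measurable]) auto
    show "Pi\<^sub>E S (\<lambda>b. {c b - e <..< c b + e}) \<subseteq> ?f -` (ball a \<rho> \<inter> V) \<inter> space ?P"
    proof
      fix k assume k: "k \<in> Pi\<^sub>E S (\<lambda>b. {c b - e <..< c b + e})"
      have "norm (?f k - a) = norm (\<Sum>b\<in>S. (k b - c b) *\<^sub>R b)"
        by (simp add: c sum_subtractf scaleR_left_diff_distrib)
      also have "\<dots> \<le> (\<Sum>b\<in>S. e)"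
      proof (rule sum_norm_le)
        fix b assume b: "b \<in> S"
        then have "c b - e < k b" "k b < c b + e" using k by auto
        then have "\<bar>k b - c b\<bar> \<le> e" by linarith
        then show "norm ((k b - c b) *\<^sub>R b) \<le> e" using S(3)[OF b] by simp
      qed
      also have "\<dots> = n * e" by (simp add: n_def S_def)
      also have "\<dots> < (n + 1) * e" using e by simp
      also have "\<dots> = \<rho>" unfolding e_def by simp
      finally have "?f k \<in> ball a \<rho>" by (simp add: dist_norm norm_minus_commute)
      moreover have "?f k \<in> V" using coord_sum_mem[OF V] by (simp add: S_def)
      moreover have "k \<in> space ?P" using k by (auto simp: space_PiM PiE_def)
      ultimately show "k \<in> ?f -` (ball a \<rho> \<inter> V) \<inter> space ?P" by simp
    qed
  qed
  also have "\<dots> = emeasure (subspace_lebesgue V) (ball a \<rho> \<inter> V)"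
    unfolding subspace_lebesgue_def S_def[symmetric]
    by (subst emeasure_distr[OF coord_sum_measurable]) (use closed_subspace[OF V] in auto)
  finally show ?thesis unfolding e_def by (simp only: of_nat_add of_nat_1)
qed

lemma ennreal_rpow_mono: "x \<le> y \<Longrightarrow> 0 \<le> r \<Longrightarrow> ennreal_rpow x r \<le> ennreal_rpow y r"
  by (auto simp: ennreal_rpow_def top_unique less_top intro!: ennreal_leI powr_mono2 enn2real_mono)

lemma ennreal_rpow_ennreal [simp]: "0 \<le> c \<Longrightarrow> ennreal_rpow (ennreal c) r = ennreal (c powr r)"
  by (simp add: ennreal_rpow_def)

lemma ennreal_rpow_inverse: "0 < r \<Longrightarrow> ennreal_rpow (ennreal_rpow x (1 / r)) r = x"
  by (cases x) (auto simp: powr_powr ennreal_rpow_def)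

lemma ennreal_rpow_inverse': "0 < r \<Longrightarrow> ennreal_rpow (ennreal_rpow x r) (1 / r) = x"
  using ennreal_rpow_inverse[of "1 / r" x] by simp

lemma ennreal_rpow_measurable [measurable]:
  assumes [measurable]: "f \<in> borel_measurable M"
  shows "(\<lambda>x. ennreal_rpow (f x) r) \<in> borel_measurable M"
  unfolding ennreal_rpow_def by measurable

text \<open>Monotonicity and invertibility of the power suffice, so that the value \<open>\<infinity>\<close> requires no
  separate treatment.\<close>

lemma ennreal_rpow_Liminf:
  assumes "0 < r"
  shows "ennreal_rpow (liminf X) r \<le> liminf (\<lambda>n. ennreal_rpow (X n) r)"
  unfolding le_Liminf_iff
proof (intro allI impI)
  fix y assume y: "y < ennreal_rpow (liminf X) r"
  have "ennreal_rpow y (1 / r) < liminf X"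
  proof (rule ccontr)
    assume "\<not> ennreal_rpow y (1 / r) < liminf X"
    then have "ennreal_rpow (liminf X) r \<le> ennreal_rpow (ennreal_rpow y (1 / r)) r"
      using assms by (intro ennreal_rpow_mono) auto
    with y show False using ennreal_rpow_inverse[OF assms] by (simp add: not_le[symmetric])
  qed
  then have "eventually (\<lambda>n. ennreal_rpow y (1 / r) < X n) sequentially"
    using le_Liminf_iff[of "liminf X"] by blast
  then show "eventually (\<lambda>n. y < ennreal_rpow (X n) r) sequentially"
  proof eventually_elim
    case (elim n)
    show ?case
    proof (rule ccontr)
      assume "\<not> y < ennreal_rpow (X n) r"
      then have "ennreal_rpow (ennreal_rpow (X n) r) (1 / r) \<le> ennreal_rpow y (1 / r)"
        using assms by (intro ennreal_rpow_mono) auto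
      with elim show False using ennreal_rpow_inverse'[OF assms] by (simp add: not_le[symmetric])
    qed
  qed
qed

text \<open>A ball carries mass proportional to \<open>\<rho> ^ n\<close>, which contributes \<open>\<rho> powr (n / p)\<close>; as \<open>\<rho> \<le> 1\<close> the
  exponent may be rounded up to a natural number. The constants are uniform in the centre, the radius
  and the function, which the iteration over the subspaces requires.\<close>

lemma Lp_qnorm_ge_on_ball:
  fixes V :: "'v::euclidean_space set"
  assumes V: "subspace V" and p: "0 < p"
  obtains \<kappa> :: real and N :: nat where "0 < \<kappa>"
    "\<And>a \<rho> c F. a \<in> V \<Longrightarrow> 0 < \<rho> \<Longrightarrow> \<rho> \<le> 1 \<Longrightarrow> 0 \<le> c \<Longrightarrow>
      (\<forall>v\<in>V. norm (v - a) < \<rho> \<longrightarrow> ennreal c \<le> F v) \<Longrightarrow>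
      ennreal (\<kappa> * \<rho> ^ N * c) \<le> Lp_qnorm p (subspace_lebesgue V) F"
proof -
  define n where "n = card (subspace_basis V)"
  note eb = emeasure_subspace_ball[OF V, folded n_def]
  have sets: "ball a \<rho> \<inter> V \<in> sets borel" for a \<rho>
    using closed_subspace[OF V] by auto
  show ?thesis
  proof (cases "p = \<infinity>")
    case True
    show ?thesis
    proof (rule that[of 1 0])
      fix a \<rho> c and F :: "'v \<Rightarrow> ennreal"
      assume a: "a \<in> V" "0 < \<rho>" "\<rho> \<le> (1::real)" and c: "0 \<le> c"
        and F': "\<forall>v\<in>V. norm (v - a) < \<rho> \<longrightarrow> ennreal c \<le> F v"
      note F = F'[rule_format]
      have "ennreal c \<le> esssup (subspace_lebesgue V) F"
      proof (rule ccontr)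
        assume "\<not> ?thesis"
        then have lt: "esssup (subspace_lebesgue V) F < ennreal c" by simp
        have "AE v in subspace_lebesgue V. v \<notin> ball a \<rho> \<inter> V"
          using esssup_AE[where M = "subspace_lebesgue V" and f = F]
        proof eventually_elim
          case (elim v)
          show ?case
          proof
            assume "v \<in> ball a \<rho> \<inter> V"
            then have "ennreal c \<le> F v" by (intro F) (auto simp: dist_norm norm_minus_commute)
            with elim lt show False by (meson leD order_trans)
          qed
        qed
        then have "emeasure (subspace_lebesgue V) (ball a \<rho> \<inter> V) = 0"
          by (subst (asm) AE_iff_measurable[of "ball a \<rho> \<inter> V"]) (use sets in auto)
        moreover have "0 < (2 * (\<rho> / (n + 1))) ^ n" using a by simp
        ultimately show False using eb[OF a(1,2)] by (simp add: ennreal_eq_0_iff not_le[symmetric] add.commute)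
      qed
      then show "ennreal (1 * \<rho> ^ 0 * c) \<le> Lp_qnorm p (subspace_lebesgue V) F"
        using True by (simp add: Lp_qnorm_def)
    qed simp
  next
    case False
    define q where "q = enn2real p"
    have q: "0 < q" using p False by (simp add: q_def enn2real_positive_iff less_top)
    define m where "m = (2 / (n + 1)) ^ n"
    have m: "0 < m" by (simp add: m_def)
    define N where "N = nat \<lceil>real n / q\<rceil>"
    have N: "real n / q \<le> N" unfolding N_def by linarith
    show ?thesis
    proof (rule that[of "m powr (1 / q)" N])
      show "0 < m powr (1 / q)" using m by simp
      fix a \<rho> c and F :: "'v \<Rightarrow> ennreal"
      assume a: "a \<in> V" "0 < \<rho>" "\<rho> \<le> (1::real)" and c: "0 \<le> c"
        and F': "\<forall>v\<in>V. norm (v - a) < \<rho> \<longrightarrow> ennreal c \<le> F v"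
      note F = F'[rule_format]
      let ?M = "subspace_lebesgue V"
      have mm: "(2 * (\<rho> / (n + 1))) ^ n = m * \<rho> ^ n"
        by (simp add: m_def power_divide power_mult_distrib)
      have "ennreal (c powr q * (m * \<rho> ^ n)) = ennreal (c powr q) * ennreal (m * \<rho> ^ n)"
        using a m by (simp add: ennreal_mult)
      also have "\<dots> \<le> ennreal (c powr q) * emeasure ?M (ball a \<rho> \<inter> V)"
        using eb[OF a(1,2)] by (intro mult_left_mono) (simp_all add: mm[symmetric] add.commute)
      also have "\<dots> = (\<integral>\<^sup>+v. ennreal (c powr q) * indicator (ball a \<rho> \<inter> V) v \<partial>?M)"
        using sets by (subst nn_integral_cmult_indicator) auto
      also have "\<dots> \<le> (\<integral>\<^sup>+v. ennreal_rpow (F v) q \<partial>?M)"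
      proof (rule nn_integral_mono)
        fix v
        have "ennreal (c powr q) \<le> ennreal_rpow (F v) q" if "v \<in> ball a \<rho> \<inter> V"
          using ennreal_rpow_mono[OF F[of v], of q] that c q
          by (auto simp: dist_norm norm_minus_commute)
        then show "ennreal (c powr q) * indicator (ball a \<rho> \<inter> V) v \<le> ennreal_rpow (F v) q"
          by (cases "v \<in> ball a \<rho> \<inter> V") auto
      qed
      finally have 1: "ennreal (c powr q * (m * \<rho> ^ n)) \<le> (\<integral>\<^sup>+v. ennreal_rpow (F v) q \<partial>?M)" .
      have "\<rho> ^ N = \<rho> powr N" using a by (simp add: powr_realpow)
      also have "\<dots> \<le> \<rho> powr (n / q)" using a N by (intro powr_mono') auto
      also have "\<dots> = (\<rho> ^ n) powr (1 / q)" using a by (simp add: powr_realpow[symmetric] powr_powr)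
      finally have "m powr (1 / q) * \<rho> ^ N * c \<le> m powr (1 / q) * (\<rho> ^ n) powr (1 / q) * c"
        using c by (intro mult_right_mono mult_left_mono) auto
      also have "\<dots> = (c powr q * (m * \<rho> ^ n)) powr (1 / q)"
        using a c m q by (simp add: powr_mult powr_powr)
      finally have "ennreal (m powr (1 / q) * \<rho> ^ N * c) \<le>
          ennreal_rpow (ennreal (c powr q * (m * \<rho> ^ n))) (1 / q)"
        using a m c by (simp add: ennreal_leI)
      also have "\<dots> \<le> ennreal_rpow (\<integral>\<^sup>+v. ennreal_rpow (F v) q \<partial>?M) (1 / q)"
        using 1 q by (intro ennreal_rpow_mono) auto
      finally show "ennreal (m powr (1 / q) * \<rho> ^ N * c) \<le> Lp_qnorm p ?M F"
        using False by (simp add: Lp_qnorm_def q_def)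
    qed
  qed
qed

text \<open>Induction over the list: on a box the innermost quasi-norm is bounded below by a constant on the
  box spanned by the remaining components.\<close>

lemma mixed_qnorm_ge_on_box:
  fixes B :: "(ennreal \<times> 'v::euclidean_space set) list"
  assumes "\<forall>(p, V)\<in>set B. 0 < p \<and> subspace V"
  shows "\<exists>\<kappa>>0. \<exists>N::nat. \<forall>as \<rho> c F. list_all2 (\<lambda>a pV. a \<in> snd pV) as B \<longrightarrow> 0 < \<rho> \<longrightarrow> \<rho> \<le> 1 \<longrightarrow>
      0 \<le> c \<longrightarrow>
      (\<forall>vs. list_all2 (\<lambda>v pV. v \<in> snd pV) vs B \<longrightarrow> list_all2 (\<lambda>v a. norm (v - a) < \<rho>) vs as \<longrightarrow>
        ennreal c \<le> F (sum_list vs)) \<longrightarrow>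
      ennreal (\<kappa> * \<rho> ^ N * c) \<le> mixed_qnorm B F"
  using assms
proof (induction B)
  case Nil
  show ?case by (intro exI[of _ 1] exI[of _ 0] conjI) auto
next
  case (Cons pV B)
  obtain p V where pV: "pV = (p, V)" by (cases pV)
  have "\<forall>(p, V)\<in>set B. 0 < p \<and> subspace V" using Cons.prems by simp
  from Cons.IH[OF this] obtain \<kappa> N where \<kappa>: "0 < \<kappa>" and
    "\<forall>as \<rho> c F. list_all2 (\<lambda>a pV. a \<in> snd pV) as B \<longrightarrow> 0 < \<rho> \<longrightarrow> \<rho> \<le> 1 \<longrightarrow>
      0 \<le> c \<longrightarrow>
      (\<forall>vs. list_all2 (\<lambda>v pV. v \<in> snd pV) vs B \<longrightarrow> list_all2 (\<lambda>v a. norm (v - a) < \<rho>) vs as \<longrightarrow>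
        ennreal c \<le> F (sum_list vs)) \<longrightarrow>
      ennreal (\<kappa> * \<rho> ^ N * c) \<le> mixed_qnorm B F"
    by blast
  note IH = this(2)[rule_format]
  have pV': "subspace V" "0 < p" using Cons.prems pV by auto
  obtain \<kappa>' N' where \<kappa>': "0 < \<kappa>'" and
    step: "\<And>a \<rho> c F. a \<in> V \<Longrightarrow> 0 < \<rho> \<Longrightarrow> \<rho> \<le> 1 \<Longrightarrow> 0 \<le> c \<Longrightarrow>
      (\<forall>v\<in>V. norm (v - a) < \<rho> \<longrightarrow> ennreal c \<le> F v) \<Longrightarrow>
      ennreal (\<kappa>' * \<rho> ^ N' * c) \<le> Lp_qnorm p (subspace_lebesgue V) F"
    apply (rule Lp_qnorm_ge_on_ball[OF pV'])
    subgoal premises prems by (rule prems(1)[OF prems(2,3)])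
    done
  have "ennreal (\<kappa> * \<kappa>' * \<rho> ^ (N + N') * c) \<le> mixed_qnorm (pV # B) F"
    if as: "list_all2 (\<lambda>a pV. a \<in> snd pV) as (pV # B)" and \<rho>: "0 < \<rho>" "\<rho> \<le> 1" and c: "0 \<le> c"
      and F: "\<forall>vs. list_all2 (\<lambda>v pV. v \<in> snd pV) vs (pV # B) \<longrightarrow> list_all2 (\<lambda>v a. norm (v - a) < \<rho>) vs as \<longrightarrow>
        ennreal c \<le> F (sum_list vs)" for as \<rho> c F
  proof -
    obtain a bs where ab: "as = a # bs" "a \<in> V" "list_all2 (\<lambda>a pV. a \<in> snd pV) bs B"
      using as pV by (auto simp: list_all2_Cons2)
    have "ennreal (\<kappa> * \<rho> ^ N * (\<kappa>' * \<rho> ^ N' * c)) \<le>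
        mixed_qnorm B (\<lambda>y. Lp_qnorm p (subspace_lebesgue V) (\<lambda>v. F (v + y)))"
    proof (rule IH[OF ab(3) \<rho>])
      show "0 \<le> \<kappa>' * \<rho> ^ N' * c" using \<kappa>' \<rho> c by simp
      fix vs assume vs: "list_all2 (\<lambda>v pV. v \<in> snd pV) vs B" "list_all2 (\<lambda>v a. norm (v - a) < \<rho>) vs bs"
      show "ennreal (\<kappa>' * \<rho> ^ N' * c) \<le> Lp_qnorm p (subspace_lebesgue V) (\<lambda>v. F (v + sum_list vs))"
      proof (intro step[OF ab(2) \<rho> c] ballI impI)
        fix v assume "v \<in> V" "norm (v - a) < \<rho>"
        then show "ennreal c \<le> F (v + sum_list vs)"
          using F[rule_format, of "v # vs"] pV ab(1) vs by simp
      qed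
    qed
    then show ?thesis by (simp add: pV power_add mult_ac)
  qed
  then show ?case using \<kappa> \<kappa>' by (intro exI[of _ "\<kappa> * \<kappa>'"] exI[of _ "N + N'"] conjI) auto
qed

lemma list_all2_component_iff:
  "list_all2 (\<lambda>v pV. v \<in> snd pV) vs B \<longleftrightarrow> length vs = length B \<and> (\<forall>j<length B. vs ! j \<in> snd (B ! j))"
  by (auto simp: list_all2_conv_all_nth)

lemma mixed_qnorm_space_decompose:
  assumes "mixed_qnorm_space B"
  obtains vs where "list_all2 (\<lambda>v pV. v \<in> snd pV) vs B" "sum_list vs = x"
  using assms unfolding mixed_qnorm_space_def list_all2_component_iff by metis

text \<open>Summation of the components maps the box of size \<open>\<rho> / (n + 1)\<close>, for \<open>n\<close> subspaces, around
  the components of the centre into the ball of radius \<open>\<rho>\<close>. Since the subspaces need not be orthogonal, only this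
  inclusion, and no identity of measures, relates the box to the ball.\<close>

lemma mixed_qnorm_ge_on_ball:
  fixes B :: "(ennreal \<times> 'v::euclidean_space set) list"
  assumes B: "mixed_qnorm_space B"
  obtains \<kappa> :: real and N :: nat where "0 < \<kappa>"
    "\<And>z \<rho> c F. 0 < \<rho> \<Longrightarrow> \<rho> \<le> 1 \<Longrightarrow> 0 \<le> c \<Longrightarrow> (\<And>w. w \<in> ball z \<rho> \<Longrightarrow> ennreal c \<le> F w) \<Longrightarrow>
      ennreal (\<kappa> * \<rho> ^ N * c) \<le> mixed_qnorm B F"
proof -
  have "\<forall>(p, V)\<in>set B. 0 < p \<and> subspace V" using B unfolding mixed_qnorm_space_def by blast
  from mixed_qnorm_ge_on_box[OF this] obtain \<kappa> N where \<kappa>: "0 < \<kappa>" and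
    "\<forall>as \<rho> c F. list_all2 (\<lambda>a pV. a \<in> snd pV) as B \<longrightarrow> 0 < \<rho> \<longrightarrow> \<rho> \<le> 1 \<longrightarrow>
      0 \<le> c \<longrightarrow>
      (\<forall>vs. list_all2 (\<lambda>v pV. v \<in> snd pV) vs B \<longrightarrow> list_all2 (\<lambda>v a. norm (v - a) < \<rho>) vs as \<longrightarrow>
        ennreal c \<le> F (sum_list vs)) \<longrightarrow>
      ennreal (\<kappa> * \<rho> ^ N * c) \<le> mixed_qnorm B F"
    by blast
  note * = this(2)[rule_format]
  define L where "L = real (length B) + 1"
  have L: "1 \<le> L" by (simp add: L_def)
  have near: "norm (sum_list vs - sum_list as) \<le> length vs * e"
    if "list_all2 (\<lambda>v a. norm (v - a) < e) vs as" for vs as :: "'v list" and e :: real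
    using that
  proof (induction rule: list_all2_induct)
    case (Cons v vs a as)
    have "norm (sum_list (v # vs) - sum_list (a # as)) \<le> norm (v - a) + norm (sum_list vs - sum_list as)"
      using norm_triangle_ineq[of "v - a" "sum_list vs - sum_list as"] by (simp add: algebra_simps)
    with Cons show ?case by (simp add: algebra_simps)
  qed simp
  show ?thesis
  proof (rule that[of "\<kappa> / L ^ N" N])
    show "0 < \<kappa> / L ^ N" using \<kappa> L by simp
    fix z \<rho> c and F :: "'v \<Rightarrow> ennreal"
    assume \<rho>: "0 < \<rho>" "\<rho> \<le> (1::real)" and c: "0 \<le> c" and F: "\<And>w. w \<in> ball z \<rho> \<Longrightarrow> ennreal c \<le> F w"
    obtain as where as: "list_all2 (\<lambda>v pV. v \<in> snd pV) as B" "sum_list as = z"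
      using mixed_qnorm_space_decompose[OF B] .
    have "ennreal (\<kappa> * (\<rho> / L) ^ N * c) \<le> mixed_qnorm B F"
    proof (rule *[OF as(1)])
      show "0 < \<rho> / L" using \<rho> L by simp
      show "\<rho> / L \<le> 1" using \<rho> L by (simp add: divide_le_eq)
      fix vs assume vs: "list_all2 (\<lambda>v pV. v \<in> snd pV) vs B" "list_all2 (\<lambda>v a. norm (v - a) < \<rho> / L) vs as"
      have "norm (sum_list vs - z) \<le> length B * (\<rho> / L)"
        using near[OF vs(2)] as list_all2_lengthD[OF vs(1)] by simp
      also have "\<dots> < L * (\<rho> / L)" using \<rho> L by (intro mult_strict_right_mono) (auto simp: L_def)
      also have "\<dots> = \<rho>" using L by simp
      finally show "ennreal c \<le> F (sum_list vs)"
        by (intro F) (simp add: dist_norm norm_minus_commute)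
    qed (rule c)
    then show "ennreal (\<kappa> / L ^ N * \<rho> ^ N * c) \<le> mixed_qnorm B F"
      by (simp add: power_divide)
  qed
qed

text \<open>Lower semicontinuity passes, by Fatou's lemma, from a function to its quasi-norm in some of the
  variables, and it implies the measurability which the integration in the next variables demands.\<close>

definition seq_lsc :: "('v::metric_space \<Rightarrow> ennreal) \<Rightarrow> bool" where
  "seq_lsc F \<longleftrightarrow> (\<forall>X x. X \<longlonglongrightarrow> x \<longrightarrow> F x \<le> liminf (\<lambda>n. F (X n)))"

lemma seq_lsc_measurable:
  assumes "seq_lsc F"
  shows "F \<in> borel_measurable borel"
proof (rule borel_measurableI_greater)
  fix c
  have "closed {x. F x \<le> c}"
    unfolding closed_sequential_limits
  proof (intro allI impI)
    fix X l assume X: "(\<forall>n. X n \<in> {x. F x \<le> c}) \<and> X \<longlonglongrightarrow> l"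
    then have "F l \<le> liminf (\<lambda>n. F (X n))" using assms by (simp add: seq_lsc_def)
    also have "\<dots> \<le> c" using X by (intro Liminf_le) auto
    finally show "l \<in> {x. F x \<le> c}" by simp
  qed
  moreover have "{x. c < F x} = - {x. F x \<le> c}" by auto
  ultimately have "open {x. c < F x}" by (simp add: open_Compl)
  then show "{x \<in> space borel. c < F x} \<in> sets borel" by simp
qed

lemma seq_lsc_shift:
  fixes F :: "'v::euclidean_space \<Rightarrow> ennreal"
  assumes "seq_lsc F"
  shows "seq_lsc (\<lambda>v. F (v + y))"
  unfolding seq_lsc_def
proof (intro allI impI)
  fix X :: "nat \<Rightarrow> 'v" and x assume "X \<longlonglongrightarrow> x"
  then have "(\<lambda>n. X n + y) \<longlonglongrightarrow> x + y" by (intro tendsto_intros)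
  then show "F (x + y) \<le> liminf (\<lambda>n. F (X n + y))" using assms by (simp add: seq_lsc_def)
qed

lemma shift_measurable:
  fixes F :: "'v::euclidean_space \<Rightarrow> ennreal"
  assumes "seq_lsc F"
  shows "(\<lambda>v. F (v + y)) \<in> borel_measurable (subspace_lebesgue V)"
  using seq_lsc_measurable[OF seq_lsc_shift[OF assms, of y]] by (simp add: measurable_def)

lemma esssup_le_liminf:
  assumes [measurable]: "\<And>n. G n \<in> borel_measurable M" and F [measurable]: "F \<in> borel_measurable M"
    and le: "\<And>v. F v \<le> liminf (\<lambda>n. G n v :: ennreal)"
  shows "esssup M F \<le> liminf (\<lambda>n. esssup M (G n))"
proof (rule esssup_I[OF F])
  have "AE v in M. \<forall>n. G n v \<le> esssup M (G n)"
    by (subst AE_all_countable) (auto intro: esssup_AE)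
  then show "AE v in M. F v \<le> liminf (\<lambda>n. esssup M (G n))"
  proof eventually_elim
    case (elim v)
    have "F v \<le> liminf (\<lambda>n. G n v)" by (rule le)
    also have "\<dots> \<le> liminf (\<lambda>n. esssup M (G n))" using elim by (intro Liminf_mono) simp
    finally show ?case .
  qed
qed

lemma seq_lsc_Lp_qnorm:
  fixes F :: "'v::euclidean_space \<Rightarrow> ennreal"
  assumes p: "0 < p" and F: "seq_lsc F"
  shows "seq_lsc (\<lambda>y. Lp_qnorm p (subspace_lebesgue V) (\<lambda>v. F (v + y)))"
  unfolding seq_lsc_def
proof (intro allI impI)
  fix X :: "nat \<Rightarrow> 'v" and x assume X: "X \<longlonglongrightarrow> x"
  have le: "F (v + x) \<le> liminf (\<lambda>n. F (v + X n))" for v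
  proof -
    have "(\<lambda>n. v + X n) \<longlonglongrightarrow> v + x" using X by (intro tendsto_intros)
    then show ?thesis using F by (simp add: seq_lsc_def)
  qed
  note [measurable] = shift_measurable[OF F, of _ V]
  let ?M = "subspace_lebesgue V"
  show "Lp_qnorm p ?M (\<lambda>v. F (v + x)) \<le> liminf (\<lambda>n. Lp_qnorm p ?M (\<lambda>v. F (v + X n)))"
  proof (cases "p = \<infinity>")
    case True
    then show ?thesis
      unfolding Lp_qnorm_def using esssup_le_liminf[OF _ _ le, where M = ?M] by simp
  next
    case False
    define q where "q = enn2real p"
    have q: "0 < q" using p False by (simp add: q_def enn2real_positive_iff less_top)
    have "(\<integral>\<^sup>+v. ennreal_rpow (F (v + x)) q \<partial>?M) \<le> (\<integral>\<^sup>+v. liminf (\<lambda>n. ennreal_rpow (F (v + X n)) q) \<partial>?M)"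
      using q by (intro nn_integral_mono order_trans[OF ennreal_rpow_mono[OF le] ennreal_rpow_Liminf]) auto
    also have "\<dots> \<le> liminf (\<lambda>n. \<integral>\<^sup>+v. ennreal_rpow (F (v + X n)) q \<partial>?M)"
      by (intro nn_integral_liminf) measurable
    finally have "ennreal_rpow (\<integral>\<^sup>+v. ennreal_rpow (F (v + x)) q \<partial>?M) (1 / q) \<le>
      ennreal_rpow (liminf (\<lambda>n. \<integral>\<^sup>+v. ennreal_rpow (F (v + X n)) q \<partial>?M)) (1 / q)"
      using q by (intro ennreal_rpow_mono) auto
    also have "\<dots> \<le> liminf (\<lambda>n. ennreal_rpow (\<integral>\<^sup>+v. ennreal_rpow (F (v + X n)) q \<partial>?M) (1 / q))"
      using q by (intro ennreal_rpow_Liminf) simp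
    finally show ?thesis using False by (simp add: Lp_qnorm_def q_def)
  qed
qed

lemma abs_coord_le_norm_sum:
  fixes S :: "'v::euclidean_space set"
  assumes S: "pairwise orthogonal S" "\<And>b. b \<in> S \<Longrightarrow> norm b = 1" "finite S" and b: "b \<in> S"
  shows "\<bar>c b\<bar> \<le> norm (\<Sum>b\<in>S. c b *\<^sub>R b)"
proof -
  have "(\<Sum>a\<in>S. c a *\<^sub>R a) \<bullet> b = (\<Sum>a\<in>S. if a = b then c a else 0)"
    unfolding inner_sum_left
  proof (rule sum.cong)
    fix a assume a: "a \<in> S"
    show "c a *\<^sub>R a \<bullet> b = (if a = b then c a else 0)"
      using S(1) S(2)[OF a] a b by (auto simp: pairwise_def orthogonal_def dot_square_norm)
  qed simp
  also have "\<dots> = c b" using S(3) b by simp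
  finally show ?thesis
    using Cauchy_Schwarz_ineq2[of "\<Sum>a\<in>S. c a *\<^sub>R a" b] S(2)[OF b] by simp
qed

lemma nn_integral_inverse_1_plus_square_finite:
  "(\<integral>\<^sup>+x. ennreal (inverse (1 + x\<^sup>2)) \<partial>lborel) < \<infinity>"
proof -
  have "integrable lborel (\<lambda>x::real. inverse (1 + x\<^sup>2))"
    using integrable_inverse_1_plus_square by (simp add: set_integrable_def)
  then show ?thesis by (simp add: integrable_iff_bounded)
qed

text \<open>In orthonormal coordinates a sufficiently high power of \<open>1 / (1 + norm v)\<close> is dominated by
  the product of the functions \<open>1 / (1 + c\<^sup>2)\<close> of the coordinates, whose integral factorises. The bound is
  assumed on \<open>V\<close> only, on which the measure is concentrated.\<close>

lemma Lp_qnorm_finite_of_decay: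
  fixes V :: "'v::euclidean_space set"
  assumes V: "subspace V" and p: "0 < p"
  obtains N :: nat and I :: real where "0 \<le> I"
    "\<And>D F. 0 \<le> D \<Longrightarrow> F \<in> borel_measurable borel \<Longrightarrow> (\<forall>v\<in>V. F v \<le> ennreal (D / (1 + norm v) ^ N)) \<Longrightarrow>
      Lp_qnorm p (subspace_lebesgue V) F \<le> ennreal (D * I)"
proof (cases "p = \<infinity>")
  case True
  show ?thesis
  proof (rule that[of 1 0])
    fix D and F :: "'v \<Rightarrow> ennreal"
    assume F: "F \<in> borel_measurable borel" "\<forall>v\<in>V. F v \<le> ennreal (D / (1 + norm v) ^ 0)"
    have "esssup (subspace_lebesgue V) F \<le> ennreal D"
      using AE_subspace_lebesgue[OF V]
      by (intro esssup_I) (use F in \<open>auto simp: measurable_def\<close>)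
    then show "Lp_qnorm p (subspace_lebesgue V) F \<le> ennreal (D * 1)"
      using True by (simp add: Lp_qnorm_def)
  qed simp
next
  case False
  define q where "q = enn2real p"
  have q: "0 < q" using p False by (simp add: q_def enn2real_positive_iff less_top)
  define S where "S = subspace_basis V"
  note S = subspace_basis_props[OF V, folded S_def]
  interpret product_sigma_finite "\<lambda>b::'v. lborel :: real measure" ..
  let ?f = "\<lambda>c. \<Sum>b\<in>S. c b *\<^sub>R b"
  let ?P = "\<Pi>\<^sub>M b\<in>S. (lborel :: real measure)"
  let ?M = "subspace_lebesgue V"
  define N where "N = nat \<lceil>2 * real (card S) / q\<rceil>"
  have "2 * real (card S) / q \<le> N" unfolding N_def by linarith
  then have N: "2 * real (card S) \<le> N * q" using q by (simp add: field_simps)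
  let ?J = "\<integral>\<^sup>+v. ennreal ((1 / (1 + norm v) ^ N) powr q) \<partial>?M"
  have J: "?J < \<infinity>"
  proof -
    have "?J = (\<integral>\<^sup>+c. ennreal ((1 / (1 + norm (?f c)) ^ N) powr q) \<partial>?P)"
      unfolding subspace_lebesgue_def S_def[symmetric]
      by (rule nn_integral_distr[OF coord_sum_measurable]) measurable
    also have "\<dots> \<le> (\<integral>\<^sup>+c. (\<Prod>b\<in>S. ennreal (inverse (1 + (c b)\<^sup>2))) \<partial>?P)"
    proof (rule nn_integral_mono)
      fix c :: "'v \<Rightarrow> real"
      define r where "r = norm (?f c)"
      have r: "0 \<le> r" by (simp add: r_def)
      have "(\<Prod>b\<in>S. 1 + (c b)\<^sup>2) \<le> (\<Prod>b\<in>S. (1 + r)\<^sup>2)"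
      proof (rule prod_mono)
        fix b assume b: "b \<in> S"
        have "(c b)\<^sup>2 \<le> r\<^sup>2"
          using abs_coord_le_norm_sum[OF S(2,3,5) b, of c] power_mono[of "\<bar>c b\<bar>" r 2] by (simp add: r_def)
        then show "0 \<le> 1 + (c b)\<^sup>2 \<and> 1 + (c b)\<^sup>2 \<le> (1 + r)\<^sup>2"
          using r by (auto simp: power2_sum)
      qed
      also have "\<dots> = (1 + r) ^ (2 * card S)" by (simp add: power_mult)
      also have "\<dots> = (1 + r) powr (2 * card S)"
        using powr_realpow[of "1 + r" "2 * card S"] r by simp
      also have "\<dots> \<le> (1 + r) powr (N * q)" using N r by (intro powr_mono) auto
      finally have le: "(\<Prod>b\<in>S. 1 + (c b)\<^sup>2) \<le> (1 + r) powr (N * q)" .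
      have "(1 / (1 + r) ^ N) powr q = inverse ((1 + r) powr (N * q))"
      proof -
        have "(1 / (1 + r) ^ N) powr q = 1 / ((1 + r) powr N) powr q"
          using r by (simp add: powr_divide powr_realpow)
        then show ?thesis by (simp add: powr_powr divide_inverse)
      qed
      also have "\<dots> \<le> inverse (\<Prod>b\<in>S. 1 + (c b)\<^sup>2)"
        using le by (intro le_imp_inverse_le prod_pos) (auto simp: add_pos_nonneg)
      also have "\<dots> = (\<Prod>b\<in>S. inverse (1 + (c b)\<^sup>2))"
        using prod_inversef[of "\<lambda>b. 1 + (c b)\<^sup>2" S] by (simp add: comp_def)
      finally show "ennreal ((1 / (1 + norm (?f c)) ^ N) powr q) \<le> (\<Prod>b\<in>S. ennreal (inverse (1 + (c b)\<^sup>2)))"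
        unfolding r_def[symmetric] by (subst prod_ennreal) (auto intro: ennreal_leI)
    qed
    also have "\<dots> = (\<Prod>b\<in>S. \<integral>\<^sup>+x. ennreal (inverse (1 + x\<^sup>2)) \<partial>lborel)"
      using S(5) by (subst product_nn_integral_prod) auto
    also have "\<dots> < \<infinity>"
      using nn_integral_inverse_1_plus_square_finite by (simp add: less_top[symmetric] ennreal_prod_eq_top power_eq_top_ennreal)
    finally show ?thesis .
  qed
  define I where "I = enn2real ?J powr (1 / q)"
  show ?thesis
  proof (rule that[of I N])
    show "0 \<le> I" by (simp add: I_def)
    fix D and F :: "'v \<Rightarrow> ennreal"
    assume D: "0 \<le> D" and F: "F \<in> borel_measurable borel" "\<forall>v\<in>V. F v \<le> ennreal (D / (1 + norm v) ^ N)"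
    have "(\<integral>\<^sup>+v. ennreal_rpow (F v) q \<partial>?M) \<le> (\<integral>\<^sup>+v. ennreal (D powr q) * ennreal ((1 / (1 + norm v) ^ N) powr q) \<partial>?M)"
    proof (rule nn_integral_mono_AE)
      show "AE v in ?M. ennreal_rpow (F v) q \<le> ennreal (D powr q) * ennreal ((1 / (1 + norm v) ^ N) powr q)"
        using AE_subspace_lebesgue[OF V]
      proof eventually_elim
        case (elim v)
        have "ennreal_rpow (F v) q \<le> ennreal_rpow (ennreal (D / (1 + norm v) ^ N)) q"
          using q F(2) elim by (intro ennreal_rpow_mono) auto
        also have "\<dots> = ennreal (D powr q * (1 / (1 + norm v) ^ N) powr q)"
          using D by (simp add: powr_divide)
        also have "\<dots> = ennreal (D powr q) * ennreal ((1 / (1 + norm v) ^ N) powr q)"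
          by (simp add: ennreal_mult)
        finally show ?case .
      qed
    qed
    also have "\<dots> = ennreal (D powr q) * ?J"
    proof (rule nn_integral_cmult)
      have "(\<lambda>v::'v. ennreal ((1 / (1 + norm v) ^ N) powr q)) \<in> borel_measurable borel" by measurable
      then show "(\<lambda>v. ennreal ((1 / (1 + norm v) ^ N) powr q)) \<in> borel_measurable ?M"
        by (simp add: measurable_def)
    qed
    also have "\<dots> = ennreal (D powr q * enn2real ?J)"
      using J by (simp add: ennreal_mult ennreal_enn2real)
    finally have "ennreal_rpow (\<integral>\<^sup>+v. ennreal_rpow (F v) q \<partial>?M) (1 / q) \<le>
        ennreal_rpow (ennreal (D powr q * enn2real ?J)) (1 / q)"
      using q by (intro ennreal_rpow_mono) auto
    also have "\<dots> = ennreal (D * I)"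
      using D q by (simp add: I_def powr_mult powr_powr)
    finally show "Lp_qnorm p ?M F \<le> ennreal (D * I)"
      using False by (simp add: Lp_qnorm_def q_def)
  qed
qed

text \<open>Induction over the list. The exponent \<open>N + N'\<close> is available for every component: the integration in
  the first one uses up \<open>N'\<close>, and the induction hypothesis uses \<open>N\<close> for each of the others.\<close>

lemma mixed_qnorm_finite_of_product_decay:
  fixes B :: "(ennreal \<times> 'v::euclidean_space set) list"
  assumes "\<forall>(p, V)\<in>set B. 0 < p \<and> subspace V"
  shows "\<exists>N::nat. \<forall>F C. seq_lsc F \<longrightarrow> 0 \<le> C \<longrightarrow>
      (\<forall>vs. list_all2 (\<lambda>v pV. v \<in> snd pV) vs B \<longrightarrow>
        F (sum_list vs) \<le> ennreal (C / (\<Prod>v\<leftarrow>vs. (1 + norm v) ^ N))) \<longrightarrow>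
      mixed_qnorm B F < \<infinity>"
  using assms
proof (induction B)
  case Nil
  show ?case by (auto simp: le_less_trans)
next
  case (Cons pV B)
  obtain p V where pV: "pV = (p, V)" by (cases pV)
  have p: "0 < p" "subspace V" using Cons.prems pV by auto
  obtain N where N: "\<And>F C. seq_lsc F \<Longrightarrow> 0 \<le> C \<Longrightarrow>
      (\<And>vs. list_all2 (\<lambda>v pV. v \<in> snd pV) vs B \<Longrightarrow>
        F (sum_list vs) \<le> ennreal (C / (\<Prod>v\<leftarrow>vs. (1 + norm v) ^ N))) \<Longrightarrow>
      mixed_qnorm B F < \<infinity>"
    using Cons by auto
  obtain N' I where I: "0 \<le> I" and
    step: "\<And>D F. 0 \<le> D \<Longrightarrow> F \<in> borel_measurable borel \<Longrightarrow> (\<forall>v\<in>V. F v \<le> ennreal (D / (1 + norm v) ^ N')) \<Longrightarrow>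
      Lp_qnorm p (subspace_lebesgue V) F \<le> ennreal (D * I)"
    apply (rule Lp_qnorm_finite_of_decay[OF p(2,1)])
    subgoal premises prems by (rule prems(1)[OF prems(2,3)])
    done
  have ge1: "1 \<le> (\<Prod>v\<leftarrow>vs. (1 + norm v) ^ k)" for vs :: "'v list" and k
    by (induction vs) (auto intro: mult_ge1_I)
  have mono: "(\<Prod>v\<leftarrow>vs. (1 + norm v) ^ N) \<le> (\<Prod>v\<leftarrow>vs. (1 + norm v) ^ (N + N'))" for vs :: "'v list"
    using order_trans[OF zero_le_one ge1] by (induction vs) (auto intro!: mult_mono power_increasing)
  have "mixed_qnorm (pV # B) F < \<infinity>" if F: "seq_lsc F" and C: "0 \<le> C"
      and b: "\<forall>vs. list_all2 (\<lambda>v pV. v \<in> snd pV) vs (pV # B) \<longrightarrow>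
        F (sum_list vs) \<le> ennreal (C / (\<Prod>v\<leftarrow>vs. (1 + norm v) ^ (N + N')))" for F C
  proof -
    have "mixed_qnorm B (\<lambda>y. Lp_qnorm p (subspace_lebesgue V) (\<lambda>v. F (v + y))) < \<infinity>"
    proof (rule N[of _ "C * I"])
      show "seq_lsc (\<lambda>y. Lp_qnorm p (subspace_lebesgue V) (\<lambda>v. F (v + y)))"
        by (rule seq_lsc_Lp_qnorm[OF p(1) F])
      show "0 \<le> C * I" using C I by simp
      fix vs assume vs: "list_all2 (\<lambda>v pV. v \<in> snd pV) vs B"
      let ?Q = "\<Prod>v\<leftarrow>vs. (1 + norm v) ^ N"
      have Q: "1 \<le> ?Q" by (rule ge1)
      have "Lp_qnorm p (subspace_lebesgue V) (\<lambda>v. F (v + sum_list vs)) \<le> ennreal (C / ?Q * I)"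
      proof (rule step)
        show "0 \<le> C / ?Q" using C Q by simp
        show "(\<lambda>v. F (v + sum_list vs)) \<in> borel_measurable borel"
          by (rule seq_lsc_measurable[OF seq_lsc_shift[OF F]])
        show "\<forall>v\<in>V. F (v + sum_list vs) \<le> ennreal (C / ?Q / (1 + norm v) ^ N')"
        proof
        fix v assume v: "v \<in> V"
        have "F (v + sum_list vs) \<le> ennreal (C / ((1 + norm v) ^ (N + N') * (\<Prod>v\<leftarrow>vs. (1 + norm v) ^ (N + N'))))"
          using b[rule_format, of "v # vs"] vs v pV by simp
        also have "\<dots> \<le> ennreal (C / (?Q * (1 + norm v) ^ N'))"
        proof (intro ennreal_leI divide_left_mono)
          show "?Q * (1 + norm v) ^ N' \<le> (1 + norm v) ^ (N + N') * (\<Prod>v\<leftarrow>vs. (1 + norm v) ^ (N + N'))"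
            unfolding mult.commute[of ?Q] by (intro mult_mono mono power_increasing) (use Q in auto)
          show "0 < (1 + norm v) ^ (N + N') * (\<Prod>v\<leftarrow>vs. (1 + norm v) ^ (N + N')) * (?Q * (1 + norm v) ^ N')"
            using Q less_le_trans[OF zero_less_one ge1, of "N + N'" vs] by (intro mult_pos_pos zero_less_power) (auto simp: add_pos_nonneg)
        qed (use C in auto)
        finally show "F (v + sum_list vs) \<le> ennreal (C / ?Q / (1 + norm v) ^ N')" by simp
        qed
      qed
      then show "Lp_qnorm p (subspace_lebesgue V) (\<lambda>v. F (v + sum_list vs)) \<le> ennreal (C * I / ?Q)"
        by simp
    qed
    then show ?thesis by (simp add: pV)
  qed
  then show ?case by blast
qed

text \<open>By uniqueness of the decomposition the components depend linearly on the sum, and linear maps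
  between finite-dimensional spaces are bounded.\<close>

lemma mixed_qnorm_space_components_bounded:
  fixes B :: "(ennreal \<times> 'v::euclidean_space set) list"
  assumes B: "mixed_qnorm_space B"
  obtains K where "1 \<le> K"
    "\<And>vs v. list_all2 (\<lambda>v pV. v \<in> snd pV) vs B \<Longrightarrow> v \<in> set vs \<Longrightarrow> norm v \<le> K * norm (sum_list vs)"
proof -
  define P where "P = (\<lambda>x. THE vs. list_all2 (\<lambda>v pV. v \<in> snd pV) vs B \<and> sum_list vs = x)"
  have ex1: "\<exists>!vs. list_all2 (\<lambda>v pV. v \<in> snd pV) vs B \<and> sum_list vs = x" for x
    using B unfolding mixed_qnorm_space_def list_all2_component_iff by (simp add: conj_assoc)
  have P: "list_all2 (\<lambda>v pV. v \<in> snd pV) (P x) B" "sum_list (P x) = x" for x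
    using theI'[OF ex1[of x]] by (auto simp: P_def)
  have P_eq: "P (sum_list vs) = vs" if "list_all2 (\<lambda>v pV. v \<in> snd pV) vs B" for vs
    using ex1[of "sum_list vs"] P[of "sum_list vs"] that by blast
  have len: "length (P x) = length B" for x using list_all2_lengthD[OF P(1)] .
  have sub: "subspace (snd (B ! j))" if "j < length B" for j
    using B that nth_mem[OF that] unfolding mixed_qnorm_space_def by (auto simp: case_prod_unfold)
  have mem: "P x ! j \<in> snd (B ! j)" if "j < length B" for x j
    using P(1)[of x] that by (auto simp: list_all2_conv_all_nth)
  have sl: "sum_list (map2 (+) (P x) (P y)) = x + y" for x y
  proof -
    have "sum_list (map2 (+) xs ys) = sum_list xs + sum_list ys"
      if "length xs = length ys" for xs ys :: "'v list"
      using that by (induction xs ys rule: list_induct2) (auto simp: algebra_simps)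
    from this[of "P x" "P y"] show ?thesis by (simp add: len P(2))
  qed
  have add: "P (x + y) = map2 (+) (P x) (P y)" for x y
  proof -
    have "list_all2 (\<lambda>v pV. v \<in> snd pV) (map2 (+) (P x) (P y)) B"
      by (auto simp: list_all2_conv_all_nth len intro!: subspace_add[OF sub] mem)
    from P_eq[OF this] show ?thesis by (simp only: sl)
  qed
  have sr: "sum_list (map ((*\<^sub>R) r) (P x)) = r *\<^sub>R x" for r x
  proof -
    have "sum_list (map ((*\<^sub>R) r) xs) = r *\<^sub>R sum_list xs" for xs :: "'v list"
      by (induction xs) (auto simp: algebra_simps)
    from this[of "P x"] show ?thesis by (simp add: P(2))
  qed
  have scale: "P (r *\<^sub>R x) = map ((*\<^sub>R) r) (P x)" for r x
  proof -
    have "list_all2 (\<lambda>v pV. v \<in> snd pV) (map ((*\<^sub>R) r) (P x)) B"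
      by (auto simp: list_all2_conv_all_nth len intro!: subspace_scale[OF sub] mem)
    from P_eq[OF this] show ?thesis by (simp only: sr)
  qed
  have "\<exists>K. \<forall>x. norm (P x ! j) \<le> norm x * K" if "j < length B" for j
  proof -
    have "linear (\<lambda>x. P x ! j)"
      by (rule linearI) (auto simp: add scale len that)
    then have "bounded_linear (\<lambda>x. P x ! j)" by (simp add: linear_conv_bounded_linear)
    then show ?thesis using bounded_linear.bounded by blast
  qed
  then obtain K where K: "\<And>j x. j < length B \<Longrightarrow> norm (P x ! j) \<le> norm x * K j" by metis
  define K' where "K' = 1 + (\<Sum>j<length B. \<bar>K j\<bar>)"
  show ?thesis
  proof (rule that[of K'])
    show "1 \<le> K'" by (simp add: K'_def sum_nonneg)
    fix vs v assume vs: "list_all2 (\<lambda>v pV. v \<in> snd pV) vs B" "v \<in> set vs"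
    then obtain j where j: "j < length B" "v = vs ! j"
      using list_all2_lengthD[OF vs(1)] by (metis in_set_conv_nth)
    have "norm v \<le> norm (sum_list vs) * K j"
      using K[OF j(1), of "sum_list vs"] P_eq[OF vs(1)] j by simp
    also have "\<dots> \<le> norm (sum_list vs) * K'"
    proof (intro mult_left_mono)
      have "\<bar>K j\<bar> \<le> (\<Sum>j<length B. \<bar>K j\<bar>)" using j by (intro member_le_sum) auto
      then show "K j \<le> K'" by (simp add: K'_def)
    qed simp
    finally show "norm v \<le> K' * norm (sum_list vs)" by (simp add: mult.commute)
  qed
qed

text \<open>Each component is bounded by a multiple of the sum, so that a power of \<open>norm z\<close> dominates the product
  of lower powers of the norms of the components.\<close>

lemma mixed_qnorm_finite_of_decay:
  fixes B :: "(ennreal \<times> 'v::euclidean_space set) list"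
  assumes B: "mixed_qnorm_space B"
  obtains N :: nat where
    "\<And>F C. seq_lsc F \<Longrightarrow> 0 \<le> C \<Longrightarrow> (\<And>z. F z \<le> ennreal (C / (1 + norm z) ^ N)) \<Longrightarrow> mixed_qnorm B F < \<infinity>"
proof -
  obtain N where N: "\<And>F C. seq_lsc F \<Longrightarrow> 0 \<le> C \<Longrightarrow>
      (\<And>vs. list_all2 (\<lambda>v pV. v \<in> snd pV) vs B \<Longrightarrow>
        F (sum_list vs) \<le> ennreal (C / (\<Prod>v\<leftarrow>vs. (1 + norm v) ^ N))) \<Longrightarrow>
      mixed_qnorm B F < \<infinity>"
    using mixed_qnorm_finite_of_product_decay[of B] B unfolding mixed_qnorm_space_def by auto
  obtain K where K: "1 \<le> K" and
    comp: "\<And>vs v. list_all2 (\<lambda>v pV. v \<in> snd pV) vs B \<Longrightarrow> v \<in> set vs \<Longrightarrow> norm v \<le> K * norm (sum_list vs)"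
    apply (rule mixed_qnorm_space_components_bounded[OF B])
    subgoal premises prems by (rule prems(1)[OF prems(2,3)])
    done
  let ?L = "length B * N"
  show ?thesis
  proof (rule that[of ?L])
    fix F :: "'v \<Rightarrow> ennreal" and C :: real assume F: "seq_lsc F" "0 \<le> C" "\<And>z. F z \<le> ennreal (C / (1 + norm z) ^ ?L)"
    show "mixed_qnorm B F < \<infinity>"
    proof (rule N[of _ "C * K ^ ?L"])
      show "seq_lsc F" by fact
      show "0 \<le> C * K ^ ?L" using F K by simp
      fix vs assume vs: "list_all2 (\<lambda>v pV. v \<in> snd pV) vs B"
      define r where "r = norm (sum_list vs)"
      have r: "0 \<le> r" by (simp add: r_def)
      have gen: "0 < (\<Prod>v\<leftarrow>xs. (1 + norm v) ^ N) \<and>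
          (\<Prod>v\<leftarrow>xs. (1 + norm v) ^ N) \<le> (K * (1 + r)) ^ (length xs * N)"
        if "\<And>v. v \<in> set xs \<Longrightarrow> norm v \<le> K * r" for xs :: "'v list"
        using that
      proof (induction xs)
        case (Cons x xs)
        have "1 + norm x \<le> K * (1 + r)" using Cons.prems[of x] K by (simp add: algebra_simps)
        then have "(1 + norm x) ^ N \<le> (K * (1 + r)) ^ N" by (intro power_mono) auto
        moreover have "0 < (1 + norm x) ^ N" by (intro zero_less_power) (simp add: add_pos_nonneg)
        ultimately show ?case
          using Cons.IH Cons.prems by (auto simp: power_add intro!: mult_mono mult_pos_pos)
      qed simp
      have g: "0 < (\<Prod>v\<leftarrow>vs. (1 + norm v) ^ N)" "(\<Prod>v\<leftarrow>vs. (1 + norm v) ^ N) \<le> (K * (1 + r)) ^ ?L"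
        using gen[of vs] comp[OF vs] list_all2_lengthD[OF vs] by (auto simp: r_def)
      have "F (sum_list vs) \<le> ennreal (C / (1 + r) ^ ?L)" using F(3) by (simp add: r_def)
      also have "C / (1 + r) ^ ?L = C * K ^ ?L / (K * (1 + r)) ^ ?L"
        using K by (simp add: power_mult_distrib)
      also have "\<dots> \<le> C * K ^ ?L / (\<Prod>v\<leftarrow>vs. (1 + norm v) ^ N)"
        using g F K r by (intro divide_left_mono mult_pos_pos zero_less_power) auto
      finally show "F (sum_list vs) \<le> ennreal (C * K ^ ?L / (\<Prod>v\<leftarrow>vs. (1 + norm v) ^ N))"
        using ennreal_leI order_trans by blast
    qed
  qed
qed

section \<open>Fourier inversion and parameter integrals\<close>

lemma
  fixes f :: "'d::finite \<Rightarrow> real \<Rightarrow> 'b::{real_normed_field, banach, second_countable_topology}"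
  assumes f: "\<And>i. integrable lborel (f i)"
  shows integrable_lborel_vec_prod: "integrable lborel (\<lambda>x::real^'d. \<Prod>i\<in>UNIV. f i (x $ i))"
    and integral_lborel_vec_prod:
      "(LINT x|lborel. (\<Prod>i\<in>UNIV. f i (x $ i))) = (\<Prod>i\<in>UNIV. LINT t|lborel. f i t)"
proof -
  interpret product_sigma_finite "\<lambda>b::real^'d. lborel :: real measure" ..
  let ?P = "\<Pi>\<^sub>M b\<in>(Basis :: (real^'d) set). (lborel :: real measure)"
  let ?m = "\<lambda>c. \<Sum>b\<in>(Basis :: (real^'d) set). c b *\<^sub>R b"
  have [measurable]: "f i \<in> borel_measurable borel" for i
    using borel_measurable_integrable[OF f[of i]] by simp
  have m: "?m \<in> ?P \<rightarrow>\<^sub>M borel" by measurable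
  have B: "Basis = (\<lambda>i. axis i 1 :: real^'d) ` UNIV" by (auto simp: Basis_vec_def)
  have inj: "inj (\<lambda>i. axis i 1 :: real^'d)" by (auto simp: inj_on_def axis_eq_axis)
  have comp: "?m c $ i = c (axis i 1)" for c i
  proof -
    have "?m c $ i = (\<Sum>j\<in>UNIV. (c (axis j 1) *\<^sub>R axis j (1::real)) $ i)"
      unfolding B by (subst sum.reindex[OF inj]) simp
    also have "\<dots> = (\<Sum>j\<in>UNIV. if j = i then c (axis j 1) else 0)"
      by (intro sum.cong) (auto simp: axis_def)
    finally show ?thesis by simp
  qed
  have prod: "(\<Prod>i\<in>UNIV. f i (?m c $ i)) = (\<Prod>b\<in>Basis. f (axis_index b) (c b))" for c
  proof -
    have "(\<Prod>i\<in>UNIV. f i (?m c $ i)) = (\<Prod>i\<in>UNIV. f i (c (axis i 1)))"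
      by (simp only: comp)
    also have "\<dots> = (\<Prod>b\<in>Basis. f (axis_index b) (c b))"
      unfolding B by (subst prod.reindex[OF inj]) simp
    finally show ?thesis .
  qed
  have g: "(\<lambda>x::real^'d. \<Prod>i\<in>UNIV. f i (x $ i)) \<in> borel_measurable borel" by measurable
  have lb: "lborel = distr ?P borel ?m" by (rule lborel_eq)
  have "integrable ?P (\<lambda>c. \<Prod>b\<in>Basis. f (axis_index b) (c b))"
    by (intro product_integrable_prod f) simp
  then show "integrable lborel (\<lambda>x::real^'d. \<Prod>i\<in>UNIV. f i (x $ i))"
    unfolding lb by (subst integrable_distr_eq[OF m g]) (simp only: prod)
  have "(LINT x|lborel. (\<Prod>i\<in>UNIV. f i (x $ i))) = (LINT c|?P. (\<Prod>b\<in>Basis. f (axis_index b) (c b)))"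
    unfolding lb by (subst integral_distr[OF m g]) (simp only: prod)
  also have "\<dots> = (\<Prod>b\<in>(Basis :: (real^'d) set). LINT t|lborel. f (axis_index b) t)"
    by (intro product_integral_prod f) simp
  also have "\<dots> = (\<Prod>i\<in>UNIV. LINT t|lborel. f i t)"
    unfolding B by (subst prod.reindex[OF inj]) simp
  finally show "(LINT x|lborel. (\<Prod>i\<in>UNIV. f i (x $ i))) = (\<Prod>i\<in>UNIV. LINT t|lborel. f i t)" .
qed

text \<open>An integrable majorant that factorises over the coordinates.\<close>

definition inv_poly :: "real^'d::finite \<Rightarrow> real" where
  "inv_poly x = (\<Prod>i\<in>UNIV. inverse (1 + (x $ i)\<^sup>2))"

lemma inv_poly_pos: "0 < inv_poly x"
  unfolding inv_poly_def by (intro prod_pos) (auto simp: add_pos_nonneg)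

lemma inv_poly_measurable [measurable]: "inv_poly \<in> borel_measurable borel"
  unfolding inv_poly_def by measurable

lemma integrable_inv_poly: "integrable lborel (inv_poly :: real^'d::finite \<Rightarrow> real)"
proof -
  have "integrable lborel (\<lambda>x::real. inverse (1 + x\<^sup>2))"
    using integrable_inverse_1_plus_square by (simp add: set_integrable_def)
  then show ?thesis unfolding inv_poly_def[abs_def] by (rule integrable_lborel_vec_prod)
qed

lemma integrable_inv_poly_prod:
  "integrable lborel (\<lambda>z::(real^'d::finite) \<times> (real^'e::finite). inv_poly (fst z) * inv_poly (snd z))"
  unfolding lborel_prod[symmetric]
proof (rule lborel_pair.Fubini_integrable)
  show "(\<lambda>z::(real^'d) \<times> (real^'e). inv_poly (fst z) * inv_poly (snd z)) \<in> borel_measurable (lborel \<Otimes>\<^sub>M lborel)"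
    by measurable
  show "integrable lborel (\<lambda>x::real^'d. LINT y::real^'e|lborel. norm (inv_poly (fst (x, y)) * inv_poly (snd (x, y))))"
    using integrable_inv_poly[where 'd = 'd] integrable_inv_poly[where 'd = 'e]
    by (simp add: abs_mult inv_poly_pos less_imp_le)
  show "AE x::real^'d in lborel. integrable lborel (\<lambda>y::real^'e. inv_poly (fst (x, y)) * inv_poly (snd (x, y)))"
    using integrable_inv_poly[where 'd = 'e] by (intro AE_I2) simp
qed

lemma inv_poly_ge: "1 / (1 + norm x) ^ (2 * CARD('d)) \<le> inv_poly (x :: real^'d::finite)"
proof -
  have "(\<Prod>i\<in>(UNIV::'d set). 1 + (x $ i)\<^sup>2) \<le> (\<Prod>i\<in>(UNIV::'d set). (1 + norm x)\<^sup>2)"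
  proof (rule prod_mono)
    fix i
    have "(x $ i)\<^sup>2 \<le> (norm x)\<^sup>2" using power_mono[OF component_le_norm_cart[of x i], of 2] by simp
    then show "0 \<le> 1 + (x $ i)\<^sup>2 \<and> 1 + (x $ i)\<^sup>2 \<le> (1 + norm x)\<^sup>2"
      by (auto simp: power2_sum intro: add_increasing2)
  qed
  also have "\<dots> = (1 + norm x) ^ (2 * CARD('d))" by (simp add: power_mult)
  finally have "1 / (1 + norm x) ^ (2 * CARD('d)) \<le> 1 / (\<Prod>i\<in>(UNIV::'d set). 1 + (x $ i)\<^sup>2)"
    by (intro divide_left_mono mult_pos_pos prod_pos zero_less_power) (auto simp: add_pos_nonneg)
  also have "\<dots> = inv_poly x"
    using prod_inversef[of "\<lambda>i. 1 + (x $ i)\<^sup>2" UNIV] by (simp add: inv_poly_def comp_def divide_inverse)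
  finally show ?thesis .
qed

text \<open>The characteristic function of the standard normal distribution, rescaled.\<close>

lemma gauss_fourier_1d:
  fixes e t :: real
  assumes e: "0 < e"
  shows "integrable lborel (\<lambda>x. complex_of_real (exp (- (e\<^sup>2 * x\<^sup>2) / 2)) * exp (\<i> * complex_of_real (t * x)))" (is ?I)
    and "(LINT x|lborel. complex_of_real (exp (- (e\<^sup>2 * x\<^sup>2) / 2)) * exp (\<i> * complex_of_real (t * x))) =
      complex_of_real (sqrt (2 * pi) / e * exp (- (t\<^sup>2) / (2 * e\<^sup>2)))" (is ?E)
proof -
  have int: "integrable lborel (\<lambda>x. complex_of_real (exp (- x\<^sup>2 / 2)) * exp (\<i> * complex_of_real (t * x)))" for t
  proof (rule Bochner_Integration.integrable_bound)
    show "integrable lborel (\<lambda>x::real. sqrt (2 * pi) * std_normal_density x)"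
      by (intro integrable_mult_right integrable_normal_density) simp
  qed (auto simp: norm_mult std_normal_density_def)
  have std: "(LINT x|lborel. complex_of_real (exp (- x\<^sup>2 / 2)) * exp (\<i> * complex_of_real (t * x))) =
      complex_of_real (sqrt (2 * pi) * exp (- (t\<^sup>2) / 2))" for t
  proof -
    have "complex_of_real (exp (- (t\<^sup>2) / 2)) = char std_normal_distribution t"
      by (simp add: char_std_normal_distribution)
    also have "\<dots> = (LINT x|lborel. std_normal_density x *\<^sub>R iexp (t * x))"
      unfolding char_def by (subst integral_density) auto
    also have "\<dots> = (LINT x|lborel. (1 / sqrt (2 * pi)) *\<^sub>R
        (complex_of_real (exp (- x\<^sup>2 / 2)) * exp (\<i> * complex_of_real (t * x))))"
      by (intro Bochner_Integration.integral_cong) (auto simp: std_normal_density_def scaleR_conv_of_real)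
    also have "\<dots> = (1 / sqrt (2 * pi)) *\<^sub>R
        (LINT x|lborel. (complex_of_real (exp (- x\<^sup>2 / 2)) * exp (\<i> * complex_of_real (t * x))))"
      by (rule integral_scaleR_right)
    finally show ?thesis by (simp add: scaleR_conv_of_real field_simps)
  qed
  let ?g = "\<lambda>x. complex_of_real (exp (- x\<^sup>2 / 2)) * exp (\<i> * complex_of_real ((t / e) * x))"
  have g: "?g (0 + e * x) = complex_of_real (exp (- (e\<^sup>2 * x\<^sup>2) / 2)) * exp (\<i> * complex_of_real (t * x))" for x
    using e by (simp add: power_mult_distrib)
  show ?I
    using lborel_integrable_real_affine[OF int[of "t / e"], of e 0] e unfolding g by simp
  have "(LINT x|lborel. ?g x) = \<bar>e\<bar> *\<^sub>R (LINT x|lborel. ?g (0 + e * x))"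
    using e by (intro lborel_integral_real_affine) simp
  then show ?E
    unfolding std g using e by (simp add: scaleR_conv_of_real field_simps power_divide)
qed

lemma exp_sum_vec: "exp (\<i> * complex_of_real (y \<bullet> x)) = (\<Prod>i\<in>UNIV. exp (\<i> * complex_of_real (y $ i * x $ i)))"
  for x y :: "real^'d::finite"
  by (simp add: inner_vec_def exp_sum sum_distrib_left)

lemma exp_norm_vec: "exp (- (c * (norm x)\<^sup>2)) = (\<Prod>i\<in>UNIV. exp (- (c * (x $ i)\<^sup>2)))"
  for x :: "real^'d::finite"
  by (simp add: norm_vec_def L2_set_def sum_nonneg exp_sum sum_distrib_left flip: sum_negf)

lemma gauss_fourier:
  fixes e :: real and y :: "real^'d::finite"
  assumes e: "0 < e"
  shows "integrable lborel (\<lambda>x::real^'d. complex_of_real (exp (- (e\<^sup>2 / 2 * (norm x)\<^sup>2))) * exp (\<i> * complex_of_real (y \<bullet> x)))"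
    and "(LINT x|lborel. complex_of_real (exp (- (e\<^sup>2 / 2 * (norm x)\<^sup>2))) * exp (\<i> * complex_of_real (y \<bullet> x))) =
      complex_of_real ((sqrt (2 * pi) / e) ^ CARD('d) * exp (- (1 / (2 * e\<^sup>2) * (norm y)\<^sup>2)))"
proof -
  let ?f = "\<lambda>i x. complex_of_real (exp (- (e\<^sup>2 * x\<^sup>2) / 2)) * exp (\<i> * complex_of_real (y $ i * x))"
  have eq: "complex_of_real (exp (- (e\<^sup>2 / 2 * (norm x)\<^sup>2))) * exp (\<i> * complex_of_real (y \<bullet> x)) =
      (\<Prod>i\<in>UNIV. ?f i (x $ i))" for x
    unfolding exp_sum_vec exp_norm_vec by (simp add: prod.distrib)
  show "integrable lborel (\<lambda>x::real^'d. complex_of_real (exp (- (e\<^sup>2 / 2 * (norm x)\<^sup>2))) * exp (\<i> * complex_of_real (y \<bullet> x)))"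
    unfolding eq by (rule integrable_lborel_vec_prod[OF gauss_fourier_1d(1)[OF e]])
  show "(LINT x|lborel. complex_of_real (exp (- (e\<^sup>2 / 2 * (norm x)\<^sup>2))) * exp (\<i> * complex_of_real (y \<bullet> x))) =
      complex_of_real ((sqrt (2 * pi) / e) ^ CARD('d) * exp (- (1 / (2 * e\<^sup>2) * (norm y)\<^sup>2)))"
  proof -
    have "(LINT x|lborel. complex_of_real (exp (- (e\<^sup>2 / 2 * (norm x)\<^sup>2))) * exp (\<i> * complex_of_real (y \<bullet> x))) =
        (\<Prod>i\<in>UNIV. LINT x|lborel. ?f i x)"
      unfolding eq by (rule integral_lborel_vec_prod[OF gauss_fourier_1d(1)[OF e]])
    also have "\<dots> = complex_of_real ((sqrt (2 * pi) / e) ^ CARD('d) * (\<Prod>i\<in>UNIV. exp (- (1 / (2 * e\<^sup>2) * (y $ i)\<^sup>2))))"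
      unfolding gauss_fourier_1d(2)[OF e] by (simp add: prod.distrib prod_dividef power_divide)
    finally show ?thesis unfolding exp_norm_vec[symmetric] .
  qed
qed

lemma integrable_gauss:
  fixes c :: real
  assumes "0 < c"
  shows "integrable lborel (\<lambda>x::real^'d::finite. exp (- (c * (norm x)\<^sup>2)))"
proof -
  define e where "e = sqrt (2 * c)"
  have e: "0 < e" "e\<^sup>2 / 2 = c" using assms by (auto simp: e_def)
  have "integrable lborel (\<lambda>x::real^'d. complex_of_real (exp (- (c * (norm x)\<^sup>2))))"
    using gauss_fourier(1)[OF e(1), of 0] unfolding e by simp
  then show ?thesis by (simp only: complex_of_real_integrable_eq)
qed

lemma
  fixes f :: "'a::euclidean_space \<Rightarrow> complex"
  assumes c: "c \<noteq> 0" and f: "integrable lborel f"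
  shows integrable_lborel_affine: "integrable lborel (\<lambda>x. f (t + c *\<^sub>R x))"
    and integral_lborel_affine: "(LINT x|lborel. f x) = complex_of_real (\<bar>c\<bar> ^ DIM('a)) * (LINT x|lborel. f (t + c *\<^sub>R x))"
proof -
  have [measurable]: "f \<in> borel_measurable borel" using borel_measurable_integrable[OF f] by simp
  have lb: "lborel = density (distr lborel borel (\<lambda>x. t + c *\<^sub>R x)) (\<lambda>_. ennreal (\<bar>c\<bar>^DIM('a)))"
    using lborel_affine[OF c, of t] by simp
  have m: "(\<lambda>x::'a. t + c *\<^sub>R x) \<in> lborel \<rightarrow>\<^sub>M borel" by measurable
  have pos: "0 < \<bar>c\<bar>^DIM('a)" using c by simp
  have "integrable (density (distr lborel borel (\<lambda>x. t + c *\<^sub>R x)) (\<lambda>_. ennreal (\<bar>c\<bar>^DIM('a)))) f"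
    using f lb by simp
  then have "integrable (distr lborel borel (\<lambda>x. t + c *\<^sub>R x)) (\<lambda>x. \<bar>c\<bar>^DIM('a) *\<^sub>R f x)"
    by (subst (asm) integrable_density) auto
  then have "integrable (distr lborel borel (\<lambda>x. t + c *\<^sub>R x)) (\<lambda>x. inverse (\<bar>c\<bar>^DIM('a)) *\<^sub>R (\<bar>c\<bar>^DIM('a) *\<^sub>R f x))"
    by (rule integrable_scaleR_right)
  then have "integrable (distr lborel borel (\<lambda>x. t + c *\<^sub>R x)) f"
    using c by simp
  then show "integrable lborel (\<lambda>x. f (t + c *\<^sub>R x))"
    by (subst (asm) integrable_distr_eq[OF m]) auto
  have "(LINT x|lborel. f x) = (LINT x|density (distr lborel borel (\<lambda>x. t + c *\<^sub>R x)) (\<lambda>_. ennreal (\<bar>c\<bar>^DIM('a))). f x)"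
    using lb by simp
  also have "\<dots> = (LINT x|distr lborel borel (\<lambda>x. t + c *\<^sub>R x). \<bar>c\<bar>^DIM('a) *\<^sub>R f x)"
    by (subst integral_density) auto
  also have "\<dots> = (LINT x|lborel. \<bar>c\<bar>^DIM('a) *\<^sub>R f (t + c *\<^sub>R x))"
    by (subst integral_distr[OF m]) auto
  also have "\<dots> = complex_of_real (\<bar>c\<bar> ^ DIM('a)) * (LINT x|lborel. f (t + c *\<^sub>R x))"
    by (simp add: scaleR_conv_of_real)
  finally show "(LINT x|lborel. f x) = complex_of_real (\<bar>c\<bar> ^ DIM('a)) * (LINT x|lborel. f (t + c *\<^sub>R x))" .
qed

text \<open>The inverse integral is regularised by a Gaussian of width \<open>1 / e\<close>. By Fubini the regularised
  integral averages \<open>k\<close> around \<open>y\<close> with a Gaussian of width \<open>e\<close>; both sides converge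
  as \<open>e\<close> tends to \<open>0\<close> by dominated convergence.\<close>

lemma fourier_inversion:
  fixes k :: "real^'d::finite \<Rightarrow> complex"
  assumes k: "integrable lborel k" and cont: "continuous_on UNIV k" and bd: "\<And>u. cmod (k u) \<le> M"
    and hat: "integrable lborel (\<lambda>\<xi>. LINT u|lborel. k u * exp (- \<i> * complex_of_real (u \<bullet> \<xi>)))"
  shows "(LINT \<xi>|lborel. (LINT u|lborel. k u * exp (- \<i> * complex_of_real (u \<bullet> \<xi>))) * exp (\<i> * complex_of_real (y \<bullet> \<xi>))) =
    complex_of_real ((2 * pi) ^ CARD('d)) * k y"
proof -
  define K where "K = (\<lambda>\<xi>. LINT u|lborel. k u * exp (- \<i> * complex_of_real (u \<bullet> \<xi>)))"
  \<comment> \<open>widths of the averaging Gaussians\<close>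
  define e where "e n = 1 / (real n + 1)" for n :: nat
  have e: "0 < e n" for n by (simp add: e_def)
  have e0: "e \<longlonglongrightarrow> 0" unfolding e_def[abs_def] using LIMSEQ_Suc[OF lim_1_over_n] by (simp add: add.commute)
  have [measurable]: "k \<in> borel_measurable borel" using borel_measurable_integrable[OF k] by simp
  have hat': "integrable lborel K" using hat by (simp add: K_def)
  have [measurable]: "K \<in> borel_measurable borel" using borel_measurable_integrable[OF hat'] by simp
  let ?g = "\<lambda>n \<xi>. complex_of_real (exp (- ((e n)\<^sup>2 / 2 * (norm \<xi>)\<^sup>2)))"
  define J where "J n = (LINT \<xi>|lborel. K \<xi> * exp (\<i> * complex_of_real (y \<bullet> \<xi>)) * ?g n \<xi>)" for n
  have lim1: "J \<longlonglongrightarrow> (LINT \<xi>|lborel. K \<xi> * exp (\<i> * complex_of_real (y \<bullet> \<xi>)))"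
    unfolding J_def[abs_def]
  proof (rule integral_dominated_convergence[where w = "\<lambda>\<xi>. cmod (K \<xi>)"])
    show "integrable lborel (\<lambda>\<xi>. cmod (K \<xi>))" using hat' by simp
    show "AE \<xi> in lborel. (\<lambda>n. K \<xi> * exp (\<i> * complex_of_real (y \<bullet> \<xi>)) * ?g n \<xi>)
        \<longlonglongrightarrow> K \<xi> * exp (\<i> * complex_of_real (y \<bullet> \<xi>))"
    proof (rule AE_I2)
      fix \<xi> :: "real^'d"
      have "(\<lambda>n. K \<xi> * exp (\<i> * complex_of_real (y \<bullet> \<xi>)) * ?g n \<xi>)
        \<longlonglongrightarrow> K \<xi> * exp (\<i> * complex_of_real (y \<bullet> \<xi>)) * complex_of_real (exp (- (0\<^sup>2 / 2 * (norm \<xi>)\<^sup>2)))"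
        by (intro tendsto_intros e0) simp
      then show "(\<lambda>n. K \<xi> * exp (\<i> * complex_of_real (y \<bullet> \<xi>)) * ?g n \<xi>)
        \<longlonglongrightarrow> K \<xi> * exp (\<i> * complex_of_real (y \<bullet> \<xi>))" by simp
    qed
    show "AE \<xi> in lborel. cmod (K \<xi> * exp (\<i> * complex_of_real (y \<bullet> \<xi>)) * ?g n \<xi>) \<le> cmod (K \<xi>)" for n
      by (auto simp: norm_mult intro!: AE_I2 mult_left_le)
  qed auto
  have J: "J n = complex_of_real ((sqrt (2 * pi)) ^ CARD('d)) *
      (LINT v|lborel. k (y + e n *\<^sub>R v) * complex_of_real (exp (- (1 / 2 * (norm v)\<^sup>2))))" for n
  proof -
    let ?F = "\<lambda>u \<xi>. k u * (?g n \<xi> * exp (\<i> * complex_of_real ((y - u) \<bullet> \<xi>)))"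
    have prodint: "integrable (lborel \<Otimes>\<^sub>M lborel) (\<lambda>(u, \<xi>). ?F u \<xi>)"
    proof (rule lborel_pair.Fubini_integrable)
      show "(\<lambda>(u, \<xi>). ?F u \<xi>) \<in> borel_measurable (lborel \<Otimes>\<^sub>M lborel)" by measurable
      have "integrable lborel (\<lambda>u. cmod (k u) * (LINT \<xi>|lborel. exp (- ((e n)\<^sup>2 / 2 * (norm (\<xi>::real^'d))\<^sup>2))))"
        using k by (intro integrable_mult_left) simp
      then show "integrable lborel (\<lambda>u. LINT \<xi>|lborel. cmod (case (u, \<xi>) of (u, \<xi>) \<Rightarrow> ?F u \<xi>))"
        by (simp add: norm_mult)
      show "AE u in lborel. integrable lborel (\<lambda>\<xi>. case (u, \<xi>) of (u, \<xi>) \<Rightarrow> ?F u \<xi>)"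
        unfolding prod.case by (intro AE_I2 integrable_mult_right gauss_fourier(1) e)
    qed
    have "J n = (LINT \<xi>|lborel. LINT u|lborel. ?F u \<xi>)"
      unfolding J_def K_def
    proof (intro Bochner_Integration.integral_cong refl)
      fix \<xi> :: "real^'d"
      have Fe: "?F u \<xi> = (k u * exp (- \<i> * complex_of_real (u \<bullet> \<xi>))) * (exp (\<i> * complex_of_real (y \<bullet> \<xi>)) * ?g n \<xi>)" for u
      proof -
        have "exp (\<i> * complex_of_real ((y - u) \<bullet> \<xi>)) = exp (- \<i> * complex_of_real (u \<bullet> \<xi>)) * exp (\<i> * complex_of_real (y \<bullet> \<xi>))"
          by (simp add: inner_diff_left algebra_simps flip: exp_add)
        then show ?thesis by (simp only: mult_ac)
      qed
      show "(LINT u|lborel. k u * exp (- \<i> * complex_of_real (u \<bullet> \<xi>))) * exp (\<i> * complex_of_real (y \<bullet> \<xi>)) * ?g n \<xi>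
         = (LINT u|lborel. ?F u \<xi>)"
        unfolding Fe integral_mult_left_zero by (simp only: mult.assoc)
    qed
    also have "\<dots> = (LINT u|lborel. LINT \<xi>|lborel. ?F u \<xi>)"
      using lborel_pair.Fubini_integral[of "\<lambda>u \<xi>. ?F u \<xi>"] prodint by simp
    also have "\<dots> = (LINT u|lborel. k u * complex_of_real ((sqrt (2 * pi) / e n) ^ CARD('d) *
        exp (- (1 / (2 * (e n)\<^sup>2) * (norm (y - u))\<^sup>2))))"
      unfolding integral_mult_right_zero gauss_fourier(2)[OF e] ..
    also have "\<dots> = complex_of_real (\<bar>e n\<bar> ^ DIM(real^'d)) * (LINT v|lborel. k (y + e n *\<^sub>R v) * complex_of_real ((sqrt (2 * pi) / e n) ^ CARD('d) *
        exp (- (1 / (2 * (e n)\<^sup>2) * (norm (y - (y + e n *\<^sub>R v)))\<^sup>2))))"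
    proof (rule integral_lborel_affine)
      show "integrable lborel (\<lambda>u. k u * complex_of_real ((sqrt (2 * pi) / e n) ^ CARD('d) *
        exp (- (1 / (2 * (e n)\<^sup>2) * (norm (y - u))\<^sup>2))))"
      proof (rule Bochner_Integration.integrable_bound)
        show "integrable lborel (\<lambda>u. complex_of_real ((sqrt (2 * pi) / e n) ^ CARD('d)) * k u)"
          using k by (rule integrable_mult_right)
        show "AE u in lborel. norm (k u * complex_of_real ((sqrt (2 * pi) / e n) ^ CARD('d) *
          exp (- (1 / (2 * (e n)\<^sup>2) * (norm (y - u))\<^sup>2)))) \<le> norm (complex_of_real ((sqrt (2 * pi) / e n) ^ CARD('d)) * k u)"
        proof (rule AE_I2)
          fix u
          define A where "A = (sqrt (2 * pi) / e n) ^ CARD('d)"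
          define E where "E = exp (- (1 / (2 * (e n)\<^sup>2) * (norm (y - u))\<^sup>2))"
          have "0 \<le> A" "0 \<le> E" "E \<le> 1" using e[of n] by (auto simp: A_def E_def)
          then have "cmod (k u) * (A * E) \<le> cmod (k u) * (A * 1)" by (intro mult_left_mono) auto
          then show "norm (k u * complex_of_real ((sqrt (2 * pi) / e n) ^ CARD('d) *
            exp (- (1 / (2 * (e n)\<^sup>2) * (norm (y - u))\<^sup>2)))) \<le> norm (complex_of_real ((sqrt (2 * pi) / e n) ^ CARD('d)) * k u)"
            using \<open>0 \<le> A\<close> \<open>0 \<le> E\<close> unfolding A_def[symmetric] E_def[symmetric]
            by (simp add: norm_mult mult.commute del: of_real_power)
        qed
      qed measurable
    qed (use e[of n] in simp)
    also have "\<dots> = complex_of_real ((sqrt (2 * pi)) ^ CARD('d)) *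
      (LINT v|lborel. k (y + e n *\<^sub>R v) * complex_of_real (exp (- (1 / 2 * (norm v)\<^sup>2))))"
    proof -
      have "k (y + e n *\<^sub>R v) * complex_of_real ((sqrt (2 * pi) / e n) ^ CARD('d) *
          exp (- (1 / (2 * (e n)\<^sup>2) * (norm (y - (y + e n *\<^sub>R v)))\<^sup>2))) =
        complex_of_real ((sqrt (2 * pi) / e n) ^ CARD('d)) * (k (y + e n *\<^sub>R v) * complex_of_real (exp (- (1 / 2 * (norm v)\<^sup>2))))" for v
      proof -
        have "norm (y - (y + e n *\<^sub>R v)) = e n * norm v" using e[of n] by simp
        then have "1 / (2 * (e n)\<^sup>2) * (norm (y - (y + e n *\<^sub>R v)))\<^sup>2 = 1 / 2 * (norm v)\<^sup>2"
          using e[of n] by (simp add: power_mult_distrib)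
        then show ?thesis by (simp only: of_real_mult mult_ac)
      qed
      then show ?thesis
        using e[of n] by (simp only: integral_mult_right_zero) (simp add: power_divide DIM_cart)
    qed
    finally show ?thesis .
  qed
  have "(\<lambda>n. LINT v|lborel. k (y + e n *\<^sub>R v) * complex_of_real (exp (- (1 / 2 * (norm v)\<^sup>2))))
      \<longlonglongrightarrow> (LINT v|lborel. k y * complex_of_real (exp (- (1 / 2 * (norm (v::real^'d))\<^sup>2))))"
  proof (rule integral_dominated_convergence[where w = "\<lambda>v. M * exp (- (1 / 2 * (norm v)\<^sup>2))"])
    show "integrable lborel (\<lambda>v::real^'d. M * exp (- (1 / 2 * (norm v)\<^sup>2)))"
      by (intro integrable_mult_right integrable_gauss) simp
    show "AE v in lborel. (\<lambda>n. k (y + e n *\<^sub>R v) * complex_of_real (exp (- (1 / 2 * (norm v)\<^sup>2))))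
        \<longlonglongrightarrow> k y * complex_of_real (exp (- (1 / 2 * (norm v)\<^sup>2)))"
    proof (intro AE_I2 tendsto_intros)
      fix v :: "real^'d"
      have "(\<lambda>n. y + e n *\<^sub>R v) \<longlonglongrightarrow> y + 0 *\<^sub>R v" by (intro tendsto_intros e0)
      then have "(\<lambda>n. y + e n *\<^sub>R v) \<longlonglongrightarrow> y" by simp
      then show "(\<lambda>n. k (y + e n *\<^sub>R v)) \<longlonglongrightarrow> k y"
        using cont by (intro continuous_on_tendsto_compose[OF cont]) auto
    qed
    show "AE v in lborel. norm (k (y + e n *\<^sub>R v) * complex_of_real (exp (- (1 / 2 * (norm v)\<^sup>2)))) \<le> M * exp (- (1 / 2 * (norm v)\<^sup>2))" for n
      using bd by (intro AE_I2) (auto simp: norm_mult intro!: mult_right_mono)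
  qed auto
  then have "J \<longlonglongrightarrow> complex_of_real ((sqrt (2 * pi)) ^ CARD('d)) *
      (LINT v|lborel. k y * complex_of_real (exp (- (1 / 2 * (norm (v::real^'d))\<^sup>2))))"
    unfolding J[abs_def] by (intro tendsto_mult tendsto_const)
  moreover have "(LINT v|lborel. k y * complex_of_real (exp (- (1 / 2 * (norm (v::real^'d))\<^sup>2)))) =
      k y * complex_of_real (sqrt (2 * pi) ^ CARD('d))"
  proof -
    have "(LINT v|lborel. complex_of_real (exp (- (1 / 2 * (norm (v::real^'d))\<^sup>2)))) = complex_of_real (sqrt (2 * pi) ^ CARD('d))"
      using gauss_fourier(2)[of 1 "0::real^'d"] by simp
    then show ?thesis by (simp only: integral_mult_right_zero)
  qed
  ultimately have J2: "J \<longlonglongrightarrow> complex_of_real ((sqrt (2 * pi)) ^ CARD('d)) * (k y * complex_of_real (sqrt (2 * pi) ^ CARD('d)))"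
    by (simp only:)
  have c2: "complex_of_real ((sqrt (2 * pi)) ^ CARD('d)) * (k y * complex_of_real (sqrt (2 * pi) ^ CARD('d))) =
      complex_of_real ((2 * pi) ^ CARD('d)) * k y"
  proof -
    have "sqrt (2 * pi) ^ CARD('d) * sqrt (2 * pi) ^ CARD('d) = (sqrt (2 * pi) * sqrt (2 * pi)) ^ CARD('d)"
      by (simp only: power_mult_distrib)
    also have "sqrt (2 * pi) * sqrt (2 * pi) = 2 * pi" by (rule real_sqrt_mult_self[THEN trans]) simp
    finally have "complex_of_real (sqrt (2 * pi) ^ CARD('d)) * complex_of_real (sqrt (2 * pi) ^ CARD('d)) =
        complex_of_real ((2 * pi) ^ CARD('d))"
      by (simp only: of_real_mult[symmetric])
    then have "complex_of_real (sqrt (2 * pi) ^ CARD('d)) * complex_of_real (sqrt (2 * pi) ^ CARD('d)) * k y =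
        complex_of_real ((2 * pi) ^ CARD('d)) * k y" by (rule arg_cong)
    then show ?thesis by (simp only: mult_ac)
  qed
  show ?thesis
    using LIMSEQ_unique[OF lim1 J2] unfolding c2 K_def .
qed

text \<open>The mean value inequality makes \<open>G\<close> a majorant of the difference quotients, to which dominated
  convergence applies along every null sequence. The derivative is measurable as a limit of difference quotients.\<close>

lemma has_vector_derivative_integral:
  fixes f :: "real \<Rightarrow> 'a \<Rightarrow> complex"
  assumes f: "\<And>\<tau>. integrable M (f \<tau>)" and G: "integrable M G"
    and d: "\<And>\<tau> z. z \<in> space M \<Longrightarrow> \<bar>\<tau>\<bar> < 1 \<Longrightarrow> ((\<lambda>r. f r z) has_vector_derivative f' \<tau> z) (at \<tau>)"
    and bd: "\<And>\<tau> z. z \<in> space M \<Longrightarrow> \<bar>\<tau>\<bar> < 1 \<Longrightarrow> cmod (f' \<tau> z) \<le> G z"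
  shows "((\<lambda>\<tau>. LINT z|M. f \<tau> z) has_vector_derivative (LINT z|M. f' 0 z)) (at 0)"
    and "integrable M (f' 0)"
proof -
  have quot: "(\<lambda>n. (1 / X n) *\<^sub>R (f (X n) z - f 0 z)) \<longlonglongrightarrow> f' 0 z"
    if X: "X \<longlonglongrightarrow> 0" "\<And>n. X n \<noteq> 0" and z: "z \<in> space M" for X z
  proof -
    have "((\<lambda>r. f r z) has_vector_derivative f' 0 z) (at 0)" using d[OF z, of 0] by simp
    then have "((\<lambda>r. (1 / (r - 0)) *\<^sub>R (f r z - f 0 z)) \<longlongrightarrow> f' 0 z) (at 0)"
      unfolding has_vector_derivative_def has_derivative_iff_norm
      apply (subst tendsto_iff)
      subgoal premises prems
      proof (intro allI impI)
        fix \<epsilon> :: real assume "0 < \<epsilon>"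
        then have "eventually (\<lambda>r. dist (norm (f r z - f 0 z - (r - 0) *\<^sub>R f' 0 z) / norm (r - 0)) 0 < \<epsilon>) (at 0)"
          using prems by (auto simp: tendsto_iff)
        moreover have "eventually (\<lambda>r::real. r \<noteq> 0) (at 0)" by (simp add: eventually_at_filter)
        ultimately show "eventually (\<lambda>r. dist ((1 / (r - 0)) *\<^sub>R (f r z - f 0 z)) (f' 0 z) < \<epsilon>) (at 0)"
        proof eventually_elim
          case (elim r)
          have "(1 / r) *\<^sub>R (f r z - f 0 z) - f' 0 z = (1 / r) *\<^sub>R (f r z - f 0 z - r *\<^sub>R f' 0 z)"
            using elim by (simp add: scaleR_diff_right)
          then show ?case using elim by (simp add: dist_norm)
        qed
      qed
      done
    then show ?thesis
      using X by (auto simp: tendsto_at_iff_sequentially comp_def)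
  qed
  have incr: "cmod (f r z - f 0 z) \<le> G z * \<bar>r\<bar>" if z: "z \<in> space M" and r: "\<bar>r\<bar> < 1" for r z
  proof -
    have "cmod (f r z - f 0 z) \<le> G z * norm (r - 0)"
    proof (rule differentiable_bound[where S = "{-1<..<1}" and f' = "\<lambda>\<tau> h. h *\<^sub>R f' \<tau> z"])
      fix \<tau> :: real assume t: "\<tau> \<in> {-1<..<1}"
      then have t': "\<bar>\<tau>\<bar> < 1" by auto
      show "((\<lambda>r. f r z) has_derivative (\<lambda>h. h *\<^sub>R f' \<tau> z)) (at \<tau> within {- 1<..<1})"
        using d[OF z t'] unfolding has_vector_derivative_def by (rule has_derivative_at_withinI)
      show "onorm (\<lambda>h. h *\<^sub>R f' \<tau> z) \<le> G z"
      proof (rule onorm_bound)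
        show "0 \<le> G z" using order_trans[OF norm_ge_zero bd[OF z t']] .
        show "cmod (h *\<^sub>R f' \<tau> z) \<le> G z * norm h" for h
          using mult_right_mono[OF bd[OF z t'], of "\<bar>h\<bar>"] by (simp add: mult.commute)
      qed
    qed (use r in auto)
    then show ?thesis by simp
  qed
  have seq0: "(\<lambda>n. 1 / (real n + 2)) \<longlonglongrightarrow> 0"
  proof -
    have "(\<lambda>n. 1 / real (n + 2)) \<longlonglongrightarrow> 0" by (rule LIMSEQ_ignore_initial_segment[OF lim_1_over_n])
    then show ?thesis by (simp add: add.commute)
  qed
  have f'_meas: "f' 0 \<in> borel_measurable M"
  proof (rule borel_measurable_LIMSEQ_metric)
    show "(\<lambda>z. (1 / (1 / (real n + 2))) *\<^sub>R (f (1 / (real n + 2)) z - f 0 z)) \<in> borel_measurable M" for n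
      using borel_measurable_integrable[OF f] by measurable
    show "(\<lambda>n. (1 / (1 / (real n + 2))) *\<^sub>R (f (1 / (real n + 2)) z - f 0 z)) \<longlonglongrightarrow> f' 0 z" if "z \<in> space M" for z
      using quot[OF seq0 _ that] by simp
  qed
  show f'_int: "integrable M (f' 0)"
    by (rule Bochner_Integration.integrable_bound[OF G f'_meas]) (use bd[of _ 0] in \<open>auto intro!: AE_I2 order_trans[OF _ abs_ge_self]\<close>)
  show "((\<lambda>\<tau>. LINT z|M. f \<tau> z) has_vector_derivative (LINT z|M. f' 0 z)) (at 0)"
    unfolding has_vector_derivative_def has_derivative_iff_norm
  proof (intro conjI)
    show "bounded_linear (\<lambda>x. x *\<^sub>R (LINT z|M. f' 0 z))" by (rule bounded_linear_scaleR_left)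
    show "((\<lambda>r. norm ((LINT z|M. f r z) - (LINT z|M. f 0 z) - (r - 0) *\<^sub>R (LINT z|M. f' 0 z)) / norm (r - 0)) \<longlongrightarrow> 0) (at 0)"
      unfolding tendsto_at_iff_sequentially
    proof (intro allI impI)
      fix X :: "nat \<Rightarrow> real" assume "\<forall>i. X i \<in> UNIV - {0}" and X: "X \<longlonglongrightarrow> 0"
      then have nz: "X n \<noteq> 0" for n by auto
      have "eventually (\<lambda>n. \<bar>X n\<bar> < 1) sequentially"
        using X unfolding tendsto_iff by (auto simp: dist_real_def)
      then obtain N where N: "\<And>n. n \<ge> N \<Longrightarrow> \<bar>X n\<bar> < 1" by (auto simp: eventually_sequentially)
      have XN: "(\<lambda>n. X (n + N)) \<longlonglongrightarrow> 0" by (rule LIMSEQ_ignore_initial_segment[OF X])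
      have "(\<lambda>n. LINT z|M. (1 / X (n + N)) *\<^sub>R (f (X (n + N)) z - f 0 z)) \<longlonglongrightarrow> (LINT z|M. f' 0 z)"
      proof (rule integral_dominated_convergence[OF f'_meas _ G])
        show "(\<lambda>z. (1 / X (n + N)) *\<^sub>R (f (X (n + N)) z - f 0 z)) \<in> borel_measurable M" for n
          using borel_measurable_integrable[OF f] by measurable
        show "AE z in M. (\<lambda>n. (1 / X (n + N)) *\<^sub>R (f (X (n + N)) z - f 0 z)) \<longlonglongrightarrow> f' 0 z"
          using quot[OF XN] nz by (intro AE_I2) auto
        show "AE z in M. norm ((1 / X (n + N)) *\<^sub>R (f (X (n + N)) z - f 0 z)) \<le> G z" for n
        proof (rule AE_I2)
          fix z assume "z \<in> space M"
          from incr[OF this N[of "n + N"]] show "norm ((1 / X (n + N)) *\<^sub>R (f (X (n + N)) z - f 0 z)) \<le> G z"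
            using nz[of "n + N"] by (simp add: divide_simps)
        qed
      qed
      then have "(\<lambda>n. norm ((LINT z|M. (1 / X (n + N)) *\<^sub>R (f (X (n + N)) z - f 0 z)) - (LINT z|M. f' 0 z))) \<longlonglongrightarrow> 0"
        by (simp add: tendsto_norm_zero_iff LIM_zero_iff)
      moreover have "norm ((LINT z|M. (1 / r) *\<^sub>R (f r z - f 0 z)) - (LINT z|M. f' 0 z)) =
         norm ((LINT z|M. f r z) - (LINT z|M. f 0 z) - (r - 0) *\<^sub>R (LINT z|M. f' 0 z)) / norm (r - 0)" if "r \<noteq> 0" for r
      proof -
        have "(LINT z|M. (1 / r) *\<^sub>R (f r z - f 0 z)) - (LINT z|M. f' 0 z) =
           (1 / r) *\<^sub>R ((LINT z|M. f r z) - (LINT z|M. f 0 z) - r *\<^sub>R (LINT z|M. f' 0 z))"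
          using that f by (simp add: scaleR_diff_right)
        then show ?thesis by simp
      qed
      ultimately have "(\<lambda>n. norm ((LINT z|M. f (X (n + N)) z) - (LINT z|M. f 0 z) - (X (n + N) - 0) *\<^sub>R (LINT z|M. f' 0 z)) / norm (X (n + N) - 0)) \<longlonglongrightarrow> 0"
        using nz by simp
      then show "((\<lambda>r. norm ((LINT z|M. f r z) - (LINT z|M. f 0 z) - (r - 0) *\<^sub>R (LINT z|M. f' 0 z)) / norm (r - 0)) \<circ> X) \<longlonglongrightarrow> 0"
        unfolding comp_def by (rule LIMSEQ_offset[of _ N])
    qed
  qed
qed

text \<open>The integral of a translate is constant in the translation. For a product \<open>F\<close> this is integration by
  parts without boundary terms.\<close>

lemma integral_directional_derivative_zero:
  fixes F :: "'a::euclidean_space \<Rightarrow> complex"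
  assumes F: "integrable lborel F"
    and d: "\<And>y. ((\<lambda>r. F (y + r *\<^sub>R e)) has_vector_derivative F' y) (at 0)"
    and G: "integrable lborel G" and bd: "\<And>\<tau> y. \<bar>\<tau>\<bar> < 1 \<Longrightarrow> cmod (F' (y + \<tau> *\<^sub>R e)) \<le> G y"
  shows "(LINT y|lborel. F' y) = 0"
proof -
  have shift: "(LINT y|lborel. F (y + \<tau> *\<^sub>R e)) = (LINT y|lborel. F y)"
      "integrable lborel (\<lambda>y. F (y + \<tau> *\<^sub>R e))" for \<tau>
    using integral_lborel_affine[of 1 F "\<tau> *\<^sub>R e"] integrable_lborel_affine[of 1 F "\<tau> *\<^sub>R e"] F
    by (simp_all add: add.commute)
  have "((\<lambda>\<tau>. LINT y|lborel. F (y + \<tau> *\<^sub>R e)) has_vector_derivative (LINT y|lborel. F' (y + 0 *\<^sub>R e))) (at 0)"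
  proof (rule has_vector_derivative_integral(1)[OF _ G])
    show "integrable lborel (\<lambda>y. F (y + \<tau> *\<^sub>R e))" for \<tau> by (rule shift)
    show "((\<lambda>r. F (y + r *\<^sub>R e)) has_vector_derivative F' (y + \<tau> *\<^sub>R e)) (at \<tau>)" for \<tau> y
    proof -
      have "((\<lambda>r. F ((y + \<tau> *\<^sub>R e) + r *\<^sub>R e)) \<circ> (\<lambda>r. r - \<tau>) has_vector_derivative (1 *\<^sub>R F' (y + \<tau> *\<^sub>R e))) (at \<tau>)"
        by (rule vector_diff_chain_at) (auto intro!: derivative_eq_intros d)
      then show ?thesis by (simp add: comp_def scaleR_diff_left)
    qed
  qed (use bd in auto)
  moreover have "((\<lambda>\<tau>. LINT y|lborel. F (y + \<tau> *\<^sub>R e)) has_vector_derivative 0) (at 0)"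
    unfolding shift(1) by (rule has_vector_derivative_const)
  ultimately show ?thesis using vector_derivative_unique_at by fastforce
qed

section \<open>Factorials, powers and exponentials\<close>

lemma power_le_fact_exp:
  fixes x :: real
  assumes "0 \<le> x"
  shows "x ^ m \<le> fact m * exp x"
proof -
  have "x ^ m / fact m = (\<Sum>n\<in>{m}. x ^ n / fact n)" by simp
  also have "\<dots> \<le> exp x"
    using sum_le_suminf[OF summable_exp[of x], of "{m}"] assms
    by (simp add: exp_def divide_inverse mult.commute)
  finally show ?thesis by (simp add: field_simps)
qed

lemma power_powr_commute: "0 \<le> x \<Longrightarrow> (x ^ m) powr s = (x powr s) ^ m" for x :: real
  by (induction m) (auto simp: powr_mult)

text \<open>The power of exponent \<open>s\<close> of \<open>y ^ m \<le> fact m * exp y\<close> at \<open>y = r / s * x powr (1 / s)\<close>.\<close>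

lemma power_le_fact_powr_exp:
  fixes x s r :: real
  assumes x: "0 \<le> x" and s: "0 < s" and r: "0 < r"
  shows "x ^ m \<le> fact m powr s * ((s / r) powr s) ^ m * exp (r * x powr (1 / s))"
proof (cases "x = 0")
  case True
  then show ?thesis using s r by (cases m) auto
next
  case False
  define y where "y = x powr (1 / s)"
  have xp: "0 < x" using False x by simp
  have y: "0 < y" using xp by (simp add: y_def)
  have xy: "x = y powr s" using s xp by (simp add: y_def powr_powr)
  have "(r / s * y) ^ m \<le> fact m * exp (r / s * y)"
    using s r y by (intro power_le_fact_exp) auto
  then have "y ^ m \<le> fact m * (s / r) ^ m * exp (r / s * y)"
    using s r by (simp add: power_mult_distrib power_divide field_simps)
  then have "(y ^ m) powr s \<le> (fact m * (s / r) ^ m * exp (r / s * y)) powr s"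
    using s y by (intro powr_mono2) auto
  also have "\<dots> = fact m powr s * ((s / r) ^ m) powr s * exp (r / s * y) powr s"
    using s r by (simp add: powr_mult)
  also have "((s / r) ^ m) powr s = ((s / r) powr s) ^ m"
    using s r by (simp add: power_powr_commute)
  also have "exp (r / s * y) powr s = exp (r * y)"
    using s by (simp add: powr_def)
  also have "(y ^ m) powr s = x ^ m"
    using y by (simp add: power_powr_commute flip: xy)
  finally show ?thesis by (simp add: y_def)
qed

text \<open>After the power of exponent \<open>1 / t\<close> the moment bounds say that the terms of an exponential series are
  dominated by those of a geometric series; the factor \<open>1 / 2\<close> in the rate makes the latter converge.\<close>

lemma decay_of_moments:
  fixes m x N h t :: real
  assumes m: "0 \<le> m" and x: "0 \<le> x" and h: "0 < h" and t: "0 < t"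
    and le: "\<And>b. m * x ^ b \<le> N * h ^ b * fact b powr t"
  shows "m \<le> N * 2 powr t * exp (- (t * h powr (- 1 / t) / 2) * x powr (1 / t))"
proof (cases "m = 0 \<or> x = 0")
  case True
  have N: "m \<le> N" using le[of 0] by simp
  have "1 \<le> 2 powr t" using t by (simp add: ge_one_powr_ge_zero)
  then have "N * 1 \<le> N * 2 powr t" using N m by (intro mult_left_mono) auto
  with True N m t show ?thesis by auto
next
  case False
  have N: "m \<le> N" using le[of 0] by simp
  have pos: "0 < m" "0 < x" "0 < N" using False m x N by auto
  define A where "A = (m / N) powr (1 / t)"
  define k where "k = h powr (- 1 / t)"
  define y where "y = x powr (1 / t)"
  have p: "0 < A" "0 < k" "0 < y" using pos h by (auto simp: A_def k_def y_def)
  have main: "A * ((k * y / 2) ^ b / fact b) \<le> (1 / 2) ^ b" for b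
  proof -
    have "m / N * x ^ b / h ^ b \<le> fact b powr t"
      using le[of b] pos h by (simp add: field_simps)
    then have "(m / N * x ^ b / h ^ b) powr (1 / t) \<le> (fact b powr t) powr (1 / t)"
      using t pos h by (intro powr_mono2) auto
    also have "\<dots> = fact b" using t by (simp add: powr_powr)
    also have "(m / N * x ^ b / h ^ b) powr (1 / t) = A * y ^ b * k ^ b"
      using pos h t by (simp add: A_def y_def k_def powr_mult powr_divide power_powr_commute powr_minus_divide power_divide mult_ac)
    finally have "A * y ^ b * k ^ b \<le> fact b" .
    then show ?thesis by (simp add: field_simps power_mult_distrib power_divide)
  qed
  have s1: "(\<lambda>b. A * ((k * y / 2) ^ b / fact b)) sums (A * exp (k * y / 2))"
    using exp_converges[of "k * y / 2"] by (intro sums_mult) (simp only: real_scaleR_def divide_inverse_commute)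
  have s2: "(\<lambda>b. (1 / 2) ^ b :: real) sums 2" using geometric_sums[of "1 / 2 :: real"] by simp
  have "A * exp (k * y / 2) \<le> 2" by (rule sums_le[OF main s1 s2])
  then have "A \<le> 2 * exp (- (k * y / 2))" by (simp add: exp_minus field_simps)
  then have "A powr t \<le> (2 * exp (- (k * y / 2))) powr t" using t p by (intro powr_mono2) auto
  also have "\<dots> = 2 powr t * exp (- (t * k / 2) * y)"
    by (simp add: powr_mult) (simp add: powr_def)
  also have "A powr t = m / N" using t pos by (simp add: A_def powr_powr)
  finally show ?thesis using pos by (simp add: k_def y_def field_simps)
qed

text \<open>The form in which the Leibniz rule and the binomial expansion of a power of a sum produce their terms.
  The factorials combine by \<open>fact k * fact (n - k) \<le> fact n\<close>, the geometric factors by the binomial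
  theorem.\<close>

lemma binomial_sum_bound:
  fixes p q :: "nat \<Rightarrow> real"
  assumes p: "\<And>m. p m \<le> P * R ^ m * fact m powr s" "\<And>m. 0 \<le> p m"
    and q: "\<And>m. q m \<le> Q * b ^ m * fact m powr s" "\<And>m. 0 \<le> q m"
    and nn: "0 \<le> s" "0 \<le> R" "0 \<le> b" "0 \<le> P" "0 \<le> Q"
  shows "(\<Sum>k\<le>n. (n choose k) * (p k * q (n - k))) \<le> P * Q * (R + b) ^ n * fact n powr s"
proof -
  have "(\<Sum>k\<le>n. (n choose k) * (p k * q (n - k))) \<le>
      (\<Sum>k\<le>n. (n choose k) * (P * Q * R ^ k * b ^ (n - k) * fact n powr s))"
  proof (intro sum_mono mult_left_mono)
    fix k assume k: "k \<in> {..n}"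
    have "p k * q (n - k) \<le> (P * R ^ k * fact k powr s) * (Q * b ^ (n - k) * fact (n - k) powr s)"
      by (intro mult_mono p q) (use nn in auto)
    also have "\<dots> = P * Q * R ^ k * b ^ (n - k) * (fact k * fact (n - k)) powr s"
      by (simp add: powr_mult)
    also have "\<dots> \<le> P * Q * R ^ k * b ^ (n - k) * fact n powr s"
    proof (intro mult_left_mono powr_mono2)
      have "fact k * fact (n - k) * 1 \<le> (fact k * fact (n - k) * (n choose k) :: nat)"
        using k by (intro mult_left_mono) (auto simp: Suc_le_eq)
      also have "\<dots> = fact n" using binomial_fact_lemma[of k n] k by simp
      finally have "fact k * fact (n - k) \<le> (fact n :: nat)" by simp
      then have "real (fact k * fact (n - k)) \<le> real (fact n)" by linarith
      then show "fact k * fact (n - k) \<le> (fact n :: real)" by simp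
    qed (use nn in auto)
    finally show "p k * q (n - k) \<le> P * Q * R ^ k * b ^ (n - k) * fact n powr s" .
  qed simp
  also have "\<dots> = P * Q * (R + b) ^ n * fact n powr s"
    by (simp add: binomial_ring sum_distrib_left sum_distrib_right mult_ac)
  finally show ?thesis .
qed

text \<open>The \<open>k\<close>-th derivative of a Gaussian is of size \<open>5 ^ k * sqrt (fact k)\<close>, and so are its moments. The
  predicate states that this is admissible in a Gelfand--Shilov quotient of exponent \<open>s\<close> at level \<open>b\<close>. One level
  is admissible for \<open>s \<ge> 1/2\<close>, and all levels are for \<open>s > 1/2\<close>; this separates the two
  kinds of spaces.\<close>

definition absorbs_gauss :: "real \<Rightarrow> real \<Rightarrow> bool" where
  "absorbs_gauss s b \<longleftrightarrow> 0 < b \<and> 0 < s \<and> (\<exists>C>0. \<forall>k::nat. 5 ^ k * sqrt (fact k) \<le> C * b ^ k * fact k powr s)"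

lemma absorbs_gauss_ge_half:
  assumes "1 / 2 \<le> s"
  shows "absorbs_gauss s 5"
proof -
  have "sqrt (fact k) \<le> fact k powr s" for k :: nat
    using assms by (simp add: powr_half_sqrt[symmetric] powr_mono)
  then show ?thesis
    using assms by (auto simp: absorbs_gauss_def intro!: exI[of _ 1])
qed

lemma absorbs_gauss_gt_half:
  assumes "1 / 2 < s" "0 < b"
  shows "absorbs_gauss s b"
proof -
  define r where "r = s - 1 / 2"
  define C where "C = exp (r * (5 / b) powr (1 / r))"
  have r: "0 < r" using assms by (simp add: r_def)
  have "5 ^ k * sqrt (fact k) \<le> C * b ^ k * fact k powr s" for k :: nat
  proof -
    have "(5 / b) ^ k \<le> fact k powr r * ((r / r) powr r) ^ k * C"
      unfolding C_def using assms r by (intro power_le_fact_powr_exp) auto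
    then have "5 ^ k \<le> b ^ k * (fact k powr r * C)"
      using assms r by (simp add: power_divide field_simps)
    then have "5 ^ k * fact k powr (1 / 2) \<le> b ^ k * (fact k powr r * C) * fact k powr (1 / 2)"
      by (intro mult_right_mono) auto
    also have "\<dots> = C * b ^ k * (fact k powr r * fact k powr (1 / 2))" by simp
    also have "fact k powr r * fact k powr (1 / 2) = fact k powr s"
      by (simp add: powr_add[symmetric] r_def)
    finally show ?thesis by (simp add: powr_half_sqrt)
  qed
  moreover have "0 < C" by (simp add: C_def)
  ultimately show ?thesis using assms by (auto simp: absorbs_gauss_def)
qed

lemma absorbs_gaussE:
  assumes "absorbs_gauss s b"
  obtains C where "0 < C" "\<And>k::nat. 5 ^ k * sqrt (fact k) \<le> C * b ^ k * fact k powr s"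
  using assms unfolding absorbs_gauss_def by blast

lemma polynomial_le_exp_powr:
  fixes r q :: real and N :: nat
  assumes r: "0 < r" and q: "0 < q"
  obtains C where "0 < C" "\<And>x. 0 \<le> x \<Longrightarrow> (1 + x) ^ N \<le> C * exp (r * x powr q)"
proof -
  define s where "s = 1 / q"
  have s: "0 < s" "1 / s = q" using q by (auto simp: s_def)
  define D where "D = fact N powr s * ((s / r) powr s) ^ N"
  have D: "0 < D" using s r by (simp add: D_def)
  show ?thesis
  proof (rule that[of "2 ^ N * (1 + D)"])
    show "0 < 2 ^ N * (1 + D)" using D by simp
    fix x :: real assume x: "0 \<le> x"
    have E: "1 \<le> exp (r * x powr q)" using r by simp
    have "(1 + x) ^ N \<le> (2 * max 1 x) ^ N" using x by (intro power_mono) auto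
    also have "\<dots> \<le> 2 ^ N * (1 + x ^ N)"
      using x by (auto simp: power_mult_distrib max_def)
    also have "1 + x ^ N \<le> exp (r * x powr q) + D * exp (r * x powr q)"
      using power_le_fact_powr_exp[OF x s(1) r, of N] E by (auto simp: D_def s intro!: add_mono)
    finally show "(1 + x) ^ N \<le> 2 ^ N * (1 + D) * exp (r * x powr q)"
      by (simp add: algebra_simps)
  qed
qed

section \<open>Gaussian wave packets\<close>

text \<open>For restrictions of products of entire functions of one variable, the partial derivatives become complex
  derivatives in one variable, to which Cauchy's inequality applies. They depend only on the number of
  differentiations in each direction, so that the choice in \<open>multi_deriv\<close> is immaterial.\<close>

definition tensor :: "('d::finite \<Rightarrow> complex \<Rightarrow> complex) \<Rightarrow> real^'d \<Rightarrow> complex" where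
  "tensor F y = (\<Prod>i\<in>UNIV. F i (complex_of_real (y $ i)))"

lemma tensor_has_vector_derivative:
  fixes F :: "'d::finite \<Rightarrow> complex \<Rightarrow> complex"
  assumes F: "F j holomorphic_on UNIV"
  shows "((\<lambda>r. tensor F (y + r *\<^sub>R axis j 1)) has_vector_derivative tensor (F(j := deriv (F j))) y) (at 0)"
proof -
  let ?R = "\<Prod>i\<in>UNIV - {j}. F i (complex_of_real (y $ i))"
  have eq: "tensor F (y + r *\<^sub>R axis j 1) = F j (complex_of_real (y $ j + r)) * ?R" for r
    unfolding tensor_def by (subst prod.remove[of _ j]) (auto simp: axis_def intro!: prod.cong)
  have "(F j has_field_derivative deriv (F j) (complex_of_real (y $ j + 0))) (at (complex_of_real (y $ j + 0)))"
    using holomorphic_derivI[OF F open_UNIV] by simp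
  then have "((F j \<circ> (\<lambda>r. complex_of_real (y $ j + r))) has_vector_derivative 1 * deriv (F j) (complex_of_real (y $ j + 0))) (at 0)"
    by (intro field_vector_diff_chain_at) (auto intro!: derivative_eq_intros simp: has_vector_derivative_def fun_eq_iff scaleR_conv_of_real)
  then have "((\<lambda>r. F j (complex_of_real (y $ j + r)) * ?R) has_vector_derivative deriv (F j) (complex_of_real (y $ j)) * ?R) (at 0)"
    unfolding comp_def by (intro has_vector_derivative_mult_left) simp
  moreover have "tensor (F(j := deriv (F j))) y = deriv (F j) (complex_of_real (y $ j)) * ?R"
    unfolding tensor_def by (subst prod.remove[of _ j]) (auto intro!: prod.cong)
  ultimately show ?thesis by (simp only: eq)
qed

lemma partial_deriv_tensor:
  fixes F :: "'d::finite \<Rightarrow> complex \<Rightarrow> complex"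
  assumes "F j holomorphic_on UNIV"
  shows "partial_deriv j (tensor F) = tensor (F(j := deriv (F j)))"
  unfolding partial_deriv_def[abs_def]
  by (intro ext vector_derivative_at tensor_has_vector_derivative assms)

lemma partial_derivs_tensor:
  fixes F :: "'d::finite \<Rightarrow> complex \<Rightarrow> complex"
  assumes F: "\<And>i. F i holomorphic_on UNIV"
  shows "partial_derivs is (tensor F) = tensor (\<lambda>i. (deriv ^^ count_list is i) (F i))"
proof (induction "is")
  case Nil
  show ?case by (simp add: partial_derivs_def)
next
  case (Cons j "is")
  let ?G = "\<lambda>i. (deriv ^^ count_list is i) (F i)"
  have "partial_derivs (j # is) (tensor F) = partial_deriv j (partial_derivs is (tensor F))"
    by (simp add: partial_derivs_def)
  also have "\<dots> = tensor (?G(j := deriv (?G j)))"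
    unfolding Cons.IH by (intro partial_deriv_tensor holomorphic_higher_deriv F open_UNIV)
  also have "?G(j := deriv (?G j)) = (\<lambda>i. (deriv ^^ count_list (j # is) i) (F i))" by auto
  finally show ?case .
qed

lemma multi_deriv_tensor:
  fixes F :: "'d::finite \<Rightarrow> complex \<Rightarrow> complex"
  assumes F: "\<And>i. F i holomorphic_on UNIV"
  shows "multi_deriv \<alpha> (tensor F) = tensor (\<lambda>i. (deriv ^^ \<alpha> i) (F i))"
proof -
  have "\<forall>i. count_list (SOME is. \<forall>i. count_list is i = \<alpha> i) i = \<alpha> i"
    by (rule someI_ex[OF count_list_exists])
  then show ?thesis unfolding multi_deriv_def by (simp add: partial_derivs_tensor[OF F])
qed

lemma continuous_on_tensor:
  assumes "\<And>i. F i holomorphic_on UNIV"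
  shows "continuous_on UNIV (tensor F)"
  unfolding tensor_def[abs_def]
  by (intro continuous_intros continuous_on_compose2[OF holomorphic_on_imp_continuous_on[OF assms]]) auto

lemma smooth_fun_tensor:
  fixes F :: "'d::finite \<Rightarrow> complex \<Rightarrow> complex"
  assumes F: "\<And>i. F i holomorphic_on UNIV"
  shows "smooth_fun (tensor F)"
  unfolding smooth_fun_def partial_derivs_tensor[OF F]
  by (auto intro!: continuous_on_tensor holomorphic_higher_deriv F differentiableI_vector[OF tensor_has_vector_derivative])

text \<open>The linear functional whose modulus is \<open>gs_quot\<close>. Linearity allows the quotients of superpositions
  to be integrated and differentiated in parameters.\<close>

definition gs_fun :: "real \<Rightarrow> real \<Rightarrow> real \<Rightarrow> ('d::finite \<Rightarrow> nat) \<times> ('d \<Rightarrow> nat) \<times> (real^'d) \<Rightarrow> (real^'d \<Rightarrow> complex) \<Rightarrow> complex" where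
  "gs_fun s t h = (\<lambda>(\<alpha>, \<beta>, x) f. of_real (multi_pow x \<beta> /
     (h ^ (\<Sum>i\<in>UNIV. \<alpha> i + \<beta> i) * multi_fact \<alpha> powr s * multi_fact \<beta> powr t)) * multi_deriv \<alpha> f x)"

lemma gs_quot_eq_norm_gs_fun:
  assumes "0 < h"
  shows "gs_quot s t h f \<mu> = cmod (gs_fun s t h \<mu> f)"
  using assms by (cases \<mu>) (simp add: gs_quot_def gs_fun_def norm_mult norm_divide norm_power abs_mult)

lemma gs_fun_lin:
  assumes "smooth_fun f" "smooth_fun g"
  shows "gs_fun s t h \<mu> (\<lambda>x. a * f x + b * g x) = a * gs_fun s t h \<mu> f + b * gs_fun s t h \<mu> g"
  unfolding gs_fun_def case_prod_unfold multi_deriv_def partial_derivs_lin[OF assms]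
  by (simp only: distrib_left mult.left_commute)

lemma gs_fun_cmult:
  assumes "smooth_fun f"
  shows "gs_fun s t h \<mu> (\<lambda>x. a * f x) = a * gs_fun s t h \<mu> f"
  using gs_fun_lin[OF assms assms, of s t h \<mu> a 0] by simp

lemma gs_fun_diff:
  assumes "smooth_fun f" "smooth_fun g"
  shows "gs_fun s t h \<mu> (\<lambda>x. f x - g x) = gs_fun s t h \<mu> f - gs_fun s t h \<mu> g"
  using gs_fun_lin[OF assms, of s t h \<mu> 1 "-1"] by simp

lemma smooth_fun_cmult: "smooth_fun f \<Longrightarrow> smooth_fun (\<lambda>x. a * f x)"
  using smooth_fun_lin[of f f a 0] by simp

lemma gs_fun_tensor:
  fixes F :: "'d::finite \<Rightarrow> complex \<Rightarrow> complex"
  assumes F: "\<And>i. F i holomorphic_on UNIV" and h: "0 < h"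
  shows "gs_fun s t h (\<alpha>, \<beta>, y) (tensor F) = (\<Prod>i\<in>UNIV. complex_of_real ((y $ i) ^ \<beta> i /
     (h ^ (\<alpha> i + \<beta> i) * fact (\<alpha> i) powr s * fact (\<beta> i) powr t)) * (deriv ^^ \<alpha> i) (F i) (complex_of_real (y $ i)))"
proof -
  have "multi_pow y \<beta> / (h ^ (\<Sum>i\<in>UNIV. \<alpha> i + \<beta> i) * multi_fact \<alpha> powr s * multi_fact \<beta> powr t) =
      (\<Prod>i\<in>UNIV. (y $ i) ^ \<beta> i / (h ^ (\<alpha> i + \<beta> i) * fact (\<alpha> i) powr s * fact (\<beta> i) powr t))"
    unfolding multi_pow_def multi_fact_def
    by (subst (1 2) prod_powr_distrib) (auto simp: power_sum prod.distrib prod_dividef)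
  then show ?thesis
    unfolding gs_fun_def prod.case multi_deriv_tensor[OF F] by (simp add: tensor_def prod.distrib del: of_real_divide of_real_mult of_real_power)
qed

definition gauss1 :: "complex \<Rightarrow> complex" where "gauss1 \<zeta> = exp (- (\<zeta>\<^sup>2) / 2)"

lemma holomorphic_gauss1 [holomorphic_intros]: "f holomorphic_on A \<Longrightarrow> (\<lambda>z. gauss1 (f z)) holomorphic_on A"
  unfolding gauss1_def by (intro holomorphic_intros) auto

text \<open>Cauchy's inequality on the circle of radius \<open>sqrt k\<close>, which balances the factor \<open>\<rho> ^ k\<close> against the growth
  of the Gaussian in the imaginary direction. Half of the real exponent is left as decay.\<close>

lemma deriv_gauss1_bound:
  "cmod ((deriv ^^ k) gauss1 (complex_of_real v)) \<le> 5 ^ k * sqrt (fact k) * exp (- (v\<^sup>2 / 4))"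
proof (cases "k = 0")
  case True
  then show ?thesis by (simp add: gauss1_def norm_exp_eq_Re flip: of_real_power)
next
  case False
  \<comment> \<open>the minimiser of \<open>exp (\<rho>\<^sup>2 / 2) / \<rho> ^ k\<close>\<close>
  define \<rho> where "\<rho> = sqrt (real k)"
  have \<rho>: "0 < \<rho>" "\<rho>\<^sup>2 = k" using False by (auto simp: \<rho>_def)
  have "cmod ((deriv ^^ k) gauss1 (complex_of_real v)) \<le> fact k * exp (- (v\<^sup>2 / 4) + \<rho>\<^sup>2 / 2) / \<rho> ^ k"
  proof (rule Cauchy_inequality)
    have hol: "gauss1 holomorphic_on A" for A using holomorphic_gauss1[OF holomorphic_on_ident] by simp
    show "gauss1 holomorphic_on ball (complex_of_real v) \<rho>" by (rule hol)
    show "continuous_on (cball (complex_of_real v) \<rho>) gauss1" by (rule holomorphic_on_imp_continuous_on[OF hol])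
    show "0 < \<rho>" by (rule \<rho>)
    fix x assume x: "cmod (complex_of_real v - x) = \<rho>"
    define a b where "a = Re x - v" and "b = Im x"
    have r: "a\<^sup>2 + b\<^sup>2 = \<rho>\<^sup>2"
      using x by (simp add: cmod_def a_def b_def power2_commute[of v] real_sqrt_eq_iff flip: x)
    have "- Re (x\<^sup>2) / 2 = - (v + a)\<^sup>2 / 2 + b\<^sup>2 / 2"
      by (simp add: a_def b_def field_simps power2_eq_square)
    also have "\<dots> \<le> - (v\<^sup>2 / 4) + (a\<^sup>2 + b\<^sup>2) / 2"
      using zero_le_power2[of "v / 2 + a"] by (simp add: power2_eq_square field_simps)
    finally show "cmod (gauss1 x) \<le> exp (- (v\<^sup>2 / 4) + \<rho>\<^sup>2 / 2)"
      by (simp add: gauss1_def norm_exp_eq_Re r)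
  qed
  also have "\<dots> = fact k / \<rho> ^ k * exp (k / 2) * exp (- (v\<^sup>2 / 4))"
    unfolding exp_add \<rho>(2) by (simp add: mult_ac)
  also have "\<dots> \<le> sqrt (fact k) * 5 ^ k * exp (- (v\<^sup>2 / 4))"
  proof (intro mult_right_mono mult_mono)
    have "fact k \<le> real k ^ k" using fact_le_power[of k, where 'a = real] by simp
    then have "sqrt (fact k) \<le> sqrt (real k ^ k)" by simp
    also have "\<dots> = \<rho> ^ k" by (simp add: \<rho>_def real_sqrt_power)
    finally have "sqrt (fact k) * sqrt (fact k) \<le> sqrt (fact k) * \<rho> ^ k" by (intro mult_left_mono) auto
    then have "fact k \<le> sqrt (fact k) * \<rho> ^ k" by simp
    then show "fact k / \<rho> ^ k \<le> sqrt (fact k)" using \<rho> by (simp add: divide_le_eq)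
    have "exp (k / 2) = exp (1 / 2) ^ k" by (simp add: exp_of_nat_mult[symmetric])
    also have "\<dots> \<le> 5 ^ k"
    proof (intro power_mono)
      have "exp (1 / 2 :: real) \<le> exp 1" by simp
      also have "\<dots> \<le> 5" using exp_le by simp
      finally show "exp (1 / 2 :: real) \<le> 5" .
    qed simp
    finally show "exp (k / 2) \<le> 5 ^ k" .
  qed auto
  finally show ?thesis by (simp add: mult_ac)
qed

text \<open>The square root of \<open>y ^ l \<le> fact l * exp y\<close> at \<open>y = v\<^sup>2 / 4\<close>.\<close>

lemma power_gauss_bound: "\<bar>v\<bar> ^ l * exp (- (v\<^sup>2 / 8)) \<le> 5 ^ l * sqrt (fact l)"
proof -
  have "(v\<^sup>2 / 4) ^ l \<le> fact l * exp (v\<^sup>2 / 4)" by (rule power_le_fact_exp) simp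
  then have "sqrt ((v\<^sup>2 / 4) ^ l) \<le> sqrt (fact l * exp (v\<^sup>2 / 4))" by simp
  also have "\<dots> = sqrt (fact l) * exp (v\<^sup>2 / 8)"
  proof -
    have "exp (v\<^sup>2 / 4) = (exp (v\<^sup>2 / 8))\<^sup>2" by (simp add: exp_double[symmetric])
    then show ?thesis by (simp add: real_sqrt_mult)
  qed
  also have "sqrt ((v\<^sup>2 / 4) ^ l) = (\<bar>v\<bar> / 2) ^ l"
  proof -
    have "v\<^sup>2 / 4 = (\<bar>v\<bar> / 2) * (\<bar>v\<bar> / 2)" by (simp add: power2_eq_square)
    then have "(v\<^sup>2 / 4) ^ l = (\<bar>v\<bar> / 2) ^ l * (\<bar>v\<bar> / 2) ^ l" by (simp only: power_mult_distrib)
    then show ?thesis by simp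
  qed
  finally have "\<bar>v\<bar> ^ l \<le> 2 ^ l * (sqrt (fact l) * exp (v\<^sup>2 / 8))" by (simp add: power_divide field_simps)
  also have "\<dots> \<le> 5 ^ l * (sqrt (fact l) * exp (v\<^sup>2 / 8))" by (intro mult_right_mono power_mono) auto
  finally show ?thesis by (simp add: exp_minus field_simps)
qed

lemma higher_deriv_exp_linear: "(deriv ^^ m) (\<lambda>\<zeta>. exp (c * \<zeta>)) = (\<lambda>\<zeta>. c ^ m * exp (c * \<zeta>))" for c :: complex
proof (induction m)
  case (Suc m)
  have "deriv (\<lambda>\<zeta>. c ^ m * exp (c * \<zeta>)) \<zeta> = c ^ Suc m * exp (c * \<zeta>)" for \<zeta>
    by (rule DERIV_imp_deriv) (auto intro!: derivative_eq_intros)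
  then show ?case using Suc by auto
qed simp

definition atom1 :: "real \<Rightarrow> real \<Rightarrow> complex \<Rightarrow> complex" where
  "atom1 x \<xi> \<zeta> = exp (- \<i> * of_real \<xi> * \<zeta>) * gauss1 (\<zeta> - of_real x)"

lemma holomorphic_atom1: "atom1 x \<xi> holomorphic_on A"
  unfolding atom1_def[abs_def] by (intro holomorphic_intros)

lemma deriv_atom1_bound:
  "cmod ((deriv ^^ a) (atom1 x \<xi>) (complex_of_real y)) \<le>
    (\<Sum>k\<le>a. (a choose k) * (\<bar>\<xi>\<bar> ^ k * (5 ^ (a - k) * sqrt (fact (a - k))))) * exp (- ((y - x)\<^sup>2 / 4))"
proof -
  have "(deriv ^^ a) (atom1 x \<xi>) (complex_of_real y) =
      (\<Sum>k=0..a. of_nat (a choose k) * (deriv ^^ k) (\<lambda>\<zeta>. exp (- \<i> * of_real \<xi> * \<zeta>)) (complex_of_real y) *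
        (deriv ^^ (a - k)) (\<lambda>\<zeta>. gauss1 (\<zeta> - of_real x)) (complex_of_real y))"
    unfolding atom1_def[abs_def] by (rule higher_deriv_mult[of _ UNIV]) (auto intro!: holomorphic_intros)
  also have "cmod \<dots> \<le> (\<Sum>k=0..a. (a choose k) * (\<bar>\<xi>\<bar> ^ k * (5 ^ (a - k) * sqrt (fact (a - k)))) * exp (- ((y - x)\<^sup>2 / 4)))"
  proof (rule sum_norm_le)
    fix k
    have "(deriv ^^ (a - k)) (\<lambda>\<zeta>. gauss1 (1 * \<zeta> + (- of_real x))) (complex_of_real y) =
        1 ^ (a - k) * (deriv ^^ (a - k)) gauss1 (1 * complex_of_real y + - of_real x)"
      by (rule higher_deriv_compose_linear'[of _ UNIV UNIV]) (auto intro!: holomorphic_intros simp: holomorphic_gauss1[OF holomorphic_on_ident, simplified])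
    then have g: "(deriv ^^ (a - k)) (\<lambda>\<zeta>. gauss1 (\<zeta> - of_real x)) (complex_of_real y) = (deriv ^^ (a - k)) gauss1 (complex_of_real (y - x))"
      by simp
    have "cmod (of_nat (a choose k) * (deriv ^^ k) (\<lambda>\<zeta>. exp (- \<i> * of_real \<xi> * \<zeta>)) (complex_of_real y) *
        (deriv ^^ (a - k)) (\<lambda>\<zeta>. gauss1 (\<zeta> - of_real x)) (complex_of_real y)) =
        (a choose k) * \<bar>\<xi>\<bar> ^ k * cmod ((deriv ^^ (a - k)) gauss1 (complex_of_real (y - x)))"
      unfolding g higher_deriv_exp_linear by (simp add: norm_mult norm_power norm_exp_eq_Re)
    also have "\<dots> \<le> (a choose k) * \<bar>\<xi>\<bar> ^ k * (5 ^ (a - k) * sqrt (fact (a - k)) * exp (- ((y - x)\<^sup>2 / 4)))"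
      by (intro mult_left_mono deriv_gauss1_bound) auto
    finally show "cmod (of_nat (a choose k) * (deriv ^^ k) (\<lambda>\<zeta>. exp (- \<i> * of_real \<xi> * \<zeta>)) (complex_of_real y) *
        (deriv ^^ (a - k)) (\<lambda>\<zeta>. gauss1 (\<zeta> - of_real x)) (complex_of_real y))
        \<le> (a choose k) * (\<bar>\<xi>\<bar> ^ k * (5 ^ (a - k) * sqrt (fact (a - k)))) * exp (- ((y - x)\<^sup>2 / 4))"
      by (simp add: mult_ac)
  qed
  finally show ?thesis by (simp add: sum_distrib_right atLeast0AtMost)
qed

lemma moment_gauss_bound:
  "\<bar>y\<bar> ^ b * exp (- ((y - x)\<^sup>2 / 8)) \<le> (\<Sum>l\<le>b. (b choose l) * (\<bar>x\<bar> ^ l * (5 ^ (b - l) * sqrt (fact (b - l)))))"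
proof -
  have "\<bar>y\<bar> ^ b \<le> (\<bar>x\<bar> + \<bar>y - x\<bar>) ^ b" by (intro power_mono) auto
  also have "\<dots> = (\<Sum>l\<le>b. (b choose l) * \<bar>x\<bar> ^ l * \<bar>y - x\<bar> ^ (b - l))" by (rule binomial_ring)
  finally have "\<bar>y\<bar> ^ b * exp (- ((y - x)\<^sup>2 / 8)) \<le>
      (\<Sum>l\<le>b. (b choose l) * \<bar>x\<bar> ^ l * \<bar>y - x\<bar> ^ (b - l)) * exp (- ((y - x)\<^sup>2 / 8))"
    by (rule mult_right_mono) simp
  also have "\<dots> = (\<Sum>l\<le>b. (b choose l) * \<bar>x\<bar> ^ l * (\<bar>y - x\<bar> ^ (b - l) * exp (- ((y - x)\<^sup>2 / 8))))"
    by (simp only: sum_distrib_right mult.assoc)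
  also have "\<dots> \<le> (\<Sum>l\<le>b. (b choose l) * \<bar>x\<bar> ^ l * (5 ^ (b - l) * sqrt (fact (b - l))))"
    by (intro sum_mono mult_left_mono power_gauss_bound) auto
  finally show ?thesis by (simp add: mult_ac)
qed

text \<open>The Leibniz rule produces powers of \<open>\<xi>\<close> and derivatives of the Gaussian, and the expansion of \<open>y\<close> around
  \<open>x\<close> produces powers of \<open>x\<close> and moments of the Gaussian. The powers of \<open>\<xi>\<close> and \<open>x\<close> cost the level \<open>R\<close> and the exponential
  of rate \<open>r\<close>; derivatives and moments cost the level \<open>b\<close>. Part of the Gaussian decay that the
  derivatives leave absorbs the moments.\<close>

lemma atom1_quotient_bound:
  assumes s: "absorbs_gauss s b" and t: "absorbs_gauss t b" and r: "0 < r" and R: "(s / r) powr s \<le> R" "(t / r) powr t \<le> R"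
  obtains C where "0 < C" "\<And>x \<xi> y \<alpha> \<beta>.
    cmod (complex_of_real (y ^ \<beta> / ((R + b) ^ (\<alpha> + \<beta>) * fact \<alpha> powr s * fact \<beta> powr t)) *
      (deriv ^^ \<alpha>) (atom1 x \<xi>) (complex_of_real y)) \<le> C * exp (r * (\<bar>x\<bar> powr (1 / t) + \<bar>\<xi>\<bar> powr (1 / s)))"
proof -
  obtain C1 where C1: "0 < C1" "\<And>k::nat. 5 ^ k * sqrt (fact k) \<le> C1 * b ^ k * fact k powr s"
    using absorbs_gaussE[OF s] by blast
  obtain C2 where C2: "0 < C2" "\<And>k::nat. 5 ^ k * sqrt (fact k) \<le> C2 * b ^ k * fact k powr t"
    using absorbs_gaussE[OF t] by blast
  have pos: "0 < b" "0 < s" "0 < t" using s t by (auto simp: absorbs_gauss_def)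
  have R0: "0 < R" using pos r R(1) by (intro less_le_trans[OF _ R(1)]) auto
  have pw: "\<bar>X\<bar> ^ m \<le> exp (r * \<bar>X\<bar> powr (1 / u)) * R ^ m * fact m powr u"
    if "0 < u" "(u / r) powr u \<le> R" for X u :: real and m
  proof -
    have "\<bar>X\<bar> ^ m \<le> fact m powr u * ((u / r) powr u) ^ m * exp (r * \<bar>X\<bar> powr (1 / u))"
      by (rule power_le_fact_powr_exp) (use that r in auto)
    also have "\<dots> \<le> fact m powr u * R ^ m * exp (r * \<bar>X\<bar> powr (1 / u))"
      using that by (intro mult_right_mono mult_left_mono power_mono) auto
    finally show ?thesis by (simp add: mult_ac)
  qed
  show ?thesis
  proof (rule that[of "C1 * C2"])
    show "0 < C1 * C2" using C1 C2 by simp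
    fix x \<xi> y :: real and \<alpha> \<beta> :: nat
    let ?D = "(deriv ^^ \<alpha>) (atom1 x \<xi>) (complex_of_real y)"
    let ?E = "exp (- ((y - x)\<^sup>2 / 8))"
    have 1: "(\<Sum>k\<le>\<alpha>. (\<alpha> choose k) * (\<bar>\<xi>\<bar> ^ k * (5 ^ (\<alpha> - k) * sqrt (fact (\<alpha> - k)))))
        \<le> exp (r * \<bar>\<xi>\<bar> powr (1 / s)) * C1 * (R + b) ^ \<alpha> * fact \<alpha> powr s"
      by (rule binomial_sum_bound[OF pw _ C1(2)]) (use pos R R0 C1 in auto)
    have 2: "(\<Sum>k\<le>\<beta>. (\<beta> choose k) * (\<bar>x\<bar> ^ k * (5 ^ (\<beta> - k) * sqrt (fact (\<beta> - k)))))
        \<le> exp (r * \<bar>x\<bar> powr (1 / t)) * C2 * (R + b) ^ \<beta> * fact \<beta> powr t"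
      by (rule binomial_sum_bound[OF pw _ C2(2)]) (use pos R R0 C2 in auto)
    \<comment> \<open>One factor absorbs the powers of y - x, the other one is bounded by 1.\<close>
    have E: "exp (- ((y - x)\<^sup>2 / 4)) = ?E * ?E" by (simp add: exp_add[symmetric])
    have "\<bar>y\<bar> ^ \<beta> * cmod ?D \<le> \<bar>y\<bar> ^ \<beta> * ((exp (r * \<bar>\<xi>\<bar> powr (1 / s)) * C1 * (R + b) ^ \<alpha> * fact \<alpha> powr s) * (?E * ?E))"
      using order_trans[OF deriv_atom1_bound mult_right_mono[OF 1]] unfolding E[symmetric]
      by (intro mult_left_mono) auto
    also have "\<dots> = (\<bar>y\<bar> ^ \<beta> * ?E) * ((exp (r * \<bar>\<xi>\<bar> powr (1 / s)) * C1 * (R + b) ^ \<alpha> * fact \<alpha> powr s) * ?E)"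
      by (simp only: mult_ac)
    also have "\<dots> \<le> (exp (r * \<bar>x\<bar> powr (1 / t)) * C2 * (R + b) ^ \<beta> * fact \<beta> powr t) *
        ((exp (r * \<bar>\<xi>\<bar> powr (1 / s)) * C1 * (R + b) ^ \<alpha> * fact \<alpha> powr s) * 1)"
      using C1 C2 R0 pos by (intro mult_mono order_trans[OF moment_gauss_bound 2]) auto
    also have "\<dots> = (C1 * C2 * exp (r * (\<bar>x\<bar> powr (1 / t) + \<bar>\<xi>\<bar> powr (1 / s)))) *
        ((R + b) ^ (\<alpha> + \<beta>) * fact \<alpha> powr s * fact \<beta> powr t)"
      by (simp add: distrib_left exp_add power_add mult_ac)
    finally have "\<bar>y\<bar> ^ \<beta> * cmod ?D / ((R + b) ^ (\<alpha> + \<beta>) * fact \<alpha> powr s * fact \<beta> powr t) \<le>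
        C1 * C2 * exp (r * (\<bar>x\<bar> powr (1 / t) + \<bar>\<xi>\<bar> powr (1 / s)))"
      using R0 pos by (subst pos_divide_le_eq) auto
    then show "cmod (complex_of_real (y ^ \<beta> / ((R + b) ^ (\<alpha> + \<beta>) * fact \<alpha> powr s * fact \<beta> powr t)) * ?D)
        \<le> C1 * C2 * exp (r * (\<bar>x\<bar> powr (1 / t) + \<bar>\<xi>\<bar> powr (1 / s)))"
      using R0 pos by (simp add: norm_mult norm_divide norm_power del: of_real_divide of_real_mult of_real_power)
        (simp add: abs_mult power_abs)
  qed
qed

text \<open>The test functions on which the transform evaluates a functional: translated and modulated windows.\<close>

definition atom :: "(real^'d::finite) \<times> (real^'d) \<Rightarrow> real^'d \<Rightarrow> complex" where
  "atom z y = cnj (gauss_window (y - fst z)) * exp (- \<i> * of_real (y \<bullet> snd z))"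

lemma stft_eq_atom: "stft u z = of_real ((2 * pi) powr (- real CARD('d) / 2)) * u (atom z)"
  for z :: "(real^'d::finite) \<times> (real^'d)"
  by (cases z) (simp add: stft_def distr_fourier_def distr_mult_def atom_def[abs_def])

lemma atom_eq_tensor:
  "atom z = (\<lambda>y. of_real (pi powr (- real CARD('d) / 4)) * tensor (\<lambda>i. atom1 (fst z $ i) (snd z $ i)) y)"
  for z :: "(real^'d::finite) \<times> (real^'d)"
proof
  fix y :: "real^'d"
  have 1: "complex_of_real (exp (- (norm (y - fst z))\<^sup>2 / 2)) = (\<Prod>i\<in>UNIV. gauss1 (complex_of_real (y $ i) - complex_of_real (fst z $ i)))"
  proof -
    have "exp (- (norm (y - fst z))\<^sup>2 / 2) = (\<Prod>i\<in>UNIV. exp (- (1 / 2 * ((y - fst z) $ i)\<^sup>2)))"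
      using exp_norm_vec[of "1 / 2" "y - fst z"] by simp
    also have "complex_of_real \<dots> = (\<Prod>i\<in>UNIV. gauss1 (complex_of_real (y $ i) - complex_of_real (fst z $ i)))"
      by (simp add: gauss1_def flip: exp_of_real)
    finally show ?thesis .
  qed
  have 2: "exp (- \<i> * complex_of_real (y \<bullet> snd z)) = (\<Prod>i\<in>UNIV. exp (- \<i> * complex_of_real (snd z $ i) * complex_of_real (y $ i)))"
    using exp_sum_vec[of "- y" "snd z"] by (simp add: mult_ac)
  show "atom z y = of_real (pi powr (- real CARD('d) / 4)) * tensor (\<lambda>i. atom1 (fst z $ i) (snd z $ i)) y"
  proof -
    have "cnj (gauss_window (y - fst z)) = of_real (pi powr (- real CARD('d) / 4)) *
        (\<Prod>i\<in>UNIV. gauss1 (complex_of_real (y $ i) - complex_of_real (fst z $ i)))"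
      unfolding gauss_window_def complex_cnj_complex_of_real by (simp only: of_real_mult 1)
    then show ?thesis
      unfolding atom_def tensor_def atom1_def prod.distrib 2 by (simp only: mult_ac)
  qed
qed

lemma smooth_fun_atom: "smooth_fun (atom z)"
  unfolding atom_eq_tensor by (intro smooth_fun_cmult smooth_fun_tensor holomorphic_atom1)

lemma powr_component_le:
  fixes x :: "real^'d::finite"
  assumes "0 < t"
  shows "(\<Sum>i\<in>UNIV. \<bar>x $ i\<bar> powr (1 / t)) \<le> CARD('d) * norm x powr (1 / t)"
proof -
  have "(\<Sum>i\<in>UNIV. \<bar>x $ i\<bar> powr (1 / t)) \<le> (\<Sum>i\<in>(UNIV::'d set). norm x powr (1 / t))"
    using assms by (intro sum_mono powr_mono2 component_le_norm_cart) auto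
  then show ?thesis by simp
qed

text \<open>The estimate in one variable is used at rate \<open>r / d\<close> because the sum of the powers of the
  coordinates is at most \<open>d\<close> times the power of the norm.\<close>

lemma gs_quot_atom_bound:
  fixes r :: real
  assumes s: "absorbs_gauss s b" and t: "absorbs_gauss t b" and r: "0 < r"
    and R: "(s / (r / CARD('d::finite))) powr s \<le> R" "(t / (r / CARD('d))) powr t \<le> R"
  obtains C where "0 < C" "\<And>(z :: (real^'d) \<times> (real^'d)) \<mu>. gs_quot s t (R + b) (atom z) \<mu> \<le> C * exp_weight s t r z"
proof -
  define q where "q = r / CARD('d)"
  have q: "0 < q" "q * CARD('d) = r" using r by (auto simp: q_def)
  have pos: "0 < b" "0 < s" "0 < t" using s t by (auto simp: absorbs_gauss_def)
  have "0 < R" by (rule less_le_trans[OF _ R(1)[folded q_def]]) (use pos q in simp)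
  then have Rb: "0 < R + b" using pos by simp
  obtain C where C: "0 < C" "\<And>x \<xi> y \<alpha> \<beta>.
    cmod (complex_of_real (y ^ \<beta> / ((R + b) ^ (\<alpha> + \<beta>) * fact \<alpha> powr s * fact \<beta> powr t)) *
      (deriv ^^ \<alpha>) (atom1 x \<xi>) (complex_of_real y)) \<le> C * exp (q * (\<bar>x\<bar> powr (1 / t) + \<bar>\<xi>\<bar> powr (1 / s)))"
    by (rule atom1_quotient_bound[OF s t q(1) R[folded q_def]]) blast
  let ?p = "pi powr (- real CARD('d) / 4)"
  show ?thesis
  proof (rule that[of "?p * C ^ CARD('d)"])
    show "0 < ?p * C ^ CARD('d)" using C by simp
    fix z :: "(real^'d) \<times> (real^'d)" and l :: "('d \<Rightarrow> nat) \<times> ('d \<Rightarrow> nat) \<times> (real^'d)"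
    obtain x \<xi> where z: "z = (x, \<xi>)" by (cases z)
    obtain \<alpha> \<beta> y where l: "l = (\<alpha>, \<beta>, y)" by (cases l)
    let ?T = "tensor (\<lambda>i. atom1 (x $ i) (\<xi> $ i))"
    have sm: "smooth_fun ?T" by (intro smooth_fun_tensor holomorphic_atom1)
    have "cmod (gs_fun s t (R + b) l ?T) = (\<Prod>i\<in>UNIV. cmod (complex_of_real ((y $ i) ^ \<beta> i /
       ((R + b) ^ (\<alpha> i + \<beta> i) * fact (\<alpha> i) powr s * fact (\<beta> i) powr t)) * (deriv ^^ \<alpha> i) (atom1 (x $ i) (\<xi> $ i)) (complex_of_real (y $ i))))"
      unfolding l gs_fun_tensor[OF holomorphic_atom1 Rb] prod_norm[symmetric] ..
    also have "\<dots> \<le> (\<Prod>i\<in>UNIV. C * exp (q * (\<bar>x $ i\<bar> powr (1 / t) + \<bar>\<xi> $ i\<bar> powr (1 / s))))"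
      by (intro prod_mono conjI C(2)) auto
    also have "\<dots> = C ^ CARD('d) * exp (q * ((\<Sum>i\<in>UNIV. \<bar>x $ i\<bar> powr (1 / t)) + (\<Sum>i\<in>UNIV. \<bar>\<xi> $ i\<bar> powr (1 / s))))"
    proof -
      have "(\<Prod>i\<in>UNIV. exp (q * (\<bar>x $ i\<bar> powr (1 / t) + \<bar>\<xi> $ i\<bar> powr (1 / s)))) =
          exp (\<Sum>i\<in>UNIV. q * (\<bar>x $ i\<bar> powr (1 / t) + \<bar>\<xi> $ i\<bar> powr (1 / s)))"
        by (rule exp_sum[symmetric]) simp
      then show ?thesis by (simp only: prod.distrib prod_constant sum_distrib_left[symmetric] sum.distrib)
    qed
    also have "\<dots> \<le> C ^ CARD('d) * exp (q * (CARD('d) * norm x powr (1 / t) + CARD('d) * norm \<xi> powr (1 / s)))"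
      using C q pos by (intro mult_left_mono exp_le_cancel_iff[THEN iffD2] add_mono powr_component_le) auto
    also have "q * (CARD('d) * norm x powr (1 / t) + CARD('d) * norm \<xi> powr (1 / s)) = r * (norm x powr (1 / t) + norm \<xi> powr (1 / s))"
      unfolding q(2)[symmetric] by (simp add: algebra_simps)
    finally have "cmod (gs_fun s t (R + b) l ?T) \<le> C ^ CARD('d) * exp_weight s t r z"
      by (simp add: exp_weight_def z)
    then have "?p * cmod (gs_fun s t (R + b) l ?T) \<le> ?p * (C ^ CARD('d) * exp_weight s t r z)"
      by (rule mult_left_mono) simp
    moreover have "gs_quot s t (R + b) (atom z) l = ?p * cmod (gs_fun s t (R + b) l ?T)"
      unfolding gs_quot_eq_norm_gs_fun[OF Rb] atom_eq_tensor z fst_conv snd_conv gs_fun_cmult[OF sm] by (simp add: norm_mult)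
    ultimately show "gs_quot s t (R + b) (atom z) l \<le> ?p * C ^ CARD('d) * exp_weight s t r z"
      by (simp add: mult.assoc)
  qed
qed

definition coh1 :: "complex \<Rightarrow> complex \<Rightarrow> complex" where
  "coh1 w \<zeta> = exp (w * \<zeta>) * gauss1 \<zeta>"

text \<open>With \<open>coh w y = exp (w \<cdot> y - y \<cdot> y / 2)\<close>, the function \<open>\<lambda>w. u (coh w)\<close> is the Bargmann transform of \<open>u\<close> up to
  normalisation. The wave packets are rescaled values of this family, which depends holomorphically on \<open>w\<close>.\<close>

definition coh :: "complex^'d::finite \<Rightarrow> real^'d \<Rightarrow> complex" where
  "coh w = tensor (\<lambda>i. coh1 (w $ i))"

text \<open>The isometric identification of phase space with complex space by \<open>x - \<i>\<xi>\<close>.\<close>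

definition cvec :: "(real^'d::finite) \<times> (real^'d) \<Rightarrow> complex^'d" where
  "cvec z = (\<chi> i. Complex (fst z $ i) (- (snd z $ i)))"

lemma holomorphic_coh1: "coh1 w holomorphic_on A"
proof -
  have "(\<lambda>\<zeta>. gauss1 \<zeta>) holomorphic_on A" by (rule holomorphic_gauss1[OF holomorphic_on_ident])
  then show ?thesis unfolding coh1_def[abs_def] by (intro holomorphic_intros)
qed

lemma smooth_fun_coh: "smooth_fun (coh w)"
  unfolding coh_def by (intro smooth_fun_tensor holomorphic_coh1)

lemma deriv_coh1: "(deriv ^^ a) (coh1 w) \<zeta> =
   (\<Sum>k=0..a. of_nat (a choose k) * (w ^ k * exp (w * \<zeta>)) * (deriv ^^ (a - k)) gauss1 \<zeta>)"
proof -
  have "(\<lambda>\<zeta>. gauss1 \<zeta>) holomorphic_on UNIV" by (rule holomorphic_gauss1[OF holomorphic_on_ident])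
  then show ?thesis
    unfolding coh1_def[abs_def]
    by (subst higher_deriv_mult[of _ UNIV]) (auto intro!: holomorphic_intros simp: higher_deriv_exp_linear)
qed

lemma gs_fun_coh_holomorphic:
  assumes h: "0 < h"
  shows "(\<lambda>\<tau>. gs_fun s t h \<mu> (coh (w + \<tau> *s \<eta>))) holomorphic_on A"
proof -
  obtain \<alpha> \<beta> y where l: "\<mu> = (\<alpha>, \<beta>, y)" by (cases \<mu>)
  show ?thesis
    unfolding l coh_def gs_fun_tensor[OF holomorphic_coh1 h] deriv_coh1 vector_add_component vector_smult_component
    by (intro holomorphic_intros)
qed

lemma atom_eq_coh:
  "atom z = (\<lambda>y. of_real (pi powr (- real CARD('d) / 4) * exp (- (norm (fst z))\<^sup>2 / 2)) * coh (cvec z) y)"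
  for z :: "(real^'d::finite) \<times> (real^'d)"
proof
  fix y :: "real^'d"
  have "atom1 a b \<zeta> = complex_of_real (exp (- (1 / 2 * a\<^sup>2))) * coh1 (Complex a (- b)) \<zeta>" for a b \<zeta>
  proof -
    have e: "- \<i> * of_real b * \<zeta> + - ((\<zeta> - of_real a)\<^sup>2) / 2 =
        complex_of_real (- (1 / 2 * a\<^sup>2)) + (Complex a (- b) * \<zeta> + - (\<zeta>\<^sup>2) / 2)"
      by (simp add: Complex_eq power2_eq_square field_simps)
    show ?thesis
      unfolding atom1_def coh1_def gauss1_def exp_of_real[symmetric] exp_add[symmetric] e ..
  qed
  then have "tensor (\<lambda>i. atom1 (fst z $ i) (snd z $ i)) y =
      (\<Prod>i\<in>UNIV. complex_of_real (exp (- (1 / 2 * (fst z $ i)\<^sup>2))) * coh1 (Complex (fst z $ i) (- (snd z $ i))) (complex_of_real (y $ i)))"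
    by (simp add: tensor_def)
  also have "\<dots> = complex_of_real (\<Prod>i\<in>UNIV. exp (- (1 / 2 * (fst z $ i)\<^sup>2))) * coh (cvec z) y"
    by (simp add: prod.distrib coh_def tensor_def cvec_def)
  finally show "atom z y = of_real (pi powr (- real CARD('d) / 4) * exp (- (norm (fst z))\<^sup>2 / 2)) * coh (cvec z) y"
    unfolding exp_norm_vec[symmetric] by (simp add: atom_eq_tensor)
qed

lemma norm_cvec: "norm (cvec z) = norm z"
proof -
  have "(norm (cvec z))\<^sup>2 = (\<Sum>i\<in>UNIV. (fst z $ i)\<^sup>2 + (snd z $ i)\<^sup>2)"
    by (simp add: norm_vec_def L2_set_def sum_nonneg cvec_def cmod_def)
  also have "\<dots> = (norm (fst z))\<^sup>2 + (norm (snd z))\<^sup>2"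
    by (simp add: norm_vec_def L2_set_def sum_nonneg sum.distrib)
  also have "\<dots> = (norm z)\<^sup>2" by (simp add: norm_prod_def)
  finally show ?thesis by simp
qed

lemma cvec_diff: "cvec z - cvec z' = cvec (z - z')"
  by (simp add: cvec_def vec_eq_iff complex_eq_iff)

lemma dist_cvec: "dist (cvec z) (cvec z') = dist z z'"
  by (simp add: dist_norm cvec_diff norm_cvec)

lemma cvec_surj: obtains z where "cvec z = w"
proof
  show "cvec (\<chi> i. Re (w $ i), \<chi> i. - Im (w $ i)) = w"
    by (simp add: cvec_def vec_eq_iff)
qed

lemma exp_weight_bounded:
  assumes "0 < s" "0 < t" "0 < r" "norm z \<le> \<rho>"
  shows "exp_weight s t r z \<le> exp (r * (\<rho> powr (1 / t) + \<rho> powr (1 / s)))"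
proof -
  have "norm (fst z) \<le> \<rho>" "norm (snd z) \<le> \<rho>"
    using assms(4) norm_fst_le[of "fst z" "snd z"] norm_snd_le[of "snd z" "fst z"] by simp_all
  then show ?thesis
    using assms unfolding exp_weight_def case_prod_unfold
    by (auto intro!: add_mono powr_mono2)
qed

text \<open>Every \<open>w\<close> has the form \<open>x - \<i>\<xi>\<close>, and the Gaussian factor between \<open>coh w\<close> and the corresponding atom is
  bounded away from zero on bounded sets.\<close>

lemma coh_bounded:
  assumes at: "\<And>(z :: (real^'d::finite) \<times> (real^'d)) \<mu>. gs_quot s t h (atom z) \<mu> \<le> C * exp_weight s t r z" and C: "0 < C"
    and pos: "0 < h" "0 < s" "0 < t" "0 < r"
  obtains M where "0 < M" "\<And>w \<mu>. norm (w :: complex^'d) \<le> \<rho> \<Longrightarrow> cmod (gs_fun s t h \<mu> (coh w)) \<le> M"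
proof -
  let ?p = "pi powr (- real CARD('d) / 4)"
  define M where "M = exp (\<rho>\<^sup>2 / 2) / ?p * (C * exp (r * (\<rho> powr (1 / t) + \<rho> powr (1 / s))))"
  have p: "0 < ?p" by simp
  show ?thesis
  proof (rule that[of M])
    show "0 < M" using C by (simp add: M_def)
    fix w :: "complex^'d" and \<mu> :: "('d \<Rightarrow> nat) \<times> ('d \<Rightarrow> nat) \<times> (real^'d)"
    assume w: "norm w \<le> \<rho>"
    obtain z where z: "cvec z = w" by (rule cvec_surj)
    have nz: "norm z \<le> \<rho>" using w norm_cvec[of z] z by simp
    define q where "q = (norm (fst z))\<^sup>2 / 2"
    define e where "e = exp (- q)"
    have "norm (fst z) \<le> \<rho>" using nz norm_fst_le[of "fst z" "snd z"] by simp
    then have "(norm (fst z))\<^sup>2 \<le> \<rho>\<^sup>2" by (rule power_mono) simp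
    then have "exp q \<le> exp (\<rho>\<^sup>2 / 2)" unfolding exp_le_cancel_iff q_def by (rule divide_right_mono) simp
    moreover have "1 / e = exp q" by (simp add: e_def exp_minus divide_inverse)
    ultimately have e: "0 < e" "1 / e \<le> exp (\<rho>\<^sup>2 / 2)" by (simp_all add: e_def)
    have "exp (- (norm (fst z))\<^sup>2 / 2) = e" by (simp add: e_def q_def)
    then have "cmod (gs_fun s t h \<mu> (atom z)) = ?p * e * cmod (gs_fun s t h \<mu> (coh w))"
      unfolding atom_eq_coh gs_fun_cmult[OF smooth_fun_coh] z by (simp add: norm_mult e_def)
    then have "(1 / e) / ?p * cmod (gs_fun s t h \<mu> (atom z)) = (1 / e) / ?p * (?p * e * cmod (gs_fun s t h \<mu> (coh w)))"
      by (simp only:)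
    also have "\<dots> = cmod (gs_fun s t h \<mu> (coh w))" using e(1) p by simp
    finally have "cmod (gs_fun s t h \<mu> (coh w)) = (1 / e) / ?p * cmod (gs_fun s t h \<mu> (atom z))" ..
    also have "\<dots> \<le> exp (\<rho>\<^sup>2 / 2) / ?p * (C * exp (r * (\<rho> powr (1 / t) + \<rho> powr (1 / s))))"
    proof (intro mult_mono divide_right_mono e)
      have "cmod (gs_fun s t h \<mu> (atom z)) \<le> C * exp_weight s t r z"
        using at[of z \<mu>] gs_quot_eq_norm_gs_fun[OF pos(1)] by metis
      also have "\<dots> \<le> C * exp (r * (\<rho> powr (1 / t) + \<rho> powr (1 / s)))"
        using C exp_weight_bounded[OF pos(2,3,4) nz] by (intro mult_left_mono) auto
      finally show "cmod (gs_fun s t h \<mu> (atom z)) \<le> C * exp (r * (\<rho> powr (1 / t) + \<rho> powr (1 / s)))" .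
    qed (use p in auto)
    finally show "cmod (gs_fun s t h \<mu> (coh w)) \<le> M" by (simp add: M_def)
  qed
qed

text \<open>Taylor's formula of order one and two with the derivatives estimated by Cauchy's inequality on discs of
  radius \<open>1/2\<close>.\<close>

lemma holomorphic_increment_bounds:
  assumes p: "p holomorphic_on UNIV" and M: "\<And>\<tau>. cmod (\<tau> - a) \<le> 1 \<Longrightarrow> cmod (p \<tau>) \<le> M"
    and \<zeta>: "cmod \<zeta> \<le> 1 / 2"
  shows "cmod (p (a + \<zeta>) - p a) \<le> 2 * M * cmod \<zeta>"
    and "cmod (p (a + \<zeta>) - p a - deriv p a * \<zeta>) \<le> 8 * M * (cmod \<zeta>)\<^sup>2"
proof -
  have der: "((deriv ^^ n) p has_field_derivative (deriv ^^ Suc n) p x) (at x within cball a (1 / 2))" for n x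
    using has_field_derivative_higher_deriv[OF p open_UNIV, of x n] by (auto intro: has_field_derivative_at_within)
  have cb: "cmod ((deriv ^^ n) p x) \<le> fact n * M / (1 / 2) ^ n" if "x \<in> cball a (1 / 2)" for n x
  proof (rule Cauchy_inequality)
    show "p holomorphic_on ball x (1 / 2)" using p by (rule holomorphic_on_subset) simp
    show "continuous_on (cball x (1 / 2)) p"
      using holomorphic_on_imp_continuous_on[OF p] by (rule continuous_on_subset) simp
    fix y assume "cmod (x - y) = 1 / 2"
    then have "cmod (y - a) \<le> 1"
      using that norm_triangle_ineq[of "y - x" "x - a"] by (simp add: dist_norm norm_minus_commute)
    then show "cmod (p y) \<le> M" by (rule M)
  qed simp
  have in1: "a \<in> cball a (1 / 2)" "a + \<zeta> \<in> cball a (1 / 2)" using \<zeta> by (auto simp: dist_norm)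
  have "cmod ((deriv ^^ Suc 0) p x) \<le> 2 * M" if "x \<in> cball a (1 / 2)" for x
    using cb[OF that, of "Suc 0"] by simp
  from complex_Taylor[of "cball a (1 / 2)" 0 "\<lambda>n. (deriv ^^ n) p" "2 * M" a "a + \<zeta>", OF convex_cball der this in1] show "cmod (p (a + \<zeta>) - p a) \<le> 2 * M * cmod \<zeta>" by simp
  have "cmod ((deriv ^^ Suc 1) p x) \<le> 8 * M" if "x \<in> cball a (1 / 2)" for x
    using cb[OF that, of "Suc 1"] by (simp add: power2_eq_square)
  from complex_Taylor[of "cball a (1 / 2)" 1 "\<lambda>n. (deriv ^^ n) p" "8 * M" a "a + \<zeta>", OF convex_cball der this in1] show "cmod (p (a + \<zeta>) - p a - deriv p a * \<zeta>) \<le> 8 * M * (cmod \<zeta>)\<^sup>2"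
    by (simp add: power2_eq_square algebra_simps)
qed

section \<open>Decay of the transform of Gelfand--Shilov functions\<close>

lemma multi_deriv_zero [simp]: "multi_deriv (\<lambda>_. 0) f = f"
proof -
  have *: "(\<forall>i::'a. count_list is i = 0) \<longleftrightarrow> is = []" for "is" by (cases "is") auto
  show ?thesis by (simp add: multi_deriv_def * partial_derivs_def)
qed

lemma multi_deriv_single: "multi_deriv (\<lambda>i. if i = j then a else 0) f = partial_derivs (replicate a j) f"
proof -
  let ?P = "\<lambda>is. \<forall>i. count_list is i = (if i = j then a else 0)"
  have "?P (Eps ?P)" by (rule someI_ex[OF count_list_exists])
  have eq: "is = replicate a j" if P_is: "?P is" for "is"
  proof -
    have "set is \<subseteq> {j}"
    proof
      fix i assume "i \<in> set is"
      then have "count_list is i \<noteq> 0" by (simp add: count_list_0_iff)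
      then show "i \<in> {j}" using P_is by (auto split: if_splits)
    qed
    then have r: "is = replicate (length is) j" by (intro replicate_eqI) auto
    have "count_list (replicate n j) j = n" for n by (induction n) auto
    then have "length is = a" using P_is r by metis
    with r show ?thesis by simp
  qed
  show ?thesis unfolding multi_deriv_def using eq[OF \<open>?P (Eps ?P)\<close>] by simp
qed

lemma gs_derivative_bound:
  fixes f :: "real^'d::finite \<Rightarrow> complex"
  assumes b: "\<And>\<mu>. gs_quot s t h f \<mu> \<le> N" and h: "0 < h"
  shows "cmod (partial_derivs (replicate a j) f y) \<le> N * h ^ a * fact a powr s"
proof -
  have "gs_quot s t h f (\<lambda>i. if i = j then a else 0, \<lambda>_. 0, y) \<le> N" by (rule b)
  then have "cmod (partial_derivs (replicate a j) f y) / (h ^ a * fact a powr s) \<le> N"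
    by (simp add: gs_quot_def multi_deriv_single multi_pow_def multi_fact_def if_distrib[of fact] cong: if_cong)
  then show ?thesis using h by (simp add: divide_le_eq mult.assoc)
qed

lemma gs_moment_bound:
  fixes f :: "real^'d::finite \<Rightarrow> complex"
  assumes b: "\<And>\<mu>. gs_quot s t h f \<mu> \<le> N" and h: "0 < h"
  shows "\<bar>y $ j\<bar> ^ b * cmod (f y) \<le> N * h ^ b * fact b powr t"
proof -
  have "gs_quot s t h f (\<lambda>_. 0, \<lambda>i. if i = j then b else 0, y) \<le> N" by (rule b)
  moreover have "multi_pow y (\<lambda>i. if i = j then b else 0) = (y $ j) ^ b"
    by (simp add: multi_pow_def if_distrib[of "\<lambda>n. _ ^ n"] cong: if_cong)
  ultimately have "\<bar>y $ j\<bar> ^ b * cmod (f y) / (h ^ b * fact b powr t) \<le> N"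
    by (simp add: gs_quot_def multi_fact_def norm_mult norm_power power_abs if_distrib[of fact] cong: if_cong)
  then show ?thesis using h by (simp add: divide_le_eq mult.assoc)
qed

lemma gs_bound_nonneg:
  assumes b: "\<And>\<mu>. gs_quot s t h f \<mu> \<le> N" and h: "0 < h"
  shows "0 \<le> N"
proof -
  have "0 \<le> gs_quot s t h f (\<lambda>_. 0, \<lambda>_. 0, 0)" using gs_quot_eq_norm_gs_fun[OF h] by (metis norm_ge_zero)
  with b show ?thesis using order_trans by blast
qed

text \<open>Expanding the product of the \<open>1 + (y $ i)\<^sup>2\<close> yields one monomial for each set of coordinates, and each of these
  is a moment that occurs in the quotients.\<close>

lemma gs_inv_poly_bound:
  fixes h t :: real
  assumes h: "0 < h"
  obtains C where "0 < C" "\<And>(f :: real^'d::finite \<Rightarrow> complex) s N y. (\<And>\<mu>. gs_quot s t h f \<mu> \<le> N) \<Longrightarrow> cmod (f y) \<le> C * N * inv_poly y"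
proof -
  define D where "D S = h ^ (\<Sum>i\<in>UNIV. (if i \<in> S then 2 else 0 :: nat)) * multi_fact (\<lambda>i::'d. if i \<in> S then 2 else 0 :: nat) powr t" for S :: "'d set"
  define C where "C = (\<Sum>S\<in>Pow UNIV. D S)"
  have mf: "0 < multi_fact \<alpha>" for \<alpha> :: "'d \<Rightarrow> nat" unfolding multi_fact_def by (intro prod_pos) auto
  have D: "0 < D S" for S using h mf[of "\<lambda>i. if i \<in> S then 2 else 0"] by (simp add: D_def)
  show ?thesis
  proof (rule that[of C])
    show "0 < C" unfolding C_def by (intro sum_pos D) auto
    fix f :: "real^'d \<Rightarrow> complex" and s N y
    assume b: "\<And>\<mu>. gs_quot s t h f \<mu> \<le> N"
    have pow: "(\<Prod>i\<in>S. (y $ i)\<^sup>2) * cmod (f y) \<le> N * D S" for S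
    proof -
      have mp: "multi_pow y (\<lambda>i. if i \<in> S then 2 else 0) = (\<Prod>i\<in>S. (y $ i)\<^sup>2)"
        unfolding multi_pow_def by (subst prod.mono_neutral_cong_right[of UNIV S _ "\<lambda>i. (y $ i)\<^sup>2"]) auto
      have "gs_quot s t h f (\<lambda>_. 0, \<lambda>i. if i \<in> S then 2 else 0, y) \<le> N" by (rule b)
      then have "(\<Prod>i\<in>S. (y $ i)\<^sup>2) * cmod (f y) / D S \<le> N"
        unfolding gs_quot_def prod.case mp D_def
        by (simp add: norm_mult multi_fact_def prod_nonneg del: of_real_prod)
      then show ?thesis using D[of S] by (simp add: divide_le_eq)
    qed
    have "(\<Prod>i\<in>UNIV. 1 + (y $ i)\<^sup>2) = (\<Sum>S\<in>Pow UNIV. \<Prod>i\<in>S. (y $ i)\<^sup>2)"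
      using prod_add[of UNIV "\<lambda>i. (y $ i)\<^sup>2" "\<lambda>_. 1"] by (simp add: add.commute)
    then have "(\<Prod>i\<in>UNIV. 1 + (y $ i)\<^sup>2) * cmod (f y) \<le> (\<Sum>S\<in>Pow UNIV. N * D S)"
      by (simp only: sum_distrib_right) (intro sum_mono pow)
    also have "\<dots> = C * N" by (simp add: C_def sum_distrib_left mult.commute)
    finally have le: "(\<Prod>i\<in>UNIV. 1 + (y $ i)\<^sup>2) * cmod (f y) \<le> C * N" .
    have inv: "inv_poly y * (\<Prod>i\<in>UNIV. 1 + (y $ i)\<^sup>2) = 1"
    proof -
      have "inverse (1 + (y $ i)\<^sup>2) * (1 + (y $ i)\<^sup>2) = 1" for i
        by (rule left_inverse) (metis add_pos_nonneg less_irrefl zero_le_power2 zero_less_one)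
      then show ?thesis unfolding inv_poly_def prod.distrib[symmetric] by simp
    qed
    have "cmod (f y) = inv_poly y * (\<Prod>i\<in>UNIV. 1 + (y $ i)\<^sup>2) * cmod (f y)" by (simp only: inv mult_1_left)
    also have "\<dots> \<le> inv_poly y * (C * N)"
      using mult_left_mono[OF le, of "inv_poly y"] inv_poly_pos[of y] by (simp add: mult.assoc)
    finally show "cmod (f y) \<le> C * N * inv_poly y" by (simp add: mult_ac)
  qed
qed

lemma smooth_fun_continuous: "smooth_fun f \<Longrightarrow> continuous_on UNIV (partial_derivs is f)"
  by (simp add: smooth_fun_def)

lemma smooth_fun_continuous0: "smooth_fun f \<Longrightarrow> continuous_on UNIV f"
  using smooth_fun_continuous[of f "[]"] by (simp add: partial_derivs_def)

lemma smooth_fun_measurable: "smooth_fun f \<Longrightarrow> partial_derivs is f \<in> borel_measurable borel"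
  by (intro borel_measurable_continuous_onI smooth_fun_continuous)

lemma smooth_fun_measurable0: "smooth_fun f \<Longrightarrow> f \<in> borel_measurable borel"
  by (intro borel_measurable_continuous_onI smooth_fun_continuous0)

lemma smooth_fun_has_vector_derivative:
  assumes "smooth_fun f"
  shows "((\<lambda>r. partial_derivs is f (x + r *\<^sub>R axis j 1)) has_vector_derivative partial_derivs (j # is) f x) (at 0)"
  using assms unfolding smooth_fun_def partial_derivs_def foldr_Cons comp_def partial_deriv_def
  by (auto simp: vector_derivative_works[symmetric])

lemma atom_real: "atom (x, 0) y = of_real (pi powr (- real CARD('d) / 4) * exp (- (norm (y - x))\<^sup>2 / 2))"
  for x y :: "real^'d::finite"
  by (simp add: atom_def gauss_window_def)

lemma atom_eq_mult: "atom (x, \<xi>) y = atom (x, 0) y * exp (- \<i> * of_real (y \<bullet> \<xi>))"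
  by (simp add: atom_def)

lemma norm_atom: "cmod (atom z y) = pi powr (- real CARD('d) / 4) * exp (- (norm (y - fst z))\<^sup>2 / 2)"
  for z :: "(real^'d::finite) \<times> (real^'d)"
proof -
  have "cmod (exp (- \<i> * of_real (y \<bullet> snd z))) = 1" by (simp add: norm_exp_eq_Re)
  then show ?thesis unfolding atom_def gauss_window_def norm_mult complex_mod_cnj
    by (simp only: norm_of_real mult_1_right) (simp add: abs_mult)
qed

lemma continuous_atom:
  assumes "continuous_on A f" "continuous_on A g"
  shows "continuous_on A (\<lambda>x. atom (f x) (g x))"
  unfolding atom_def gauss_window_def by (intro continuous_intros assms) simp

lemma atom_measurable_pair:
  "(\<lambda>p. atom (fst p) (snd p)) \<in> borel_measurable (borel \<Otimes>\<^sub>M borel)"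
  "(\<lambda>p. atom (snd p) (fst p)) \<in> borel_measurable (borel \<Otimes>\<^sub>M borel)"
  unfolding borel_prod by (intro borel_measurable_continuous_onI continuous_atom continuous_intros)+

lemma atom_measurable [measurable]: "atom z \<in> borel_measurable borel" "(\<lambda>z. atom z y) \<in> borel_measurable borel"
  by (intro borel_measurable_continuous_onI continuous_atom continuous_intros)+

lemma partial_derivs_atom:
  fixes z :: "(real^'d::finite) \<times> (real^'d)"
  shows "partial_derivs is (atom z) = (\<lambda>y. of_real (pi powr (- real CARD('d) / 4)) *
    tensor (\<lambda>i. (deriv ^^ count_list is i) (atom1 (fst z $ i) (snd z $ i))) y)"
proof -
  have sm: "smooth_fun (tensor (\<lambda>i. atom1 (fst z $ i) (snd z $ i)))" by (intro smooth_fun_tensor holomorphic_atom1)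
  show ?thesis
    unfolding atom_eq_tensor
    using partial_derivs_lin[OF sm sm, of "is" _ 0] by (simp add: partial_derivs_tensor[OF holomorphic_atom1])
qed

lemma pi_powr_le_1: "pi powr (- real n / 4) \<le> 1"
proof -
  have "pi powr (- real n / 4) \<le> pi powr 0" using pi_gt3 by (intro powr_mono) auto
  then show ?thesis by simp
qed

lemma real_gauss_derivative_bound:
  fixes x y :: "real^'d::finite"
  shows "cmod (partial_derivs (replicate m j) (atom (x, 0)) y) \<le> 5 ^ m * sqrt (fact m) * exp (- ((norm (y - x))\<^sup>2 / 4))"
proof -
  let ?c = "\<lambda>i. count_list (replicate m j) i"
  have c: "?c i = (if i = j then m else 0)" for i by (induction m) auto
  have b: "cmod ((deriv ^^ ?c i) (atom1 (x $ i) 0) (complex_of_real (y $ i))) \<le>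
      (if i = j then 5 ^ m * sqrt (fact m) else 1) * exp (- (1 / 4 * ((y - x) $ i)\<^sup>2))" for i
  proof -
    have "(\<Sum>k\<le>a. real (a choose k) * (\<bar>0\<bar> ^ k * (5 ^ (a - k) * sqrt (fact (a - k))))) = 5 ^ a * sqrt (fact a)" for a
      by (subst sum.remove[of _ 0]) (auto intro!: sum.neutral)
    note S = this
    show ?thesis using deriv_atom1_bound[of "?c i" "x $ i" 0 "y $ i"] unfolding S c by (cases "i = j") simp_all
  qed
  have p: "pi powr (- real CARD('d) / 4) \<le> 1" by (rule pi_powr_le_1)
  have "cmod (partial_derivs (replicate m j) (atom (x, 0)) y) =
      pi powr (- real CARD('d) / 4) * (\<Prod>i\<in>UNIV. cmod ((deriv ^^ ?c i) (atom1 (x $ i) 0) (complex_of_real (y $ i))))"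
    by (simp add: partial_derivs_atom norm_mult tensor_def prod_norm)
  also have "\<dots> \<le> 1 * (\<Prod>i\<in>UNIV. (if i = j then 5 ^ m * sqrt (fact m) else 1) * exp (- (1 / 4 * ((y - x) $ i)\<^sup>2)))"
    by (intro mult_mono p prod_mono conjI b prod_nonneg) auto
  also have "\<dots> = 5 ^ m * sqrt (fact m) * exp (- (1 / 4 * (norm (y - x))\<^sup>2))"
    unfolding exp_norm_vec by (simp add: prod.distrib)
  finally show ?thesis by simp
qed

lemma integrable_gauss_shift:
  fixes c :: real and x :: "real^'d::finite"
  assumes "0 < c"
  shows "integrable lborel (\<lambda>y. exp (- (c * (norm (y - x))\<^sup>2)))"
    and "(LINT y|lborel. exp (- (c * (norm (y - x))\<^sup>2))) = (LINT y|lborel. exp (- (c * (norm (y::real^'d))\<^sup>2)))"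
proof -
  have i: "integrable lborel (\<lambda>y::real^'d. complex_of_real (exp (- (c * (norm y)\<^sup>2))))"
    using integrable_gauss[OF assms] by (simp only: complex_of_real_integrable_eq)
  have "integrable lborel (\<lambda>y::real^'d. complex_of_real (exp (- (c * (norm (- x + 1 *\<^sub>R y))\<^sup>2))))"
    by (rule integrable_lborel_affine[OF _ i]) simp
  then show "integrable lborel (\<lambda>y. exp (- (c * (norm (y - x))\<^sup>2)))"
    by (simp only: complex_of_real_integrable_eq) simp
  have "(LINT y|lborel. complex_of_real (exp (- (c * (norm (y::real^'d))\<^sup>2)))) =
     complex_of_real (\<bar>1\<bar> ^ DIM(real^'d)) * (LINT y|lborel. complex_of_real (exp (- (c * (norm (- x + 1 *\<^sub>R y))\<^sup>2))))"
    by (rule integral_lborel_affine[OF _ i]) simp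
  then have "complex_of_real (LINT y|lborel. exp (- (c * (norm (y::real^'d))\<^sup>2))) =
     complex_of_real (LINT y|lborel. exp (- (c * (norm (y - x))\<^sup>2)))"
    by (simp add: integral_complex_of_real)
  then show "(LINT y|lborel. exp (- (c * (norm (y - x))\<^sup>2))) = (LINT y|lborel. exp (- (c * (norm (y::real^'d))\<^sup>2)))"
    by (simp only: of_real_eq_iff)
qed

definition stft_fun :: "(real^'d::finite \<Rightarrow> complex) \<Rightarrow> (real^'d) \<times> (real^'d) \<Rightarrow> complex" where
  "stft_fun f z = of_real ((2 * pi) powr (- real CARD('d) / 2)) * (LINT y|lborel. f y * atom z y)"

text \<open>Iterated integration by parts, in which each step moves a derivative onto one of two factors.\<close>

lemma binomial_recursion:
  fixes I :: "nat \<Rightarrow> nat \<Rightarrow> complex"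
  assumes rec: "\<And>k m. c * I k m = I (Suc k) m + I k (Suc m)"
  shows "c ^ a * I k m = (\<Sum>i\<le>a. of_nat (a choose i) * I (k + i) (m + (a - i)))"
proof (induction a arbitrary: k m)
  case (Suc a)
  have "c ^ Suc a * I k m = c ^ a * I (Suc k) m + c ^ a * I k (Suc m)"
    using rec[of k m] by (simp add: mult.assoc mult.left_commute distrib_left[symmetric])
  also have "\<dots> = (\<Sum>i\<le>a. of_nat (a choose i) * I (k + Suc i) (m + (a - i))) +
      (\<Sum>i\<le>a. of_nat (a choose i) * I (k + i) (m + (Suc a - i)))"
    unfolding Suc.IH by (intro arg_cong2[where f = "(+)"] sum.cong) (auto simp: Suc_diff_le)
  also have "(\<Sum>i\<le>a. of_nat (a choose i) * I (k + i) (m + (Suc a - i))) =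
      I k (m + Suc a) + (\<Sum>i\<le>a. of_nat (a choose Suc i) * I (k + Suc i) (m + (a - i)))"
  proof -
    have "(\<Sum>i\<le>a. of_nat (a choose i) * I (k + i) (m + (Suc a - i))) =
        (\<Sum>i\<le>Suc a. of_nat (a choose i) * I (k + i) (m + (Suc a - i)))" by simp
    also have "\<dots> = I k (m + Suc a) + (\<Sum>i\<le>a. of_nat (a choose Suc i) * I (k + Suc i) (m + (a - i)))"
      by (subst sum.atMost_Suc_shift) simp
    finally show ?thesis .
  qed
  also have "(\<Sum>i\<le>a. of_nat (a choose i) * I (k + Suc i) (m + (a - i))) +
      (I k (m + Suc a) + (\<Sum>i\<le>a. of_nat (a choose Suc i) * I (k + Suc i) (m + (a - i)))) =
      I k (m + Suc a) + (\<Sum>i\<le>a. of_nat (Suc a choose Suc i) * I (k + Suc i) (m + (a - i)))"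
    by (simp add: sum.distrib[symmetric] algebra_simps)
  also have "\<dots> = (\<Sum>i\<le>Suc a. of_nat (Suc a choose i) * I (k + i) (m + (Suc a - i)))"
    by (subst sum.atMost_Suc_shift) simp
  finally show ?case .
qed simp

text \<open>Multiplication of the transform by \<open>\<i> \<xi> $ j\<close> is a derivative that integration by parts distributes onto
  the function and onto the window.\<close>

lemma frequency_moment:
  fixes f :: "real^'d::finite \<Rightarrow> complex"
  assumes sm: "smooth_fun f" and b: "\<And>\<mu>. gs_quot s t h f \<mu> \<le> N" and h: "0 < h"
    and s: "0 \<le> s" and b0: "0 < b0" "0 < C" "\<And>k::nat. 5 ^ k * sqrt (fact k) \<le> C * b0 ^ k * fact k powr s"
  shows "\<bar>\<xi> $ j\<bar> ^ a * cmod (LINT y|lborel. f y * atom (x, \<xi>) y) \<le>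
    (LINT y|lborel. exp (- (1 / 4 * (norm (y::real^'d))\<^sup>2))) * (N * C) * (h + b0) ^ a * fact a powr s"
proof -
  define e where "e = (axis j 1 :: real^'d)"
  define \<gamma> where "\<gamma> = (atom (x, 0) :: real^'d \<Rightarrow> complex)"
  have sg: "smooth_fun \<gamma>" unfolding \<gamma>_def by (rule smooth_fun_atom)
  define E where "E y = exp (- \<i> * complex_of_real (y \<bullet> \<xi>))" for y
  have nE: "cmod (E y) = 1" for y by (simp add: E_def norm_exp_eq_Re)
  define p where "p k = partial_derivs (replicate k j) f" for k
  define g where "g m = partial_derivs (replicate m j) \<gamma>" for m
  define F where "F k m y = p k y * g m y * E y" for k m y
  define I where "I k m = (LINT y|lborel. F k m y)" for k m
  define P where "P k = N * h ^ k * fact k powr s" for k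
  define Q where "Q m = 5 ^ m * sqrt (fact m)" for m :: nat
  define G where "G c y = exp (- (c * (norm (y - x))\<^sup>2))" for c :: real and y
  have N: "0 \<le> N" by (rule gs_bound_nonneg[OF b h])
  have P: "0 \<le> P k" "cmod (p k y) \<le> P k" for k y
    using N h gs_derivative_bound[OF b h, of k j y] by (auto simp: P_def p_def)
  have Q: "0 \<le> Q m" "cmod (g m y) \<le> Q m * G (1 / 4) y" for m y
    using real_gauss_derivative_bound[of m j x y] by (auto simp: Q_def g_def \<gamma>_def G_def)
  have F: "cmod (F k m y) \<le> P k * Q m * G (1 / 4) y" for k m y
  proof -
    have "cmod (F k m y) \<le> P k * (Q m * G (1 / 4) y)"
      unfolding F_def norm_mult nE mult_1_right by (intro mult_mono P Q) auto
    then show ?thesis by (simp add: mult.assoc)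
  qed
  have meas [measurable]: "F k m \<in> borel_measurable borel" for k m
  proof -
    have [measurable]: "p k \<in> borel_measurable borel" "g m \<in> borel_measurable borel"
      unfolding p_def g_def by (intro smooth_fun_measurable sm sg)+
    show ?thesis unfolding F_def[abs_def] E_def by measurable
  qed
  have Gi: "integrable lborel (G c)" if "0 < c" for c
    unfolding G_def[abs_def] by (rule integrable_gauss_shift[OF that])
  have Fi: "integrable lborel (F k m)" for k m
  proof (rule Bochner_Integration.integrable_bound)
    show "integrable lborel (\<lambda>y. P k * Q m * G (1 / 4) y)" by (intro integrable_mult_right Gi) simp
    show "AE y in lborel. norm (F k m y) \<le> norm (P k * Q m * G (1 / 4) y)"
      unfolding real_norm_def by (intro AE_I2 order_trans[OF F abs_ge_self])
  qed simp
  define c where "c = \<i> * complex_of_real (\<xi> $ j)"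
  have rec: "c * I k m = I (Suc k) m + I k (Suc m)" for k m
  proof -
    define F' where "F' y = F (Suc k) m y + F k (Suc m) y - c * F k m y" for y
    define K where "K = P (Suc k) * Q m + P k * Q (Suc m) + cmod c * (P k * Q m)"
    have K: "0 \<le> K" by (simp add: K_def P Q)
    have "(LINT y|lborel. F' y) = 0"
    proof (rule integral_directional_derivative_zero[OF Fi])
      show "((\<lambda>r. F k m (y + r *\<^sub>R e)) has_vector_derivative F' y) (at 0)" for y
      proof -
        have dp: "((\<lambda>r. p k (y + r *\<^sub>R e)) has_vector_derivative p (Suc k) y) (at 0)"
          using smooth_fun_has_vector_derivative[OF sm, of "replicate k j" y j] by (simp add: p_def e_def)
        have dg: "((\<lambda>r. g m (y + r *\<^sub>R e)) has_vector_derivative g (Suc m) y) (at 0)"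
          using smooth_fun_has_vector_derivative[OF sg, of "replicate m j" y j] by (simp add: g_def e_def)
        have dE: "((\<lambda>r. E (y + r *\<^sub>R e)) has_vector_derivative - c * E y) (at 0)"
        proof -
          have "((\<lambda>w. exp (- \<i> * (complex_of_real (y \<bullet> \<xi>) + w * complex_of_real (\<xi> $ j)))) has_field_derivative - c * E y) (at (complex_of_real 0))"
            by (auto intro!: derivative_eq_intros simp: c_def E_def)
          then have "((\<lambda>r. exp (- \<i> * (complex_of_real (y \<bullet> \<xi>) + complex_of_real r * complex_of_real (\<xi> $ j)))) has_vector_derivative - c * E y) (at 0)"
            by (rule has_vector_derivative_real_field)
          moreover have "E (y + r *\<^sub>R e) = exp (- \<i> * (complex_of_real (y \<bullet> \<xi>) + complex_of_real r * complex_of_real (\<xi> $ j)))" for r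
            by (simp add: E_def e_def inner_add_left inner_axis' )
          ultimately show ?thesis by simp
        qed
        have "((\<lambda>r. p k (y + r *\<^sub>R e) * g m (y + r *\<^sub>R e) * E (y + r *\<^sub>R e)) has_vector_derivative
            (p k (y + 0 *\<^sub>R e) * g m (y + 0 *\<^sub>R e)) * (- c * E y) +
            (p k (y + 0 *\<^sub>R e) * g (Suc m) y + p (Suc k) y * g m (y + 0 *\<^sub>R e)) * E (y + 0 *\<^sub>R e)) (at 0)"
          by (intro has_vector_derivative_mult dp dg dE)
        moreover have "(p k (y + 0 *\<^sub>R e) * g m (y + 0 *\<^sub>R e)) * (- c * E y) +
            (p k (y + 0 *\<^sub>R e) * g (Suc m) y + p (Suc k) y * g m (y + 0 *\<^sub>R e)) * E (y + 0 *\<^sub>R e) = F' y"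
          by (simp add: F'_def F_def algebra_simps)
        ultimately show ?thesis unfolding F_def by simp
      qed
      \<comment> \<open>A translation by less than one turns the Gaussian of exponent 1/4 into one of exponent 1/8.\<close>
      show "integrable lborel (\<lambda>y. K * exp (1 / 4) * G (1 / 8) y)" by (intro integrable_mult_right Gi) simp
      fix \<tau> :: real and y assume \<tau>: "\<bar>\<tau>\<bar> < 1"
      have "cmod (F' (y + \<tau> *\<^sub>R e)) \<le> K * G (1 / 4) (y + \<tau> *\<^sub>R e)"
      proof -
        have "cmod (F' w) \<le> cmod (F (Suc k) m w) + cmod (F k (Suc m) w) + cmod c * cmod (F k m w)" for w
          unfolding F'_def norm_mult[symmetric] by (meson norm_triangle_ineq4 norm_triangle_ineq order_trans add_right_mono)
        also have "\<dots> w \<le> P (Suc k) * Q m * G (1 / 4) w + P k * Q (Suc m) * G (1 / 4) w + cmod c * (P k * Q m * G (1 / 4) w)" for w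
          by (intro add_mono F mult_left_mono) auto
        finally show ?thesis by (simp add: K_def algebra_simps)
      qed
      also have "G (1 / 4) (y + \<tau> *\<^sub>R e) \<le> exp (1 / 4) * G (1 / 8) y"
      proof -
        have "norm (y - x) \<le> norm (y + \<tau> *\<^sub>R e - x) + norm (\<tau> *\<^sub>R e)"
          using norm_triangle_ineq4[of "y + \<tau> *\<^sub>R e - x" "\<tau> *\<^sub>R e"] by (simp add: algebra_simps)
        also have "\<dots> \<le> norm (y + \<tau> *\<^sub>R e - x) + 1" using \<tau> by (simp add: e_def)
        finally have "(norm (y - x))\<^sup>2 \<le> (norm (y + \<tau> *\<^sub>R e - x) + 1)\<^sup>2" by (intro power_mono) auto
        also have "\<dots> \<le> 2 * (norm (y + \<tau> *\<^sub>R e - x))\<^sup>2 + 2"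
          using zero_le_power2[of "norm (y + \<tau> *\<^sub>R e - x) - 1"] by (simp add: power2_eq_square algebra_simps)
        finally show ?thesis by (simp add: G_def exp_add[symmetric])
      qed
      finally show "cmod (F' (y + \<tau> *\<^sub>R e)) \<le> K * exp (1 / 4) * G (1 / 8) y"
        using K by (simp add: mult.assoc mult_left_mono)
    qed
    moreover have "(LINT y|lborel. F' y) = I (Suc k) m + I k (Suc m) - c * I k m"
      unfolding F'_def I_def using Fi by simp
    ultimately show ?thesis by simp
  qed
  let ?G = "LINT y|lborel. exp (- (1 / 4 * (norm (y::real^'d))\<^sup>2))"
  have Gint: "(LINT y|lborel. G (1 / 4) y) = ?G"
    unfolding G_def by (rule integrable_gauss_shift) simp
  have G0: "0 \<le> ?G" by (intro integral_nonneg_AE) auto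
  have Ib: "cmod (I k m) \<le> P k * Q m * ?G" for k m
  proof -
    have "cmod (I k m) \<le> (LINT y|lborel. P k * Q m * G (1 / 4) y)"
      unfolding I_def by (intro Bochner_Integration.integral_norm_bound_integral Fi integrable_mult_right Gi F) auto
    then show ?thesis by (simp add: Gint)
  qed
  have "c ^ a * I 0 0 = (\<Sum>i\<le>a. of_nat (a choose i) * I i (a - i))"
    using binomial_recursion[of c I a 0 0, OF rec] by simp
  then have "cmod c ^ a * cmod (I 0 0) = cmod (\<Sum>i\<le>a. of_nat (a choose i) * I i (a - i))"
    by (metis norm_mult norm_power)
  also have "\<dots> \<le> (\<Sum>i\<le>a. (a choose i) * (P i * Q (a - i) * ?G))"
  proof (rule sum_norm_le)
    fix i
    have "norm (of_nat (a choose i) * I i (a - i)) = (a choose i) * cmod (I i (a - i))" by (simp add: norm_mult)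
    also have "\<dots> \<le> (a choose i) * (P i * Q (a - i) * ?G)" by (intro mult_left_mono Ib) simp
    finally show "norm (of_nat (a choose i) * I i (a - i)) \<le> (a choose i) * (P i * Q (a - i) * ?G)" .
  qed
  also have "\<dots> = ?G * (\<Sum>i\<le>a. (a choose i) * (P i * Q (a - i)))"
    by (simp add: sum_distrib_left mult_ac)
  also have "\<dots> \<le> ?G * (N * C * (h + b0) ^ a * fact a powr s)"
  proof (intro mult_left_mono G0 binomial_sum_bound)
    show "P m \<le> N * h ^ m * fact m powr s" for m by (simp add: P_def)
    show "Q m \<le> C * b0 ^ m * fact m powr s" for m using b0(3) by (simp add: Q_def)
  qed (use P Q N s h b0 in auto)
  also have "I 0 0 = (LINT y|lborel. f y * atom (x, \<xi>) y)"
    by (simp add: I_def F_def p_def g_def partial_derivs_def \<gamma>_def E_def atom_eq_mult[of x \<xi>] mult.assoc)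
  finally show ?thesis by (simp add: c_def norm_mult mult.assoc)
qed

text \<open>With \<open>x\<close> expanded around \<open>y\<close>, powers of \<open>y\<close> are moments of the function, and powers of the
  difference are absorbed by the window.\<close>

lemma position_moment:
  fixes f :: "real^'d::finite \<Rightarrow> complex"
  assumes sm: "smooth_fun f" and b: "\<And>\<mu>. gs_quot s t h f \<mu> \<le> N" and h: "0 < h"
    and t: "0 \<le> t" and b0: "0 < b0" "0 < C" "\<And>k::nat. 5 ^ k * sqrt (fact k) \<le> C * b0 ^ k * fact k powr t"
  shows "\<bar>x $ j\<bar> ^ a * cmod (LINT y|lborel. f y * atom (x, \<xi>) y) \<le>
    (LINT y|lborel. exp (- (1 / 4 * (norm (y::real^'d))\<^sup>2))) * (N * C) * (h + b0) ^ a * fact a powr t"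
proof -
  define G where "G c y = exp (- (c * (norm (y - x))\<^sup>2))" for c :: real and y
  let ?G = "LINT y|lborel. exp (- (1 / 4 * (norm (y::real^'d))\<^sup>2))"
  have Gi: "integrable lborel (G (1 / 4))"
    unfolding G_def[abs_def] by (rule integrable_gauss_shift) simp
  have Gint: "(LINT y|lborel. G (1 / 4) y) = ?G"
    unfolding G_def by (rule integrable_gauss_shift) simp
  have N: "0 \<le> N" by (rule gs_bound_nonneg[OF b h])
  define D where "D = N * C * (h + b0) ^ a * fact a powr t"
  have D: "0 \<le> D" using N b0 h by (simp add: D_def)
  have pw: "cmod (complex_of_real (\<bar>x $ j\<bar> ^ a) * (f y * atom (x, \<xi>) y)) \<le> D * G (1 / 4) y" for y
  proof -
    define v where "v = \<bar>y $ j - x $ j\<bar>"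
    have "\<bar>x $ j\<bar> ^ a \<le> (\<bar>y $ j\<bar> + v) ^ a" unfolding v_def by (intro power_mono) auto
    also have "\<dots> = (\<Sum>k\<le>a. (a choose k) * \<bar>y $ j\<bar> ^ k * v ^ (a - k))" by (rule binomial_ring)
    finally have "\<bar>x $ j\<bar> ^ a * cmod (f y) * exp (- (v\<^sup>2 / 8)) \<le>
        (\<Sum>k\<le>a. (a choose k) * \<bar>y $ j\<bar> ^ k * v ^ (a - k)) * cmod (f y) * exp (- (v\<^sup>2 / 8))"
      by (intro mult_right_mono) auto
    also have "\<dots> = (\<Sum>k\<le>a. (a choose k) * ((\<bar>y $ j\<bar> ^ k * cmod (f y)) * (v ^ (a - k) * exp (- (v\<^sup>2 / 8)))))"
      unfolding sum_distrib_right by (intro sum.cong refl) (simp only: mult_ac)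
    also have "\<dots> \<le> (\<Sum>k\<le>a. (a choose k) * ((N * h ^ k * fact k powr t) * (5 ^ (a - k) * sqrt (fact (a - k)))))"
    proof (intro sum_mono mult_left_mono)
      fix k
      show "(\<bar>y $ j\<bar> ^ k * cmod (f y)) * (v ^ (a - k) * exp (- (v\<^sup>2 / 8))) \<le>
          (N * h ^ k * fact k powr t) * (5 ^ (a - k) * sqrt (fact (a - k)))"
      proof (rule mult_mono[OF gs_moment_bound[OF b h]])
        show "v ^ (a - k) * exp (- (v\<^sup>2 / 8)) \<le> 5 ^ (a - k) * sqrt (fact (a - k))"
          using power_gauss_bound[of "y $ j - x $ j" "a - k"] by (simp add: v_def)
        show "0 \<le> N * h ^ k * fact k powr t" using N h by simp
        show "0 \<le> v ^ (a - k) * exp (- (v\<^sup>2 / 8))" by (simp add: v_def)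
      qed
    qed simp
    also have "\<dots> \<le> D"
      unfolding D_def using b0(3) N h b0 t by (intro binomial_sum_bound) auto
    finally have 1: "\<bar>x $ j\<bar> ^ a * cmod (f y) * exp (- (v\<^sup>2 / 8)) \<le> D" .
    have p: "pi powr (- real CARD('d) / 4) \<le> 1" by (rule pi_powr_le_1)
    have "cmod (atom (x, \<xi>) y) \<le> exp (- (v\<^sup>2 / 8)) * G (1 / 4) y"
    proof -
      have "v\<^sup>2 \<le> (norm (y - x))\<^sup>2"
        using component_le_norm_cart[of "y - x" j] by (intro power_mono) (auto simp: v_def)
      then have "exp (- (norm (y - x))\<^sup>2 / 2) \<le> exp (- (v\<^sup>2 / 8)) * G (1 / 4) y"
        unfolding G_def exp_add[symmetric] exp_le_cancel_iff using zero_le_power2[of "norm (y - x)"] by linarith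
      moreover have "cmod (atom (x, \<xi>) y) \<le> 1 * exp (- (norm (y - x))\<^sup>2 / 2)"
        unfolding norm_atom fst_conv by (intro mult_right_mono p) auto
      ultimately show ?thesis by simp
    qed
    then have "\<bar>x $ j\<bar> ^ a * cmod (f y) * cmod (atom (x, \<xi>) y) \<le> \<bar>x $ j\<bar> ^ a * cmod (f y) * (exp (- (v\<^sup>2 / 8)) * G (1 / 4) y)"
      by (intro mult_left_mono) auto
    also have "\<dots> = (\<bar>x $ j\<bar> ^ a * cmod (f y) * exp (- (v\<^sup>2 / 8))) * G (1 / 4) y" by (simp only: mult_ac)
    also have "\<dots> \<le> D * G (1 / 4) y" using 1 by (intro mult_right_mono) (auto simp: G_def)
    finally show ?thesis by (simp add: norm_mult norm_power mult.assoc)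
  qed
  have [measurable]: "f \<in> borel_measurable borel" by (rule smooth_fun_measurable0[OF sm])
  have "\<bar>x $ j\<bar> ^ a * cmod (LINT y|lborel. f y * atom (x, \<xi>) y) = cmod (LINT y|lborel. complex_of_real (\<bar>x $ j\<bar> ^ a) * (f y * atom (x, \<xi>) y))"
    by (simp add: norm_mult norm_power)
  also have "\<dots> \<le> (LINT y|lborel. D * G (1 / 4) y)"
  proof (rule Bochner_Integration.integral_norm_bound_integral[OF _ _ pw])
    show "integrable lborel (\<lambda>y. D * G (1 / 4) y)" by (intro integrable_mult_right Gi)
    show "integrable lborel (\<lambda>y. complex_of_real (\<bar>x $ j\<bar> ^ a) * (f y * atom (x, \<xi>) y))"
    proof (rule Bochner_Integration.integrable_bound)
      show "integrable lborel (\<lambda>y. D * G (1 / 4) y)" by (intro integrable_mult_right Gi)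
      show "AE y in lborel. norm (complex_of_real (\<bar>x $ j\<bar> ^ a) * (f y * atom (x, \<xi>) y)) \<le> norm (D * G (1 / 4) y)"
        unfolding real_norm_def by (intro AE_I2 order_trans[OF pw abs_ge_self])
    qed measurable
  qed
  also have "\<dots> = D * ?G" by (simp add: Gint)
  finally show ?thesis by (simp add: D_def mult_ac)
qed

text \<open>The rate of \<open>decay_of_moments\<close>, with the loss from passing to the largest coordinate (the factor
  \<open>(1 / d) powr (1 / u)\<close>) and from the geometric mean of the decay in position and in frequency (the last \<open>1 / 2\<close>).\<close>

definition decay_rate :: "nat \<Rightarrow> real \<Rightarrow> real \<Rightarrow> real" where
  "decay_rate d u H = u * H powr (- 1 / u) / 2 * (1 / d) powr (1 / u) / 2"

lemma component_decay_imp_norm_decay: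
  fixes v :: "real^'d::finite"
  assumes b: "\<And>j. m \<le> K * exp (- (c * \<bar>v $ j\<bar> powr (1 / u)))" and c: "0 \<le> c" and u: "0 < u" and K: "0 \<le> K"
  shows "m \<le> K * exp (- (c * (1 / CARD('d)) powr (1 / u) * norm v powr (1 / u)))"
proof -
  have "Max (range (\<lambda>i. \<bar>v $ i\<bar>)) \<in> range (\<lambda>i. \<bar>v $ i\<bar>)" by (intro Max_in) auto
  then obtain j where "Max (range (\<lambda>i. \<bar>v $ i\<bar>)) = \<bar>v $ j\<bar>" by (rule imageE)
  then have j: "\<bar>v $ i\<bar> \<le> \<bar>v $ j\<bar>" for i
    using Max_ge[of "range (\<lambda>i. \<bar>v $ i\<bar>)" "\<bar>v $ i\<bar>"] by simp
  have "norm v \<le> (\<Sum>i\<in>UNIV. \<bar>v $ i\<bar>)" by (rule norm_le_l1_cart)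
  also have "\<dots> \<le> CARD('d) * \<bar>v $ j\<bar>" using sum_mono[of UNIV "\<lambda>i. \<bar>v $ i\<bar>" "\<lambda>_. \<bar>v $ j\<bar>"] j by simp
  finally have "1 / CARD('d) * norm v \<le> \<bar>v $ j\<bar>" by (simp add: field_simps)
  then have "(1 / CARD('d) * norm v) powr (1 / u) \<le> \<bar>v $ j\<bar> powr (1 / u)" using u by (intro powr_mono2) auto
  then have "c * ((1 / CARD('d)) powr (1 / u) * norm v powr (1 / u)) \<le> c * \<bar>v $ j\<bar> powr (1 / u)"
    using c by (subst powr_mult[symmetric]) (auto intro!: mult_left_mono)
  then have "K * exp (- (c * \<bar>v $ j\<bar> powr (1 / u))) \<le> K * exp (- (c * (1 / CARD('d)) powr (1 / u) * norm v powr (1 / u)))"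
    using K by (intro mult_left_mono) (auto simp: mult.assoc)
  with b[of j] show ?thesis by linarith
qed

text \<open>The moments in position and in frequency yield two separate bounds by exponentials in \<open>x\<close> and in \<open>\<xi>\<close>, whose
  geometric mean is the joint bound. The constant is linear in \<open>N\<close> and otherwise uniform in the function, so
  that the bound also measures continuity.\<close>

lemma stft_fun_decay:
  assumes s: "absorbs_gauss s b" and t: "absorbs_gauss t b" and h: "0 < h"
    and r: "r \<le> decay_rate CARD('d::finite) s (h + b)" "r \<le> decay_rate CARD('d) t (h + b)"
  obtains C where "0 < C" "\<And>(f :: real^'d \<Rightarrow> complex) N z. smooth_fun f \<Longrightarrow> (\<And>\<mu>. gs_quot s t h f \<mu> \<le> N) \<Longrightarrow>
    cmod (stft_fun f z) \<le> C * N * exp_weight s t (- r) z"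
proof -
  obtain C1 where C1: "0 < C1" "\<And>k::nat. 5 ^ k * sqrt (fact k) \<le> C1 * b ^ k * fact k powr s"
    using absorbs_gaussE[OF s] by blast
  obtain C2 where C2: "0 < C2" "\<And>k::nat. 5 ^ k * sqrt (fact k) \<le> C2 * b ^ k * fact k powr t"
    using absorbs_gaussE[OF t] by blast
  have pos: "0 < b" "0 < s" "0 < t" using s t by (auto simp: absorbs_gauss_def)
  define H where "H = h + b"
  have H: "0 < H" using h pos by (simp add: H_def)
  let ?G = "LINT y|lborel. exp (- (1 / 4 * (norm (y::real^'d))\<^sup>2))"
  let ?c = "(2 * pi) powr (- real CARD('d) / 2)"
  have G0: "0 \<le> ?G" by (intro integral_nonneg_AE) auto
  define K where "K = 1 + ?G * C1 * 2 powr s + ?G * C2 * 2 powr t"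
  have K: "0 < K" using G0 C1 C2 by (simp add: K_def add_pos_nonneg)
  have dr: "0 \<le> decay_rate CARD('d) u H" if "0 < u" for u using that by (simp add: decay_rate_def)
  show ?thesis
  proof (rule that[of "?c * K"])
    show "0 < ?c * K" using K by simp
    fix f :: "real^'d \<Rightarrow> complex" and N and z :: "(real^'d) \<times> (real^'d)"
    assume sm: "smooth_fun f" and bd: "\<And>\<mu>. gs_quot s t h f \<mu> \<le> N"
    obtain x \<xi> where z: "z = (x, \<xi>)" by (cases z)
    have N: "0 \<le> N" by (rule gs_bound_nonneg[OF bd h])
    define m where "m = cmod (LINT y|lborel. f y * atom (x, \<xi>) y)"
    have gen: "m \<le> K * N * exp (- (2 * r * norm v powr (1 / u)))"
      if u: "0 < u" and r: "r \<le> decay_rate CARD('d) u H" and D: "0 \<le> D" "D * 2 powr u \<le> K"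
        and mom: "\<And>j a. \<bar>v $ j\<bar> ^ a * m \<le> D * N * H ^ a * fact a powr u" for v :: "real^'d" and u D
    proof -
      have "m \<le> K * N * exp (- (u * H powr (- 1 / u) / 2 * \<bar>v $ j\<bar> powr (1 / u)))" for j
      proof -
        have "m \<le> D * N * 2 powr u * exp (- (u * H powr (- 1 / u) / 2) * \<bar>v $ j\<bar> powr (1 / u))"
          by (rule decay_of_moments) (use H u mom[of j] in \<open>auto simp: m_def mult.commute\<close>)
        also have "D * N * 2 powr u = (D * 2 powr u) * N" by simp
        also have "(D * 2 powr u) * N * exp (- (u * H powr (- 1 / u) / 2) * \<bar>v $ j\<bar> powr (1 / u)) \<le>
            K * N * exp (- (u * H powr (- 1 / u) / 2) * \<bar>v $ j\<bar> powr (1 / u))"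
          using N D by (intro mult_right_mono) auto
        finally show ?thesis by simp
      qed
      then have "m \<le> K * N * exp (- (u * H powr (- 1 / u) / 2 * (1 / CARD('d)) powr (1 / u) * norm v powr (1 / u)))"
        using u K N by (intro component_decay_imp_norm_decay) auto
      also have "\<dots> \<le> K * N * exp (- (2 * r * norm v powr (1 / u)))"
      proof -
        have "2 * r \<le> u * H powr (- 1 / u) / 2 * (1 / CARD('d)) powr (1 / u)"
          using r by (simp add: decay_rate_def)
        then have "2 * r * norm v powr (1 / u) \<le> u * H powr (- 1 / u) / 2 * (1 / CARD('d)) powr (1 / u) * norm v powr (1 / u)"
          by (rule mult_right_mono) simp
        then show ?thesis using K N by (intro mult_left_mono) auto
      qed
      finally show ?thesis .
    qed
    have m1: "m \<le> K * N * exp (- (2 * r * norm \<xi> powr (1 / s)))"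
    proof (rule gen[of s "?G * C1"])
      show "\<bar>\<xi> $ j\<bar> ^ a * m \<le> ?G * C1 * N * H ^ a * fact a powr s" for j a
        using frequency_moment[OF sm bd h _ pos(1) C1, of \<xi> j a x] pos by (simp add: m_def H_def mult_ac)
      show "?G * C1 * 2 powr s \<le> K" using G0 C2 by (simp add: K_def)
    qed (use pos r G0 C1 in \<open>auto simp: H_def\<close>)
    have m2: "m \<le> K * N * exp (- (2 * r * norm x powr (1 / t)))"
    proof (rule gen[of t "?G * C2"])
      show "\<bar>x $ j\<bar> ^ a * m \<le> ?G * C2 * N * H ^ a * fact a powr t" for j a
        using position_moment[OF sm bd h _ pos(1) C2, of x j a \<xi>] pos by (simp add: m_def H_def mult_ac)
      show "?G * C2 * 2 powr t \<le> K" using G0 C1 by (simp add: K_def)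
    qed (use pos r G0 C2 in \<open>auto simp: H_def\<close>)
    have m0: "0 \<le> m" by (simp add: m_def)
    have "m * m \<le> (K * N * exp (- (2 * r * norm \<xi> powr (1 / s)))) * (K * N * exp (- (2 * r * norm x powr (1 / t))))"
      using m0 m1 m2 K N by (intro mult_mono) auto
    also have "\<dots> = (K * N * exp_weight s t (- r) z) * (K * N * exp_weight s t (- r) z)"
      by (simp add: exp_weight_def z algebra_simps flip: exp_add)
    finally have "m\<^sup>2 \<le> (K * N * exp_weight s t (- r) z)\<^sup>2" by (simp add: power2_eq_square)
    then have "m \<le> K * N * exp_weight s t (- r) z"
      by (rule power2_le_imp_le) (use K N in \<open>auto simp: exp_weight_def z\<close>)
    then have "?c * m \<le> ?c * (K * N * exp_weight s t (- r) z)" by (intro mult_left_mono) auto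
    then show "cmod (stft_fun f z) \<le> ?c * K * N * exp_weight s t (- r) z"
      by (simp add: stft_fun_def norm_mult m_def z mult.assoc)
  qed
qed

section \<open>Inversion and synthesis\<close>

lemma exp_weight_pos: "0 < exp_weight s t r z"
  by (cases z) (simp add: exp_weight_def)

lemma exp_weight_mult: "exp_weight s t a z * exp_weight s t b z = exp_weight s t (a + b) z"
  by (cases z) (simp add: exp_weight_def distrib_right exp_add)

lemma continuous_exp_weight:
  assumes "0 < s" "0 < t"
  shows "continuous_on UNIV (exp_weight s t r)"
  unfolding exp_weight_def case_prod_unfold
  by (intro continuous_intros continuous_on_powr') (use assms in auto)

lemma exp_weight_measurable:
  assumes "0 < s" "0 < t"
  shows "exp_weight s t r \<in> borel_measurable borel"
  by (intro borel_measurable_continuous_onI continuous_exp_weight assms)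

lemma exp_weight_decay:
  fixes M :: nat
  assumes "0 < s" "0 < t" "0 < r"
  obtains C where "0 < C" "\<And>z :: (real^'d::finite) \<times> (real^'d).
    exp_weight s t (- r) z * ((1 + norm (fst z)) * (1 + norm (snd z))) ^ M \<le> C"
proof -
  obtain C1 where C1: "0 < C1" "\<And>x. 0 \<le> x \<Longrightarrow> (1 + x) ^ M \<le> C1 * exp (r * x powr (1 / t))"
    using polynomial_le_exp_powr[of r "1 / t" M] assms by auto
  obtain C2 where C2: "0 < C2" "\<And>x. 0 \<le> x \<Longrightarrow> (1 + x) ^ M \<le> C2 * exp (r * x powr (1 / s))"
    using polynomial_le_exp_powr[of r "1 / s" M] assms by auto
  show ?thesis
  proof (rule that[of "C1 * C2"])
    show "0 < C1 * C2" using C1 C2 by simp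
    fix z :: "(real^'d) \<times> (real^'d)"
    obtain x \<xi> where z: "z = (x, \<xi>)" by (cases z)
    have "((1 + norm x) * (1 + norm \<xi>)) ^ M \<le> (C1 * exp (r * norm x powr (1 / t))) * (C2 * exp (r * norm \<xi> powr (1 / s)))"
      unfolding power_mult_distrib by (intro mult_mono C1 C2) (use C1 in auto)
    also have "\<dots> = C1 * C2 * exp_weight s t r z"
      by (simp add: exp_weight_def z distrib_left exp_add)
    finally have "exp_weight s t (- r) z * ((1 + norm x) * (1 + norm \<xi>)) ^ M \<le> exp_weight s t (- r) z * (C1 * C2 * exp_weight s t r z)"
      by (intro mult_left_mono) (simp_all add: less_imp_le[OF exp_weight_pos])
    also have "\<dots> = C1 * C2 * (exp_weight s t (- r) z * exp_weight s t r z)" by (simp only: mult_ac)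
    also have "\<dots> = C1 * C2" unfolding exp_weight_mult by (simp add: exp_weight_def z)
    finally show "exp_weight s t (- r) z * ((1 + norm (fst z)) * (1 + norm (snd z))) ^ M \<le> C1 * C2"
      by (simp add: z)
  qed
qed

lemma exp_weight_le_inv_poly:
  assumes "0 < s" "0 < t" "0 < r"
  obtains C where "0 < C" "\<And>z :: (real^'d::finite) \<times> (real^'d).
    exp_weight s t (- r) z \<le> C * (inv_poly (fst z) * inv_poly (snd z))"
proof -
  obtain C where C: "0 < C" "\<And>z :: (real^'d) \<times> (real^'d).
    exp_weight s t (- r) z * ((1 + norm (fst z)) * (1 + norm (snd z))) ^ (2 * CARD('d)) \<le> C"
    by (rule exp_weight_decay[OF assms]) blast
  show ?thesis
  proof (rule that[OF C(1)])
    fix z :: "(real^'d) \<times> (real^'d)"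
    let ?P = "((1 + norm (fst z)) * (1 + norm (snd z))) ^ (2 * CARD('d))"
    have P: "0 < ?P" by (intro zero_less_power mult_pos_pos) (auto simp: add_pos_nonneg)
    have "exp_weight s t (- r) z \<le> C * (1 / ?P)" using C(2)[of z] P by (simp add: field_simps)
    also have "1 / ?P = (1 / (1 + norm (fst z)) ^ (2 * CARD('d))) * (1 / (1 + norm (snd z)) ^ (2 * CARD('d)))"
      by (simp add: power_mult_distrib)
    also have "C * \<dots> \<le> C * (inv_poly (fst z) * inv_poly (snd z))"
      using C(1) by (intro mult_left_mono mult_mono inv_poly_ge) (auto simp: less_imp_le[OF inv_poly_pos])
    finally show "exp_weight s t (- r) z \<le> C * (inv_poly (fst z) * inv_poly (snd z))" .
  qed
qed

lemma exp_weight_le_inverse_power: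
  assumes "0 < s" "0 < t" "0 < r"
  obtains C where "0 < C" "\<And>z :: (real^'d::finite) \<times> (real^'d). exp_weight s t (- r) z \<le> C / (1 + norm z) ^ M"
proof -
  obtain C where C: "0 < C" "\<And>z :: (real^'d) \<times> (real^'d).
    exp_weight s t (- r) z * ((1 + norm (fst z)) * (1 + norm (snd z))) ^ M \<le> C"
    by (rule exp_weight_decay[OF assms]) blast
  show ?thesis
  proof (rule that[OF C(1)])
    fix z :: "(real^'d) \<times> (real^'d)"
    have "norm z \<le> norm (fst z) + norm (snd z)" using norm_Pair_le[of "fst z" "snd z"] by simp
    also have "1 + \<dots> \<le> (1 + norm (fst z)) * (1 + norm (snd z))" by (simp add: algebra_simps)
    finally have "(1 + norm z) ^ M \<le> ((1 + norm (fst z)) * (1 + norm (snd z))) ^ M" by (intro power_mono) auto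
    then have "exp_weight s t (- r) z * (1 + norm z) ^ M \<le> exp_weight s t (- r) z * ((1 + norm (fst z)) * (1 + norm (snd z))) ^ M"
      by (intro mult_left_mono) (simp_all add: less_imp_le[OF exp_weight_pos])
    also have "\<dots> \<le> C" by (rule C)
    finally show "exp_weight s t (- r) z \<le> C / (1 + norm z) ^ M"
      by (subst pos_le_divide_eq) (auto simp: add_pos_nonneg)
  qed
qed

lemma integrable_exp_weight:
  assumes "0 < s" "0 < t" "0 < r"
  shows "integrable lborel (exp_weight s t (- r) :: (real^'d::finite) \<times> (real^'d) \<Rightarrow> real)"
proof -
  obtain C where C: "0 < C" "\<And>z :: (real^'d) \<times> (real^'d). exp_weight s t (- r) z \<le> C * (inv_poly (fst z) * inv_poly (snd z))"
    by (rule exp_weight_le_inv_poly[OF assms]) blast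
  show ?thesis
  proof (rule Bochner_Integration.integrable_bound)
    show "integrable lborel (\<lambda>z :: (real^'d) \<times> (real^'d). C * (inv_poly (fst z) * inv_poly (snd z)))"
      by (intro integrable_mult_right integrable_inv_poly_prod)
    show "exp_weight s t (- r) \<in> borel_measurable lborel"
      using exp_weight_measurable[OF assms(1,2)] by simp
    show "AE z in lborel. norm (exp_weight s t (- r) z) \<le> norm (C * (inv_poly (fst z) * inv_poly (snd z :: real^'d)))"
      using C by (intro AE_I2) (auto intro: order_trans[OF _ abs_ge_self] simp: abs_of_pos[OF exp_weight_pos])
  qed
qed

lemma integrable_of_weight_bound:
  fixes H :: "(real^'d::finite) \<times> (real^'d) \<Rightarrow> 'b::{banach, second_countable_topology}"
  assumes "0 < s" "0 < t" "0 < r" and H: "H \<in> borel_measurable borel" "\<And>z. norm (H z) \<le> C * exp_weight s t (- r) z"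
  shows "integrable lborel H"
proof (rule Bochner_Integration.integrable_bound)
  show "integrable lborel (\<lambda>z :: (real^'d) \<times> (real^'d). C * exp_weight s t (- r) z)"
    by (intro integrable_mult_right integrable_exp_weight assms)
  show "AE z in lborel. norm (H z) \<le> norm (C * exp_weight s t (- r) z)"
    unfolding real_norm_def by (intro AE_I2 order_trans[OF H(2) abs_ge_self])
qed (use H in simp)

lemma stft_fun_measurable:
  fixes f :: "real^'d::finite \<Rightarrow> complex"
  assumes [measurable]: "f \<in> borel_measurable borel"
  shows "stft_fun f \<in> borel_measurable borel"
proof -
  have [measurable]: "(\<lambda>p. atom (fst p) (snd p) :: complex) \<in> borel_measurable (borel \<Otimes>\<^sub>M (borel :: (real^'d) measure))"
    by (rule atom_measurable_pair)
  have "(\<lambda>(z, y). f y * atom z y) \<in> borel_measurable (borel \<Otimes>\<^sub>M borel)"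
    unfolding case_prod_unfold by measurable
  then have "(\<lambda>(z, y). f y * atom z y) \<in> borel_measurable (borel \<Otimes>\<^sub>M lborel)"
    by (subst measurable_cong_sets[OF sets_pair_measure_cong refl]) auto
  then have "(\<lambda>z. LINT y|lborel. f y * atom z y) \<in> borel_measurable borel"
    by (rule lborel.borel_measurable_lebesgue_integral)
  then show ?thesis unfolding stft_fun_def[abs_def] by measurable
qed

text \<open>The pairing is bilinear, hence the modulations in the inversion formula are conjugate to those in the
  transform.\<close>

definition flip :: "(real^'d) \<times> (real^'d) \<Rightarrow> (real^'d) \<times> (real^'d)" where
  "flip z = (fst z, - snd z)"

text \<open>The transpose of the transform (\<open>synth_adjoint\<close>).\<close>

definition synth :: "((real^'d::finite) \<times> (real^'d) \<Rightarrow> complex) \<Rightarrow> real^'d \<Rightarrow> complex" where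
  "synth H y = of_real ((2 * pi) powr (- real CARD('d) / 2)) * (LINT z|lborel. H z * atom z y)"

lemma exp_weight_flip: "exp_weight s t r (flip z) = exp_weight s t r z"
  by (simp add: exp_weight_def flip_def case_prod_unfold)

lemma flip_measurable [measurable]: "flip \<in> borel \<rightarrow>\<^sub>M (borel :: ((real^'d::finite) \<times> (real^'d)) measure)"
  unfolding flip_def[abs_def] by (intro borel_measurable_continuous_onI continuous_intros)

lemma norm_atom_le_1: "cmod (atom z y) \<le> 1"
  for z :: "(real^'d::finite) \<times> (real^'d)"
  unfolding norm_atom by (rule mult_le_one[OF pi_powr_le_1]) auto

text \<open>The normalisation of the window, on which the constant in the inversion formula depends.\<close>

lemma gauss_window_square_integral:
  fixes y :: "real^'d::finite"
  shows "integrable lborel (\<lambda>x. atom (x, 0) y * atom (x, 0) y)" "(LINT x|lborel. atom (x, 0) y * atom (x, 0) y) = 1"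
proof -
  let ?p = "pi powr (- real CARD('d) / 4)"
  have eq: "atom (x, 0) y * atom (x, 0) y = complex_of_real (?p * ?p * exp (- (1 * (norm (x - y))\<^sup>2)))" for x
  proof -
    have "exp (- (norm (y - x))\<^sup>2 / 2) * exp (- (norm (y - x))\<^sup>2 / 2) = exp (- (1 * (norm (x - y))\<^sup>2))"
      by (simp add: exp_add[symmetric] norm_minus_commute)
    then show ?thesis unfolding atom_real of_real_mult[symmetric] by (simp only: mult_ac)
  qed
  have i: "integrable lborel (\<lambda>x. ?p * ?p * exp (- (1 * (norm (x - y))\<^sup>2)))"
    by (intro integrable_mult_right integrable_gauss_shift) simp
  show "integrable lborel (\<lambda>x. atom (x, 0) y * atom (x, 0) y)"
    unfolding eq using i by (simp only: complex_of_real_integrable_eq)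
  have "complex_of_real (LINT x|lborel. exp (- (1 * (norm (x::real^'d))\<^sup>2))) = complex_of_real ((sqrt (2 * pi) / sqrt 2) ^ CARD('d))"
    using gauss_fourier(2)[of "sqrt 2" "0::real^'d"] by (simp add: integral_complex_of_real)
  then have "(LINT x|lborel. exp (- (1 * (norm (x::real^'d))\<^sup>2))) = sqrt pi ^ CARD('d)"
    by (simp only: of_real_eq_iff) (simp add: real_sqrt_mult)
  then have "(LINT x|lborel. ?p * ?p * exp (- (1 * (norm (x - y))\<^sup>2))) = ?p * ?p * sqrt pi ^ CARD('d)"
    by (simp only: integral_mult_right_zero integrable_gauss_shift(2)[OF zero_less_one])
  also have "sqrt pi ^ CARD('d) = pi powr (real CARD('d) / 2)"
    by (simp add: powr_half_sqrt[symmetric] powr_realpow[symmetric] powr_powr)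
  also have "?p * ?p * pi powr (real CARD('d) / 2) = 1"
    by (simp add: powr_add[symmetric])
  finally show "(LINT x|lborel. atom (x, 0) y * atom (x, 0) y) = 1"
    unfolding eq integral_complex_of_real by simp
qed

text \<open>For a fixed position, Fourier inversion in the frequency recovers the product of the function with the translated
  window. A second multiplication by the window and integration over the position leaves the square
  integral of the window.\<close>

lemma stft_inversion:
  fixes f :: "real^'d::finite \<Rightarrow> complex"
  assumes int: "integrable lborel f" and cont: "continuous_on UNIV f" and bd: "\<And>y. cmod (f y) \<le> M"
    and st: "0 < s" "0 < t" "0 < r" and V: "\<And>z. cmod (stft_fun f z) \<le> C * exp_weight s t (- r) z"
  shows "f = synth (\<lambda>z. stft_fun f (flip z))"
proof
  fix y
  have [measurable]: "f \<in> borel_measurable borel" using borel_measurable_integrable[OF int] by simp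
  have Vm [measurable]: "stft_fun f \<in> borel_measurable borel" by (rule stft_fun_measurable) measurable
  define c where "c = (2 * pi) powr (- real CARD('d) / 2)"
  have c: "0 < c" "c * c * (2 * pi) ^ CARD('d) = 1"
  proof -
    have "(2 * pi) ^ CARD('d) = (2 * pi) powr (real CARD('d))" by (simp add: powr_realpow)
    then show "c * c * (2 * pi) ^ CARD('d) = 1" by (simp add: c_def powr_add[symmetric])
  qed (simp add: c_def)
  obtain C' where C': "0 < C'" "\<And>z :: (real^'d) \<times> (real^'d). exp_weight s t (- r) z \<le> C' * (inv_poly (fst z) * inv_poly (snd z))"
    by (rule exp_weight_le_inv_poly[OF st]) blast
  have C0: "0 \<le> C"
    using order_trans[OF norm_ge_zero V[of 0]] exp_weight_pos[of s t "- r" "0 :: (real^'d) \<times> (real^'d)"] by (simp add: zero_le_mult_iff)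
  have inner: "(LINT \<xi>|lborel. stft_fun f (flip (x, \<xi>)) * atom (x, \<xi>) y) =
      complex_of_real (c * (2 * pi) ^ CARD('d)) * f y * (atom (x, 0) y * atom (x, 0) y)" for x
  proof -
    define k where "k u = f u * atom (x, 0) u" for u
    define E where "E v \<xi> = exp (\<i> * complex_of_real (v \<bullet> \<xi>))" for v \<xi> :: "real^'d"
    have hat: "(LINT u|lborel. k u * exp (- \<i> * complex_of_real (u \<bullet> \<xi>))) = stft_fun f (x, \<xi>) / c" for \<xi>
      using c unfolding stft_fun_def k_def c_def[symmetric] atom_eq_mult[of x \<xi>] by (simp add: mult.assoc)
    have sm: "(\<lambda>\<xi>. stft_fun f (x, \<xi>)) \<in> borel_measurable borel"
    proof -
      have "(\<lambda>\<xi>::real^'d. (x, \<xi>)) \<in> borel \<rightarrow>\<^sub>M borel"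
        by (intro borel_measurable_continuous_onI continuous_intros)
      from measurable_compose[OF this Vm] show ?thesis .
    qed
    have si: "integrable lborel (\<lambda>\<xi>. stft_fun f (x, \<xi>))"
    proof (rule Bochner_Integration.integrable_bound)
      show "integrable lborel (\<lambda>\<xi>::real^'d. C * (C' * inv_poly x) * inv_poly \<xi>)"
        by (intro integrable_mult_right integrable_inv_poly)
      have "cmod (stft_fun f (x, \<xi>)) \<le> C * (C' * inv_poly x) * inv_poly \<xi>" for \<xi>
        using order_trans[OF V mult_left_mono[OF C'(2) C0]] by (metis fst_conv snd_conv mult.assoc)
      then show "AE \<xi> in lborel. norm (stft_fun f (x, \<xi>)) \<le> norm (C * (C' * inv_poly x) * inv_poly \<xi>)"
        by (intro AE_I2) (metis abs_ge_self order_trans real_norm_def)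
    qed (use sm in simp)
    have FI: "(LINT \<xi>|lborel. (LINT u|lborel. k u * exp (- \<i> * complex_of_real (u \<bullet> \<xi>))) * E y \<xi>) =
        complex_of_real ((2 * pi) ^ CARD('d)) * k y"
      unfolding E_def
    proof (rule fourier_inversion)
      show "integrable lborel k"
      proof (rule Bochner_Integration.integrable_bound[OF int])
        show "k \<in> borel_measurable lborel" unfolding k_def[abs_def] by measurable
        show "AE u in lborel. norm (k u) \<le> norm (f u)"
          unfolding k_def norm_mult by (intro AE_I2 mult_right_le_one_le norm_atom_le_1) auto
      qed
      show "continuous_on UNIV k" unfolding k_def by (intro continuous_intros cont continuous_atom)
      show "cmod (k u) \<le> M" for u
        unfolding k_def norm_mult by (intro order_trans[OF mult_right_le_one_le bd] norm_atom_le_1) auto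
      show "integrable lborel (\<lambda>\<xi>. LINT u|lborel. k u * exp (- \<i> * complex_of_real (u \<bullet> \<xi>)))"
        unfolding hat using si by simp
    qed
    have "(LINT \<xi>|lborel. stft_fun f (flip (x, \<xi>)) * atom (x, \<xi>) y) =
        (LINT \<xi>|lborel. stft_fun f (flip (x, 0 + (-1) *\<^sub>R \<xi>)) * atom (x, 0 + (-1) *\<^sub>R \<xi>) y)"
    proof -
      have "integrable lborel (\<lambda>\<xi>. stft_fun f (x, 0 + (-1) *\<^sub>R \<xi>))" by (rule integrable_lborel_affine[OF _ si]) simp
      then have "integrable lborel (\<lambda>\<xi>. stft_fun f (flip (x, \<xi>)))" by (simp add: flip_def)
      then have "integrable lborel (\<lambda>\<xi>. stft_fun f (flip (x, \<xi>)) * atom (x, \<xi>) y)"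
      proof (rule Bochner_Integration.integrable_bound)
        have "(\<lambda>\<xi>. atom (x, \<xi>) y) \<in> borel_measurable borel"
          by (intro borel_measurable_continuous_onI continuous_atom continuous_intros)
        moreover have "(\<lambda>\<xi>. stft_fun f (flip (x, \<xi>))) \<in> borel_measurable borel"
          using \<open>integrable lborel (\<lambda>\<xi>. stft_fun f (flip (x, \<xi>)))\<close> by (auto dest: borel_measurable_integrable)
        ultimately show "(\<lambda>\<xi>. stft_fun f (flip (x, \<xi>)) * atom (x, \<xi>) y) \<in> borel_measurable lborel" by measurable
        show "AE \<xi> in lborel. norm (stft_fun f (flip (x, \<xi>)) * atom (x, \<xi>) y) \<le> norm (stft_fun f (flip (x, \<xi>)))"
          unfolding norm_mult by (intro AE_I2 mult_right_le_one_le norm_atom_le_1) auto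
      qed
      then show ?thesis
        using integral_lborel_affine[of "-1" "\<lambda>\<xi>. stft_fun f (flip (x, \<xi>)) * atom (x, \<xi>) y" 0] by simp
    qed
    also have "\<dots> = (LINT \<xi>|lborel. complex_of_real c * atom (x, 0) y *
        ((LINT u|lborel. k u * exp (- \<i> * complex_of_real (u \<bullet> \<xi>))) * E y \<xi>))"
      unfolding hat atom_eq_mult[of x "_ + _"] E_def using c by (simp add: flip_def mult_ac)
    also have "\<dots> = complex_of_real c * atom (x, 0) y * (complex_of_real ((2 * pi) ^ CARD('d)) * k y)"
      unfolding integral_mult_right_zero FI ..
    finally show ?thesis by (simp add: k_def mult_ac)
  qed
  have Hi: "integrable (lborel \<Otimes>\<^sub>M lborel) (\<lambda>z. stft_fun f (flip z) * atom z y)"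
    unfolding lborel_prod
  proof (rule integrable_of_weight_bound[OF st])
    show "(\<lambda>z. stft_fun f (flip z) * atom z y) \<in> borel_measurable borel" by measurable
    show "norm (stft_fun f (flip z) * atom z y) \<le> C * exp_weight s t (- r) z" for z
      unfolding norm_mult
      using order_trans[OF mult_right_le_one_le[OF norm_ge_zero norm_ge_zero norm_atom_le_1] V[of "flip z"], of z y] by (simp add: exp_weight_flip)
  qed
  have "(LINT z|lborel. stft_fun f (flip z) * atom z y) = (LINT x|lborel. LINT \<xi>|lborel. stft_fun f (flip (x, \<xi>)) * atom (x, \<xi>) y)"
    unfolding lborel_prod[symmetric] using lborel_pair.integral_fst'[OF Hi] by simp
  also have "\<dots> = complex_of_real (c * (2 * pi) ^ CARD('d)) * f y"
    unfolding inner integral_mult_right_zero gauss_window_square_integral(2) by simp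
  finally have "synth (\<lambda>z. stft_fun f (flip z)) y = complex_of_real (c * (c * (2 * pi) ^ CARD('d))) * f y"
    unfolding synth_def c_def[symmetric] by (simp only: of_real_mult mult.assoc)
  moreover have "c * (c * (2 * pi) ^ CARD('d)) = 1" using c(2) by (simp only: mult.assoc)
  ultimately show "f y = synth (\<lambda>z. stft_fun f (flip z)) y" by (simp only: of_real_1 mult_1_left)
qed

lemma multi_deriv_atom:
  fixes z :: "(real^'d::finite) \<times> (real^'d)"
  assumes "\<And>i. count_list is i = \<alpha> i"
  shows "multi_deriv \<alpha> (atom z) = partial_derivs is (atom z)"
proof -
  have "\<forall>i. count_list (SOME is. \<forall>i. count_list is i = \<alpha> i) i = \<alpha> i" by (rule someI_ex[OF count_list_exists])
  then show ?thesis unfolding multi_deriv_def partial_derivs_atom using assms by simp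
qed

lemma continuous_partial_derivs_atom:
  "continuous_on UNIV (\<lambda>z :: (real^'d::finite) \<times> (real^'d). partial_derivs is (atom z) y)"
proof -
  have eq: "partial_derivs is (atom z) y = of_real (pi powr (- real CARD('d) / 4) * exp (- (norm (fst z))\<^sup>2 / 2)) *
    (\<Prod>i\<in>UNIV. \<Sum>k = 0..count_list is i. of_nat (count_list is i choose k) *
      ((of_real (fst z $ i) + \<i> * of_real (- (snd z $ i))) ^ k * exp ((of_real (fst z $ i) + \<i> * of_real (- (snd z $ i))) * of_real (y $ i))) *
      (deriv ^^ (count_list is i - k)) gauss1 (of_real (y $ i)))" for z :: "(real^'d) \<times> (real^'d)"
  proof -
    have "partial_derivs is (atom z) y = of_real (pi powr (- real CARD('d) / 4) * exp (- (norm (fst z))\<^sup>2 / 2)) * partial_derivs is (coh (cvec z)) y"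
      unfolding atom_eq_coh using partial_derivs_lin[OF smooth_fun_coh smooth_fun_coh, of "is" _ "cvec z" 0] by simp
    also have "partial_derivs is (coh (cvec z)) y = (\<Prod>i\<in>UNIV. (deriv ^^ count_list is i) (coh1 (cvec z $ i)) (of_real (y $ i)))"
      unfolding coh_def partial_derivs_tensor[OF holomorphic_coh1] tensor_def ..
    finally show ?thesis unfolding deriv_coh1 by (simp add: cvec_def Complex_eq)
  qed
  show ?thesis unfolding eq by (intro continuous_intros) auto
qed

lemma continuous_gs_fun_atom:
  "continuous_on UNIV (\<lambda>z :: (real^'d::finite) \<times> (real^'d). gs_fun s t h \<mu> (atom z))"
  unfolding gs_fun_def case_prod_unfold multi_deriv_def
  by (intro continuous_intros continuous_partial_derivs_atom)

text \<open>Each quotient of the superposition is the superposition of the quotients of the atoms: the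
  decay \<open>r1\<close> of the coefficients outweighs the growth \<open>r2\<close> of the atoms and permits differentiation under the integral.\<close>

lemma synth_in_gs:
  fixes H :: "(real^'d::finite) \<times> (real^'d) \<Rightarrow> complex"
  assumes st: "0 < s" "0 < t" "0 < h" and H: "H \<in> borel_measurable borel" "\<And>z. cmod (H z) \<le> A * exp_weight s t (- r1) z"
    and at: "\<And>(z :: (real^'d) \<times> (real^'d)) \<mu>. gs_quot s t h (atom z) \<mu> \<le> C * exp_weight s t r2 z" and r: "r2 < r1"
  shows "smooth_fun (synth H)"
    and "integrable lborel (\<lambda>z. H z * gs_fun s t h \<mu> (atom z))"
    and "gs_fun s t h \<mu> (synth H) = of_real ((2 * pi) powr (- real CARD('d) / 2)) * (LINT z|lborel. H z * gs_fun s t h \<mu> (atom z))"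
    and "gs_quot s t h (synth H) \<mu> \<le> (2 * pi) powr (- real CARD('d) / 2) *
      (A * C * (LINT z|lborel. exp_weight s t (- (r1 - r2)) (z :: (real^'d) \<times> (real^'d))))"
proof -
  define c where "c = (2 * pi) powr (- real CARD('d) / 2)"
  have A: "0 \<le> A"
    using order_trans[OF norm_ge_zero H(2)[of 0]] exp_weight_pos[of s t "- r1" "0 :: (real^'d) \<times> (real^'d)"] by (simp add: zero_le_mult_iff)
  have rr: "0 < r1 - r2" using r by simp
  have wprod: "A * exp_weight s t (- r1) z * (B * exp_weight s t r2 z) = A * B * exp_weight s t (- (r1 - r2)) z" for B z
    using exp_weight_mult[of s t "- r1" z r2] by (simp add: mult_ac)
  define W where "W B z = A * B * exp_weight s t (- (r1 - r2)) z" for B and z :: "(real^'d) \<times> (real^'d)"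
  have Wi: "integrable lborel (W B)" for B
    unfolding W_def[abs_def] by (intro integrable_mult_right integrable_exp_weight st rr)
  have Hb: "cmod (H z * v) \<le> W B z" if "cmod v \<le> B * exp_weight s t r2 z" for v B z
    unfolding norm_mult W_def wprod[symmetric] using that H(2) A
    by (intro mult_mono) (auto simp: less_imp_le[OF exp_weight_pos])
  define B where "B is = C * (h ^ (\<Sum>i\<in>UNIV. count_list is i) * multi_fact (count_list is :: 'd \<Rightarrow> nat) powr s)" for "is"
  have pd: "cmod (partial_derivs is (atom z) y) \<le> B is * exp_weight s t r2 z" for "is" y and z :: "(real^'d) \<times> (real^'d)"
  proof -
    have mf: "0 < multi_fact \<alpha>" for \<alpha> :: "'d \<Rightarrow> nat" unfolding multi_fact_def by (intro prod_pos) auto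
    have "gs_quot s t h (atom z) (count_list is, \<lambda>_. 0, y) \<le> C * exp_weight s t r2 z" by (rule at)
    then have "cmod (partial_derivs is (atom z) y) / (h ^ (\<Sum>i\<in>UNIV. count_list is i) * multi_fact (count_list is :: 'd \<Rightarrow> nat) powr s) \<le> C * exp_weight s t r2 z"
      unfolding gs_quot_def prod.case multi_deriv_atom[OF refl] by (simp add: multi_pow_def multi_fact_def)
    then show ?thesis using st mf[of "count_list is"] by (simp add: B_def divide_le_eq mult_ac)
  qed
  have pm [measurable]: "(\<lambda>z. partial_derivs is (atom z) y) \<in> borel_measurable borel" for "is" y
    by (intro borel_measurable_continuous_onI continuous_partial_derivs_atom)
  note [measurable] = H(1)
  have pi_int: "integrable lborel (\<lambda>z. H z * partial_derivs is (atom z) y)" for "is" y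
    by (rule Bochner_Integration.integrable_bound[OF Wi[of "B is"]])
       (auto intro!: AE_I2 order_trans[OF Hb[OF pd] abs_ge_self])
  define S where "S is y = of_real c * (LINT z|lborel. H z * partial_derivs is (atom z) y)" for "is" y
  have dS: "((\<lambda>r. S is (y + r *\<^sub>R axis j 1)) has_vector_derivative S (j # is) y) (at 0)" for "is" j y
  proof -
    have "((\<lambda>r. LINT z|lborel. H z * partial_derivs is (atom z) (y + r *\<^sub>R axis j 1)) has_vector_derivative
       (LINT z|lborel. H z * partial_derivs (j # is) (atom z) (y + 0 *\<^sub>R axis j 1))) (at 0)"
    proof (rule has_vector_derivative_integral(1)[OF pi_int Wi[of "B (j # is)"]])
      show "((\<lambda>r. H z * partial_derivs is (atom z) (y + r *\<^sub>R axis j 1)) has_vector_derivative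
          H z * partial_derivs (j # is) (atom z) (y + \<tau> *\<^sub>R axis j 1)) (at \<tau>)" for \<tau> z
      proof -
        have "((\<lambda>r. partial_derivs is (atom z) ((y + \<tau> *\<^sub>R axis j 1) + r *\<^sub>R axis j 1)) \<circ> (\<lambda>r. r - \<tau>) has_vector_derivative
            (1 *\<^sub>R partial_derivs (j # is) (atom z) (y + \<tau> *\<^sub>R axis j 1))) (at \<tau>)"
          by (rule vector_diff_chain_at)
             (auto intro!: derivative_eq_intros smooth_fun_has_vector_derivative smooth_fun_atom)
        then show ?thesis
          by (intro has_vector_derivative_mult_right) (simp add: comp_def scaleR_diff_left)
      qed
      show "cmod (H z * partial_derivs (j # is) (atom z) (y + \<tau> *\<^sub>R axis j 1)) \<le> W (B (j # is)) z" for \<tau> z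
        by (rule Hb[OF pd])
    qed
    then show ?thesis unfolding S_def by (intro has_vector_derivative_mult_right) simp
  qed
  have pS: "partial_derivs is (synth H) = S is" for "is"
  proof (induction "is")
    case Nil
    show ?case by (simp add: partial_derivs_def S_def[abs_def] synth_def[abs_def] c_def)
  next
    case (Cons j "is")
    have "partial_derivs (j # is) (synth H) = partial_deriv j (S is)"
      using Cons.IH by (simp add: partial_derivs_def)
    also have "\<dots> = S (j # is)"
      unfolding partial_deriv_def[abs_def] by (intro ext vector_derivative_at dS)
    finally show ?case .
  qed
  have cS: "continuous_on UNIV (S is)" for "is"
    unfolding continuous_on_sequentially
  proof (intro allI ballI impI)
    fix X :: "nat \<Rightarrow> real^'d" and a assume X: "(\<forall>n. X n \<in> UNIV) \<and> X \<longlonglongrightarrow> a"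
    have "(\<lambda>n. LINT z|lborel. H z * partial_derivs is (atom z) (X n)) \<longlonglongrightarrow> (LINT z|lborel. H z * partial_derivs is (atom z) a)"
    proof (rule integral_dominated_convergence[OF _ _ Wi[of "B is"]])
      show "AE z in lborel. (\<lambda>n. H z * partial_derivs is (atom z) (X n)) \<longlonglongrightarrow> H z * partial_derivs is (atom z) a"
        using X by (intro AE_I2 tendsto_intros continuous_on_tendsto_compose[OF smooth_fun_continuous[OF smooth_fun_atom]]) auto
      show "AE z in lborel. norm (H z * partial_derivs is (atom z) (X n)) \<le> W (B is) z" for n
        by (intro AE_I2 Hb[OF pd])
    qed auto
    then show "(S is \<circ> X) \<longlonglongrightarrow> S is a" unfolding S_def comp_def by (intro tendsto_intros)
  qed
  show sm: "smooth_fun (synth H)"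
    unfolding smooth_fun_def pS by (auto intro!: cS differentiableI_vector[OF dS])
  have gb: "cmod (gs_fun s t h \<mu> (atom z)) \<le> C * exp_weight s t r2 z" for z :: "(real^'d) \<times> (real^'d)"
    using at[of z \<mu>] gs_quot_eq_norm_gs_fun[OF st(3)] by metis
  have gm [measurable]: "(\<lambda>z :: (real^'d) \<times> (real^'d). gs_fun s t h \<mu> (atom z)) \<in> borel_measurable borel"
    by (intro borel_measurable_continuous_onI continuous_gs_fun_atom)
  show gi: "integrable lborel (\<lambda>z. H z * gs_fun s t h \<mu> (atom z))"
    by (rule Bochner_Integration.integrable_bound[OF Wi[of C]])
       (auto intro!: AE_I2 order_trans[OF Hb[OF gb] abs_ge_self])
  show eq: "gs_fun s t h \<mu> (synth H) = of_real ((2 * pi) powr (- real CARD('d) / 2)) * (LINT z|lborel. H z * gs_fun s t h \<mu> (atom z))"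
  proof -
    obtain \<alpha> \<beta> y where m: "\<mu> = (\<alpha>, \<beta>, y)" by (cases \<mu>)
    let ?k = "complex_of_real (multi_pow y \<beta> / (h ^ (\<Sum>i\<in>UNIV. \<alpha> i + \<beta> i) * multi_fact \<alpha> powr s * multi_fact \<beta> powr t))"
    have "H z * gs_fun s t h \<mu> (atom z) = ?k * (H z * partial_derivs (SOME is. \<forall>i. count_list is i = \<alpha> i) (atom z) y)" for z
      by (simp add: m gs_fun_def multi_deriv_def)
    then have "(LINT z|lborel. H z * gs_fun s t h \<mu> (atom z)) =
        ?k * (LINT z|lborel. H z * partial_derivs (SOME is. \<forall>i. count_list is i = \<alpha> i) (atom z) y)"
      by (simp only: integral_mult_right_zero)
    then show ?thesis
      unfolding m gs_fun_def prod.case multi_deriv_def pS S_def c_def by (simp only: mult_ac)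
  qed
  have "cmod (LINT z|lborel. H z * gs_fun s t h \<mu> (atom z)) \<le> (LINT z|lborel. W C z)"
    by (rule Bochner_Integration.integral_norm_bound_integral[OF gi Wi Hb[OF gb]])
  also have "\<dots> = A * C * (LINT z|lborel. exp_weight s t (- (r1 - r2)) (z :: (real^'d) \<times> (real^'d)))"
    unfolding W_def by (rule integral_mult_right_zero)
  finally show "gs_quot s t h (synth H) \<mu> \<le> (2 * pi) powr (- real CARD('d) / 2) *
      (A * C * (LINT z|lborel. exp_weight s t (- (r1 - r2)) (z :: (real^'d) \<times> (real^'d))))"
    unfolding gs_quot_eq_norm_gs_fun[OF st(3)] eq norm_mult norm_of_real by (intro mult_mono) auto
qed

section \<open>Functionals on superpositions of wave packets\<close>

lemma norm_vec_smult: "norm (c *s v) = cmod c * norm v" for v :: "complex^'d::finite"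
  by (simp add: norm_vec_def norm_mult L2_set_right_distrib)

text \<open>The Cauchy criterion for difference quotients, which involves no candidate for the derivative.\<close>

lemma field_differentiable_of_difference_quotients:
  fixes \<Phi> :: "complex \<Rightarrow> complex"
  defines "Q \<equiv> \<lambda>a \<zeta>. (\<Phi> (a + \<zeta>) - \<Phi> a) / \<zeta>"
  assumes Q: "\<And>\<zeta> \<zeta>'. \<zeta> \<noteq> 0 \<Longrightarrow> \<zeta>' \<noteq> 0 \<Longrightarrow> cmod \<zeta> \<le> 1 / 2 \<Longrightarrow> cmod \<zeta>' \<le> 1 / 2 \<Longrightarrow>
      cmod (Q a \<zeta> - Q a \<zeta>') \<le> A * (cmod \<zeta> + cmod \<zeta>')"
  shows "\<Phi> field_differentiable at a"
proof -
  define e where "e n = complex_of_real (1 / (real n + 2))" for n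
  have ne: "cmod (e n) = 1 / (real n + 2)" for n unfolding e_def by (simp only: norm_of_real) simp
  have "0 < cmod (e n)" "cmod (e n) \<le> 1 / 2" for n
    unfolding ne by (simp_all add: field_simps)
  then have e: "e n \<noteq> 0" "cmod (e n) \<le> 1 / 2" for n by auto
  have e0: "(\<lambda>n. cmod (e n)) \<longlonglongrightarrow> 0"
  proof -
    have "(\<lambda>n. 1 / real (n + 2)) \<longlonglongrightarrow> 0" by (rule LIMSEQ_ignore_initial_segment[OF lim_1_over_n])
    then show ?thesis unfolding ne by (simp add: add.commute)
  qed
  have A: "0 \<le> A"
  proof -
    have "0 \<le> A * (cmod (e 0) + cmod (e 0))" using order_trans[OF norm_ge_zero Q[OF e(1) e(1) e(2) e(2)]] .
    moreover have "0 < cmod (e 0) + cmod (e 0)" by (simp add: ne)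
    ultimately show ?thesis by (simp add: zero_le_mult_iff)
  qed
  have "Cauchy (\<lambda>n. Q a (e n))"
  proof (rule metric_CauchyI)
    fix \<epsilon> :: real assume \<epsilon>: "0 < \<epsilon>"
    have "(\<lambda>n. A * (cmod (e n) + cmod (e n))) \<longlonglongrightarrow> A * (0 + 0)" by (intro tendsto_intros e0)
    then have "eventually (\<lambda>n. A * (cmod (e n) + cmod (e n)) < \<epsilon>) sequentially"
      using \<epsilon> by (intro order_tendstoD(2)[of _ "A * (0 + 0)"]) auto
    then obtain N where N: "A * (cmod (e N) + cmod (e N)) < \<epsilon>" by (auto simp: eventually_sequentially)
    have mono: "cmod (e n) \<le> cmod (e N)" if "N \<le> n" for n
      using that by (simp add: ne field_simps)
    show "\<exists>M. \<forall>m\<ge>M. \<forall>n\<ge>M. dist (Q a (e m)) (Q a (e n)) < \<epsilon>"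
    proof (intro exI allI impI)
      fix m n assume mn: "N \<le> m" "N \<le> n"
      have "dist (Q a (e m)) (Q a (e n)) \<le> A * (cmod (e m) + cmod (e n))"
        unfolding dist_norm by (rule Q) (rule e)+
      also have "\<dots> \<le> A * (cmod (e N) + cmod (e N))" using A mn by (intro mult_left_mono add_mono mono)
      finally show "dist (Q a (e m)) (Q a (e n)) < \<epsilon>" using N by simp
    qed
  qed
  then obtain L where L: "(\<lambda>n. Q a (e n)) \<longlonglongrightarrow> L" using Cauchy_convergent_iff convergent_def by blast
  have QL: "cmod (Q a \<zeta> - L) \<le> A * cmod \<zeta>" if \<zeta>: "\<zeta> \<noteq> 0" "cmod \<zeta> \<le> 1 / 2" for \<zeta>
  proof (rule LIMSEQ_le)
    show "(\<lambda>n. cmod (Q a \<zeta> - Q a (e n))) \<longlonglongrightarrow> cmod (Q a \<zeta> - L)" by (intro tendsto_intros L)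
    have "(\<lambda>n. A * (cmod \<zeta> + cmod (e n))) \<longlonglongrightarrow> A * (cmod \<zeta> + 0)" by (intro tendsto_intros e0)
    then show "(\<lambda>n. A * (cmod \<zeta> + cmod (e n))) \<longlonglongrightarrow> A * cmod \<zeta>" by simp
    show "\<exists>N. \<forall>n\<ge>N. cmod (Q a \<zeta> - Q a (e n)) \<le> A * (cmod \<zeta> + cmod (e n))"
      using Q[OF \<zeta>(1) e(1) \<zeta>(2) e(2)] by blast
  qed
  have "(\<lambda>\<zeta>. Q a \<zeta> - L) \<midarrow>0\<rightarrow> 0"
  proof (rule Lim_null_comparison)
    have "eventually (\<lambda>\<zeta>. \<zeta> \<noteq> 0 \<and> cmod \<zeta> \<le> 1 / 2) (at (0::complex))"
      unfolding eventually_at by (intro exI[of _ "1 / 2"]) auto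
    then show "eventually (\<lambda>\<zeta>. norm (Q a \<zeta> - L) \<le> A * cmod \<zeta>) (at 0)"
      by eventually_elim (use QL in auto)
    have "((\<lambda>\<zeta>. A * cmod \<zeta>) \<longlongrightarrow> A * cmod 0) (at 0)" by (intro tendsto_intros)
    then show "((\<lambda>\<zeta>. A * cmod \<zeta>) \<longlongrightarrow> 0) (at 0)" by simp
  qed
  then have "Q a \<midarrow>0\<rightarrow> L" by (rule LIM_zero_cancel)
  then have "(\<Phi> has_field_derivative L) (at a)" by (simp add: DERIV_def Q_def)
  then show ?thesis by (auto simp: field_differentiable_def)
qed

definition linear_on :: "(real^'d::finite \<Rightarrow> complex) set \<Rightarrow> ((real^'d \<Rightarrow> complex) \<Rightarrow> complex) \<Rightarrow> bool" where
  "linear_on X u \<longleftrightarrow> (\<forall>f\<in>X. \<forall>g\<in>X. \<forall>a b. u (\<lambda>x. a * f x + b * g x) = a * u f + b * u g)"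

text \<open>The situation common to the two kinds of dual spaces: a functional bounded at one level on a linear space of
  test functions that contains the family \<open>coh\<close>. The space may be incomplete at this level, so limits of
  test functions are expressed by uniform bounds on the functionals \<open>gs_fun\<close>.\<close>

locale gs_functional =
  fixes s t h K :: real and D :: "(real^'d::finite \<Rightarrow> complex) set" and u :: "(real^'d \<Rightarrow> complex) \<Rightarrow> complex"
  assumes st: "0 < s" "0 < t" "0 < h" and K: "0 \<le> K"
    and D_smooth: "\<And>f. f \<in> D \<Longrightarrow> smooth_fun f"
    and D_lin: "\<And>f g a b. f \<in> D \<Longrightarrow> g \<in> D \<Longrightarrow> (\<lambda>x. a * f x + b * g x) \<in> D"
    and coh_D: "\<And>w. coh w \<in> D"
    and u_lin: "\<And>f g a b. f \<in> D \<Longrightarrow> g \<in> D \<Longrightarrow> u (\<lambda>x. a * f x + b * g x) = a * u f + b * u g"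
    and u_bound: "\<And>f B. f \<in> D \<Longrightarrow> (\<And>\<mu>. cmod (gs_fun s t h \<mu> f) \<le> B) \<Longrightarrow> cmod (u f) \<le> K * B"
    and coh_bd: "\<And>\<rho>. \<exists>M>0. \<forall>(w :: complex^'d) \<mu>. norm w \<le> \<rho> \<longrightarrow> cmod (gs_fun s t h \<mu> (coh w)) \<le> M"
begin

lemma line_bound:
  obtains M where "0 < M" "\<And>(w :: complex^'d) \<eta> \<zeta> \<mu>. norm w \<le> \<rho> \<Longrightarrow> norm \<eta> \<le> 1 \<Longrightarrow> cmod \<zeta> \<le> 1 \<Longrightarrow>
      cmod (gs_fun s t h \<mu> (coh (w + \<zeta> *s \<eta>))) \<le> M"
proof -
  obtain M where M: "0 < M" "\<And>(w :: complex^'d) \<mu>. norm w \<le> \<rho> + 1 \<Longrightarrow> cmod (gs_fun s t h \<mu> (coh w)) \<le> M"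
    using coh_bd[of "\<rho> + 1"] by blast
  show ?thesis
  proof (rule that[OF M(1)])
    fix w \<eta> :: "complex^'d" and \<zeta> \<mu> assume *: "norm w \<le> \<rho>" "norm \<eta> \<le> 1" "cmod \<zeta> \<le> 1"
    have "norm (w + \<zeta> *s \<eta>) \<le> norm w + cmod \<zeta> * norm \<eta>"
      using norm_triangle_ineq[of w "\<zeta> *s \<eta>"] by (simp add: norm_vec_smult)
    also have "\<dots> \<le> \<rho> + 1" using * mult_le_one[of "cmod \<zeta>" "norm \<eta>"] by simp
    finally show "cmod (gs_fun s t h \<mu> (coh (w + \<zeta> *s \<eta>))) \<le> M" by (rule M(2))
  qed
qed

text \<open>The holomorphic functions \<open>\<lambda>\<tau>. gs_fun s t h \<mu> (coh (w + \<tau> *s \<eta>))\<close> are bounded uniformly in \<open>\<mu>\<close>,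
  hence so are their increments. Far apart points are covered by the bound itself.\<close>

lemma coh_lipschitz:
  obtains L where "0 < L" "\<And>(w :: complex^'d) w' \<mu>. norm w \<le> \<rho> \<Longrightarrow> norm w' \<le> \<rho> \<Longrightarrow>
      cmod (gs_fun s t h \<mu> (coh w') - gs_fun s t h \<mu> (coh w)) \<le> L * norm (w' - w)"
proof -
  obtain M where M: "0 < M" "\<And>(w :: complex^'d) \<eta> \<zeta> \<mu>. norm w \<le> \<rho> \<Longrightarrow> norm \<eta> \<le> 1 \<Longrightarrow> cmod \<zeta> \<le> 1 \<Longrightarrow>
      cmod (gs_fun s t h \<mu> (coh (w + \<zeta> *s \<eta>))) \<le> M"
    by (rule line_bound[of \<rho>]) blast
  show ?thesis
  proof (rule that[of "4 * M"])
    show "0 < 4 * M" using M by simp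
    fix w w' :: "complex^'d" and \<mu> assume w: "norm w \<le> \<rho>" "norm w' \<le> \<rho>"
    define \<delta> where "\<delta> = norm (w' - w)"
    have \<delta>0: "0 \<le> \<delta>" by (simp add: \<delta>_def)
    consider "\<delta> = 0" | "0 < \<delta>" "\<delta> \<le> 1 / 2" | "1 / 2 < \<delta>" using \<delta>0 by linarith
    then have "cmod (gs_fun s t h \<mu> (coh w') - gs_fun s t h \<mu> (coh w)) \<le> 4 * M * \<delta>"
    proof cases
      case 1
      then show ?thesis by (simp add: \<delta>_def)
    next
      case 2
      define \<eta> where "\<eta> = complex_of_real (1 / \<delta>) *s (w' - w)"
      have \<eta>: "norm \<eta> \<le> 1" using 2 unfolding \<eta>_def norm_vec_smult \<delta>_def[symmetric] by (simp add: norm_divide)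
      have w': "w' = w + complex_of_real \<delta> *s \<eta>"
        using 2 by (simp add: \<eta>_def vector_smult_assoc vec_eq_iff)
      have "cmod (gs_fun s t h \<mu> (coh (w + (0 + complex_of_real \<delta>) *s \<eta>)) - gs_fun s t h \<mu> (coh (w + 0 *s \<eta>))) \<le> 2 * M * cmod (complex_of_real \<delta>)"
        by (rule holomorphic_increment_bounds(1)[OF gs_fun_coh_holomorphic[OF st(3)]])
           (use M(2)[OF w(1) \<eta>] 2 in auto)
      then have "cmod (gs_fun s t h \<mu> (coh w') - gs_fun s t h \<mu> (coh w)) \<le> 2 * M * \<delta>"
        using 2 by (simp add: w'[symmetric])
      also have "\<dots> \<le> 4 * M * \<delta>" using M 2 by simp
      finally show ?thesis .
    next
      case 3
      have "cmod (gs_fun s t h \<mu> (coh w') - gs_fun s t h \<mu> (coh w)) \<le> M + M"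
        using M(2)[OF w(1), of 0 0 \<mu>] M(2)[OF w(2), of 0 0 \<mu>]
        by (intro order_trans[OF norm_triangle_ineq4] add_mono) auto
      also have "\<dots> \<le> 4 * M * \<delta>" using M 3 by simp
      finally show ?thesis .
    qed
    then show "cmod (gs_fun s t h \<mu> (coh w') - gs_fun s t h \<mu> (coh w)) \<le> 4 * M * norm (w' - w)"
      by (simp add: \<delta>_def)
  qed
qed

lemma D_diff: "f \<in> D \<Longrightarrow> g \<in> D \<Longrightarrow> (\<lambda>x. f x - g x) \<in> D"
  using D_lin[of f g 1 "-1"] by simp

lemma D_cmult: "f \<in> D \<Longrightarrow> (\<lambda>x. c * f x) \<in> D"
  using D_lin[of f f c 0] by simp

lemma u_diff: "f \<in> D \<Longrightarrow> g \<in> D \<Longrightarrow> u (\<lambda>x. f x - g x) = u f - u g"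
  using u_lin[of f g 1 "-1"] by simp

lemma u_cmult: "f \<in> D \<Longrightarrow> u (\<lambda>x. c * f x) = c * u f"
  using u_lin[of f f c 0] by simp

lemma u_coh_lipschitz:
  obtains L where "0 \<le> L" "\<And>(w :: complex^'d) w'. norm w \<le> \<rho> \<Longrightarrow> norm w' \<le> \<rho> \<Longrightarrow>
      cmod (u (coh w') - u (coh w)) \<le> L * norm (w' - w)"
proof -
  obtain L where L: "0 < L" "\<And>(w :: complex^'d) w' \<mu>. norm w \<le> \<rho> \<Longrightarrow> norm w' \<le> \<rho> \<Longrightarrow>
      cmod (gs_fun s t h \<mu> (coh w') - gs_fun s t h \<mu> (coh w)) \<le> L * norm (w' - w)"
    by (rule coh_lipschitz[of \<rho>]) blast
  show ?thesis
  proof (rule that[of "K * L"])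
    show "0 \<le> K * L" using K L by simp
    fix w w' :: "complex^'d" assume w: "norm w \<le> \<rho>" "norm w' \<le> \<rho>"
    have "cmod (u (\<lambda>x. coh w' x - coh w x)) \<le> K * (L * norm (w' - w))"
      by (intro u_bound D_diff coh_D) (simp add: gs_fun_diff smooth_fun_coh L(2)[OF w])
    then show "cmod (u (coh w') - u (coh w)) \<le> K * L * norm (w' - w)"
      by (simp add: u_diff coh_D mult.assoc)
  qed
qed

lemma continuous_u_coh: "continuous_on UNIV (\<lambda>w. u (coh w))"
  unfolding continuous_on_sequentially
proof (intro allI ballI impI)
  fix X :: "nat \<Rightarrow> complex^'d" and a assume X: "(\<forall>n. X n \<in> UNIV) \<and> X \<longlonglongrightarrow> a"
  then have "Bseq X" by (intro convergent_imp_Bseq convergentI) auto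
  then obtain \<rho>0 where "\<forall>n. norm (X n) \<le> \<rho>0" unfolding Bseq_def by blast
  then have \<rho>: "norm (X n) \<le> max \<rho>0 (norm a)" "norm a \<le> max \<rho>0 (norm a)" for n by (auto simp: le_max_iff_disj)
  obtain L where L: "0 \<le> L" "\<And>(w :: complex^'d) w'. norm w \<le> max \<rho>0 (norm a) \<Longrightarrow> norm w' \<le> max \<rho>0 (norm a) \<Longrightarrow>
      cmod (u (coh w') - u (coh w)) \<le> L * norm (w' - w)"
    by (rule u_coh_lipschitz[of "max \<rho>0 (norm a)"]) blast
  have "(\<lambda>n. L * norm (X n - a)) \<longlonglongrightarrow> L * norm (a - a)" using X by (intro tendsto_intros) auto
  then have "(\<lambda>n. L * norm (X n - a)) \<longlonglongrightarrow> 0" by simp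
  then have "(\<lambda>n. u (coh (X n)) - u (coh a)) \<longlonglongrightarrow> 0"
    by (rule Lim_null_comparison[rotated]) (auto intro!: always_eventually L(2) \<rho>)
  then show "((\<lambda>w. u (coh w)) \<circ> X) \<longlonglongrightarrow> u (coh a)" unfolding comp_def by (simp add: LIM_zero_iff)
qed

text \<open>The difference quotients of the family \<open>coh\<close> lie in \<open>D\<close>, which the derivative need not do, and form a Cauchy
  family uniformly in \<open>\<mu>\<close>. The functional carries this over to the difference quotients of its values.\<close>

lemma holomorphic_u_coh:
  assumes \<eta>: "norm \<eta> \<le> 1"
  shows "(\<lambda>\<tau>. u (coh (w + \<tau> *s \<eta>))) holomorphic_on A"
proof -
  have "(\<lambda>\<tau>. u (coh (w + \<tau> *s \<eta>))) field_differentiable at a" for a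
  proof -
    \<comment> \<open>Recentring at a reduces to difference quotients at 0.\<close>
    define v where "v = w + a *s \<eta>"
    obtain M where M: "0 < M" "\<And>(w' :: complex^'d) \<eta> \<zeta> \<mu>. norm w' \<le> norm v \<Longrightarrow> norm \<eta> \<le> 1 \<Longrightarrow> cmod \<zeta> \<le> 1 \<Longrightarrow>
        cmod (gs_fun s t h \<mu> (coh (w' + \<zeta> *s \<eta>))) \<le> M"
      by (rule line_bound[of "norm v"]) blast
    define q where "q \<zeta> x = (1 / \<zeta>) * coh (v + \<zeta> *s \<eta>) x + (- 1 / \<zeta>) * coh v x" for \<zeta> x
    have qD: "q \<zeta> \<in> D" for \<zeta> unfolding q_def[abs_def] by (intro D_lin coh_D)
    have uq: "u (q \<zeta>) = (u (coh (v + \<zeta> *s \<eta>)) - u (coh v)) / \<zeta>" for \<zeta>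
      unfolding q_def[abs_def] by (subst u_lin) (auto simp: coh_D diff_divide_distrib)
    have gq: "gs_fun s t h \<mu> (q \<zeta>) = (gs_fun s t h \<mu> (coh (v + \<zeta> *s \<eta>)) - gs_fun s t h \<mu> (coh v)) / \<zeta>" for \<mu> \<zeta>
      unfolding q_def[abs_def] by (subst gs_fun_lin) (auto simp: smooth_fun_coh diff_divide_distrib)
    have near: "cmod (gs_fun s t h \<mu> (q \<zeta>) - deriv (\<lambda>\<tau>. gs_fun s t h \<mu> (coh (v + \<tau> *s \<eta>))) 0) \<le> 8 * M * cmod \<zeta>"
      if \<zeta>: "\<zeta> \<noteq> 0" "cmod \<zeta> \<le> 1 / 2" for \<mu> \<zeta>
    proof -
      let ?p = "\<lambda>\<tau>. gs_fun s t h \<mu> (coh (v + \<tau> *s \<eta>))"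
      have "cmod (?p (0 + \<zeta>) - ?p 0 - deriv ?p 0 * \<zeta>) \<le> 8 * M * (cmod \<zeta>)\<^sup>2"
        by (rule holomorphic_increment_bounds(2)[OF gs_fun_coh_holomorphic[OF st(3)] _ \<zeta>(2)]) (use M(2) \<eta> in auto)
      moreover have "?p (0 + \<zeta>) - ?p 0 - deriv ?p 0 * \<zeta> = (gs_fun s t h \<mu> (q \<zeta>) - deriv ?p 0) * \<zeta>"
        using \<zeta> unfolding gq by (simp add: field_simps)
      ultimately have "cmod (gs_fun s t h \<mu> (q \<zeta>) - deriv ?p 0) * cmod \<zeta> \<le> 8 * M * cmod \<zeta> * cmod \<zeta>"
        by (simp only: norm_mult power2_eq_square mult.assoc)
      then show ?thesis using \<zeta> by simp
    qed
    have "(\<lambda>\<tau>. u (coh (w + \<tau> *s \<eta>))) field_differentiable at a"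
    proof (rule field_differentiable_of_difference_quotients[of _ _ "K * (8 * M)"])
      fix \<zeta> \<zeta>' :: complex assume \<zeta>: "\<zeta> \<noteq> 0" "\<zeta>' \<noteq> 0" "cmod \<zeta> \<le> 1 / 2" "cmod \<zeta>' \<le> 1 / 2"
      have va: "w + (a + \<zeta>) *s \<eta> = v + \<zeta> *s \<eta>" for \<zeta> by (simp add: v_def vector_sadd_rdistrib add.assoc)
      have "cmod (u (\<lambda>x. q \<zeta> x - q \<zeta>' x)) \<le> K * (8 * M * cmod \<zeta> + 8 * M * cmod \<zeta>')"
      proof (intro u_bound D_diff qD)
        fix \<mu>
        let ?d = "deriv (\<lambda>\<tau>. gs_fun s t h \<mu> (coh (v + \<tau> *s \<eta>))) 0"
        have "cmod (gs_fun s t h \<mu> (\<lambda>x. q \<zeta> x - q \<zeta>' x)) = cmod ((gs_fun s t h \<mu> (q \<zeta>) - ?d) - (gs_fun s t h \<mu> (q \<zeta>') - ?d))"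
          by (simp add: gs_fun_diff D_smooth qD)
        also have "\<dots> \<le> 8 * M * cmod \<zeta> + 8 * M * cmod \<zeta>'"
          by (intro order_trans[OF norm_triangle_ineq4] add_mono near \<zeta>)
        finally show "cmod (gs_fun s t h \<mu> (\<lambda>x. q \<zeta> x - q \<zeta>' x)) \<le> 8 * M * cmod \<zeta> + 8 * M * cmod \<zeta>'" .
      qed
      then show "cmod ((u (coh (w + (a + \<zeta>) *s \<eta>)) - u (coh (w + a *s \<eta>))) / \<zeta> - (u (coh (w + (a + \<zeta>') *s \<eta>)) - u (coh (w + a *s \<eta>))) / \<zeta>')
        \<le> K * (8 * M) * (cmod \<zeta> + cmod \<zeta>')"
        unfolding va v_def[symmetric] uq[symmetric] u_diff[OF qD qD, symmetric] by (simp add: algebra_simps)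
    qed
    then show ?thesis .
  qed
  then show ?thesis unfolding holomorphic_on_def by (blast intro: field_differentiable_at_within)
qed

definition atom_const :: "(real^'d) \<times> (real^'d) \<Rightarrow> complex" where
  "atom_const z = of_real (pi powr (- real CARD('d) / 4) * exp (- (norm (fst z))\<^sup>2 / 2))"

lemma atom_D: "atom z \<in> D"
  unfolding atom_eq_coh by (intro D_cmult coh_D)

lemma u_atom: "u (atom z) = atom_const z * u (coh (cvec z))"
  unfolding atom_eq_coh atom_const_def by (rule u_cmult[OF coh_D])

lemma gs_fun_atom: "gs_fun s t h \<mu> (atom z) = atom_const z * gs_fun s t h \<mu> (coh (cvec z))"
  unfolding atom_eq_coh atom_const_def by (rule gs_fun_cmult[OF smooth_fun_coh])

lemma continuous_cvec: "continuous_on A (cvec :: (real^'d) \<times> (real^'d) \<Rightarrow> _)"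
  unfolding continuous_on_iff by (metis dist_cvec)

lemma continuous_atom_const: "continuous_on A atom_const"
  unfolding atom_const_def[abs_def] by (intro continuous_intros) auto

lemma continuous_u_atom: "continuous_on UNIV (\<lambda>z. u (atom z))"
  unfolding u_atom
  by (intro continuous_intros continuous_atom_const continuous_on_compose2[OF continuous_u_coh continuous_cvec]) auto

lemma linear_on_u: "linear_on D u"
  by (simp add: linear_on_def u_lin)

lemma linear_on_gs_fun: "linear_on D (gs_fun s t h \<mu>)"
  by (simp add: linear_on_def gs_fun_lin D_smooth)

lemma riemann_sum_functional:
  assumes L: "linear_on D L" and A: "finite A"
  shows "(\<lambda>x. \<Sum>a\<in>A. c a * coh (v a) x) \<in> D \<and> L (\<lambda>x. \<Sum>a\<in>A. c a * coh (v a) x) = (\<Sum>a\<in>A. c a * (L (coh (v a)) :: complex))"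
  using A
proof (induction A)
  case empty
  note lin = L[unfolded linear_on_def, rule_format]
  have "(\<lambda>x. 0 * coh 0 x + 0 * coh 0 x) \<in> D" by (intro D_lin coh_D)
  moreover have "L (\<lambda>x. 0 * coh 0 x + 0 * coh 0 x) = 0 * L (coh 0) + 0 * L (coh 0)" by (intro lin coh_D)
  ultimately show ?case by simp
next
  case (insert a A)
  note lin = L[unfolded linear_on_def, rule_format]
  let ?S = "\<lambda>x. \<Sum>a\<in>A. c a * coh (v a) x"
  have S: "?S \<in> D" "L ?S = (\<Sum>a\<in>A. c a * L (coh (v a)))" using insert.IH by auto
  have "(\<lambda>x. c a * coh (v a) x + 1 * ?S x) \<in> D" by (intro D_lin coh_D S)
  moreover have "L (\<lambda>x. c a * coh (v a) x + 1 * ?S x) = c a * L (coh (v a)) + 1 * L ?S" by (intro lin coh_D S)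
  ultimately show ?case using insert.hyps S(2) by simp
qed

text \<open>The combination \<open>S\<close> is a Riemann sum of the integral over the ball \<open>Q\<close>, with sample points \<open>F z\<close>. Its
  error consists of the displacement \<open>F z - z\<close>, weighted with a Lipschitz constant, and of the tail outside \<open>Q\<close>. The
  statement concerns an arbitrary linear \<open>L\<close> because it is applied both to \<open>u\<close> and to every \<open>gs_fun\<close>.\<close>

lemma riemann_error:
  fixes \<kappa> :: "(real^'d) \<times> (real^'d) \<Rightarrow> complex" and F :: "(real^'d) \<times> (real^'d) \<Rightarrow> (real^'d) \<times> (real^'d)"
  assumes lin: "linear_on D L"
    and lip: "\<And>(w :: complex^'d) w'. norm w \<le> 2 * R \<Longrightarrow> norm w' \<le> 2 * R \<Longrightarrow> cmod (L (coh w') - L (coh w)) \<le> \<Lambda> * norm (w' - w)" and \<Lambda>: "0 \<le> \<Lambda>"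
    and F: "simple_function lborel F" "\<And>z. norm (F z) \<le> 2 * norm z"
    and \<kappa>: "integrable lborel \<kappa>" and W: "integrable lborel W" "\<And>z. cmod (\<kappa> z * L (coh (cvec z))) \<le> W z"
    and Lm: "(\<lambda>z. L (coh (cvec z))) \<in> borel_measurable borel"
  defines "Q \<equiv> cball 0 R"
  defines "S \<equiv> \<lambda>x. \<Sum>a\<in>range F. (LINT z|lborel. indicator (F -` {a} \<inter> Q) z * \<kappa> z) * coh (cvec a) x"
  shows "S \<in> D" and "cmod (L S - (LINT z|lborel. \<kappa> z * L (coh (cvec z)))) \<le>
    \<Lambda> * (LINT z|lborel. indicator Q z * (cmod (\<kappa> z) * norm (F z - z))) + (LINT z|lborel. indicator (- Q) z * W z)"
proof -
  have fin: "finite (range F)" using F(1) by (auto dest: simple_functionD(1))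
  have S: "S \<in> D" "L S = (\<Sum>a\<in>range F. (LINT z|lborel. indicator (F -` {a} \<inter> Q) z * \<kappa> z) * L (coh (cvec a)))"
    using riemann_sum_functional[OF lin fin, of "\<lambda>a. LINT z|lborel. indicator (F -` {a} \<inter> Q) z * \<kappa> z" cvec]
    unfolding S_def[symmetric] by simp_all
  show "S \<in> D" by (rule S)
  have [measurable]: "\<kappa> \<in> borel_measurable borel" using borel_measurable_integrable[OF \<kappa>] by simp
  have Fm [measurable]: "F \<in> borel \<rightarrow>\<^sub>M borel" using borel_measurable_simple_function[OF F(1)] by simp
  have [measurable]: "Q \<in> sets borel" by (simp add: Q_def)
  have [measurable]: "F -` {a} \<inter> Q \<in> sets borel" for a
    using measurable_sets[OF Fm, of "{a}"] by auto
  note [measurable] = Lm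
  have LF [measurable]: "(\<lambda>z. L (coh (cvec (F z)))) \<in> borel_measurable borel"
    using measurable_compose[OF Fm Lm] .
  have i1: "integrable lborel (\<lambda>z. indicator (F -` {a} \<inter> Q) z * \<kappa> z)" for a
    by (rule Bochner_Integration.integrable_bound[OF \<kappa>]) (auto simp: indicator_def norm_mult intro!: AE_I2)
  have i2: "integrable lborel (\<lambda>z. \<kappa> z * L (coh (cvec z)))"
    by (rule Bochner_Integration.integrable_bound[OF W(1)]) (auto intro!: AE_I2 order_trans[OF W(2) abs_ge_self])
  have i3: "integrable lborel (\<lambda>z. indicator Q z * (cmod (\<kappa> z) * norm (F z - z)))"
  proof (rule Bochner_Integration.integrable_bound)
    show "integrable lborel (\<lambda>z. 3 * \<bar>R\<bar> * cmod (\<kappa> z))" using \<kappa> by (intro integrable_mult_right) simp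
    show "AE z in lborel. norm (indicator Q z * (cmod (\<kappa> z) * norm (F z - z))) \<le> norm (3 * \<bar>R\<bar> * cmod (\<kappa> z))"
    proof (rule AE_I2)
      fix z :: "(real^'d) \<times> (real^'d)"
      show "norm (indicator Q z * (cmod (\<kappa> z) * norm (F z - z))) \<le> norm (3 * \<bar>R\<bar> * cmod (\<kappa> z))"
      proof (cases "z \<in> Q")
        case True
        then have "norm z \<le> R" by (simp add: Q_def)
        then have "norm (F z - z) \<le> 3 * \<bar>R\<bar>"
          using norm_triangle_ineq4[of "F z" z] F(2)[of z] by simp
        then show ?thesis using True by (simp add: abs_mult mult.commute mult_left_mono)
      qed simp
    qed
  qed measurable
  have LS: "L S = (LINT z|lborel. indicator Q z * (\<kappa> z * L (coh (cvec (F z)))))"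
  proof -
    have pick: "(\<Sum>a\<in>range F. (indicator (F -` {a} \<inter> Q) z * \<kappa> z) * L (coh (cvec a))) = indicator Q z * (\<kappa> z * L (coh (cvec (F z))))" for z
    proof -
      have "(\<Sum>a\<in>range F. (indicator (F -` {a} \<inter> Q) z * \<kappa> z) * L (coh (cvec a))) =
          (\<Sum>a\<in>range F. if a = F z then indicator Q z * (\<kappa> z * L (coh (cvec a))) else 0)"
        by (intro sum.cong) (auto simp: indicator_def)
      then show ?thesis using fin by simp
    qed
    have "L S = (\<Sum>a\<in>range F. LINT z|lborel. (indicator (F -` {a} \<inter> Q) z * \<kappa> z) * L (coh (cvec a)))"
      unfolding S(2) by (simp only: integral_mult_left_zero)
    also have "\<dots> = (LINT z|lborel. (\<Sum>a\<in>range F. (indicator (F -` {a} \<inter> Q) z * \<kappa> z) * L (coh (cvec a))))"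
      by (intro Bochner_Integration.integral_sum[symmetric] integrable_mult_left i1)
    finally show ?thesis unfolding pick .
  qed
  have pw: "cmod (indicator Q z * (\<kappa> z * L (coh (cvec (F z)))) - \<kappa> z * L (coh (cvec z))) \<le>
      \<Lambda> * (indicator Q z * (cmod (\<kappa> z) * norm (F z - z))) + indicator (- Q) z * W z" for z
  proof (cases "z \<in> Q")
    case True
    then have z: "norm z \<le> R" "0 \<le> R" by (auto simp: Q_def intro: order_trans[OF norm_ge_zero])
    have "cmod (L (coh (cvec (F z))) - L (coh (cvec z))) \<le> \<Lambda> * norm (cvec (F z) - cvec z)"
      using z F(2)[of z] by (intro lip) (auto simp: norm_cvec)
    then have "cmod (\<kappa> z * (L (coh (cvec (F z))) - L (coh (cvec z)))) \<le> cmod (\<kappa> z) * (\<Lambda> * norm (F z - z))"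
      unfolding norm_mult cvec_diff norm_cvec by (intro mult_left_mono) auto
    then show ?thesis using True by (simp add: right_diff_distrib mult_ac)
  next
    case False
    then show ?thesis using W(2)[of z] by simp
  qed
  have i4: "integrable lborel (\<lambda>z. indicator (- Q) z * W z)"
    by (rule Bochner_Integration.integrable_bound[OF W(1)])
       (use borel_measurable_integrable[OF W(1)] in \<open>auto simp: indicator_def intro!: AE_I2\<close>)
  have i5: "integrable lborel (\<lambda>z. indicator Q z * (\<kappa> z * L (coh (cvec (F z)))))"
  proof -
    have "integrable lborel (\<lambda>z. (indicator Q z * (\<kappa> z * L (coh (cvec (F z)))) - \<kappa> z * L (coh (cvec z))) + \<kappa> z * L (coh (cvec z)))"
    proof (rule Bochner_Integration.integrable_add[OF _ i2])
      show "integrable lborel (\<lambda>z. indicator Q z * (\<kappa> z * L (coh (cvec (F z)))) - \<kappa> z * L (coh (cvec z)))"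
      proof (rule Bochner_Integration.integrable_bound)
        show "integrable lborel (\<lambda>z. \<Lambda> * (indicator Q z * (cmod (\<kappa> z) * norm (F z - z))) + indicator (- Q) z * W z)"
          by (intro Bochner_Integration.integrable_add integrable_mult_right i3 i4)
        show "AE z in lborel. norm (indicator Q z * (\<kappa> z * L (coh (cvec (F z)))) - \<kappa> z * L (coh (cvec z)))
          \<le> norm (\<Lambda> * (indicator Q z * (cmod (\<kappa> z) * norm (F z - z))) + indicator (- Q) z * W z)"
          unfolding real_norm_def by (intro AE_I2 order_trans[OF pw abs_ge_self])
      qed measurable
    qed
    then show ?thesis by simp
  qed
  have "L S - (LINT z|lborel. \<kappa> z * L (coh (cvec z))) = (LINT z|lborel. indicator Q z * (\<kappa> z * L (coh (cvec (F z)))) - \<kappa> z * L (coh (cvec z)))"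
    unfolding LS by (rule Bochner_Integration.integral_diff[OF i5 i2, symmetric])
  also have "cmod \<dots> \<le> (LINT z|lborel. \<Lambda> * (indicator Q z * (cmod (\<kappa> z) * norm (F z - z))) + indicator (- Q) z * W z)"
    by (intro Bochner_Integration.integral_norm_bound_integral Bochner_Integration.integrable_diff Bochner_Integration.integrable_add integrable_mult_right i2 i3 i4 i5 pw)
  also have "\<dots> = \<Lambda> * (LINT z|lborel. indicator Q z * (cmod (\<kappa> z) * norm (F z - z))) + (LINT z|lborel. indicator (- Q) z * W z)"
    using i3 i4 by simp
  finally show "cmod (L S - (LINT z|lborel. \<kappa> z * L (coh (cvec z)))) \<le>
    \<Lambda> * (LINT z|lborel. indicator Q z * (cmod (\<kappa> z) * norm (F z - z))) + (LINT z|lborel. indicator (- Q) z * W z)" .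
qed

text \<open>The same Riemann sums approximate the superposition uniformly in all \<open>gs_fun\<close>, whence \<open>u\<close> of the sums
  approximates \<open>u\<close> of the superposition, and they approximate the integral of the values of \<open>u\<close>. The sample points are
  refined for a fixed radius first, which leaves the tails; then the radius tends to infinity.\<close>

lemma functional_of_synth:
  fixes H :: "(real^'d) \<times> (real^'d) \<Rightarrow> complex"
  assumes H: "H \<in> borel_measurable borel" "\<And>z. cmod (H z) \<le> A * exp_weight s t (- r1) z"
    and at: "\<And>(z :: (real^'d) \<times> (real^'d)) \<mu>. gs_quot s t h (atom z) \<mu> \<le> C * exp_weight s t r2 z" and r: "r2 < r1" "0 < r1"
    and D: "synth H \<in> D"
  shows "u (synth H) = of_real ((2 * pi) powr (- real CARD('d) / 2)) * (LINT z|lborel. H z * u (atom z))"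
proof -
  define c where "c = (2 * pi) powr (- real CARD('d) / 2)"
  have c: "0 < c" by (simp add: c_def)
  define \<kappa> where "\<kappa> z = of_real c * H z * atom_const z" for z
  define I where "I = (LINT z|lborel. \<kappa> z * u (coh (cvec z)))"
  have I: "I = of_real c * (LINT z|lborel. H z * u (atom z))"
    unfolding I_def \<kappa>_def u_atom mult.assoc integral_mult_right_zero ..
  have gI: "gs_fun s t h \<mu> (synth H) = (LINT z|lborel. \<kappa> z * gs_fun s t h \<mu> (coh (cvec z)))" for \<mu>
    unfolding synth_in_gs(3)[OF st H at r(1)] \<kappa>_def gs_fun_atom mult.assoc integral_mult_right_zero c_def ..
  have A: "0 \<le> A"
    using order_trans[OF norm_ge_zero H(2)[of 0]] exp_weight_pos[of s t "- r1" "0 :: (real^'d) \<times> (real^'d)"] by (simp add: zero_le_mult_iff)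
  have gb: "cmod (gs_fun s t h \<mu> (atom z)) \<le> C * exp_weight s t r2 z" for \<mu> and z :: "(real^'d) \<times> (real^'d)"
    using at[of z \<mu>] gs_quot_eq_norm_gs_fun[OF st(3)] by metis
  have rr: "0 < r1 - r2" using r by simp
  define W where "W z = c * (A * C) * exp_weight s t (- (r1 - r2)) z" for z :: "(real^'d) \<times> (real^'d)"
  have Wi: "integrable lborel W"
    unfolding W_def[abs_def] by (intro integrable_mult_right integrable_exp_weight st rr)
  have prodb: "c * (cmod (H z) * X) \<le> W z" if "0 \<le> X" "X \<le> C * exp_weight s t r2 z" for X z
  proof -
    have "cmod (H z) * X \<le> (A * exp_weight s t (- r1) z) * (C * exp_weight s t r2 z)"
      using that A H(2) by (intro mult_mono) (auto simp: less_imp_le[OF exp_weight_pos])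
    also have "\<dots> = A * C * exp_weight s t (- (r1 - r2)) z"
      using exp_weight_mult[of s t "- r1" z r2] by (simp add: mult_ac)
    finally show ?thesis using c by (simp add: W_def mult.assoc)
  qed
  have Wg: "cmod (\<kappa> z * gs_fun s t h \<mu> (coh (cvec z))) \<le> W z" for z \<mu>
  proof -
    have "cmod (\<kappa> z * gs_fun s t h \<mu> (coh (cvec z))) = c * (cmod (H z) * cmod (gs_fun s t h \<mu> (atom z)))"
      using c by (simp add: \<kappa>_def gs_fun_atom norm_mult mult.assoc)
    then show ?thesis using prodb[OF norm_ge_zero gb] by simp
  qed
  have Wu: "cmod (\<kappa> z * u (coh (cvec z))) \<le> K * W z" for z
  proof -
    have "(\<lambda>x. \<kappa> z * coh (cvec z) x) \<in> D" by (intro D_cmult coh_D)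
    then have "cmod (u (\<lambda>x. \<kappa> z * coh (cvec z) x)) \<le> K * W z"
      by (rule u_bound) (simp only: gs_fun_cmult[OF smooth_fun_coh] Wg)
    then show ?thesis by (simp add: u_cmult[OF coh_D])
  qed
  have acm [measurable]: "atom_const \<in> borel_measurable borel"
    by (intro borel_measurable_continuous_onI continuous_atom_const)
  note [measurable] = H(1)
  have ac1: "cmod (atom_const z) \<le> 1" for z
    using norm_atom_le_1[of z "fst z"] mult_le_one[OF pi_powr_le_1[of "CARD('d)"], of "exp (- (norm (fst z))\<^sup>2 / 2)"]
    by (simp add: atom_const_def norm_mult)
  have \<kappa>i: "integrable lborel \<kappa>"
  proof (rule integrable_of_weight_bound[OF st(1,2) r(2)])
    show "\<kappa> \<in> borel_measurable borel" unfolding \<kappa>_def[abs_def] by measurable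
    fix z
    have "cmod (H z) * cmod (atom_const z) \<le> cmod (H z)" by (intro mult_right_le_one_le ac1) auto
    also have "\<dots> \<le> A * exp_weight s t (- r1) z" by (rule H)
    finally show "norm (\<kappa> z) \<le> c * A * exp_weight s t (- r1) z"
      using c by (simp add: \<kappa>_def norm_mult mult.assoc)
  qed
  have um: "(\<lambda>z. u (coh (cvec z))) \<in> borel_measurable borel"
    by (intro borel_measurable_continuous_onI continuous_on_compose2[OF continuous_u_coh continuous_cvec]) auto
  have gm: "(\<lambda>z :: (real^'d) \<times> (real^'d). gs_fun s t h \<mu> (coh (cvec z))) \<in> borel_measurable borel" for \<mu>
  proof (intro borel_measurable_continuous_onI)
    have nz: "atom_const z \<noteq> 0" for z :: "(real^'d) \<times> (real^'d)" by (simp add: atom_const_def)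
    have "continuous_on UNIV (\<lambda>z. gs_fun s t h \<mu> (atom z) / atom_const z)"
      using nz by (intro continuous_intros continuous_gs_fun_atom continuous_atom_const) auto
    then show "continuous_on UNIV (\<lambda>z :: (real^'d) \<times> (real^'d). gs_fun s t h \<mu> (coh (cvec z)))"
      using nz by (simp add: gs_fun_atom)
  qed
  obtain F :: "nat \<Rightarrow> (real^'d) \<times> (real^'d) \<Rightarrow> (real^'d) \<times> (real^'d)" where
    F: "\<And>n. simple_function lborel (F n)" "\<And>z. (\<lambda>n. F n z) \<longlonglongrightarrow> z" "\<And>n z. dist (F n z) 0 \<le> 2 * dist z 0"
    using borel_measurable_implies_sequence_metric[of "\<lambda>z. z" "lborel :: ((real^'d) \<times> (real^'d)) measure" 0] by auto
  have Fn: "norm (F n z) \<le> 2 * norm z" for n z using F(3)[of n z] by simp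
  define T where "T R = (LINT z|lborel. indicator (- cball 0 R) z * W z)" for R :: real
  \<comment> \<open>One tail stems from the approximation of the superposition, the other from that of the integral.\<close>
  have key: "cmod (u (synth H) - I) \<le> 2 * K * T R" for R
  proof -
    obtain L where L: "0 < L" "\<And>(w :: complex^'d) w' \<mu>. norm w \<le> 2 * R \<Longrightarrow> norm w' \<le> 2 * R \<Longrightarrow>
        cmod (gs_fun s t h \<mu> (coh w') - gs_fun s t h \<mu> (coh w)) \<le> L * norm (w' - w)"
      by (rule coh_lipschitz[of "2 * R"]) blast
    obtain L' where L': "0 \<le> L'" "\<And>(w :: complex^'d) w'. norm w \<le> 2 * R \<Longrightarrow> norm w' \<le> 2 * R \<Longrightarrow>
        cmod (u (coh w') - u (coh w)) \<le> L' * norm (w' - w)"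
      by (rule u_coh_lipschitz[of "2 * R"]) blast
    define a where "a n = (LINT z|lborel. indicator (cball 0 R) z * (cmod (\<kappa> z) * norm (F n z - z)))" for n
    have a0: "a \<longlonglongrightarrow> 0"
    proof -
      have "a \<longlonglongrightarrow> (LINT z|(lborel :: ((real^'d) \<times> (real^'d)) measure). (0::real))"
        unfolding a_def[abs_def]
      proof (rule integral_dominated_convergence[where w = "\<lambda>z. 3 * \<bar>R\<bar> * cmod (\<kappa> z)"])
        show "integrable lborel (\<lambda>z. 3 * \<bar>R\<bar> * cmod (\<kappa> z))" using \<kappa>i by (intro integrable_mult_right) simp
        have [measurable]: "cball 0 R \<in> sets (borel :: ((real^'d) \<times> (real^'d)) measure)" by simp
        have [measurable]: "F n \<in> borel \<rightarrow>\<^sub>M borel" for n using borel_measurable_simple_function[OF F(1)] by simp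
        have [measurable]: "\<kappa> \<in> borel_measurable borel" using borel_measurable_integrable[OF \<kappa>i] by simp
        show "(\<lambda>z. indicator (cball 0 R) z * (cmod (\<kappa> z) * norm (F n z - z))) \<in> borel_measurable lborel" for n by measurable
        show "AE z in lborel. (\<lambda>n. indicator (cball 0 R) z * (cmod (\<kappa> z) * norm (F n z - z))) \<longlonglongrightarrow> (0::real)"
        proof (rule AE_I2)
          fix z
          have "(\<lambda>n. indicator (cball 0 R) z * (cmod (\<kappa> z) * norm (F n z - z))) \<longlonglongrightarrow> indicator (cball 0 R) z * (cmod (\<kappa> z) * norm (z - z))"
            by (intro tendsto_intros F)
          then show "(\<lambda>n. indicator (cball 0 R) z * (cmod (\<kappa> z) * norm (F n z - z))) \<longlonglongrightarrow> (0::real)" by simp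
        qed
        show "AE z in lborel. norm (indicator (cball 0 R) z * (cmod (\<kappa> z) * norm (F n z - z))) \<le> 3 * \<bar>R\<bar> * cmod (\<kappa> z)" for n
        proof (rule AE_I2)
          fix z :: "(real^'d) \<times> (real^'d)"
          show "norm (indicator (cball 0 R) z * (cmod (\<kappa> z) * norm (F n z - z))) \<le> 3 * \<bar>R\<bar> * cmod (\<kappa> z)"
          proof (cases "z \<in> cball 0 R")
            case True
            then have "norm (F n z - z) \<le> 3 * \<bar>R\<bar>"
              using norm_triangle_ineq4[of "F n z" z] Fn[of n z] by simp
            then show ?thesis using True by (simp add: abs_mult mult.commute mult_left_mono)
          qed simp
        qed
      qed simp
      then show ?thesis by simp
    qed
    have "cmod (u (synth H) - I) \<le> K * (L * a n + T R) + (L' * a n + K * T R)" for n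
    proof -
      define S where "S x = (\<Sum>b\<in>range (F n). (LINT z|lborel. indicator (F n -` {b} \<inter> cball 0 R) z * \<kappa> z) * coh (cvec b) x)" for x
      have SD: "S \<in> D"
        unfolding S_def[abs_def] by (rule riemann_error(1)[OF linear_on_u L'(2,1) F(1) Fn \<kappa>i _ Wu um]) (use Wi in auto)
      have uS: "cmod (u S - I) \<le> L' * a n + (LINT z|lborel. indicator (- cball 0 R) z * (K * W z))"
        unfolding S_def[abs_def] I_def a_def by (rule riemann_error(2)[OF linear_on_u L'(2,1) F(1) Fn \<kappa>i _ Wu um]) (use Wi in auto)
      have gS: "cmod (gs_fun s t h \<mu> S - gs_fun s t h \<mu> (synth H)) \<le> L * a n + T R" for \<mu>
        unfolding gI S_def[abs_def] a_def T_def
        by (rule riemann_error(2)[OF linear_on_gs_fun L(2) less_imp_le[OF L(1)] F(1) Fn \<kappa>i Wi Wg gm])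
      have "cmod (u (\<lambda>x. synth H x - S x)) \<le> K * (L * a n + T R)"
      proof (intro u_bound D_diff D SD)
        show "cmod (gs_fun s t h \<mu> (\<lambda>x. synth H x - S x)) \<le> L * a n + T R" for \<mu>
          using gS[of \<mu>] by (simp add: gs_fun_diff[OF D_smooth[OF D] D_smooth[OF SD]] norm_minus_commute)
      qed
      then have "cmod (u (synth H) - u S) \<le> K * (L * a n + T R)" by (simp add: u_diff[OF D SD])
      moreover have "(LINT z|lborel. indicator (- cball 0 R) z * (K * W z)) = K * T R"
        unfolding T_def integral_mult_right_zero[symmetric] by (intro Bochner_Integration.integral_cong) auto
      moreover have "cmod (u (synth H) - I) \<le> cmod (u (synth H) - u S) + cmod (u S - I)"
        using norm_triangle_ineq[of "u (synth H) - u S" "u S - I"] by simp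
      ultimately show ?thesis using uS by linarith
    qed
    moreover have "(\<lambda>n. K * (L * a n + T R) + (L' * a n + K * T R)) \<longlonglongrightarrow> K * (L * 0 + T R) + (L' * 0 + K * T R)"
      by (intro tendsto_intros a0)
    ultimately have "cmod (u (synth H) - I) \<le> K * (L * 0 + T R) + (L' * 0 + K * T R)"
      by (intro LIMSEQ_le_const) auto
    then show ?thesis by simp
  qed
  have T0: "(\<lambda>n. T (real n)) \<longlonglongrightarrow> 0"
  proof -
    have "(\<lambda>n. T (real n)) \<longlonglongrightarrow> (LINT z|(lborel :: ((real^'d) \<times> (real^'d)) measure). (0::real))"
      unfolding T_def
    proof (rule integral_dominated_convergence[OF _ _ Wi])
      have [measurable]: "W \<in> borel_measurable borel" using borel_measurable_integrable[OF Wi] by simp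
      show "(\<lambda>z. indicator (- cball 0 (real n)) z * W z) \<in> borel_measurable lborel" for n by measurable
      show "AE z in lborel. (\<lambda>n. indicator (- cball 0 (real n)) z * W z) \<longlonglongrightarrow> 0"
      proof (rule AE_I2)
        fix z :: "(real^'d) \<times> (real^'d)"
        obtain N where N: "norm z \<le> real N" using real_arch_simple by blast
        have "eventually (\<lambda>n. indicator (- cball 0 (real n)) z * W z = 0) sequentially"
          using eventually_ge_at_top[of N] by eventually_elim (use N in \<open>auto simp: indicator_def\<close>)
        then show "(\<lambda>n. indicator (- cball 0 (real n)) z * W z) \<longlonglongrightarrow> 0" by (rule tendsto_eventually)
      qed
      have "0 \<le> W z" for z using order_trans[OF norm_ge_zero Wg] .
      then show "AE z in lborel. norm (indicator (- cball 0 (real n)) z * W z) \<le> W z" for n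
        by (intro AE_I2) (auto simp: indicator_def)
    qed simp
    then show ?thesis by simp
  qed
  have "(\<lambda>n. 2 * K * T (real n)) \<longlonglongrightarrow> 2 * K * 0" by (intro tendsto_intros T0)
  then have "cmod (u (synth H) - I) \<le> 2 * K * 0" using key by (intro LIMSEQ_le_const) auto
  then have "u (synth H) = I" by simp
  then show ?thesis by (simp add: I c_def)
qed

end

section \<open>Pointwise bounds from mixed quasi-norms\<close>

context gs_functional
begin

lemma stft_u: "stft u z = of_real ((2 * pi) powr (- real CARD('d) / 2)) * atom_const z * u (coh (cvec z))"
  unfolding stft_eq_atom u_atom by (simp only: mult.assoc)

lemma continuous_stft_u: "continuous_on UNIV (stft u)"
  unfolding stft_eq_atom[abs_def] by (intro continuous_intros continuous_u_atom)

text \<open>The point \<open>w0\<close> maximises \<open>(R - dist w w1) ^ k * cmod (u (coh w))\<close> on the ball, and \<open>2 * \<rho>\<close> is its distance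
  from the boundary. Maximality bounds the entire function on the ball of radius \<open>\<rho>\<close> around \<open>w0\<close> by \<open>2 ^ k\<close> times its
  modulus at \<open>w0\<close>, so that by Cauchy's inequality it keeps half of this modulus on a ball of radius proportional to
  \<open>\<rho>\<close>. A lower bound on balls is all that it requires of a quasi-norm, irrespective of
  exponents and subspaces.\<close>

lemma near_maximum:
  fixes w1 :: "complex^'d"
  assumes R: "0 < R" "R \<le> 1" and k: "0 < k"
  obtains w0 \<rho> where "0 < \<rho>" "\<rho> \<le> 1" "dist w0 w1 \<le> R - 2 * \<rho>"
    "R ^ k * cmod (u (coh w1)) \<le> (2 * \<rho>) ^ k * cmod (u (coh w0))"
    "\<And>v. dist v w0 < \<rho> / 2 ^ (k + 2) \<Longrightarrow> cmod (u (coh w0)) / 2 \<le> cmod (u (coh v))"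
proof (cases "u (coh w1) = 0")
  case True
  show ?thesis by (rule that[of "R / 2" w1]) (use R True in auto)
next
  case False
  define \<Phi> where "\<Phi> w = u (coh w)" for w :: "complex^'d"
  define g where "g w = (R - dist w w1) ^ k * cmod (\<Phi> w)" for w
  have "continuous_on (cball w1 R) g"
    unfolding g_def[abs_def] \<Phi>_def
    by (intro continuous_intros continuous_on_subset[OF continuous_u_coh]) auto
  then obtain w0 where w0: "w0 \<in> cball w1 R" "\<And>w. w \<in> cball w1 R \<Longrightarrow> g w \<le> g w0"
    using continuous_attains_sup[of "cball w1 R" g] R by auto
  have "0 < g w1" using R False by (simp add: g_def \<Phi>_def)
  also have g1: "g w1 \<le> g w0" using R by (intro w0) simp
  finally have "g w0 \<noteq> 0" by simp
  then have "dist w0 w1 \<noteq> R" "\<Phi> w0 \<noteq> 0" using k by (auto simp: g_def)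
  then have lt: "dist w0 w1 < R" using w0(1) by (simp add: dist_commute)
  define \<rho> where "\<rho> = (R - dist w0 w1) / 2"
  have \<rho>: "0 < \<rho>" "2 * \<rho> = R - dist w0 w1" using lt by (auto simp: \<rho>_def)
  have \<rho>1: "\<rho> \<le> 1" using \<rho> R zero_le_dist[of w0 w1] by linarith
  have bound: "cmod (\<Phi> v) \<le> 2 ^ k * cmod (\<Phi> w0)" if v: "dist v w0 \<le> \<rho>" for v
  proof -
    have d: "dist v w1 \<le> \<rho> + dist w0 w1" using dist_triangle[of v w1 w0] v by simp
    then have "v \<in> cball w1 R" using \<rho> by (simp add: dist_commute)
    then have "g v \<le> g w0" by (rule w0)
    moreover have "\<rho> ^ k * cmod (\<Phi> v) \<le> g v"
      unfolding g_def using \<rho> d by (intro mult_right_mono power_mono) auto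
    moreover have "g w0 = \<rho> ^ k * (2 ^ k * cmod (\<Phi> w0))"
      unfolding g_def \<rho>(2)[symmetric] by (simp add: power_mult_distrib)
    ultimately have "\<rho> ^ k * cmod (\<Phi> v) \<le> \<rho> ^ k * (2 ^ k * cmod (\<Phi> w0))" by linarith
    then show ?thesis using \<rho> by simp
  qed
  show ?thesis
  proof (rule that[of \<rho> w0])
    show "R ^ k * cmod (u (coh w1)) \<le> (2 * \<rho>) ^ k * cmod (u (coh w0))"
      using g1 \<rho>(2) by (simp add: g_def \<Phi>_def)
    fix v assume v: "dist v w0 < \<rho> / 2 ^ (k + 2)"
    define \<delta> where "\<delta> = dist v w0"
    show "cmod (u (coh w0)) / 2 \<le> cmod (u (coh v))"
    proof (cases "\<delta> = 0")
      case True
      then show ?thesis by (simp add: \<delta>_def)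
    next
      case False
      then have \<delta>: "0 < \<delta>" by (simp add: \<delta>_def)
      define \<eta> where "\<eta> = complex_of_real (\<rho> / \<delta>) *s (v - w0)"
      have n\<eta>: "norm \<eta> = \<rho>"
        using \<delta> \<rho> unfolding \<eta>_def norm_vec_smult by (simp add: \<delta>_def dist_norm norm_divide)
      have ve: "v = w0 + complex_of_real (\<delta> / \<rho>) *s \<eta>"
        using \<delta> \<rho> by (simp add: \<eta>_def vector_smult_assoc vec_eq_iff)
      have ratio: "\<delta> / \<rho> \<le> 1 / 2 ^ (k + 2)" using v \<rho> by (simp add: \<delta>_def field_simps)
      have "(1::real) / 2 ^ (k + 2) \<le> 1 / 2 ^ 1" by (intro divide_left_mono power_increasing) auto
      from order_trans[OF ratio this] have half: "\<delta> / \<rho> \<le> 1 / 2" by (simp only: power_one_right)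
      have "cmod (\<Phi> (w0 + (0 + complex_of_real (\<delta> / \<rho>)) *s \<eta>) - \<Phi> (w0 + 0 *s \<eta>)) \<le>
          2 * (2 ^ k * cmod (\<Phi> w0)) * cmod (complex_of_real (\<delta> / \<rho>))"
      proof (rule holomorphic_increment_bounds(1))
        show "(\<lambda>\<tau>. \<Phi> (w0 + \<tau> *s \<eta>)) holomorphic_on UNIV"
          unfolding \<Phi>_def using n\<eta> \<rho>1 by (intro holomorphic_u_coh) simp
        show "cmod (complex_of_real (\<delta> / \<rho>)) \<le> 1 / 2" using half \<delta> \<rho> by (simp only: norm_of_real) simp
        fix \<tau> :: complex assume "cmod (\<tau> - 0) \<le> 1"
        then have "cmod \<tau> * \<rho> \<le> 1 * \<rho>" using \<rho> by (intro mult_right_mono) auto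
        then show "cmod (\<Phi> (w0 + \<tau> *s \<eta>)) \<le> 2 ^ k * cmod (\<Phi> w0)"
          by (intro bound) (simp add: dist_norm norm_vec_smult n\<eta>)
      qed
      then have "cmod (\<Phi> v - \<Phi> w0) \<le> 2 * (2 ^ k * cmod (\<Phi> w0)) * (\<delta> / \<rho>)"
      proof -
        have "w0 + (0 + complex_of_real (\<delta> / \<rho>)) *s \<eta> = v" "w0 + 0 *s \<eta> = w0"
          using ve by (simp_all only: add_0_left add_0_right vector_smult_lzero)
        moreover have "cmod (complex_of_real (\<delta> / \<rho>)) = \<delta> / \<rho>" using \<delta> \<rho> by (simp only: norm_of_real) simp
        ultimately show ?thesis
          using \<open>cmod (\<Phi> (w0 + (0 + complex_of_real (\<delta> / \<rho>)) *s \<eta>) - \<Phi> (w0 + 0 *s \<eta>)) \<le> _\<close> by metis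
      qed
      also have "\<dots> \<le> 2 * (2 ^ k * cmod (\<Phi> w0)) * (1 / 2 ^ (k + 2))"
        by (intro mult_left_mono ratio) auto
      also have "\<dots> = cmod (\<Phi> w0) / 2" by (simp add: power_add)
      finally have "cmod (\<Phi> v - \<Phi> w0) \<le> cmod (\<Phi> w0) / 2" .
      then have "cmod (\<Phi> w0) / 2 \<le> cmod (\<Phi> v)"
        using norm_triangle_ineq3[of "\<Phi> v" "\<Phi> w0"] by linarith
      then show ?thesis by (simp add: \<Phi>_def)
    qed
  qed (use \<rho> \<rho>1 in auto)
qed

end

lemma powr_shift_bound:
  fixes a b q :: real
  assumes "0 \<le> a" "0 \<le> b" "a \<le> b + 1" "0 < q" "q \<le> 2"
  shows "a powr q \<le> 4 * (b powr q + 1)"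
proof -
  have "a powr q \<le> (2 * max b 1) powr q" using assms by (intro powr_mono2) auto
  also have "\<dots> = 2 powr q * max b 1 powr q" using assms by (simp add: powr_mult)
  also have "\<dots> \<le> 2 powr 2 * (b powr q + 1)"
    using assms by (intro mult_mono powr_mono) (auto simp: max_def)
  finally show ?thesis by simp
qed

text \<open>Shifting the argument of a power with exponent at most \<open>2\<close> by \<open>1\<close> costs a factor \<open>4\<close>, up to an additive
  constant (\<open>powr_shift_bound\<close>). Hence the rate of a weight deteriorates by this factor when it is compared
  at two points of distance at most \<open>1\<close>.\<close>

definition shifted_rate :: "real \<Rightarrow> real" where
  "shifted_rate r = (if 0 < r then r / 4 else 4 * r)"

lemma exp_weight_shift:
  assumes s: "1 / 2 \<le> s" and t: "1 / 2 \<le> t" and d: "dist z z1 \<le> 1"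
  shows "exp (- (8 * \<bar>r\<bar>)) * exp_weight s t (shifted_rate r) z1 \<le> exp_weight s t r z"
proof -
  obtain x \<xi> x1 \<xi>1 where z: "z = (x, \<xi>)" "z1 = (x1, \<xi>1)" by (cases z, cases z1) auto
  have "dist x x1 \<le> 1" "dist \<xi> \<xi>1 \<le> 1"
    using d dist_fst_le[of z z1] dist_snd_le[of z z1] by (auto simp: z)
  then have n: "norm x \<le> norm x1 + 1" "norm x1 \<le> norm x + 1" "norm \<xi> \<le> norm \<xi>1 + 1" "norm \<xi>1 \<le> norm \<xi> + 1"
    using norm_triangle_ineq3[of x x1] norm_triangle_ineq3[of \<xi> \<xi>1] by (auto simp: dist_norm)
  have q: "0 < 1 / s" "1 / s \<le> 2" "0 < 1 / t" "1 / t \<le> 2" using s t by (auto simp: field_simps)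
  define A B where "A = norm x powr (1 / t) + norm \<xi> powr (1 / s)" and "B = norm x1 powr (1 / t) + norm \<xi>1 powr (1 / s)"
  have AB: "A \<le> 4 * B + 8" "B \<le> 4 * A + 8"
    using powr_shift_bound[OF _ _ n(1) q(3,4)] powr_shift_bound[OF _ _ n(2) q(3,4)]
      powr_shift_bound[OF _ _ n(3) q(1,2)] powr_shift_bound[OF _ _ n(4) q(1,2)]
    by (simp_all add: A_def B_def)
  have "- (8 * \<bar>r\<bar>) + shifted_rate r * B \<le> r * A"
  proof (cases "0 < r")
    case True
    then have "r * B \<le> r * (4 * A + 8)" using AB by (intro mult_left_mono) auto
    then show ?thesis using True by (simp add: shifted_rate_def algebra_simps)
  next
    case False
    then have "r * (4 * B + 8) \<le> r * A" using AB by (intro mult_left_mono_neg) auto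
    then show ?thesis using False by (simp add: shifted_rate_def algebra_simps)
  qed
  then show ?thesis unfolding exp_weight_def z prod.case A_def[symmetric] B_def[symmetric] exp_add[symmetric] by simp
qed

context gs_functional
begin

text \<open>The transform is a Gaussian in \<open>x\<close> times an entire function. Around a near maximum of the latter the product
  stays large on a ball, which bounds the quasi-norm from below. The radius \<open>1 / (1 + norm x)\<close> keeps the Gaussian
  comparable on the ball and costs a polynomial factor, which is absorbed in \<open>\<epsilon>\<close>.\<close>

lemma stft_bound_of_mixed_qnorm:
  fixes B :: "(ennreal \<times> ((real^'d) \<times> (real^'d)) set) list"
  assumes B: "mixed_qnorm_space B" and s': "1 / 2 \<le> s'" and t': "1 / 2 \<le> t'"
    and fin: "mixed_qnorm B (\<lambda>z. ennreal (cmod (stft u z * of_real (exp_weight s' t' r z)))) < \<infinity>" and \<epsilon>: "0 < \<epsilon>"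
  obtains C where "0 < C" "\<And>z. cmod (stft u z) \<le> C * exp_weight s' t' (\<epsilon> - shifted_rate r) z"
proof -
  define F where "F z = ennreal (cmod (stft u z * of_real (exp_weight s' t' r z)))" for z
  define X where "X = enn2real (mixed_qnorm B F)"
  have X: "mixed_qnorm B F = ennreal X" "0 \<le> X"
    using fin by (auto simp: X_def F_def[abs_def] ennreal_enn2real)
  obtain \<kappa> N where \<kappa>: "0 < \<kappa>" and low: "\<And>z \<rho> c F. 0 < \<rho> \<Longrightarrow> \<rho> \<le> 1 \<Longrightarrow> 0 \<le> c \<Longrightarrow> (\<And>w. w \<in> ball z \<rho> \<Longrightarrow> ennreal c \<le> F w) \<Longrightarrow>
      ennreal (\<kappa> * \<rho> ^ N * c) \<le> mixed_qnorm B F"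
    using mixed_qnorm_ge_on_ball[OF B] by blast
  \<comment> \<open>At least the N powers of \<open>\<rho>\<close> lost in the lower bound must be compensated, and k must be positive for the
    maximum to lie in the interior.\<close>
  define k where "k = Suc N"
  define c2 where "c2 = (2 * pi) powr (- real CARD('d) / 2) * pi powr (- real CARD('d) / 4)"
  have c2: "0 < c2" by (simp add: c2_def)
  have V: "cmod (stft u z) = c2 * exp (- ((norm (fst z))\<^sup>2 / 2)) * cmod (u (coh (cvec z)))" for z
    unfolding stft_u atom_const_def norm_mult norm_of_real c2_def by (simp add: abs_mult)
  \<comment> \<open>the losses from the Gaussian, from the near maximum and from the weight\<close>
  define m0 where "m0 = exp (- (3 / 2)) / 2 * exp (- (8 * \<bar>r\<bar>))"
  have m0: "0 < m0" by (simp add: m0_def)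
  define q :: real where "q = (1 / 2) ^ (k + 2)"
  have q: "0 < q" "q \<le> 1" by (auto simp: q_def simp del: power_add power_Suc intro!: power_le_one)
  have q_eq: "\<rho> / 2 ^ (k + 2) = \<rho> * q" for \<rho> :: real by (simp only: q_def divide_inverse mult_1_left power_inverse)
  define C where "C = 2 ^ k * X / (\<kappa> * q ^ N * m0)"
  have main: "cmod (stft u z1) * exp_weight s' t' (shifted_rate r) z1 \<le> C * (1 + norm (fst z1)) ^ k" for z1
  proof -
    define x1 where "x1 = fst z1"
    \<comment> \<open>Within this radius the Gaussian decreases by a factor of at most exp (3/2).\<close>
    define R where "R = 1 / (1 + norm x1)"
    have R: "0 < R" "R \<le> 1" by (auto simp: R_def add_pos_nonneg)
    obtain w0 \<rho> where w0: "0 < \<rho>" "\<rho> \<le> 1" "dist w0 (cvec z1) \<le> R - 2 * \<rho>"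
      "R ^ k * cmod (u (coh (cvec z1))) \<le> (2 * \<rho>) ^ k * cmod (u (coh w0))"
      "\<And>v. dist v w0 < \<rho> / 2 ^ (k + 2) \<Longrightarrow> cmod (u (coh w0)) / 2 \<le> cmod (u (coh v))"
      by (rule near_maximum[OF R, of k "cvec z1"]) (simp add: k_def, blast)
    obtain z0 where z0: "cvec z0 = w0" by (rule cvec_surj)
    define \<sigma> where "\<sigma> = \<rho> * q"
    have \<sigma>: "0 < \<sigma>" "\<sigma> \<le> \<rho>" using w0(1) q mult_left_mono[OF q(2), of \<rho>] by (auto simp: \<sigma>_def)
    define E where "E = exp_weight s' t' (shifted_rate r) z1"
    have E: "0 < E" by (simp add: E_def exp_weight_pos)
    define m where "m = m0 * (c2 * exp (- ((norm x1)\<^sup>2 / 2)) * cmod (u (coh w0)) * E)"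
    have "ennreal (\<kappa> * \<sigma> ^ N * m) \<le> mixed_qnorm B F"
    proof (rule low)
      show "0 < \<sigma>" "\<sigma> \<le> 1" using \<sigma> w0(2) by auto
      show "0 \<le> m" using m0 c2 E by (simp add: m_def)
      fix z assume "z \<in> ball z0 \<sigma>"
      then have dz: "dist z z0 < \<sigma>" by (simp add: dist_commute)
      have "dist z z1 \<le> dist z z0 + dist z0 z1" by (rule dist_triangle)
      also have "\<dots> \<le> \<rho> + (R - 2 * \<rho>)"
        using dz \<sigma> w0(3) unfolding z0[symmetric] dist_cvec by linarith
      finally have dR: "dist z z1 \<le> R" using w0(1) by simp
      have "norm (fst z) \<le> norm x1 + R"
        using dist_fst_le[of z z1] dR norm_triangle_ineq3[of "fst z" "fst z1"] by (simp add: dist_norm x1_def)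
      then have "(norm (fst z))\<^sup>2 \<le> (norm x1 + R)\<^sup>2" by (intro power_mono) auto
      also have "\<dots> = (norm x1)\<^sup>2 + 2 * (norm x1 * R) + R\<^sup>2" by (simp add: power2_sum)
      also have "\<dots> \<le> (norm x1)\<^sup>2 + 2 * 1 + 1"
        using R by (intro add_mono mult_left_mono power_le_one) (auto simp: R_def divide_le_eq_1 add_pos_nonneg)
      finally have "exp (- (3 / 2)) * exp (- ((norm x1)\<^sup>2 / 2)) \<le> exp (- ((norm (fst z))\<^sup>2 / 2))"
        unfolding exp_add[symmetric] exp_le_cancel_iff by linarith
      moreover have "cmod (u (coh w0)) / 2 \<le> cmod (u (coh (cvec z)))"
        using dz by (intro w0(5)) (simp only: z0[symmetric] dist_cvec \<sigma>_def q_eq)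
      ultimately have "(exp (- (3 / 2)) * exp (- ((norm x1)\<^sup>2 / 2))) * (cmod (u (coh w0)) / 2) \<le>
          exp (- ((norm (fst z))\<^sup>2 / 2)) * cmod (u (coh (cvec z)))"
        by (intro mult_mono) auto
      then have "c2 * ((exp (- (3 / 2)) * exp (- ((norm x1)\<^sup>2 / 2))) * (cmod (u (coh w0)) / 2)) \<le> cmod (stft u z)"
        unfolding V mult.assoc using c2 by (intro mult_left_mono) (auto simp: mult.assoc)
      moreover have "exp (- (8 * \<bar>r\<bar>)) * E \<le> exp_weight s' t' r z"
        unfolding E_def using dR R by (intro exp_weight_shift s' t') simp
      ultimately have "(c2 * ((exp (- (3 / 2)) * exp (- ((norm x1)\<^sup>2 / 2))) * (cmod (u (coh w0)) / 2))) * (exp (- (8 * \<bar>r\<bar>)) * E) \<le>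
          cmod (stft u z) * exp_weight s' t' r z"
        using E by (intro mult_mono) auto
      then have "m \<le> cmod (stft u z * of_real (exp_weight s' t' r z))"
        using exp_weight_pos[of s' t' r z] by (simp add: m_def m0_def norm_mult mult_ac)
      then show "ennreal m \<le> F z" unfolding F_def by (rule ennreal_leI)
    qed
    then have le: "\<kappa> * \<sigma> ^ N * m \<le> X" using X by simp
    have "R ^ k * cmod (u (coh (cvec z1))) \<le> 2 ^ k * (\<rho> ^ N * cmod (u (coh w0)))"
    proof -
      have "(2 * \<rho>) ^ k * cmod (u (coh w0)) = \<rho> * (2 ^ k * (\<rho> ^ N * cmod (u (coh w0))))"
        by (simp add: k_def power_mult_distrib)
      also have "\<dots> \<le> 1 * (2 ^ k * (\<rho> ^ N * cmod (u (coh w0))))"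
        using w0 by (intro mult_right_mono) auto
      finally have "(2 * \<rho>) ^ k * cmod (u (coh w0)) \<le> 1 * (2 ^ k * (\<rho> ^ N * cmod (u (coh w0))))" .
      from order_trans[OF w0(4) this] show ?thesis by (simp only: mult_1_left)
    qed
    then have "(\<kappa> * q ^ N * m0 * (c2 * exp (- ((norm x1)\<^sup>2 / 2)) * E)) * (R ^ k * cmod (u (coh (cvec z1)))) \<le>
        (\<kappa> * q ^ N * m0 * (c2 * exp (- ((norm x1)\<^sup>2 / 2)) * E)) * (2 ^ k * (\<rho> ^ N * cmod (u (coh w0))))"
      using \<kappa> m0 c2 E q by (intro mult_left_mono) auto
    also have "\<dots> = 2 ^ k * (\<kappa> * \<sigma> ^ N * m)" by (simp add: \<sigma>_def m_def power_mult_distrib mult_ac)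
    also have "\<dots> \<le> 2 ^ k * X" using le by simp
    finally have "(\<kappa> * q ^ N * m0) * ((cmod (stft u z1) * E) * R ^ k) \<le> 2 ^ k * X"
      by (simp add: V x1_def mult_ac)
    moreover have P: "0 < \<kappa> * q ^ N * m0" using \<kappa> m0 q by simp
    ultimately have "(cmod (stft u z1) * E) * R ^ k \<le> C"
      unfolding C_def by (subst pos_le_divide_eq) (auto simp: mult.commute)
    then have "((cmod (stft u z1) * E) * R ^ k) * (1 + norm x1) ^ k \<le> C * (1 + norm x1) ^ k"
      by (rule mult_right_mono) simp
    moreover have "R ^ k * (1 + norm x1) ^ k = 1"
    proof -
      have "R * (1 + norm x1) = 1" unfolding R_def by (metis add_pos_nonneg less_irrefl nonzero_eq_divide_eq norm_ge_zero zero_less_one)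
      then show ?thesis by (simp only: power_mult_distrib[symmetric]) simp
    qed
    ultimately have "(cmod (stft u z1) * E) * 1 \<le> C * (1 + norm x1) ^ k" by (simp only: mult.assoc)
    then show ?thesis by (simp add: E_def x1_def)
  qed
  have st': "0 < s'" "0 < t'" using s' t' by auto
  obtain C3 where C3: "0 < C3" "\<And>x. 0 \<le> x \<Longrightarrow> (1 + x) ^ k \<le> C3 * exp (\<epsilon> * x powr (1 / t'))"
    using polynomial_le_exp_powr[of \<epsilon> "1 / t'" k] \<epsilon> st' by auto
  have C0: "0 \<le> C" using X \<kappa> m0 q by (simp add: C_def)
  show ?thesis
  proof (rule that[of "(C + 1) * C3"])
    show "0 < (C + 1) * C3" using C0 C3 by simp
    fix z :: "(real^'d) \<times> (real^'d)"
    have "(1 + norm (fst z)) ^ k \<le> C3 * exp_weight s' t' \<epsilon> z"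
    proof -
      have "exp (\<epsilon> * norm (fst z) powr (1 / t')) \<le> exp_weight s' t' \<epsilon> z"
        using \<epsilon> by (simp add: exp_weight_def case_prod_unfold)
      then have "C3 * exp (\<epsilon> * norm (fst z) powr (1 / t')) \<le> C3 * exp_weight s' t' \<epsilon> z"
        using C3 by (intro mult_left_mono) auto
      then show ?thesis using C3(2)[of "norm (fst z)"] by simp
    qed
    then have "C * (1 + norm (fst z)) ^ k \<le> (C + 1) * (C3 * exp_weight s' t' \<epsilon> z)"
      using C0 by (intro mult_mono) auto
    then have "cmod (stft u z) * exp_weight s' t' (shifted_rate r) z \<le> (C + 1) * C3 * exp_weight s' t' \<epsilon> z"
      using main[of z] by (simp add: mult.assoc)
    then have "(cmod (stft u z) * exp_weight s' t' (shifted_rate r) z) * exp_weight s' t' (- shifted_rate r) z \<le>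
        ((C + 1) * C3 * exp_weight s' t' \<epsilon> z) * exp_weight s' t' (- shifted_rate r) z"
      by (intro mult_right_mono) (auto simp: less_imp_le[OF exp_weight_pos])
    then have "cmod (stft u z) * (exp_weight s' t' (shifted_rate r) z * exp_weight s' t' (- shifted_rate r) z) \<le>
        (C + 1) * C3 * (exp_weight s' t' \<epsilon> z * exp_weight s' t' (- shifted_rate r) z)"
      by (simp only: mult.assoc)
    then show "cmod (stft u z) \<le> (C + 1) * C3 * exp_weight s' t' (\<epsilon> - shifted_rate r) z"
      unfolding exp_weight_mult by (simp add: exp_weight_def case_prod_unfold)
  qed
qed

lemma mixed_qnorm_of_stft_bound:
  fixes B :: "(ennreal \<times> ((real^'d) \<times> (real^'d)) set) list"
  assumes B: "mixed_qnorm_space B" and st': "0 < s'" "0 < t'"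
    and b: "\<And>z. cmod (stft u z) \<le> C * exp_weight s' t' r1 z" and r: "r1 + r < 0"
  shows "mixed_qnorm B (\<lambda>z. ennreal (cmod (stft u z * of_real (exp_weight s' t' r z)))) < \<infinity>"
proof -
  obtain N where N: "\<And>F C. seq_lsc F \<Longrightarrow> 0 \<le> C \<Longrightarrow> (\<And>z. F z \<le> ennreal (C / (1 + norm z) ^ N)) \<Longrightarrow> mixed_qnorm B F < \<infinity>"
    by (rule mixed_qnorm_finite_of_decay[OF B]) blast
  have "0 < - (r1 + r)" using r by simp
  then obtain C' where C': "0 < C'" "\<And>z :: (real^'d) \<times> (real^'d). exp_weight s' t' (- (- (r1 + r))) z \<le> C' / (1 + norm z) ^ N"
    by (rule exp_weight_le_inverse_power[OF st', of _ N]) blast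
  let ?F = "\<lambda>z. ennreal (cmod (stft u z * of_real (exp_weight s' t' r z)))"
  have C: "0 \<le> C"
    using order_trans[OF norm_ge_zero b[of 0]] exp_weight_pos[of s' t' r1 "0 :: (real^'d) \<times> (real^'d)"] by (simp add: zero_le_mult_iff)
  show ?thesis
  proof (rule N[of _ "C * C'"])
    show "seq_lsc ?F"
      unfolding seq_lsc_def
    proof (intro allI impI)
      fix X :: "nat \<Rightarrow> (real^'d) \<times> (real^'d)" and x assume X: "X \<longlonglongrightarrow> x"
      have "(\<lambda>n. ?F (X n)) \<longlonglongrightarrow> ?F x"
        by (intro tendsto_intros continuous_on_tendsto_compose[OF continuous_stft_u X] continuous_on_tendsto_compose[OF continuous_exp_weight[OF st'] X]) auto
      then have "liminf (\<lambda>n. ?F (X n)) = ?F x" by (rule lim_imp_Liminf[OF trivial_limit_sequentially])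
      then show "?F x \<le> liminf (\<lambda>n. ?F (X n))" by (simp only: order_refl)
    qed
    show "0 \<le> C * C'" using C C' by simp
    fix z
    have "cmod (stft u z * of_real (exp_weight s' t' r z)) = cmod (stft u z) * exp_weight s' t' r z"
      using exp_weight_pos[of s' t' r z] by (simp add: norm_mult)
    also have "\<dots> \<le> (C * exp_weight s' t' r1 z) * exp_weight s' t' r z"
      by (intro mult_right_mono b) (simp add: less_imp_le[OF exp_weight_pos])
    also have "\<dots> = C * exp_weight s' t' (- (- (r1 + r))) z" by (simp add: mult.assoc exp_weight_mult add.commute)
    also have "\<dots> \<le> C * (C' / (1 + norm z) ^ N)" by (intro mult_left_mono C' C)
    finally show "?F z \<le> ennreal (C * C' / (1 + norm z) ^ N)" by (intro ennreal_leI) simp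
  qed
qed

end

section \<open>Continuity of functionals as boundedness\<close>

lemma multi_fact_ge_1: "1 \<le> multi_fact \<alpha>"
  unfolding multi_fact_def by (intro prod_ge_1) (auto simp: fact_ge_1)

lemma gs_quot_mono:
  assumes h: "0 < h" "h \<le> h'" and st: "s \<le> s'" "t \<le> t'"
  shows "gs_quot s' t' h' f \<mu> \<le> gs_quot s t h f \<mu>"
proof -
  obtain \<alpha> \<beta> x where m: "\<mu> = (\<alpha>, \<beta>, x)" by (cases \<mu>)
  let ?n = "\<Sum>i\<in>UNIV. \<alpha> i + \<beta> i"
  have mf: "0 < multi_fact \<gamma>" for \<gamma> :: "'a \<Rightarrow> nat" using less_le_trans[OF zero_less_one multi_fact_ge_1] .
  have "h ^ ?n * multi_fact \<alpha> powr s * multi_fact \<beta> powr t \<le> h' ^ ?n * multi_fact \<alpha> powr s' * multi_fact \<beta> powr t'"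
    using h st multi_fact_ge_1 by (intro mult_mono power_mono powr_mono) auto
  then show ?thesis
    unfolding m gs_quot_def prod.case using h mf[of \<alpha>] mf[of \<beta>]
    by (intro divide_left_mono mult_pos_pos zero_less_power) auto
qed

text \<open>A power \<open>(h / h') ^ n\<close> is dominated by \<open>fact n powr (s - 1/2)\<close>. Thus the smallest Roumieu space lies
  in every Beurling space of larger exponents.\<close>

lemma gs_quot_gain:
  fixes h h' s t :: real
  assumes h: "0 < h" "0 < h'" and st: "1 / 2 < s" "1 / 2 < t"
  obtains C where "0 < C" "\<And>(f :: real^'d::finite \<Rightarrow> complex) \<mu>. gs_quot s t h' f \<mu> \<le> C * gs_quot (1/2) (1/2) h f \<mu>"
proof -
  have gain: "\<exists>C>0. \<forall>\<alpha> :: 'd \<Rightarrow> nat. (h / h') ^ (\<Sum>i\<in>UNIV. \<alpha> i) \<le> C * multi_fact \<alpha> powr (u - 1/2)" if u: "1 / 2 < u" for u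
  proof -
    define r where "r = u - 1 / 2"
    have r: "0 < r" using u by (simp add: r_def)
    define C where "C = exp (r * (h / h') powr (1 / r))"
    have one: "(h / h') ^ m \<le> C * fact m powr r" for m
      using power_le_fact_powr_exp[of "h / h'" r r m] h r by (simp add: C_def mult_ac)
    have "(h / h') ^ (\<Sum>i\<in>UNIV. \<alpha> i) \<le> C ^ CARD('d) * multi_fact \<alpha> powr (u - 1/2)" for \<alpha> :: "'d \<Rightarrow> nat"
    proof -
      have "(h / h') ^ (\<Sum>i\<in>UNIV. \<alpha> i) = (\<Prod>i\<in>UNIV. (h / h') ^ \<alpha> i)" by (rule power_sum)
      also have "\<dots> \<le> (\<Prod>i\<in>UNIV. C * fact (\<alpha> i) powr r)" using h by (intro prod_mono conjI one) auto
      also have "\<dots> = C ^ CARD('d) * multi_fact \<alpha> powr r"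
        unfolding multi_fact_def by (subst prod_powr_distrib) (auto simp: prod.distrib)
      finally show ?thesis by (simp add: r_def)
    qed
    moreover have "0 < C ^ CARD('d)" by (simp add: C_def)
    ultimately show ?thesis by blast
  qed
  obtain C1 where C1: "0 < C1" "\<And>\<alpha> :: 'd \<Rightarrow> nat. (h / h') ^ (\<Sum>i\<in>UNIV. \<alpha> i) \<le> C1 * multi_fact \<alpha> powr (s - 1/2)"
    using gain[OF st(1)] by blast
  obtain C2 where C2: "0 < C2" "\<And>\<alpha> :: 'd \<Rightarrow> nat. (h / h') ^ (\<Sum>i\<in>UNIV. \<alpha> i) \<le> C2 * multi_fact \<alpha> powr (t - 1/2)"
    using gain[OF st(2)] by blast
  show ?thesis
  proof (rule that[of "C1 * C2"])
    show "0 < C1 * C2" using C1 C2 by simp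
    fix f :: "real^'d \<Rightarrow> complex" and \<mu> :: "('d \<Rightarrow> nat) \<times> ('d \<Rightarrow> nat) \<times> (real^'d)"
    obtain \<alpha> \<beta> x where m: "\<mu> = (\<alpha>, \<beta>, x)" by (cases \<mu>)
    let ?n = "\<Sum>i\<in>UNIV. \<alpha> i + \<beta> i"
    let ?A = "multi_fact \<alpha>" and ?B = "multi_fact \<beta>"
    have mf: "0 < ?A" "0 < ?B" using less_le_trans[OF zero_less_one multi_fact_ge_1] by auto
    define D where "D = h ^ ?n * ?A powr (1/2) * ?B powr (1/2)"
    define D' where "D' = h' ^ ?n * ?A powr s * ?B powr t"
    have pos: "0 < D" "0 < D'" using h mf by (auto simp: D_def D'_def)
    have "(h / h') ^ ?n = (h / h') ^ (\<Sum>i\<in>UNIV. \<alpha> i) * (h / h') ^ (\<Sum>i\<in>UNIV. \<beta> i)"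
      by (simp add: sum.distrib power_add)
    also have "\<dots> \<le> (C1 * ?A powr (s - 1/2)) * (C2 * ?B powr (t - 1/2))"
      using h C1 C2 by (intro mult_mono) auto
    finally have "h' ^ ?n * (h / h') ^ ?n \<le> h' ^ ?n * ((C1 * ?A powr (s - 1/2)) * (C2 * ?B powr (t - 1/2)))"
      using h by (intro mult_left_mono) auto
    moreover have "h' ^ ?n * (h / h') ^ ?n = h ^ ?n" using h by (simp add: power_divide)
    ultimately have "h ^ ?n \<le> h' ^ ?n * ((C1 * ?A powr (s - 1/2)) * (C2 * ?B powr (t - 1/2)))" by linarith
    then have "h ^ ?n * (?A powr (1/2) * ?B powr (1/2)) \<le>
        (h' ^ ?n * ((C1 * ?A powr (s - 1/2)) * (C2 * ?B powr (t - 1/2)))) * (?A powr (1/2) * ?B powr (1/2))"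
      by (rule mult_right_mono) simp
    also have "\<dots> = C1 * C2 * (h' ^ ?n * (?A powr (s - 1/2) * ?A powr (1/2)) * (?B powr (t - 1/2) * ?B powr (1/2)))"
      by (simp only: mult_ac)
    also have "\<dots> = C1 * C2 * D'" unfolding powr_add[symmetric] D'_def by simp
    finally have le: "D \<le> C1 * C2 * D'" by (simp add: D_def mult.assoc)
    define Y where "Y = cmod (of_real (multi_pow x \<beta>) * multi_deriv \<alpha> f x)"
    have "Y * D \<le> Y * (C1 * C2 * D')" using le by (intro mult_left_mono) (auto simp: Y_def)
    then have "Y / D' \<le> C1 * C2 * (Y / D)" using pos by (simp add: field_simps)
    then show "gs_quot s t h' f \<mu> \<le> C1 * C2 * gs_quot (1/2) (1/2) h f \<mu>"
      unfolding m gs_quot_def prod.case D_def[symmetric] D'_def[symmetric] Y_def[symmetric] .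
  qed
qed

lemma gs_banachI:
  assumes "smooth_fun f" "\<And>\<mu>. gs_quot s t h f \<mu> \<le> B"
  shows "f \<in> gs_banach s t h"
  using assms by (auto simp: gs_banach_def intro!: bdd_aboveI2)

lemma gs_quot_le_norm: "f \<in> gs_banach s t h \<Longrightarrow> gs_quot s t h f \<mu> \<le> gs_norm s t h f"
  unfolding gs_norm_def by (intro cSUP_upper) (auto simp: gs_banach_def)

lemma gs_norm_le: "(\<And>\<mu>. gs_quot s t h f \<mu> \<le> B) \<Longrightarrow> gs_norm s t h f \<le> B"
  unfolding gs_norm_def by (intro cSUP_least) auto

lemma gs_norm_nonneg: "f \<in> gs_banach s t h \<Longrightarrow> 0 \<le> gs_norm s t h f"
  using order_trans[OF norm_ge_zero norm_le_gs_norm] .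

lemma gs_banach_mono:
  assumes "0 < h" "h \<le> h'" "s \<le> s'" "t \<le> t'"
  shows "gs_banach s t h \<subseteq> gs_banach s' t' h'"
proof
  fix f :: "real^'d \<Rightarrow> complex" assume f: "f \<in> gs_banach s t h"
  show "f \<in> gs_banach s' t' h'"
    by (rule gs_banachI[of _ _ _ _ "gs_norm s t h f"])
       (use f in \<open>auto simp: gs_banach_def intro: order_trans[OF gs_quot_mono[OF assms] gs_quot_le_norm]\<close>)
qed

lemma gs_norm_mono:
  assumes "0 < h" "h \<le> h'" "f \<in> gs_banach s t h"
  shows "gs_norm s t h' f \<le> gs_norm s t h f"
  by (intro gs_norm_le order_trans[OF gs_quot_mono gs_quot_le_norm] assms) auto

lemma zero_gs_banach: "0 < h \<Longrightarrow> (\<lambda>_. 0) \<in> gs_banach s t h"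
proof -
  assume h: "0 < h"
  have sm: "smooth_fun (\<lambda>_::real^'d. 0 :: complex)" using smooth_fun_cmult[OF smooth_fun_coh[of 0], of 0] by simp
  have "gs_quot s t h (\<lambda>_::real^'d. 0) \<mu> \<le> 0" for \<mu>
    using gs_fun_cmult[OF smooth_fun_coh[of 0], of s t h \<mu> 0] by (simp add: gs_quot_eq_norm_gs_fun[OF h])
  then show ?thesis by (rule gs_banachI[OF sm])
qed

lemma gs_roumieu_lin:
  assumes "f \<in> gs_roumieu s t" "g \<in> gs_roumieu s t"
  shows "(\<lambda>x. a * f x + b * g x) \<in> gs_roumieu s t"
proof -
  obtain h h' where h: "0 < h" "f \<in> gs_banach s t h" "0 < h'" "g \<in> gs_banach s t h'"
    using assms by (auto simp: gs_roumieu_def)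
  have "f \<in> gs_banach s t (max h h')" "g \<in> gs_banach s t (max h h')"
    using h gs_banach_mono[of h "max h h'" s s t t] gs_banach_mono[of h' "max h h'" s s t t] by auto
  then show ?thesis using h gs_banach_lin(1)[of f s t "max h h'" g a b] by (auto simp: gs_roumieu_def intro!: bexI[of _ "max h h'"])
qed

lemma gs_beurling_lin:
  assumes "f \<in> gs_beurling s t" "g \<in> gs_beurling s t"
  shows "(\<lambda>x. a * f x + b * g x) \<in> gs_beurling s t"
  using assms by (auto simp: gs_beurling_def intro!: gs_banach_lin(1))

lemma gs_roumieu_smooth: "f \<in> gs_roumieu s t \<Longrightarrow> smooth_fun f"
  by (auto simp: gs_roumieu_def gs_banach_def)

lemma gs_beurling_smooth: "f \<in> gs_beurling s t \<Longrightarrow> smooth_fun f"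
  by (auto simp: gs_beurling_def gs_banach_def intro: zero_less_one)

lemma openin_gs_roumieu_top: "openin (gs_roumieu_top s t) U \<longleftrightarrow> gs_roumieu_open s t U"
  unfolding gs_roumieu_top_def by (simp add: topology_inverse'[OF istopology_gs_roumieu_open])

lemma topspace_gs_roumieu_top: "topspace (gs_roumieu_top s t) = (gs_roumieu s t :: (real^'d::finite \<Rightarrow> complex) set)"
proof
  show "topspace (gs_roumieu_top s t) \<subseteq> (gs_roumieu s t :: (real^'d \<Rightarrow> complex) set)"
    unfolding topspace_def openin_gs_roumieu_top gs_roumieu_open_def by auto
  have "gs_roumieu_nhd0 s t (gs_roumieu s t :: (real^'d \<Rightarrow> complex) set)"
    unfolding gs_roumieu_nhd0_def absolutely_convex_def
  proof (intro conjI ballI allI impI)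
    show "\<exists>e>0. {f :: real^'d \<Rightarrow> complex. f \<in> gs_banach s t h \<and> gs_norm s t h f < e} \<subseteq> gs_roumieu s t" if "0 < h" for h
      using that by (intro exI[of _ 1]) (auto simp: gs_roumieu_def)
  qed (auto intro: gs_roumieu_lin)
  moreover have "(\<lambda>g x. f x + g x) ` gs_roumieu s t \<subseteq> gs_roumieu s t" if "f \<in> gs_roumieu s t" for f :: "real^'d \<Rightarrow> complex"
    using gs_roumieu_lin[OF that, of _ 1 1] by auto
  ultimately have "gs_roumieu_open s t (gs_roumieu s t :: (real^'d \<Rightarrow> complex) set)"
    unfolding gs_roumieu_open_def by blast
  then show "(gs_roumieu s t :: (real^'d \<Rightarrow> complex) set) \<subseteq> topspace (gs_roumieu_top s t)"
    unfolding openin_gs_roumieu_top[symmetric] by (rule openin_subset)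
qed

lemma linear_on_iff:
  assumes lin: "\<And>f g a b. f \<in> X \<Longrightarrow> g \<in> X \<Longrightarrow> (\<lambda>x. a * f x + b * g x) \<in> X"
  shows "(\<forall>f\<in>X. \<forall>g\<in>X. u (\<lambda>x. f x + g x) = u f + u g) \<and> (\<forall>c. \<forall>f\<in>X. u (\<lambda>x. c * f x) = c * u f) \<longleftrightarrow> linear_on X u"
proof
  assume L: "(\<forall>f\<in>X. \<forall>g\<in>X. u (\<lambda>x. f x + g x) = u f + u g) \<and> (\<forall>c. \<forall>f\<in>X. u (\<lambda>x. c * f x) = c * u f)"
  have cm: "(\<lambda>x. a * f x) \<in> X" if "f \<in> X" for f a using lin[OF that that, of a 0] by simp
  show "linear_on X u" unfolding linear_on_def using L cm by simp
next
  assume L: "linear_on X u"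
  have "u (\<lambda>x. f x + g x) = u f + u g" if "f \<in> X" "g \<in> X" for f g
    using L[unfolded linear_on_def, rule_format, OF that, of 1 1] by simp
  moreover have "u (\<lambda>x. c * f x) = c * u f" if "f \<in> X" for f c
    using L[unfolded linear_on_def, rule_format, OF that that, of c 0] by simp
  ultimately show "(\<forall>f\<in>X. \<forall>g\<in>X. u (\<lambda>x. f x + g x) = u f + u g) \<and> (\<forall>c. \<forall>f\<in>X. u (\<lambda>x. c * f x) = c * u f)" by (intro conjI ballI allI)
qed

lemma linear_onD:
  assumes "linear_on X u" "f \<in> X" "g \<in> X"
  shows "u (\<lambda>x. a * f x + b * g x) = a * u f + b * u g"
  by (rule assms(1)[unfolded linear_on_def, THEN bspec, OF assms(2), THEN bspec, OF assms(3), THEN spec, THEN spec])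

lemma linear_on_zero: "linear_on X u \<Longrightarrow> f \<in> X \<Longrightarrow> u (\<lambda>_. 0) = 0"
  using linear_onD[of X u f f 0 0] by simp

lemma linear_on_diff: "linear_on X u \<Longrightarrow> f \<in> X \<Longrightarrow> g \<in> X \<Longrightarrow> u (\<lambda>x. f x - g x) = u f - u g"
  using linear_onD[of X u f g 1 "-1"] by simp

lemma linear_on_cmult: "linear_on X u \<Longrightarrow> f \<in> X \<Longrightarrow> u (\<lambda>x. c * f x) = c * u f"
  using linear_onD[of X u f f c 0] by simp

text \<open>Stated in terms of bounds on the quotients since \<open>gs_norm\<close> is a norm only on functions whose quotients are
  bounded.\<close>

definition bounded_on :: "(real^'d::finite \<Rightarrow> complex) set \<Rightarrow> real \<Rightarrow> real \<Rightarrow> real \<Rightarrow> ((real^'d \<Rightarrow> complex) \<Rightarrow> complex) \<Rightarrow> bool" where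
  "bounded_on X s t h u \<longleftrightarrow> (\<exists>K\<ge>0. \<forall>f\<in>X. \<forall>B. (\<forall>\<mu>. gs_quot s t h f \<mu> \<le> B) \<longrightarrow> cmod (u f) \<le> K * B)"

text \<open>Scaling to norm \<open>e / 2\<close>; a function with vanishing bound is zero.\<close>

lemma bounded_on_of_small:
  assumes lin: "\<And>f g a b. f \<in> X \<Longrightarrow> g \<in> X \<Longrightarrow> (\<lambda>x. a * f x + b * g x) \<in> X" and sm: "\<And>f. f \<in> X \<Longrightarrow> smooth_fun f"
    and L: "linear_on X u" and h: "0 < h" and e: "0 < e"
    and small: "\<And>f. f \<in> X \<Longrightarrow> f \<in> gs_banach s t h \<Longrightarrow> gs_norm s t h f < e \<Longrightarrow> cmod (u f) < 1"
  shows "bounded_on X s t h u"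
  unfolding bounded_on_def
proof (intro exI conjI ballI allI impI)
  show "0 \<le> 2 / e" using e by simp
  fix f B assume f: "f \<in> X" and B: "\<forall>\<mu>. gs_quot s t h f \<mu> \<le> B"
  have fb: "f \<in> gs_banach s t h" using B by (intro gs_banachI[OF sm[OF f]]) auto
  have B0: "0 \<le> B" using gs_bound_nonneg[of s t h f B] B h by auto
  show "cmod (u f) \<le> 2 / e * B"
  proof (cases "B = 0")
    case True
    have "cmod (f x) \<le> 0" for x using order_trans[OF norm_le_gs_norm[OF fb] gs_norm_le[of s t h f B]] B True by auto
    then have "f = (\<lambda>_. 0)" by auto
    then show ?thesis using linear_on_zero[OF L f] True by simp
  next
    case False
    then have Bp: "0 < B" using B0 by simp
    define c where "c = e / (2 * B)"
    have c: "0 < c" using e Bp by (simp add: c_def)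
    let ?g = "\<lambda>x. complex_of_real c * f x"
    have gX: "?g \<in> X" using lin[OF f f, of "complex_of_real c" 0] by simp
    have q: "gs_quot s t h ?g \<mu> \<le> c * B" for \<mu>
    proof -
      have "gs_quot s t h ?g \<mu> = c * gs_quot s t h f \<mu>"
        using c by (simp only: gs_quot_eq_norm_gs_fun[OF h] gs_fun_cmult[OF sm[OF f]] norm_mult norm_of_real abs_of_pos)
      also have "\<dots> \<le> c * B" using c by (intro mult_left_mono[OF spec[OF B]]) simp
      finally show ?thesis .
    qed
    have "?g \<in> gs_banach s t h" by (rule gs_banachI[OF sm[OF gX] q])
    moreover have "gs_norm s t h ?g < e" using gs_norm_le[OF q] e Bp by (simp add: c_def)
    ultimately have "cmod (u ?g) < 1" by (rule small[OF gX])
    then have "c * cmod (u f) < 1" using c by (simp add: linear_on_cmult[OF L f] norm_mult)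
    then show ?thesis using c e Bp by (simp add: c_def field_simps)
  qed
qed

text \<open>The set where \<open>u\<close> is smaller than \<open>\<epsilon>\<close> is absolutely convex, and it is a neighbourhood of zero in the inductive
  limit if and only if it contains a ball of each step.\<close>

lemma gs_roumieu_dual_iff:
  fixes u :: "(real^'d::finite \<Rightarrow> complex) \<Rightarrow> complex"
  shows "u \<in> gs_roumieu_dual s t \<longleftrightarrow> u \<in> extensional (gs_roumieu s t) \<and> linear_on (gs_roumieu s t) u \<and>
    (\<forall>h>0. bounded_on (gs_roumieu s t) s t h u)" (is "?L \<longleftrightarrow> ?R")
proof -
  let ?X = "gs_roumieu s t :: (real^'d \<Rightarrow> complex) set"
  have cd: "?L \<longleftrightarrow> u \<in> extensional ?X \<and> linear_on ?X u \<and> continuous_map (gs_roumieu_top s t) euclidean u"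
    unfolding gs_roumieu_dual_def continuous_dual_def topspace_gs_roumieu_top
    by (simp only: mem_Collect_eq linear_on_iff[OF gs_roumieu_lin, of s t u, symmetric] conj_assoc)
  have "continuous_map (gs_roumieu_top s t) euclidean u \<longleftrightarrow> (\<forall>h>0. bounded_on ?X s t h u)" if L: "linear_on ?X u"
  proof
    assume C: "continuous_map (gs_roumieu_top s t) euclidean u"
    have "openin euclidean (ball (0::complex) 1)" by (simp only: open_openin[symmetric] open_ball)
    then have "openin (gs_roumieu_top s t) {f \<in> ?X. u f \<in> ball 0 1}"
      using C unfolding continuous_map topspace_gs_roumieu_top by blast
    then have op: "gs_roumieu_open s t {f \<in> ?X. u f \<in> ball 0 1}" by (simp only: openin_gs_roumieu_top)
    have z: "(\<lambda>_. 0) \<in> ?X" using zero_gs_banach[of 1 s t] by (auto simp: gs_roumieu_def intro!: bexI[of _ 1])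
    then have "(\<lambda>_. 0) \<in> {f \<in> ?X. u f \<in> ball 0 1}" using linear_on_zero[OF L z] by simp
    with op obtain W where W: "gs_roumieu_nhd0 s t W" "(\<lambda>g x. 0 + g x) ` W \<subseteq> {f \<in> ?X. u f \<in> ball 0 1}"
      unfolding gs_roumieu_open_def by blast
    show "\<forall>h>0. bounded_on ?X s t h u"
    proof (intro allI impI)
      fix h :: real assume h: "0 < h"
      obtain e where e: "0 < e" "{f \<in> gs_banach s t h. gs_norm s t h f < e} \<subseteq> W"
        using W(1) h unfolding gs_roumieu_nhd0_def by blast
      show "bounded_on ?X s t h u"
      proof (rule bounded_on_of_small[OF gs_roumieu_lin gs_roumieu_smooth L h e(1)])
        fix f :: "real^'d \<Rightarrow> complex" assume "f \<in> gs_banach s t h" "gs_norm s t h f < e"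
        then have "f \<in> W" using e by auto
        then show "cmod (u f) < 1" using W(2) by auto
      qed
    qed
  next
    assume bd: "\<forall>h>0. bounded_on ?X s t h u"
    show "continuous_map (gs_roumieu_top s t) euclidean u"
      unfolding continuous_map topspace_gs_roumieu_top
    proof (intro conjI allI impI)
      fix U :: "complex set" assume U: "openin euclidean U"
      have "gs_roumieu_open s t {f \<in> ?X. u f \<in> U}"
        unfolding gs_roumieu_open_def
      proof (intro conjI ballI)
        fix f :: "real^'d \<Rightarrow> complex" assume f: "f \<in> {f \<in> ?X. u f \<in> U}"
        then have "open U" "u f \<in> U" using U by auto
        then obtain \<epsilon> where \<epsilon>: "0 < \<epsilon>" "ball (u f) \<epsilon> \<subseteq> U" by (rule openE)
        define W where "W = {g \<in> ?X. cmod (u g) < \<epsilon>}"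
        have "absolutely_convex W"
          unfolding absolutely_convex_def
        proof (intro ballI allI impI)
          fix g k :: "real^'d \<Rightarrow> complex" and a b assume g: "g \<in> W" "k \<in> W" and ab: "cmod a + cmod b \<le> 1"
          then have X: "g \<in> ?X" "k \<in> ?X" and lt: "cmod (u g) < \<epsilon>" "cmod (u k) < \<epsilon>" by (auto simp: W_def)
          define m where "m = max (cmod (u g)) (cmod (u k))"
          have m: "0 \<le> m" "m < \<epsilon>" "cmod (u g) \<le> m" "cmod (u k) \<le> m" using lt by (auto simp: m_def le_max_iff_disj)
          have "cmod (u (\<lambda>x. a * g x + b * k x)) \<le> cmod a * cmod (u g) + cmod b * cmod (u k)"
            using L X unfolding linear_on_def by (metis norm_mult norm_triangle_ineq)
          also have "\<dots> \<le> cmod a * m + cmod b * m" using m by (intro add_mono mult_left_mono) auto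
          also have "\<dots> \<le> 1 * m" unfolding distrib_right[symmetric] by (rule mult_right_mono[OF ab m(1)])
          finally show "(\<lambda>x. a * g x + b * k x) \<in> W" using m gs_roumieu_lin[OF X] by (simp add: W_def)
        qed
        moreover have "\<exists>e>0. {g \<in> gs_banach s t h. gs_norm s t h g < e} \<subseteq> W" if h: "0 < h" for h
        proof -
          obtain K where K: "0 \<le> K" "\<forall>f\<in>?X. \<forall>B. (\<forall>\<mu>. gs_quot s t h f \<mu> \<le> B) \<longrightarrow> cmod (u f) \<le> K * B"
            using bd h unfolding bounded_on_def by blast
          show ?thesis
          proof (intro exI conjI subsetI)
            show "0 < \<epsilon> / (K + 1)" using \<epsilon> K by simp
            fix g :: "real^'d \<Rightarrow> complex" assume "g \<in> {g \<in> gs_banach s t h. gs_norm s t h g < \<epsilon> / (K + 1)}"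
            then have g: "g \<in> gs_banach s t h" "gs_norm s t h g < \<epsilon> / (K + 1)" by auto
            have gX: "g \<in> ?X" using g h by (auto simp: gs_roumieu_def)
            have "cmod (u g) \<le> K * gs_norm s t h g" using K(2) gX gs_quot_le_norm[OF g(1)] by blast
            also have "\<dots> \<le> (K + 1) * gs_norm s t h g" using gs_norm_nonneg[OF g(1)] by (intro mult_right_mono) auto
            also have "\<dots> < \<epsilon>" using g(2) K by (simp add: pos_less_divide_eq mult.commute add_nonneg_pos)
            finally show "g \<in> W" using gX by (simp add: W_def)
          qed
        qed
        ultimately have W: "gs_roumieu_nhd0 s t W" unfolding gs_roumieu_nhd0_def by (auto simp: W_def)
        have "(\<lambda>g x. f x + g x) ` W \<subseteq> {f \<in> ?X. u f \<in> U}"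
        proof safe
          fix g :: "real^'d \<Rightarrow> complex" assume g: "g \<in> W"
          then have gX: "g \<in> ?X" and fX: "f \<in> ?X" using f by (auto simp: W_def)
          show "(\<lambda>x. f x + g x) \<in> ?X" using gs_roumieu_lin[OF fX gX, of 1 1] by simp
          have "u (\<lambda>x. f x + g x) = u f + u g"
            using L[unfolded linear_on_def, rule_format, OF fX gX, of 1 1] by simp
          then show "u (\<lambda>x. f x + g x) \<in> U" using g \<epsilon>(2) by (auto simp: W_def dist_norm)
        qed
        with W show "\<exists>W. gs_roumieu_nhd0 s t W \<and> (\<lambda>g x. f x + g x) ` W \<subseteq> {f \<in> ?X. u f \<in> U}" by blast
      qed auto
      then show "openin (gs_roumieu_top s t) {f \<in> ?X. u f \<in> U}" by (simp only: openin_gs_roumieu_top)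
    qed auto
  qed
  with cd show ?thesis by blast
qed

text \<open>A neighbourhood of zero for the projective limit involves finitely many levels and hence contains a ball of
  the smallest of them.\<close>

lemma gs_beurling_dual_iff:
  fixes u :: "(real^'d::finite \<Rightarrow> complex) \<Rightarrow> complex"
  shows "u \<in> gs_beurling_dual s t \<longleftrightarrow> u \<in> extensional (gs_beurling s t) \<and> linear_on (gs_beurling s t) u \<and>
    (\<exists>h>0. bounded_on (gs_beurling s t) s t h u)" (is "?L \<longleftrightarrow> ?R")
proof -
  let ?X = "gs_beurling s t :: (real^'d \<Rightarrow> complex) set"
  have cd: "?L \<longleftrightarrow> u \<in> extensional ?X \<and> linear_on ?X u \<and> continuous_map (gs_beurling_top s t) euclidean u"
    unfolding gs_beurling_dual_def continuous_dual_def topspace_gs_beurling_top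
    by (simp only: mem_Collect_eq linear_on_iff[OF gs_beurling_lin, of s t u, symmetric] conj_assoc)
  have Xh: "f \<in> gs_banach s t h" if "f \<in> ?X" "0 < h" for f h using that by (auto simp: gs_beurling_def)
  have z: "(\<lambda>_. 0) \<in> ?X" using zero_gs_banach by (auto simp: gs_beurling_def)
  have "continuous_map (gs_beurling_top s t) euclidean u \<longleftrightarrow> (\<exists>h>0. bounded_on ?X s t h u)" if L: "linear_on ?X u"
  proof
    assume C: "continuous_map (gs_beurling_top s t) euclidean u"
    have "openin euclidean (ball (0::complex) 1)" by (simp only: open_openin[symmetric] open_ball)
    then have "openin (gs_beurling_top s t) {f \<in> ?X. u f \<in> ball 0 1}"
      using C unfolding continuous_map topspace_gs_beurling_top by blast
    then have gen: "generate_topology_on {U \<inter> ?X | U h. 0 < h \<and> openin (gs_banach_top s t h) U} {f \<in> ?X. u f \<in> ball 0 1}"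
      unfolding gs_beurling_top_def by (simp only: openin_topology_generated_by_iff)
    have "(\<lambda>_. 0) \<in> P \<longrightarrow> (\<exists>h>0. \<exists>e>0. \<forall>f\<in>?X. gs_norm s t h f < e \<longrightarrow> f \<in> P)"
      if "generate_topology_on {U \<inter> ?X | U h. 0 < h \<and> openin (gs_banach_top s t h) U} P" for P
      using that
    proof induction
      case Empty
      show ?case by simp
    next
      case (Int a b)
      show ?case
      proof
        assume "(\<lambda>_. 0) \<in> a \<inter> b"
        then obtain h e h' e' where *: "0 < h" "0 < e" "\<forall>f\<in>?X. gs_norm s t h f < e \<longrightarrow> f \<in> a"
            "0 < h'" "0 < e'" "\<forall>f\<in>?X. gs_norm s t h' f < e' \<longrightarrow> f \<in> b"
          using Int.IH by blast
        show "\<exists>h>0. \<exists>e>0. \<forall>f\<in>?X. gs_norm s t h f < e \<longrightarrow> f \<in> a \<inter> b"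
        proof (intro exI conjI ballI impI)
          show "0 < min h h'" "0 < min e e'" using * by auto
          fix f :: "real^'d \<Rightarrow> complex" assume f: "f \<in> ?X" "gs_norm s t (min h h') f < min e e'"
          have mb: "f \<in> gs_banach s t (min h h')" using * by (intro Xh f) auto
          have "gs_norm s t h f \<le> gs_norm s t (min h h') f" "gs_norm s t h' f \<le> gs_norm s t (min h h') f"
            using * by (intro gs_norm_mono mb; simp)+
          then show "f \<in> a \<inter> b" using * f by auto
        qed
      qed
    next
      case (UN K)
      then show ?case by blast
    next
      case (Basis P)
      show ?case
      proof
        assume zP: "(\<lambda>_. 0) \<in> P"
        obtain U h where U: "P = U \<inter> ?X" "0 < h" "openin (gs_banach_top s t h) U" using Basis by blast
        interpret M: Metric_space "gs_banach s t h :: (real^'d \<Rightarrow> complex) set" "gs_dist s t h" by (rule Metric_space_gs_banach[OF U(2)])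
        obtain e where e: "0 < e" "M.mball (\<lambda>_. 0) e \<subseteq> U"
          using U zP unfolding gs_banach_top_def M.openin_mtopology by blast
        show "\<exists>h>0. \<exists>e>0. \<forall>f\<in>?X. gs_norm s t h f < e \<longrightarrow> f \<in> P"
        proof (intro exI conjI ballI impI)
          fix f :: "real^'d \<Rightarrow> complex" assume f: "f \<in> ?X" "gs_norm s t h f < e"
          have fb: "f \<in> gs_banach s t h" by (rule Xh[OF f(1) U(2)])
          have "gs_dist s t h (\<lambda>_. 0) f = gs_dist s t h f (\<lambda>_. 0)" by (rule M.commute)
          also have "\<dots> = gs_norm s t h f"
            unfolding gs_dist_def if_P[OF conjI[OF fb zero_gs_banach[OF U(2)]]] by (simp only: diff_0_right)
          finally have "f \<in> M.mball (\<lambda>_. 0) e" using f fb zero_gs_banach[OF U(2)] by simp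
          then show "f \<in> P" using e U f by auto
        qed (use e U in auto)
      qed
    qed
    from this[OF gen] obtain h e where he: "0 < h" "0 < e" "\<forall>f\<in>?X. gs_norm s t h f < e \<longrightarrow> f \<in> {f \<in> ?X. u f \<in> ball 0 1}"
      using z linear_on_zero[OF L z] by auto
    have "bounded_on ?X s t h u"
      by (rule bounded_on_of_small[OF gs_beurling_lin gs_beurling_smooth L he(1,2)]) (use he in auto)
    then show "\<exists>h>0. bounded_on ?X s t h u" using he by blast
  next
    assume "\<exists>h>0. bounded_on ?X s t h u"
    then obtain h K where h: "0 < h" and K: "0 \<le> K" "\<forall>f\<in>?X. \<forall>B. (\<forall>\<mu>. gs_quot s t h f \<mu> \<le> B) \<longrightarrow> cmod (u f) \<le> K * B"
      unfolding bounded_on_def by blast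
    interpret M: Metric_space "gs_banach s t h :: (real^'d \<Rightarrow> complex) set" "gs_dist s t h" by (rule Metric_space_gs_banach[OF h])
    show "continuous_map (gs_beurling_top s t) euclidean u"
      unfolding continuous_map topspace_gs_beurling_top
    proof (intro conjI allI impI)
      fix U :: "complex set" assume U: "openin euclidean U"
      show "openin (gs_beurling_top s t) {f \<in> ?X. u f \<in> U}"
      proof (subst openin_subopen, intro ballI)
        fix f :: "real^'d \<Rightarrow> complex" assume f: "f \<in> {f \<in> ?X. u f \<in> U}"
        then have "open U" "u f \<in> U" using U by auto
        then obtain \<epsilon> where \<epsilon>: "0 < \<epsilon>" "ball (u f) \<epsilon> \<subseteq> U" by (rule openE)
        have fX: "f \<in> ?X" using f by simp
        define e where "e = \<epsilon> / (K + 1)"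
        have e: "0 < e" using \<epsilon> K by (simp add: e_def)
        have "openin (gs_beurling_top s t) (M.mball f e \<inter> ?X)"
          unfolding gs_beurling_top_def openin_topology_generated_by_iff
          by (rule generate_topology_on.Basis) (use h M.openin_mball in \<open>auto simp: gs_banach_top_def\<close>)
        moreover have "f \<in> M.mball f e \<inter> ?X" using fX e Xh[OF fX h] by simp
        moreover have "M.mball f e \<inter> ?X \<subseteq> {f \<in> ?X. u f \<in> U}"
        proof safe
          fix g :: "real^'d \<Rightarrow> complex" assume g: "g \<in> M.mball f e" "g \<in> ?X"
          have d: "(\<lambda>x. f x - g x) \<in> ?X" using gs_beurling_lin[OF fX g(2), of 1 "-1"] by simp
          have "gs_norm s t h (\<lambda>x. f x - g x) < e" using g Xh[OF fX h] Xh[OF g(2) h] by (simp add: gs_dist_def)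
          have "cmod (u (\<lambda>x. f x - g x)) \<le> K * gs_norm s t h (\<lambda>x. f x - g x)"
            using K(2) d gs_quot_le_norm[OF Xh[OF d h]] by blast
          also have "\<dots> \<le> (K + 1) * gs_norm s t h (\<lambda>x. f x - g x)"
            using gs_norm_nonneg[OF Xh[OF d h]] by (intro mult_right_mono) auto
          also have "\<dots> < \<epsilon>" using \<open>gs_norm s t h (\<lambda>x. f x - g x) < e\<close> K
            by (simp add: e_def pos_less_divide_eq mult.commute add_nonneg_pos)
          finally have "cmod (u f - u g) < \<epsilon>" by (simp add: linear_on_diff[OF L fX g(2)])
          then show "u g \<in> U" using \<epsilon>(2) by (auto simp: dist_norm)
        qed
        ultimately show "\<exists>T. openin (gs_beurling_top s t) T \<and> f \<in> T \<and> T \<subseteq> {f \<in> ?X. u f \<in> U}" by blast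
      qed
    qed auto
  qed
  with cd show ?thesis by blast
qed

section \<open>Levels and rates\<close>

text \<open>The predicate records that atoms at level \<open>h\<close> grow with rate at most \<open>r\<close>. The dimension occurs in the bound
  variables only and is therefore passed as a type.\<close>

definition atom_control :: "real \<Rightarrow> real \<Rightarrow> real \<Rightarrow> real \<Rightarrow> 'd::finite itself \<Rightarrow> bool" where
  "atom_control s t h r _ \<longleftrightarrow>
    (\<exists>C>0. \<forall>(z :: (real^'d) \<times> (real^'d)) \<mu>. gs_quot s t h (atom z) \<mu> \<le> C * exp_weight s t r z)"

definition decay_control :: "real \<Rightarrow> real \<Rightarrow> real \<Rightarrow> real \<Rightarrow> 'd::finite itself \<Rightarrow> bool" where
  "decay_control s t h r _ \<longleftrightarrow>
    (\<exists>C>0. \<forall>(f :: real^'d \<Rightarrow> complex) N z. smooth_fun f \<longrightarrow> (\<forall>\<mu>. gs_quot s t h f \<mu> \<le> N) \<longrightarrow>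
      cmod (stft_fun f z) \<le> C * N * exp_weight s t (- r) z)"

lemma atom_control_roumieu:
  assumes st: "1 / 2 \<le> s" "1 / 2 \<le> t" and r: "0 < r"
  shows "\<exists>h>0. atom_control s t h r TYPE('d::finite)"
proof -
  define R where "R = max ((s / (r / CARD('d))) powr s) ((t / (r / CARD('d))) powr t)"
  have R: "(s / (r / CARD('d))) powr s \<le> R" "(t / (r / CARD('d))) powr t \<le> R" by (simp_all add: R_def)
  have R0: "0 \<le> R" using order_trans[OF powr_ge_zero R(1)] .
  show ?thesis
    unfolding atom_control_def
    apply (rule exI[of _ "R + 5"], rule conjI)
    subgoal using R0 by simp
    subgoal by (rule gs_quot_atom_bound[OF absorbs_gauss_ge_half[OF st(1)] absorbs_gauss_ge_half[OF st(2)] r R]) blast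
    done
qed

text \<open>The level \<open>h\<close> is divided equally between the Gaussian and the powers of the arguments; the latter force
  a large rate.\<close>

lemma atom_control_beurling:
  assumes st: "1 / 2 < s" "1 / 2 < t" and h: "0 < h"
  shows "\<exists>r>0. atom_control s t h r TYPE('d::finite)"
proof -
  define b where "b = h / 2"
  have b: "0 < b" "b + b = h" using h by (auto simp: b_def)
  have small: "(q / (r / CARD('d))) powr q \<le> b" if "1 / 2 < q" "q * CARD('d) / b powr (1 / q) \<le> r" for q r :: real
  proof -
    have q: "0 < q" using that by simp
    have r: "0 < r" using less_le_trans[OF _ that(2), of 0] q b by simp
    have "q / (r / CARD('d)) \<le> b powr (1 / q)" using that(2) r b by (simp add: field_simps)
    then have "(q / (r / CARD('d))) powr q \<le> (b powr (1 / q)) powr q" using q r by (intro powr_mono2) auto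
    also have "\<dots> = b" using b q by (simp add: powr_powr)
    finally show ?thesis .
  qed
  define r where "r = max (s * CARD('d) / b powr (1 / s)) (t * CARD('d) / b powr (1 / t))"
  have R: "(s / (r / CARD('d))) powr s \<le> b" "(t / (r / CARD('d))) powr t \<le> b"
    using small[OF st(1), of r] small[OF st(2), of r] by (simp_all add: r_def)
  have r: "0 < r" using st b by (auto simp: r_def less_max_iff_disj)
  show ?thesis
    unfolding atom_control_def
    apply (rule exI[of _ r], rule conjI[OF r])
    apply (rule gs_quot_atom_bound[OF absorbs_gauss_gt_half[OF st(1) b(1)] absorbs_gauss_gt_half[OF st(2) b(1)] r R])
    unfolding b(2) by blast
qed

lemma decay_rate_pos: "0 < d \<Longrightarrow> 0 < u \<Longrightarrow> 0 < H \<Longrightarrow> 0 < decay_rate d u H"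
  by (simp add: decay_rate_def)

lemma decay_control_roumieu:
  assumes st: "1 / 2 \<le> s" "1 / 2 \<le> t" and h: "0 < h"
  shows "\<exists>r>0. decay_control s t h r TYPE('d::finite)"
proof -
  define r where "r = min (decay_rate CARD('d) s (h + 5)) (decay_rate CARD('d) t (h + 5))"
  have r: "0 < r" "r \<le> decay_rate CARD('d) s (h + 5)" "r \<le> decay_rate CARD('d) t (h + 5)"
    using st h by (auto simp: r_def intro!: decay_rate_pos)
  show ?thesis
    unfolding decay_control_def
    apply (rule exI[of _ r], rule conjI[OF r(1)])
    apply (rule stft_fun_decay[OF absorbs_gauss_ge_half[OF st(1)] absorbs_gauss_ge_half[OF st(2)] h r(2,3)])
    by blast
qed

text \<open>The rate \<open>decay_rate\<close> is unbounded as the level tends to zero.\<close>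

lemma decay_control_beurling:
  assumes st: "1 / 2 < s" "1 / 2 < t"
  shows "\<exists>h>0. decay_control s t h r TYPE('d::finite)"
proof -
  have large: "\<exists>h>0. \<forall>h'. 0 < h' \<longrightarrow> h' \<le> h \<longrightarrow> r \<le> decay_rate CARD('d) q (h' + h')" if q: "1 / 2 < q" for q
  proof -
    define k where "k = q * (1 / CARD('d)) powr (1 / q) / 4"
    have k: "0 < k" using q by (simp add: k_def)
    define H where "H = (k / (\<bar>r\<bar> + 1)) powr q"
    have H: "0 < H" using k by (simp add: H_def)
    have "r \<le> decay_rate CARD('d) q (h' + h')" if h': "0 < h'" "h' \<le> H / 2" for h'
    proof -
      have "r \<le> \<bar>r\<bar> + 1" by simp
      also have "\<dots> = k * H powr (- 1 / q)"
        using q k by (simp add: H_def powr_powr powr_minus powr_divide field_simps)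
      also have "\<dots> \<le> k * (h' + h') powr (- 1 / q)"
        using h' q k by (intro mult_left_mono powr_mono2') auto
      also have "\<dots> = decay_rate CARD('d) q (h' + h')" by (simp add: decay_rate_def k_def mult_ac)
      finally show ?thesis .
    qed
    then show ?thesis using H by (intro exI[of _ "H / 2"]) auto
  qed
  obtain h1 where h1: "0 < h1" "\<forall>h'. 0 < h' \<longrightarrow> h' \<le> h1 \<longrightarrow> r \<le> decay_rate CARD('d) s (h' + h')" using large[OF st(1)] by blast
  obtain h2 where h2: "0 < h2" "\<forall>h'. 0 < h' \<longrightarrow> h' \<le> h2 \<longrightarrow> r \<le> decay_rate CARD('d) t (h' + h')" using large[OF st(2)] by blast
  define h where "h = min h1 h2"
  have h: "0 < h" using h1 h2 by (simp add: h_def)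
  have r: "r \<le> decay_rate CARD('d) s (h + h)" "r \<le> decay_rate CARD('d) t (h + h)"
    using h1 h2 h by (auto simp: h_def)
  show ?thesis
    unfolding decay_control_def
    apply (rule exI[of _ h], rule conjI[OF h])
    apply (rule stft_fun_decay[OF absorbs_gauss_gt_half[OF st(1) h] absorbs_gauss_gt_half[OF st(2) h] h r])
    by blast
qed

lemma coh_bounded_of_atom_control:
  assumes ac: "atom_control s t h r TYPE('d::finite)" and pos: "0 < h" "0 < s" "0 < t" "0 < r"
  shows "\<exists>M>0. \<forall>(w :: complex^'d) \<mu>. norm w \<le> \<rho> \<longrightarrow> cmod (gs_fun s t h \<mu> (coh w)) \<le> M"
proof -
  obtain C where C: "0 < C" "\<And>(z :: (real^'d) \<times> (real^'d)) \<mu>. gs_quot s t h (atom z) \<mu> \<le> C * exp_weight s t r z"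
    using ac unfolding atom_control_def by blast
  show ?thesis by (rule coh_bounded[OF C(2,1) pos, of \<rho>]) blast
qed

lemma coh_banach:
  assumes ac: "atom_control s t h r TYPE('d::finite)" and pos: "0 < h" "0 < s" "0 < t" "0 < r"
  shows "coh (w :: complex^'d) \<in> gs_banach s t h"
proof -
  obtain M where M: "\<And>(w' :: complex^'d) \<mu>. norm w' \<le> norm w \<Longrightarrow> cmod (gs_fun s t h \<mu> (coh w')) \<le> M"
    using coh_bounded_of_atom_control[OF assms, of "norm w"] by blast
  show ?thesis by (rule gs_banachI[OF smooth_fun_coh, of _ _ _ _ M]) (simp add: gs_quot_eq_norm_gs_fun[OF pos(1)] M)
qed

lemma coh_roumieu:
  assumes "1 / 2 \<le> s" "1 / 2 \<le> t"
  shows "coh w \<in> gs_roumieu s t"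
proof -
  obtain h where "0 < h" "atom_control s t h 1 TYPE('a)" using atom_control_roumieu[OF assms, of 1] by auto
  then show ?thesis using coh_banach[of s t h 1 w] assms by (auto simp: gs_roumieu_def)
qed

lemma coh_beurling:
  assumes "1 / 2 < s" "1 / 2 < t"
  shows "coh (w :: complex^'d::finite) \<in> gs_beurling s t"
  unfolding gs_beurling_def
proof (rule INT_I)
  fix h :: real assume h: "h \<in> {0<..}"
  then obtain r where "0 < r" "atom_control s t h r TYPE('d)" using atom_control_beurling[OF assms, of h] by auto
  then show "coh w \<in> gs_banach s t h" using coh_banach[of s t h r w] assms h by auto
qed

lemma S_half_le_roumieu: "1 / 2 \<le> s \<Longrightarrow> 1 / 2 \<le> t \<Longrightarrow> S_half \<subseteq> gs_roumieu s t"
  unfolding gs_roumieu_def using gs_banach_mono[of _ _ "1/2" s "1/2" t] by fastforce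

lemma S_half_le_beurling:
  assumes "1 / 2 < s" "1 / 2 < t"
  shows "S_half \<subseteq> (gs_beurling s t :: (real^'d::finite \<Rightarrow> complex) set)"
proof
  fix f :: "real^'d \<Rightarrow> complex" assume "f \<in> S_half"
  then obtain h where h: "0 < h" "f \<in> gs_banach (1/2) (1/2) h" by (auto simp: gs_roumieu_def)
  have "f \<in> gs_banach s t h'" if h': "0 < h'" for h'
  proof -
    obtain C where C: "0 < C" "\<And>(f :: real^'d \<Rightarrow> complex) \<mu>. gs_quot s t h' f \<mu> \<le> C * gs_quot (1/2) (1/2) h f \<mu>"
      by (rule gs_quot_gain[OF h(1) h' assms]) blast
    show ?thesis
    proof (rule gs_banachI)
      show "smooth_fun f" using h by (simp add: gs_banach_def)
      show "gs_quot s t h' f \<mu> \<le> C * gs_norm (1/2) (1/2) h f" for \<mu>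
        using order_trans[OF C(2) mult_left_mono[OF gs_quot_le_norm[OF h(2)]]] C(1) by (metis less_imp_le)
    qed
  qed
  then show "f \<in> gs_beurling s t" by (simp add: gs_beurling_def)
qed

section \<open>The pairing identity\<close>

lemma integral_flip:
  fixes F :: "(real^'d::finite) \<times> (real^'d) \<Rightarrow> complex"
  assumes F: "integrable lborel F" "integrable lborel (\<lambda>z. F (flip z))"
  shows "(LINT z|lborel. F (flip z)) = (LINT z|lborel. F z)"
proof -
  have F': "integrable (lborel \<Otimes>\<^sub>M lborel) F" "integrable (lborel \<Otimes>\<^sub>M lborel) (\<lambda>z. F (flip z))"
    using F by (simp_all add: lborel_prod)
  have "(LINT z|lborel. F (flip z)) = (LINT x|lborel. LINT \<xi>|lborel. F (flip (x, \<xi>)))"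
    unfolding lborel_prod[symmetric] using lborel_pair.integral_fst'[OF F'(2)] by simp
  also have "\<dots> = (LINT x|lborel. LINT \<xi>|lborel. F (x, \<xi>))"
  proof (rule Bochner_Integration.integral_cong[OF refl])
    fix x :: "real^'d"
    show "(LINT \<xi>|lborel. F (flip (x, \<xi>))) = (LINT \<xi>|lborel. F (x, \<xi>))"
    proof -
      have [measurable]: "F \<in> borel_measurable (borel \<Otimes>\<^sub>M borel)"
        using borel_measurable_integrable[OF F(1)] by (simp add: borel_prod)
      have "(\<lambda>\<xi>. F (x, \<xi>)) \<in> borel_measurable borel" by measurable
      then have "(LINT \<xi>|distr lborel borel uminus. F (x, \<xi>)) = (LINT \<xi>|lborel. F (x, - \<xi>))"
        by (intro integral_distr) auto
      moreover have "distr lborel borel uminus = (lborel :: (real^'d) measure)"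
        using lborel_affine[of "-1" "0 :: real^'d"] by (simp add: density_1 one_ennreal_def[symmetric])
      ultimately show ?thesis by (simp add: flip_def)
    qed
  qed
  also have "\<dots> = (LINT z|lborel. F z)"
    unfolding lborel_prod[symmetric] using lborel_pair.integral_fst'[OF F'(1)] by simp
  finally show ?thesis .
qed

lemma synth_adjoint:
  fixes H :: "(real^'d::finite) \<times> (real^'d) \<Rightarrow> complex" and g :: "real^'d \<Rightarrow> complex"
  assumes H: "integrable lborel H" and g: "integrable lborel g"
  shows "(LINT y|lborel. synth H y * g y) = (LINT z|lborel. H z * stft_fun g z)"
proof -
  define c where "c = complex_of_real ((2 * pi) powr (- real CARD('d) / 2))"
  have [measurable]: "H \<in> borel_measurable borel" "g \<in> borel_measurable borel"
    using borel_measurable_integrable[OF H] borel_measurable_integrable[OF g] by simp_all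
  have meas: "(\<lambda>p. H (fst p) * g (snd p) * atom (fst p) (snd p)) \<in> borel_measurable (lborel \<Otimes>\<^sub>M lborel)"
  proof -
    have [measurable]: "(\<lambda>p. atom (fst p) (snd p)) \<in> borel_measurable ((borel :: ((real^'d) \<times> (real^'d)) measure) \<Otimes>\<^sub>M borel)"
      by (rule atom_measurable_pair)
    have "(\<lambda>p. H (fst p) * g (snd p) * atom (fst p) (snd p)) \<in> borel_measurable (borel \<Otimes>\<^sub>M borel)" by measurable
    then show ?thesis by simp
  qed
  have ga: "integrable lborel (\<lambda>y. g y * atom z y)" for z
  proof (rule Bochner_Integration.integrable_bound[OF g])
    show "AE y in lborel. norm (g y * atom z y) \<le> norm (g y)"
      unfolding norm_mult by (intro AE_I2 mult_right_le_one_le norm_atom_le_1) auto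
  qed measurable
  have prodint: "integrable (lborel \<Otimes>\<^sub>M lborel) (\<lambda>p. H (fst p) * g (snd p) * atom (fst p) (snd p))"
  proof (rule lborel_pair.Fubini_integrable)
    show "(\<lambda>p. H (fst p) * g (snd p) * atom (fst p) (snd p)) \<in> borel_measurable (lborel \<Otimes>\<^sub>M lborel)" by (rule meas)
    show "integrable lborel (\<lambda>z. LINT y|lborel. norm (H (fst (z, y)) * g (snd (z, y)) * atom (fst (z, y)) (snd (z, y))))"
    proof (rule Bochner_Integration.integrable_bound[OF integrable_mult_left[OF integrable_norm[OF H], of "LINT y|lborel. norm (g y)"]])
      have "(\<lambda>p. norm (H (fst p) * g (snd p) * atom (fst p) (snd p))) \<in> borel_measurable (lborel \<Otimes>\<^sub>M lborel)"
        by (rule measurable_compose[OF meas borel_measurable_norm])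
      from lborel.borel_measurable_lebesgue_integral[of "\<lambda>z y. norm (H (fst (z, y)) * g (snd (z, y)) * atom (fst (z, y)) (snd (z, y)))" lborel] this
      show "(\<lambda>z. LINT y|lborel. norm (H (fst (z, y)) * g (snd (z, y)) * atom (fst (z, y)) (snd (z, y)))) \<in> borel_measurable lborel"
        by (simp add: case_prod_unfold)
      show "AE z in lborel. norm (LINT y|lborel. norm (H (fst (z, y)) * g (snd (z, y)) * atom (fst (z, y)) (snd (z, y)))) \<le>
          norm (norm (H z) * (LINT y|lborel. norm (g y)))"
      proof (intro AE_I2)
        fix z
        have "(LINT y|lborel. norm (H z * g y * atom z y)) \<le> (LINT y|lborel. norm (H z) * norm (g y))"
        proof (rule integral_mono)
          show "integrable lborel (\<lambda>y. norm (H z * g y * atom z y))"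
            using integrable_mult_right[OF ga[of z], of "H z"] by (intro integrable_norm) (simp only: mult.assoc)
          show "integrable lborel (\<lambda>y. norm (H z) * norm (g y))" using g by (intro integrable_mult_right integrable_norm)
          show "norm (H z * g y * atom z y) \<le> norm (H z) * norm (g y)" for y
            unfolding norm_mult by (intro mult_right_le_one_le norm_atom_le_1) auto
        qed
        then show "norm (LINT y|lborel. norm (H (fst (z, y)) * g (snd (z, y)) * atom (fst (z, y)) (snd (z, y)))) \<le>
          norm (norm (H z) * (LINT y|lborel. norm (g y)))"
          by (simp add: abs_mult)
      qed
    qed
    show "AE z in lborel. integrable lborel (\<lambda>y. H (fst (z, y)) * g (snd (z, y)) * atom (fst (z, y)) (snd (z, y)))"
    proof (intro AE_I2)
      fix z
      show "integrable lborel (\<lambda>y. H (fst (z, y)) * g (snd (z, y)) * atom (fst (z, y)) (snd (z, y)))"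
        using integrable_mult_right[OF ga[of z], of "H z"] by (simp add: mult.assoc)
    qed
  qed
  have "(LINT y|lborel. synth H y * g y) = (LINT y|lborel. c * (LINT z|lborel. H z * g y * atom z y))"
  proof (rule Bochner_Integration.integral_cong[OF refl])
    fix y
    have "(LINT z|lborel. H z * g y * atom z y) = (LINT z|lborel. H z * atom z y * g y)" by (simp only: mult_ac)
    also have "\<dots> = (LINT z|lborel. H z * atom z y) * g y" by (rule integral_mult_left_zero)
    finally show "synth H y * g y = c * (LINT z|lborel. H z * g y * atom z y)" by (simp add: synth_def c_def)
  qed
  also have "\<dots> = c * (LINT y|lborel. LINT z|lborel. H z * g y * atom z y)" by (rule integral_mult_right_zero)
  also have "(LINT y|lborel. LINT z|lborel. H z * g y * atom z y) = (LINT z|lborel. LINT y|lborel. H z * g y * atom z y)"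
    using lborel_pair.Fubini_integral[of "\<lambda>z y. H z * g y * atom z y"] prodint by (simp add: case_prod_unfold)
  also have "c * \<dots> = (LINT z|lborel. c * (LINT y|lborel. H z * g y * atom z y))" by (rule integral_mult_right_zero[symmetric])
  also have "\<dots> = (LINT z|lborel. H z * stft_fun g z)"
  proof (rule Bochner_Integration.integral_cong[OF refl])
    fix z
    have "(LINT y|lborel. H z * g y * atom z y) = H z * (LINT y|lborel. g y * atom z y)"
      unfolding mult.assoc by (rule integral_mult_right_zero)
    then show "c * (LINT y|lborel. H z * g y * atom z y) = H z * stft_fun g z" by (simp add: stft_fun_def c_def)
  qed
  finally show ?thesis .
qed

lemma gs_banach_integrable:
  fixes f :: "real^'d::finite \<Rightarrow> complex"
  assumes h: "0 < h" and f: "f \<in> gs_banach s t h"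
  shows "integrable lborel f"
proof -
  obtain C where C: "0 < C" "\<And>(f :: real^'d \<Rightarrow> complex) s N y. (\<And>\<mu>. gs_quot s t h f \<mu> \<le> N) \<Longrightarrow> cmod (f y) \<le> C * N * inv_poly y"
    by (rule gs_inv_poly_bound[OF h, of t]) blast
  have b: "cmod (f y) \<le> C * gs_norm s t h f * inv_poly y" for y
    by (rule C(2)) (rule gs_quot_le_norm[OF f])
  have "integrable lborel (\<lambda>y :: real^'d. C * gs_norm s t h f * inv_poly y)" by (intro integrable_mult_right integrable_inv_poly)
  then show ?thesis
  proof (rule Bochner_Integration.integrable_bound)
    show "f \<in> borel_measurable lborel" using smooth_fun_measurable0[of f] f by (simp add: gs_banach_def)
    show "AE y in lborel. norm (f y) \<le> norm (C * gs_norm s t h f * inv_poly y)"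
      using order_trans[OF b abs_ge_self] by (intro AE_I2) simp
  qed
qed

lemma stft_fun_inversion:
  fixes f :: "real^'d::finite \<Rightarrow> complex"
  assumes h: "0 < h" and f: "f \<in> gs_banach s t h" and dc: "decay_control s t h r TYPE('d)" and st: "0 < s" "0 < t" "0 < r"
  shows "f = synth (\<lambda>z. stft_fun f (flip z))"
proof -
  obtain C where C: "\<And>(f :: real^'d \<Rightarrow> complex) N z. smooth_fun f \<Longrightarrow> (\<forall>\<mu>. gs_quot s t h f \<mu> \<le> N) \<Longrightarrow>
      cmod (stft_fun f z) \<le> C * N * exp_weight s t (- r) z"
    using dc unfolding decay_control_def by blast
  have sm: "smooth_fun f" using f by (simp add: gs_banach_def)
  show ?thesis
  proof (rule stft_inversion[OF gs_banach_integrable[OF h f] smooth_fun_continuous0[OF sm] norm_le_gs_norm[OF f] st])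
    show "cmod (stft_fun f z) \<le> (C * gs_norm s t h f) * exp_weight s t (- r) z" for z
      by (rule C[OF sm]) (use gs_quot_le_norm[OF f] in blast)
  qed
qed

lemma stft_fun_decay_banach:
  fixes f :: "real^'d::finite \<Rightarrow> complex"
  assumes f: "f \<in> gs_banach s t h" and dc: "decay_control s t h r TYPE('d)"
  obtains A where "\<And>z. cmod (stft_fun f z) \<le> A * exp_weight s t (- r) z"
proof -
  obtain C where C: "\<And>(f :: real^'d \<Rightarrow> complex) N z. smooth_fun f \<Longrightarrow> (\<forall>\<mu>. gs_quot s t h f \<mu> \<le> N) \<Longrightarrow>
      cmod (stft_fun f z) \<le> C * N * exp_weight s t (- r) z"
    using dc unfolding decay_control_def by blast
  have sm: "smooth_fun f" using f by (simp add: gs_banach_def)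
  show thesis
    by (rule that[of "C * gs_norm s t h f"], rule C[OF sm]) (use gs_quot_le_norm[OF f] in blast)
qed

context gs_functional begin

lemma stft_bound_of_atom_control:
  assumes ac: "atom_control s t h r TYPE('d)"
  obtains A where "0 \<le> A" "\<And>z. cmod (stft u z) \<le> A * exp_weight s t r z"
proof -
  obtain C where C: "0 < C" "\<And>(z :: (real^'d) \<times> (real^'d)) \<mu>. gs_quot s t h (atom z) \<mu> \<le> C * exp_weight s t r z"
    using ac unfolding atom_control_def by blast
  define c where "c = (2 * pi) powr (- real CARD('d) / 2)"
  have c: "0 \<le> c" by (simp add: c_def)
  have "cmod (stft u z) \<le> c * K * C * exp_weight s t r z" for z
  proof -
    have "cmod (u (atom z)) \<le> K * (C * exp_weight s t r z)"
      by (rule u_bound[OF atom_D]) (simp add: C(2) gs_quot_eq_norm_gs_fun[OF st(3), symmetric])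
    then have "c * cmod (u (atom z)) \<le> c * (K * (C * exp_weight s t r z))" using c by (rule mult_left_mono)
    then show ?thesis using c unfolding stft_eq_atom c_def[symmetric] norm_mult by (simp add: mult_ac)
  qed
  moreover have "0 \<le> c * K * C" using c K C by simp
  ultimately show ?thesis by (rule that[rotated])
qed

text \<open>By inversion \<open>g\<close> is a superposition of atoms, and \<open>u\<close> may be applied under the integral.\<close>

lemma pairing_identity:
  assumes g: "g \<in> D" "g \<in> gs_banach s t h'" "0 < h'" and dc: "decay_control s t h' r1 TYPE('d)"
    and ac: "atom_control s t h r2 TYPE('d)" and r: "r2 < r1" "0 < r1"
  shows "u g = (LINT z|lborel. stft_fun g (flip z) * stft u z)"
proof -
  obtain C where C: "0 < C" "\<And>(z :: (real^'d) \<times> (real^'d)) \<mu>. gs_quot s t h (atom z) \<mu> \<le> C * exp_weight s t r2 z"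
    using ac unfolding atom_control_def by blast
  obtain A where A: "\<And>z. cmod (stft_fun g z) \<le> A * exp_weight s t (- r1) z"
    by (rule stft_fun_decay_banach[OF g(2) dc]) blast
  let ?H = "\<lambda>z. stft_fun g (flip z)"
  have g_eq: "g = synth ?H" by (rule stft_fun_inversion[OF g(3,2) dc st(1,2) r(2)])
  have [measurable]: "stft_fun g \<in> borel_measurable borel"
    using D_smooth[OF g(1)] by (intro stft_fun_measurable smooth_fun_measurable0)
  have Hm: "?H \<in> borel_measurable borel" by measurable
  have Hb: "cmod (?H z) \<le> A * exp_weight s t (- r1) z" for z using A[of "flip z"] by (simp add: exp_weight_flip)
  have "u g = u (synth ?H)" using g_eq by simp
  also have "\<dots> = of_real ((2*pi) powr (-real CARD('d)/2)) * (LINT z|lborel. ?H z * u (atom z))"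
    by (rule functional_of_synth[OF Hm Hb C(2) r]) (use g_eq g in simp)
  also have "\<dots> = (LINT z|lborel. of_real ((2*pi) powr (-real CARD('d)/2)) * (?H z * u (atom z)))"
    by (rule integral_mult_right_zero[symmetric])
  also have "\<dots> = (LINT z|lborel. ?H z * stft u z)" unfolding stft_eq_atom by (simp only: mult_ac)
  finally show ?thesis .
qed

end

section \<open>Functionals and functions with a given transform\<close>

lemma gs_functional_of_bounded:
  fixes u :: "(real^'d::finite \<Rightarrow> complex) \<Rightarrow> complex"
  assumes pos: "0 < h" "0 < s" "0 < t" "0 < r"
    and X: "\<And>f. f \<in> X \<Longrightarrow> smooth_fun f" "\<And>f g a b. f \<in> X \<Longrightarrow> g \<in> X \<Longrightarrow> (\<lambda>x. a * f x + b * g x) \<in> X" "\<And>w. coh w \<in> X"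
    and u: "linear_on X u" "bounded_on X s t h u" and ac: "atom_control s t h r TYPE('d)"
  shows "\<exists>K. gs_functional s t h K X u"
proof -
  obtain K where K: "0 \<le> K" "\<forall>f\<in>X. \<forall>B. (\<forall>\<mu>. gs_quot s t h f \<mu> \<le> B) \<longrightarrow> cmod (u f) \<le> K * B"
    using u(2) unfolding bounded_on_def by blast
  have "gs_functional s t h K X u"
  proof (unfold_locales)
    show "cmod (u f) \<le> K * B" if "f \<in> X" "\<And>\<mu>. cmod (gs_fun s t h \<mu> f) \<le> B" for f B
      using K(2) that by (simp add: gs_quot_eq_norm_gs_fun[OF pos(1)])
    show "\<exists>M>0. \<forall>(w :: complex^'d) \<mu>. norm w \<le> \<rho> \<longrightarrow> cmod (gs_fun s t h \<mu> (coh w)) \<le> M" for \<rho>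
      by (rule coh_bounded_of_atom_control[OF ac pos])
  qed (use pos X K linear_onD[OF u(1)] in \<open>assumption | blast\<close>)+
  then show ?thesis by blast
qed

lemma gs_functional_roumieu:
  fixes u :: "(real^'d::finite \<Rightarrow> complex) \<Rightarrow> complex"
  assumes st: "1 / 2 \<le> s" "1 / 2 \<le> t" and u: "u \<in> gs_roumieu_dual s t" and r: "0 < r"
  obtains h K where "gs_functional s t h K (gs_roumieu s t) u" "atom_control s t h r TYPE('d)"
proof -
  obtain h where h: "0 < h" "atom_control s t h r TYPE('d)" using atom_control_roumieu[OF st r] by blast
  have pos: "0 < s" "0 < t" using st by auto
  have "linear_on (gs_roumieu s t) u" "bounded_on (gs_roumieu s t) s t h u" using u h(1) by (simp_all add: gs_roumieu_dual_iff)
  then have "\<exists>K. gs_functional s t h K (gs_roumieu s t) u"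
    by (intro gs_functional_of_bounded[OF h(1) pos r _ _ _ _ _ h(2)])
       (erule gs_roumieu_smooth, erule (1) gs_roumieu_lin, rule coh_roumieu[OF st])
  then obtain K where "gs_functional s t h K (gs_roumieu s t) u" ..
  then show thesis using h(2) by (rule that)
qed

lemma gs_functional_beurling:
  fixes u :: "(real^'d::finite \<Rightarrow> complex) \<Rightarrow> complex"
  assumes st: "1 / 2 < s" "1 / 2 < t" and u: "u \<in> gs_beurling_dual s t"
  obtains h K r where "0 < r" "gs_functional s t h K (gs_beurling s t) u" "atom_control s t h r TYPE('d)"
proof -
  obtain h where h: "0 < h" "bounded_on (gs_beurling s t) s t h u" using u by (auto simp: gs_beurling_dual_iff)
  obtain r where r: "0 < r" "atom_control s t h r TYPE('d)" using atom_control_beurling[OF st h(1)] by blast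
  have pos: "0 < s" "0 < t" using st by auto
  have "linear_on (gs_beurling s t) u" using u by (simp add: gs_beurling_dual_iff)
  then have "\<exists>K. gs_functional s t h K (gs_beurling s t) u"
    by (intro gs_functional_of_bounded[OF h(1) pos r(1) _ _ _ _ h(2) r(2)])
       (erule gs_beurling_smooth, erule (1) gs_beurling_lin, rule coh_beurling[OF st])
  then obtain K where "gs_functional s t h K (gs_beurling s t) u" ..
  with r(1) show thesis using r(2) by (rule that)
qed

lemma pairing_roumieu:
  fixes u :: "(real^'d::finite \<Rightarrow> complex) \<Rightarrow> complex"
  assumes st: "1 / 2 \<le> s" "1 / 2 \<le> t" and u: "u \<in> gs_roumieu_dual s t" and g: "g \<in> gs_roumieu s t"
  shows "u g = (LINT z|lborel. stft_fun g (flip z) * stft u z)"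
proof -
  obtain h' where h': "0 < h'" "g \<in> gs_banach s t h'" using g by (auto simp: gs_roumieu_def)
  obtain r1 where r1: "0 < r1" "decay_control s t h' r1 TYPE('d)" using decay_control_roumieu[OF st h'(1)] by blast
  have "0 < r1 / 2" using r1 by simp
  then obtain h K where f: "gs_functional s t h K (gs_roumieu s t) u" and ac: "atom_control s t h (r1 / 2) TYPE('d)"
    by (rule gs_functional_roumieu[OF st u])
  show ?thesis by (rule gs_functional.pairing_identity[OF f g h'(2,1) r1(2) ac]) (use r1 in auto)
qed

lemma pairing_beurling:
  fixes u :: "(real^'d::finite \<Rightarrow> complex) \<Rightarrow> complex"
  assumes st: "1 / 2 < s" "1 / 2 < t" and u: "u \<in> gs_beurling_dual s t" and g: "g \<in> gs_beurling s t"
  shows "u g = (LINT z|lborel. stft_fun g (flip z) * stft u z)"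
proof -
  obtain h K r where r: "0 < r" and f: "gs_functional s t h K (gs_beurling s t) u" and ac: "atom_control s t h r TYPE('d)"
    by (rule gs_functional_beurling[OF st u])
  obtain h' where h': "0 < h'" "decay_control s t h' (r + 1) TYPE('d)" using decay_control_beurling[OF st] by blast
  have "g \<in> gs_banach s t h'" using g h' by (auto simp: gs_beurling_def)
  from gs_functional.pairing_identity[OF f g this h' ac] r show ?thesis by auto
qed

lemma atom_roumieu:
  assumes "1 / 2 \<le> s" "1 / 2 \<le> t"
  shows "atom z \<in> gs_roumieu s t"
  unfolding atom_eq_coh
  using gs_roumieu_lin[OF coh_roumieu[OF assms] coh_roumieu[OF assms], of _ "cvec z" 0 "cvec z"] by simp

lemma atom_S_half: "atom z \<in> S_half"
  by (rule atom_roumieu) auto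

lemma stft_distr_of_dual: "stft (distr_of_dual u) = stft u"
  by (rule ext) (simp only: stft_eq_atom distr_of_dual_def restrict_apply' atom_S_half)

lemma stft_distr_of_fun: "stft (distr_of_fun f) = stft_fun f"
  by (rule ext) (simp only: stft_eq_atom distr_of_fun_def restrict_apply' atom_S_half stft_fun_def)

lemma integrable_mult_gs:
  fixes f g :: "real^'d::finite \<Rightarrow> complex"
  assumes f: "integrable lborel f" and g: "g \<in> gs_banach s t h"
  shows "integrable lborel (\<lambda>y. f y * g y)"
proof (rule Bochner_Integration.integrable_bound[OF integrable_mult_left[OF f, of "complex_of_real (gs_norm s t h g)"]])
  have [measurable]: "g \<in> borel_measurable borel" using g by (auto simp: gs_banach_def intro: smooth_fun_measurable0)
  show "(\<lambda>y. f y * g y) \<in> borel_measurable lborel" using borel_measurable_integrable[OF f] by simp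
  show "AE y in lborel. norm (f y * g y) \<le> norm (f y * complex_of_real (gs_norm s t h g))"
    unfolding norm_mult norm_of_real
    by (intro AE_I2 mult_left_mono order_trans[OF norm_le_gs_norm[OF g] abs_ge_self]) auto
qed

lemma distr_of_fun_in_dual:
  fixes f :: "real^'d::finite \<Rightarrow> complex"
  assumes f: "integrable lborel f"
  shows "distr_of_fun f \<in> S_half_dual"
  unfolding gs_roumieu_dual_iff
proof (intro conjI allI impI)
  show "distr_of_fun f \<in> extensional S_half" by (simp add: distr_of_fun_def)
  have int: "integrable lborel (\<lambda>y. f y * g y)" if "g \<in> S_half" for g
    using that integrable_mult_gs[OF f] by (auto simp: gs_roumieu_def)
  show "linear_on S_half (distr_of_fun f)"
    unfolding linear_on_def
  proof (intro ballI allI)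
    fix g k :: "real^'d \<Rightarrow> complex" and a b assume gk: "g \<in> S_half" "k \<in> S_half"
    have "(LINT y|lborel. f y * (a * g y + b * k y)) = (LINT y|lborel. a * (f y * g y) + b * (f y * k y))"
      by (simp only: algebra_simps)
    also have "\<dots> = a * (LINT y|lborel. f y * g y) + b * (LINT y|lborel. f y * k y)"
      using int[OF gk(1)] int[OF gk(2)] by (subst Bochner_Integration.integral_add) auto
    finally show "distr_of_fun f (\<lambda>x. a * g x + b * k x) = a * distr_of_fun f g + b * distr_of_fun f k"
      using gk gs_roumieu_lin[OF gk] by (simp add: distr_of_fun_def)
  qed
  fix h :: real assume h: "0 < h"
  show "bounded_on S_half (1/2) (1/2) h (distr_of_fun f)"
    unfolding bounded_on_def
  proof (intro exI conjI ballI allI impI)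
    show "0 \<le> (LINT y|lborel. cmod (f y))" by simp
    fix g :: "real^'d \<Rightarrow> complex" and B assume g: "g \<in> S_half" and B: "\<forall>\<mu>. gs_quot (1/2) (1/2) h g \<mu> \<le> B"
    have gb: "g \<in> gs_banach (1/2) (1/2) h" by (rule gs_banachI[OF gs_roumieu_smooth[OF g] spec[OF B]])
    have gB: "cmod (g y) \<le> B" for y using order_trans[OF norm_le_gs_norm[OF gb] gs_norm_le[OF spec[OF B]]] .
    have "cmod (LINT y|lborel. f y * g y) \<le> (LINT y|lborel. cmod (f y) * B)"
    proof (rule Bochner_Integration.integral_norm_bound_integral[OF int[OF g]])
      show "integrable lborel (\<lambda>y. cmod (f y) * B)" using f by (intro integrable_mult_left integrable_norm)
      show "cmod (f y * g y) \<le> cmod (f y) * B" for y unfolding norm_mult by (intro mult_left_mono gB) auto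
    qed
    then show "cmod (distr_of_fun f g) \<le> (LINT y|lborel. cmod (f y)) * B" using g by (simp add: distr_of_fun_def)
  qed
qed

lemma distr_of_dual_in_dual:
  fixes u :: "(real^'d::finite \<Rightarrow> complex) \<Rightarrow> complex"
  assumes X: "S_half \<subseteq> X" and u: "linear_on X u"
    and b: "\<And>h. 0 < h \<Longrightarrow> \<exists>h' C. 0 < C \<and> bounded_on X s t h' u \<and>
      (\<forall>(f :: real^'d \<Rightarrow> complex) \<mu>. gs_quot s t h' f \<mu> \<le> C * gs_quot (1/2) (1/2) h f \<mu>)"
  shows "distr_of_dual u \<in> S_half_dual"
  unfolding gs_roumieu_dual_iff
proof (intro conjI allI impI)
  show "distr_of_dual u \<in> extensional S_half" by (simp add: distr_of_dual_def)
  show "linear_on S_half (distr_of_dual u)"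
    unfolding linear_on_def
  proof (intro ballI allI)
    fix g k :: "real^'d \<Rightarrow> complex" and a b assume gk: "g \<in> S_half" "k \<in> S_half"
    show "distr_of_dual u (\<lambda>x. a * g x + b * k x) = a * distr_of_dual u g + b * distr_of_dual u k"
      using linear_onD[OF u subsetD[OF X gk(1)] subsetD[OF X gk(2)]]
      by (simp only: distr_of_dual_def restrict_apply' gk gs_roumieu_lin[OF gk])
  qed
  fix h :: real assume "0 < h"
  then obtain h' C where C: "0 < C" and bd: "bounded_on X s t h' u"
    and q: "\<And>(f :: real^'d \<Rightarrow> complex) \<mu>. gs_quot s t h' f \<mu> \<le> C * gs_quot (1/2) (1/2) h f \<mu>" using b by blast
  obtain K where K: "0 \<le> K" "\<forall>f\<in>X. \<forall>B. (\<forall>\<mu>. gs_quot s t h' f \<mu> \<le> B) \<longrightarrow> cmod (u f) \<le> K * B"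
    using bd unfolding bounded_on_def by blast
  show "bounded_on S_half (1/2) (1/2) h (distr_of_dual u)"
    unfolding bounded_on_def
  proof (intro exI conjI ballI allI impI)
    show "0 \<le> K * C" using K C by simp
    fix g :: "real^'d \<Rightarrow> complex" and B assume g: "g \<in> S_half" and B: "\<forall>\<mu>. gs_quot (1/2) (1/2) h g \<mu> \<le> B"
    have "gs_quot s t h' g \<mu> \<le> C * B" for \<mu>
      using order_trans[OF q mult_left_mono[OF spec[OF B]]] C by simp
    then have "cmod (u g) \<le> K * (C * B)" using K(2) subsetD[OF X g] by blast
    then show "cmod (distr_of_dual u g) \<le> K * C * B" using g by (simp add: distr_of_dual_def mult_ac)
  qed
qed

lemma distr_of_dual_roumieu:
  fixes u :: "(real^'d::finite \<Rightarrow> complex) \<Rightarrow> complex"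
  assumes st: "1 / 2 \<le> s" "1 / 2 \<le> t" and u: "u \<in> gs_roumieu_dual s t"
  shows "distr_of_dual u \<in> S_half_dual"
proof (rule distr_of_dual_in_dual[OF S_half_le_roumieu[OF st]])
  show "linear_on (gs_roumieu s t) u" using u by (simp add: gs_roumieu_dual_iff)
  show "\<exists>h' C. 0 < C \<and> bounded_on (gs_roumieu s t) s t h' u \<and>
      (\<forall>(f :: real^'d \<Rightarrow> complex) \<mu>. gs_quot s t h' f \<mu> \<le> C * gs_quot (1/2) (1/2) h f \<mu>)" if h: "0 < h" for h
  proof (intro exI conjI allI)
    show "(0::real) < 1" by simp
    show "bounded_on (gs_roumieu s t) s t h u" using u h by (simp add: gs_roumieu_dual_iff)
    show "gs_quot s t h f \<mu> \<le> 1 * gs_quot (1/2) (1/2) h f \<mu>" for f :: "real^'d \<Rightarrow> complex" and \<mu>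
      using gs_quot_mono[OF h order_refl st, of f \<mu>] by simp
  qed
qed

lemma distr_of_dual_beurling:
  fixes u :: "(real^'d::finite \<Rightarrow> complex) \<Rightarrow> complex"
  assumes st: "1 / 2 < s" "1 / 2 < t" and u: "u \<in> gs_beurling_dual s t"
  shows "distr_of_dual u \<in> S_half_dual"
proof (rule distr_of_dual_in_dual[OF S_half_le_beurling[OF st]])
  show "linear_on (gs_beurling s t) u" using u by (simp add: gs_beurling_dual_iff)
  obtain h' where h': "0 < h'" "bounded_on (gs_beurling s t) s t h' u" using u by (auto simp: gs_beurling_dual_iff)
  show "\<exists>h' C. 0 < C \<and> bounded_on (gs_beurling s t) s t h' u \<and>
      (\<forall>(f :: real^'d \<Rightarrow> complex) \<mu>. gs_quot s t h' f \<mu> \<le> C * gs_quot (1/2) (1/2) h f \<mu>)" if h: "0 < h" for h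
    by (rule gs_quot_gain[OF h h'(1) st]) (use h'(2) in blast)
qed

lemma S_half_functional:
  fixes u :: "(real^'d::finite \<Rightarrow> complex) \<Rightarrow> complex"
  assumes "u \<in> S_half_dual"
  obtains h K where "gs_functional (1/2) (1/2) h K S_half u"
  by (rule gs_functional_roumieu[OF order_refl order_refl assms zero_less_one])

lemma stft_measurable:
  assumes "u \<in> S_half_dual"
  shows "stft u \<in> borel_measurable borel"
proof -
  obtain h K where "gs_functional (1/2) (1/2) h K S_half u" by (rule S_half_functional[OF assms])
  from gs_functional.continuous_stft_u[OF this] show ?thesis by (rule borel_measurable_continuous_onI)
qed

lemma stft_bound_of_modulation_space:
  assumes B: "mixed_qnorm_space B" and st: "1 / 2 \<le> s" "1 / 2 \<le> t"
    and u: "u \<in> modulation_space (exp_weight s t r) B" and \<epsilon>: "0 < \<epsilon>"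
  obtains C where "0 < C" "\<And>z. cmod (stft u z) \<le> C * exp_weight s t (\<epsilon> - shifted_rate r) z"
proof -
  have ud: "u \<in> S_half_dual" and fin: "mixed_qnorm B (\<lambda>z. ennreal (cmod (stft u z * of_real (exp_weight s t r z)))) < \<infinity>"
    using u by (auto simp: modulation_space_def)
  obtain h K where f: "gs_functional (1/2) (1/2) h K S_half u" by (rule S_half_functional[OF ud])
  show thesis by (rule gs_functional.stft_bound_of_mixed_qnorm[OF f B st fin \<epsilon>]) (rule that)
qed

lemma modulation_spaceI:
  assumes B: "mixed_qnorm_space B" and st: "0 < s" "0 < t" and u: "u \<in> S_half_dual"
    and b: "\<And>z. cmod (stft u z) \<le> C * exp_weight s t r1 z" and r: "r1 + r < 0"
  shows "u \<in> modulation_space (exp_weight s t r) B"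
proof -
  obtain h K where f: "gs_functional (1/2) (1/2) h K S_half u" by (rule S_half_functional[OF u])
  show ?thesis unfolding modulation_space_def
    using gs_functional.mixed_qnorm_of_stft_bound[OF f B st b r] u by simp
qed

lemma S_half_dual_eqI:
  assumes "u \<in> S_half_dual" "v \<in> S_half_dual" "\<And>g. g \<in> S_half \<Longrightarrow> u g = v g"
  shows "u = v"
  by (rule extensionalityI[of _ S_half]) (use assms in \<open>auto simp: gs_roumieu_dual_iff\<close>)

text \<open>The integral of \<open>synth H\<close> against \<open>g\<close> is that of \<open>H\<close> against the transform of \<open>g\<close>, which for the transform
  of \<open>u\<close> is \<open>u g\<close> by the pairing identity.\<close>

lemma synth_represents:
  fixes u :: "(real^'d::finite \<Rightarrow> complex) \<Rightarrow> complex"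
  assumes u: "u \<in> S_half_dual" and pos: "0 < s" "0 < t" "0 < h" and b: "\<And>z. cmod (stft u z) \<le> A * exp_weight s t (- r1) z"
    and ac: "atom_control s t h r2 TYPE('d)" and r: "r2 < r1" "0 < r1"
  shows "synth (\<lambda>z. stft u (flip z)) \<in> gs_banach s t h" "distr_of_fun (synth (\<lambda>z. stft u (flip z))) = u"
proof -
  let ?H = "\<lambda>z. stft u (flip z)"
  have [measurable]: "stft u \<in> borel_measurable borel" by (rule stft_measurable[OF u])
  have Hm: "?H \<in> borel_measurable borel" by measurable
  have Hb: "cmod (?H z) \<le> A * exp_weight s t (- r1) z" for z using b[of "flip z"] by (simp add: exp_weight_flip)
  obtain C where C: "0 < C" "\<And>(z :: (real^'d) \<times> (real^'d)) \<mu>. gs_quot s t h (atom z) \<mu> \<le> C * exp_weight s t r2 z"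
    using ac unfolding atom_control_def by blast
  note S = synth_in_gs[OF pos Hm Hb C(2) r(1)]
  show gb: "synth ?H \<in> gs_banach s t h" by (rule gs_banachI[OF S(1,4)])
  have Hi: "integrable lborel ?H" by (rule integrable_of_weight_bound[OF pos(1,2) r(2) Hm Hb])
  show "distr_of_fun (synth ?H) = u"
  proof (rule S_half_dual_eqI[OF distr_of_fun_in_dual[OF gs_banach_integrable[OF pos(3) gb]] u])
    fix g :: "real^'d \<Rightarrow> complex" assume g: "g \<in> S_half"
    obtain hg where hg: "0 < hg" "g \<in> gs_banach (1/2) (1/2) hg" using g by (auto simp: gs_roumieu_def)
    obtain rg where rg: "0 < rg" "decay_control (1/2) (1/2) hg rg TYPE('d)"
      using decay_control_roumieu[of "1/2" "1/2" hg] hg by auto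
    obtain Ag where Ag: "\<And>z. cmod (stft_fun g z) \<le> Ag * exp_weight (1/2) (1/2) (- rg) z"
      by (rule stft_fun_decay_banach[OF hg(2) rg(2)]) blast
    have gi: "integrable lborel g" by (rule gs_banach_integrable[OF hg])
    have [measurable]: "stft_fun g \<in> borel_measurable borel"
      by (intro stft_fun_measurable smooth_fun_measurable0 gs_roumieu_smooth[OF g])
    have Vb: "cmod (stft_fun g z) \<le> \<bar>Ag\<bar>" for z
    proof -
      have "exp_weight (1/2) (1/2) (- rg) z \<le> 1" using rg by (simp add: exp_weight_def case_prod_unfold)
      then have "Ag * exp_weight (1/2) (1/2) (- rg) z \<le> \<bar>Ag\<bar> * 1"
        using exp_weight_pos[of "1/2" "1/2" "- rg" z] by (intro mult_mono) auto
      then show ?thesis using order_trans[OF Ag] by simp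
    qed
    have prod: "integrable lborel (\<lambda>z. F z * G z)" if "integrable lborel F" "G \<in> borel_measurable borel" "\<And>z. cmod (G z) \<le> \<bar>Ag\<bar>"
      for F G :: "(real^'d) \<times> (real^'d) \<Rightarrow> complex"
    proof (rule Bochner_Integration.integrable_bound[OF integrable_mult_left[OF that(1), of "complex_of_real \<bar>Ag\<bar>"]])
      have [measurable]: "F \<in> borel_measurable borel" "G \<in> borel_measurable borel"
        using borel_measurable_integrable[OF that(1)] that(2) by simp_all
      show "(\<lambda>z. F z * G z) \<in> borel_measurable lborel" by simp
      show "AE z in lborel. norm (F z * G z) \<le> norm (F z * complex_of_real \<bar>Ag\<bar>)"
        using that(3) by (intro AE_I2) (simp add: norm_mult mult_left_mono)
    qed
    have Ui: "integrable lborel (stft u)" by (rule integrable_of_weight_bound[OF pos(1,2) r(2) _ b]) measurable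
    have ff: "flip (flip z) = z" for z :: "(real^'d) \<times> (real^'d)" by (simp add: flip_def)
    have "distr_of_fun (synth ?H) g = (LINT y|lborel. synth ?H y * g y)" using g by (simp add: distr_of_fun_def)
    also have "\<dots> = (LINT z|lborel. stft u (flip z) * stft_fun g z)" by (rule synth_adjoint[OF Hi gi])
    also have "\<dots> = (LINT z|lborel. stft u (flip z) * stft_fun g (flip (flip z)))" by (simp only: ff)
    also have "\<dots> = (LINT z|lborel. stft u z * stft_fun g (flip z))"
    proof (rule integral_flip[of "\<lambda>z. stft u z * stft_fun g (flip z)"])
      show "integrable lborel (\<lambda>z. stft u z * stft_fun g (flip z))" by (rule prod[OF Ui _ Vb]) measurable
      show "integrable lborel (\<lambda>z. stft u (flip z) * stft_fun g (flip (flip z)))" unfolding ff by (rule prod[OF Hi _ Vb]) measurable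
    qed
    also have "\<dots> = (LINT z|lborel. stft_fun g (flip z) * stft u z)" by (simp only: mult.commute)
    also have "\<dots> = u g" by (rule pairing_roumieu[symmetric, OF _ _ u g]) auto
    finally show "distr_of_fun (synth ?H) g = u g" .
  qed
qed

text \<open>The right-hand side of the pairing identity on a test space \<open>X\<close> that may be larger than the domain of \<open>u\<close>.\<close>

definition extend_dual :: "(real^'d::finite \<Rightarrow> complex) set \<Rightarrow> ((real^'d \<Rightarrow> complex) \<Rightarrow> complex) \<Rightarrow> (real^'d \<Rightarrow> complex) \<Rightarrow> complex" where
  "extend_dual X u = restrict (\<lambda>g. LINT z|lborel. stft_fun g (flip z) * stft u z) X"

lemma stft_fun_lin:
  assumes f: "integrable lborel f" and g: "integrable lborel g"
  shows "stft_fun (\<lambda>x. a * f x + b * g x) z = a * stft_fun f z + b * stft_fun g z"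
proof -
  have i: "integrable lborel (\<lambda>y. k y * atom z y)" if k: "integrable lborel k" for k :: "real^'a \<Rightarrow> complex"
  proof (rule Bochner_Integration.integrable_bound[OF k])
    have [measurable]: "k \<in> borel_measurable borel" using borel_measurable_integrable[OF k] by simp
    show "(\<lambda>y. k y * atom z y) \<in> borel_measurable lborel" by simp
    show "AE y in lborel. norm (k y * atom z y) \<le> norm (k y)"
      unfolding norm_mult by (intro AE_I2 mult_right_le_one_le norm_atom_le_1) auto
  qed
  have "(LINT y|lborel. (a * f y + b * g y) * atom z y) = (LINT y|lborel. a * (f y * atom z y) + b * (g y * atom z y))"
    by (simp only: algebra_simps)
  also have "\<dots> = a * (LINT y|lborel. f y * atom z y) + b * (LINT y|lborel. g y * atom z y)"
    using i[OF f] i[OF g] by (subst Bochner_Integration.integral_add) auto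
  finally show ?thesis by (simp add: stft_fun_def algebra_simps)
qed

lemma pairing_integrand_bound:
  fixes u :: "(real^'d::finite \<Rightarrow> complex) \<Rightarrow> complex"
  assumes u: "u \<in> S_half_dual" and pos: "0 < s" "0 < t" and b: "\<And>z. cmod (stft u z) \<le> A * exp_weight s t r1 z"
    and r: "r1 < r" and g: "smooth_fun g" "\<And>z. cmod (stft_fun g z) \<le> N * exp_weight s t (- r) z"
  shows "integrable lborel (\<lambda>z. stft_fun g (flip z) * stft u z)"
    and "cmod (LINT z|lborel. stft_fun g (flip z) * stft u z) \<le>
      N * A * (LINT z|lborel. exp_weight s t (- (r - r1)) (z :: (real^'d) \<times> (real^'d)))"
proof -
  have [measurable]: "stft u \<in> borel_measurable borel" "stft_fun g \<in> borel_measurable borel"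
    using stft_measurable[OF u] stft_fun_measurable[OF smooth_fun_measurable0[OF g(1)]] by simp_all
  have le: "cmod (stft_fun g (flip z) * stft u z) \<le> N * A * exp_weight s t (- (r - r1)) z" for z
  proof -
    have "cmod (stft_fun g (flip z) * stft u z) \<le> (N * exp_weight s t (- r) z) * (A * exp_weight s t r1 z)"
      unfolding norm_mult using g(2)[of "flip z"] b[of z] norm_ge_zero
      by (intro mult_mono) (auto simp: exp_weight_flip intro: order_trans[OF norm_ge_zero])
    also have "\<dots> = N * A * (exp_weight s t (- r) z * exp_weight s t r1 z)" by (simp only: mult_ac)
    also have "\<dots> = N * A * exp_weight s t (- (r - r1)) z" by (simp only: exp_weight_mult) simp
    finally show ?thesis .
  qed
  have rr: "0 < r - r1" using r by simp
  show int: "integrable lborel (\<lambda>z. stft_fun g (flip z) * stft u z)"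
    by (rule integrable_of_weight_bound[OF pos rr _ le]) measurable
  have "cmod (LINT z|lborel. stft_fun g (flip z) * stft u z) \<le> (LINT z|lborel. N * A * exp_weight s t (- (r - r1)) (z :: (real^'d) \<times> (real^'d)))"
  proof (rule Bochner_Integration.integral_norm_bound_integral[OF int])
    show "integrable lborel (\<lambda>z :: (real^'d) \<times> (real^'d). N * A * exp_weight s t (- (r - r1)) z)"
      by (rule integrable_mult_right[OF integrable_exp_weight[OF pos rr]])
  qed (rule le)
  then show "cmod (LINT z|lborel. stft_fun g (flip z) * stft u z) \<le>
      N * A * (LINT z|lborel. exp_weight s t (- (r - r1)) (z :: (real^'d) \<times> (real^'d)))"
    unfolding integral_mult_right_zero .
qed

lemma bounded_on_extend_dual:
  fixes u :: "(real^'d::finite \<Rightarrow> complex) \<Rightarrow> complex"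
  assumes u: "u \<in> S_half_dual" and pos: "0 < s" "0 < t" and b: "\<And>z. cmod (stft u z) \<le> A * exp_weight s t r1 z"
    and r: "r1 < r" and dc: "decay_control s t h r TYPE('d)" and X: "\<And>f. f \<in> X \<Longrightarrow> smooth_fun f"
  shows "bounded_on X s t h (extend_dual X u)"
proof -
  define I where "I = (LINT z|lborel. exp_weight s t (- (r - r1)) (z :: (real^'d) \<times> (real^'d)))"
  have I: "0 \<le> I" unfolding I_def by (rule Bochner_Integration.integral_nonneg) (rule less_imp_le[OF exp_weight_pos])
  have A: "0 \<le> A"
    using order_trans[OF norm_ge_zero b[of 0]] exp_weight_pos[of s t r1 "0 :: (real^'d) \<times> (real^'d)"] by (simp add: zero_le_mult_iff)
  obtain C where C: "0 < C" "\<And>(f :: real^'d \<Rightarrow> complex) N z. smooth_fun f \<Longrightarrow> (\<forall>\<mu>. gs_quot s t h f \<mu> \<le> N) \<Longrightarrow>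
      cmod (stft_fun f z) \<le> C * N * exp_weight s t (- r) z"
    using dc unfolding decay_control_def by blast
  show ?thesis
    unfolding bounded_on_def
  proof (intro exI conjI ballI allI impI)
    show "0 \<le> C * A * I" using C A I by simp
    fix g B assume g: "g \<in> X" and B: "\<forall>\<mu>. gs_quot s t h g \<mu> \<le> B"
    have "cmod (LINT z|lborel. stft_fun g (flip z) * stft u z) \<le> C * B * A * I"
      unfolding I_def by (rule pairing_integrand_bound(2)[OF u pos b r X[OF g] C(2)[OF X[OF g] B]])
    then show "cmod (extend_dual X u g) \<le> C * A * I * B" using g by (simp add: extend_dual_def mult_ac)
  qed
qed

lemma linear_on_extend_dual:
  fixes u :: "(real^'d::finite \<Rightarrow> complex) \<Rightarrow> complex"
  assumes u: "u \<in> S_half_dual" and pos: "0 < s" "0 < t"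
    and X: "\<And>f. f \<in> X \<Longrightarrow> smooth_fun f" "\<And>f g a b. f \<in> X \<Longrightarrow> g \<in> X \<Longrightarrow> (\<lambda>x. a * f x + b * g x) \<in> X"
    and d: "\<And>g. g \<in> X \<Longrightarrow> \<exists>h r r1 A. 0 < h \<and> g \<in> gs_banach s t h \<and> decay_control s t h r TYPE('d) \<and> r1 < r \<and>
      (\<forall>z. cmod (stft u z) \<le> A * exp_weight s t r1 z)"
  shows "linear_on X (extend_dual X u)"
  unfolding linear_on_def
proof (intro ballI allI)
  have *: "integrable lborel g \<and> integrable lborel (\<lambda>z. stft_fun g (flip z) * stft u z)" if gX: "g \<in> X" for g
  proof -
    obtain h r r1 A where g: "0 < h" "g \<in> gs_banach s t h" "decay_control s t h r TYPE('d)" "r1 < r"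
      and b: "\<And>z. cmod (stft u z) \<le> A * exp_weight s t r1 z" using d[OF gX] by blast
    obtain N where N: "\<And>z. cmod (stft_fun g z) \<le> N * exp_weight s t (- r) z"
      by (rule stft_fun_decay_banach[OF g(2,3)]) blast
    show ?thesis using gs_banach_integrable[OF g(1,2)] pairing_integrand_bound(1)[OF u pos b g(4) X(1)[OF gX] N] by blast
  qed
  fix f g a b assume fg: "f \<in> X" "g \<in> X"
  have "(LINT z|lborel. stft_fun (\<lambda>x. a * f x + b * g x) (flip z) * stft u z) =
      (LINT z|lborel. a * (stft_fun f (flip z) * stft u z) + b * (stft_fun g (flip z) * stft u z))"
    unfolding stft_fun_lin[OF conjunct1[OF *[OF fg(1)]] conjunct1[OF *[OF fg(2)]]] by (simp only: algebra_simps)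
  also have "\<dots> = a * (LINT z|lborel. stft_fun f (flip z) * stft u z) + b * (LINT z|lborel. stft_fun g (flip z) * stft u z)"
    using *[OF fg(1)] *[OF fg(2)] by (subst Bochner_Integration.integral_add) auto
  finally show "extend_dual X u (\<lambda>x. a * f x + b * g x) = a * extend_dual X u f + b * extend_dual X u g"
    using fg X(2)[OF fg] by (simp add: extend_dual_def)
qed

lemma distr_of_dual_extend_dual:
  fixes u :: "(real^'d::finite \<Rightarrow> complex) \<Rightarrow> complex"
  assumes u: "u \<in> S_half_dual" and X: "S_half \<subseteq> X"
  shows "distr_of_dual (extend_dual X u) = u"
proof (rule extensionalityI[of _ S_half])
  show "distr_of_dual (extend_dual X u) \<in> extensional S_half" by (simp add: distr_of_dual_def)
  show "u \<in> extensional S_half" using u by (simp add: gs_roumieu_dual_iff)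
  fix g :: "real^'d \<Rightarrow> complex" assume g: "g \<in> S_half"
  have "u g = (LINT z|lborel. stft_fun g (flip z) * stft u z)" by (rule pairing_roumieu[OF _ _ u g]) auto
  then show "distr_of_dual (extend_dual X u) g = u g" using g X by (auto simp: distr_of_dual_def extend_dual_def)
qed

section \<open>Identification with modulation spaces\<close>

text \<open>Inversion recovers the function from the transform of its distribution.\<close>

lemma distr_of_fun_inj:
  fixes X :: "(real^'d::finite \<Rightarrow> complex) set"
  assumes st: "1 / 2 \<le> s" "1 / 2 \<le> t" and X: "X \<subseteq> gs_roumieu s t"
  shows "inj_on distr_of_fun X"
proof (rule inj_onI)
  fix f g assume fg: "f \<in> X" "g \<in> X" and eq: "distr_of_fun f = distr_of_fun g"
  have pos: "0 < s" "0 < t" using st by auto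
  have "k = synth (\<lambda>z. stft_fun k (flip z))" if "k \<in> X" for k
  proof -
    have "k \<in> gs_roumieu s t" using X that by blast
    then obtain h where h: "0 < h" "k \<in> gs_banach s t h" by (auto simp: gs_roumieu_def)
    obtain r where r: "0 < r" "decay_control s t h r TYPE('d)" using decay_control_roumieu[OF st h(1)] by blast
    show ?thesis by (rule stft_fun_inversion[OF h r(2) pos r(1)])
  qed
  moreover have "stft_fun f = stft_fun g" using arg_cong[OF eq, of stft] by (simp only: stft_distr_of_fun)
  ultimately show "f = g" using fg by metis
qed

lemma shifted_rate_at:
  shows "0 < r \<Longrightarrow> shifted_rate r = r / 4" "r < 0 \<Longrightarrow> shifted_rate r = 4 * r"
  by (auto simp: shifted_rate_def)

text \<open>A transform of finite quasi-norm with weight of rate \<open>r\<close> decays with rate \<open>r / 4 - \<epsilon>\<close>; with \<open>\<epsilon> = r / 8\<close> there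
  remains the rate \<open>r / 8\<close>, against which the atoms are synthesised at a level where they grow with half of it.\<close>

lemma gs_roumieu_eq_modulation_spaces:
  fixes B :: "(ennreal \<times> ((real^'d::finite) \<times> (real^'d)) set) list"
  assumes B: "mixed_qnorm_space B" and st: "1 / 2 \<le> s" "1 / 2 \<le> t"
  shows "bij_betw distr_of_fun (gs_roumieu s t) (\<Union>r\<in>{0<..}. modulation_space (exp_weight s t r) B)"
  unfolding bij_betw_def
proof (intro conjI distr_of_fun_inj[OF st] order_refl equalityI subsetI)
  have pos: "0 < s" "0 < t" using st by auto
  fix u :: "(real^'d \<Rightarrow> complex) \<Rightarrow> complex" assume "u \<in> distr_of_fun ` gs_roumieu s t"
  then obtain f h where h: "0 < h" "f \<in> gs_banach s t h" and u: "u = distr_of_fun f" by (auto simp: gs_roumieu_def)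
  obtain r where r: "0 < r" "decay_control s t h r TYPE('d)" using decay_control_roumieu[OF st h(1)] by blast
  obtain A where A: "\<And>z. cmod (stft_fun f z) \<le> A * exp_weight s t (- r) z"
    by (rule stft_fun_decay_banach[OF h(2) r(2)]) blast
  have "u \<in> modulation_space (exp_weight s t (r / 2)) B"
    by (rule modulation_spaceI[OF B pos _ , of _ A "- r"])
       (use A r distr_of_fun_in_dual[OF gs_banach_integrable[OF h]] in \<open>simp_all add: u stft_distr_of_fun\<close>)
  moreover have "r / 2 \<in> {0<..}" using r by simp
  ultimately show "u \<in> (\<Union>r\<in>{0<..}. modulation_space (exp_weight s t r) B)" by (rule UN_I[rotated])
next
  have pos: "0 < s" "0 < t" using st by auto
  fix u :: "(real^'d \<Rightarrow> complex) \<Rightarrow> complex" assume "u \<in> (\<Union>r\<in>{0<..}. modulation_space (exp_weight s t r) B)"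
  then obtain r where r: "0 < r" and u: "u \<in> modulation_space (exp_weight s t r) B" by auto
  have ud: "u \<in> S_half_dual" using u by (simp add: modulation_space_def)
  have r8: "0 < r / 8" "0 < r / 16" "r / 16 < r / 8" using r by auto
  obtain C where "\<And>z. cmod (stft u z) \<le> C * exp_weight s t (r / 8 - shifted_rate r) z"
    by (rule stft_bound_of_modulation_space[OF B st u r8(1)]) blast
  moreover have "r / 8 - shifted_rate r = - (r / 8)" using r by (simp add: shifted_rate_at)
  ultimately have b: "\<And>z. cmod (stft u z) \<le> C * exp_weight s t (- (r / 8)) z" by simp
  obtain h where h: "0 < h" "atom_control s t h (r / 16) TYPE('d)" using atom_control_roumieu[OF st r8(2)] by blast
  note S = synth_represents[OF ud pos h(1) b h(2) r8(3,1)]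
  have "synth (\<lambda>z. stft u (flip z)) \<in> gs_roumieu s t" using S(1) h(1) by (auto simp: gs_roumieu_def)
  with S(2)[symmetric] show "u \<in> distr_of_fun ` gs_roumieu s t" by (rule image_eqI)
qed

text \<open>For every level the atoms grow with some rate \<open>r\<close>, and the transform decays faster since it has finite
  quasi-norm for all rates. The synthesised function is the same for all levels.\<close>

lemma gs_beurling_eq_modulation_spaces:
  fixes B :: "(ennreal \<times> ((real^'d::finite) \<times> (real^'d)) set) list"
  assumes B: "mixed_qnorm_space B" and st: "1 / 2 < s" "1 / 2 < t"
  shows "bij_betw distr_of_fun (gs_beurling s t) (\<Inter>r\<in>{0<..}. modulation_space (exp_weight s t r) B)"
  unfolding bij_betw_def
proof (intro conjI equalityI subsetI)
  have st': "1 / 2 \<le> s" "1 / 2 \<le> t" using st by auto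
  have "gs_beurling s t \<subseteq> (gs_roumieu s t :: (real^'d \<Rightarrow> complex) set)"
  proof
    fix f :: "real^'d \<Rightarrow> complex" assume "f \<in> gs_beurling s t"
    then have "f \<in> gs_banach s t 1" unfolding gs_beurling_def by (rule INT_D) simp
    then show "f \<in> gs_roumieu s t" unfolding gs_roumieu_def by (rule UN_I[rotated]) simp
  qed
  then show "inj_on distr_of_fun (gs_beurling s t :: (real^'d \<Rightarrow> complex) set)" by (rule distr_of_fun_inj[OF st'])
next
  have pos: "0 < s" "0 < t" using st by auto
  fix u :: "(real^'d \<Rightarrow> complex) \<Rightarrow> complex" assume "u \<in> distr_of_fun ` gs_beurling s t"
  then obtain f where f: "f \<in> gs_beurling s t" and u: "u = distr_of_fun f" by auto
  show "u \<in> (\<Inter>r\<in>{0<..}. modulation_space (exp_weight s t r) B)"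
  proof (rule INT_I)
    fix r :: real assume "r \<in> {0<..}"
    obtain h where h: "0 < h" "decay_control s t h (r + 1) TYPE('d)" using decay_control_beurling[OF st] by blast
    have fh: "f \<in> gs_banach s t h" using f h by (auto simp: gs_beurling_def)
    obtain A where A: "\<And>z. cmod (stft_fun f z) \<le> A * exp_weight s t (- (r + 1)) z"
      by (rule stft_fun_decay_banach[OF fh h(2)]) blast
    show "u \<in> modulation_space (exp_weight s t r) B"
      by (rule modulation_spaceI[OF B pos _ , of _ A "- (r + 1)"])
         (use A distr_of_fun_in_dual[OF gs_banach_integrable[OF h(1) fh]] in \<open>simp_all add: u stft_distr_of_fun\<close>)
  qed
next
  have st': "1 / 2 \<le> s" "1 / 2 \<le> t" and pos: "0 < s" "0 < t" using st by auto
  fix u :: "(real^'d \<Rightarrow> complex) \<Rightarrow> complex" assume u: "u \<in> (\<Inter>r\<in>{0<..}. modulation_space (exp_weight s t r) B)"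
  have "u \<in> modulation_space (exp_weight s t 1) B" using u by (rule INT_D) simp
  then have ud: "u \<in> S_half_dual" by (simp add: modulation_space_def)
  have S: "synth (\<lambda>z. stft u (flip z)) \<in> gs_banach s t h \<and> distr_of_fun (synth (\<lambda>z. stft u (flip z))) = u" if h: "0 < h" for h
  proof -
    obtain r where r: "0 < r" "atom_control s t h r TYPE('d)" using atom_control_beurling[OF st h] by blast
    \<comment> \<open>chosen such that a quarter of it exceeds the required rate \<open>2 * r\<close> by one\<close>
    define q where "q = 8 * r + 4"
    have q: "0 < q" "shifted_rate q = 2 * r + 1" using r by (simp_all add: q_def shifted_rate_at)
    have "u \<in> modulation_space (exp_weight s t q) B" using u by (rule INT_D) (use q in simp)
    then obtain C where b: "\<And>z. cmod (stft u z) \<le> C * exp_weight s t (1 - shifted_rate q) z"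
      by (rule stft_bound_of_modulation_space[OF B st' _ zero_less_one]) blast
    have "1 - shifted_rate q = - (2 * r)" using q by simp
    then have b': "\<And>z. cmod (stft u z) \<le> C * exp_weight s t (- (2 * r)) z" using b by simp
    have rr: "r < 2 * r" "0 < 2 * r" using r by auto
    show ?thesis using synth_represents[OF ud pos h b' r(2) rr] by blast
  qed
  have "synth (\<lambda>z. stft u (flip z)) \<in> gs_beurling s t" using S by (auto simp: gs_beurling_def)
  with conjunct2[OF S[OF zero_less_one], symmetric] show "u \<in> distr_of_fun ` gs_beurling s t" by (rule image_eqI)
qed

text \<open>Boundedness at all levels means growth of the transform with all positive rates. In the reverse direction,
  every level has a positive rate of decay of test functions, and the transform of the given functional grows with
  half of it.\<close>

lemma gs_roumieu_dual_eq_modulation_spaces: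
  fixes B :: "(ennreal \<times> ((real^'d::finite) \<times> (real^'d)) set) list"
  assumes B: "mixed_qnorm_space B" and st: "1 / 2 \<le> s" "1 / 2 \<le> t"
  shows "bij_betw distr_of_dual (gs_roumieu_dual s t) (\<Inter>r\<in>{..<0}. modulation_space (exp_weight s t r) B)"
  unfolding bij_betw_def
proof (intro conjI equalityI subsetI)
  show "inj_on distr_of_dual (gs_roumieu_dual s t :: ((real^'d \<Rightarrow> complex) \<Rightarrow> complex) set)"
  proof (rule inj_onI)
    fix u v :: "(real^'d \<Rightarrow> complex) \<Rightarrow> complex"
    assume uv: "u \<in> gs_roumieu_dual s t" "v \<in> gs_roumieu_dual s t" and eq: "distr_of_dual u = distr_of_dual v"
    have V: "stft u = stft v" using arg_cong[OF eq, of stft] by (simp only: stft_distr_of_dual)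
    show "u = v"
    proof (rule extensionalityI[of _ "gs_roumieu s t"])
      fix g :: "real^'d \<Rightarrow> complex" assume g: "g \<in> gs_roumieu s t"
      show "u g = v g" by (simp only: pairing_roumieu[OF st uv(1) g] pairing_roumieu[OF st uv(2) g] V)
    qed (use uv in \<open>simp_all add: gs_roumieu_dual_iff\<close>)
  qed
next
  have pos: "0 < s" "0 < t" using st by auto
  fix w :: "(real^'d \<Rightarrow> complex) \<Rightarrow> complex" assume "w \<in> distr_of_dual ` (gs_roumieu_dual s t :: ((real^'d \<Rightarrow> complex) \<Rightarrow> complex) set)"
  then obtain u where u: "u \<in> gs_roumieu_dual s t" and w: "w = distr_of_dual u" by auto
  show "w \<in> (\<Inter>r\<in>{..<0}. modulation_space (exp_weight s t r) B)"
  proof (rule INT_I)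
    fix r :: real assume "r \<in> {..<0}"
    then have r: "0 < - r / 2" "- r / 2 + r < 0" by auto
    obtain h K where f: "gs_functional s t h K (gs_roumieu s t) u" and ac: "atom_control s t h (- r / 2) TYPE('d)"
      by (rule gs_functional_roumieu[OF st u r(1)])
    obtain A where A: "\<And>z. cmod (stft u z) \<le> A * exp_weight s t (- r / 2) z"
      by (rule gs_functional.stft_bound_of_atom_control[OF f ac]) blast
    show "w \<in> modulation_space (exp_weight s t r) B"
      by (rule modulation_spaceI[OF B pos _ _ r(2)])
         (use A distr_of_dual_roumieu[OF st u] in \<open>simp_all add: w stft_distr_of_dual\<close>)
  qed
next
  have pos: "0 < s" "0 < t" using st by auto
  fix w :: "(real^'d \<Rightarrow> complex) \<Rightarrow> complex" assume w: "w \<in> (\<Inter>r\<in>{..<0}. modulation_space (exp_weight s t r) B)"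
  have "w \<in> modulation_space (exp_weight s t (- 1)) B" using w by (rule INT_D) simp
  then have wd: "w \<in> S_half_dual" by (simp add: modulation_space_def)
  have b: "\<exists>A. \<forall>z. cmod (stft w z) \<le> A * exp_weight s t r z" if r: "0 < r" for r
  proof -
    have "w \<in> modulation_space (exp_weight s t (- (r / 8))) B" using w by (rule INT_D) (use r in simp)
    moreover have "0 < r / 2" using r by simp
    ultimately obtain A where "\<And>z. cmod (stft w z) \<le> A * exp_weight s t (r / 2 - shifted_rate (- (r / 8))) z"
      by (rule stft_bound_of_modulation_space[OF B st]) blast
    moreover have "r / 2 - shifted_rate (- (r / 8)) = r" using r by (simp add: shifted_rate_at)
    ultimately show ?thesis by metis
  qed
  let ?X = "gs_roumieu s t :: (real^'d \<Rightarrow> complex) set"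
  have "linear_on ?X (extend_dual ?X w)"
  proof (rule linear_on_extend_dual[OF wd pos gs_roumieu_smooth gs_roumieu_lin])
    fix g assume "g \<in> ?X"
    then obtain h where h: "0 < h" "g \<in> gs_banach s t h" by (auto simp: gs_roumieu_def)
    obtain r where r: "0 < r" "decay_control s t h r TYPE('d)" using decay_control_roumieu[OF st h(1)] by blast
    obtain A where "\<forall>z. cmod (stft w z) \<le> A * exp_weight s t (r / 2) z" using b[of "r / 2"] r by auto
    moreover have "r / 2 < r" using r by simp
    ultimately show "\<exists>h r r1 A. 0 < h \<and> g \<in> gs_banach s t h \<and> decay_control s t h r TYPE('d) \<and> r1 < r \<and>
      (\<forall>z. cmod (stft w z) \<le> A * exp_weight s t r1 z)" using h r by blast
  qed
  moreover have "bounded_on ?X s t h (extend_dual ?X w)" if h: "0 < h" for h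
  proof -
    obtain r where r: "0 < r" "decay_control s t h r TYPE('d)" using decay_control_roumieu[OF st h] by blast
    obtain A where A: "\<And>z. cmod (stft w z) \<le> A * exp_weight s t (r / 2) z" using b[of "r / 2"] r by auto
    have "r / 2 < r" using r by simp
    from bounded_on_extend_dual[OF wd pos A this r(2) gs_roumieu_smooth] show ?thesis .
  qed
  moreover have "extend_dual ?X w \<in> extensional ?X" by (simp add: extend_dual_def)
  ultimately have "extend_dual ?X w \<in> gs_roumieu_dual s t" by (simp add: gs_roumieu_dual_iff)
  with distr_of_dual_extend_dual[OF wd S_half_le_roumieu[OF st], symmetric]
  show "w \<in> distr_of_dual ` gs_roumieu_dual s t" by (rule image_eqI)
qed

text \<open>Boundedness at one level means growth of the transform with some rate. In the reverse direction, test
  functions decay with any prescribed rate at a suitable level.\<close>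

lemma gs_beurling_dual_eq_modulation_spaces:
  fixes B :: "(ennreal \<times> ((real^'d::finite) \<times> (real^'d)) set) list"
  assumes B: "mixed_qnorm_space B" and st: "1 / 2 < s" "1 / 2 < t"
  shows "bij_betw distr_of_dual (gs_beurling_dual s t) (\<Union>r\<in>{..<0}. modulation_space (exp_weight s t r) B)"
  unfolding bij_betw_def
proof (intro conjI equalityI subsetI)
  show "inj_on distr_of_dual (gs_beurling_dual s t :: ((real^'d \<Rightarrow> complex) \<Rightarrow> complex) set)"
  proof (rule inj_onI)
    fix u v :: "(real^'d \<Rightarrow> complex) \<Rightarrow> complex"
    assume uv: "u \<in> gs_beurling_dual s t" "v \<in> gs_beurling_dual s t" and eq: "distr_of_dual u = distr_of_dual v"
    have V: "stft u = stft v" using arg_cong[OF eq, of stft] by (simp only: stft_distr_of_dual)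
    show "u = v"
    proof (rule extensionalityI[of _ "gs_beurling s t"])
      fix g :: "real^'d \<Rightarrow> complex" assume g: "g \<in> gs_beurling s t"
      show "u g = v g" by (simp only: pairing_beurling[OF st uv(1) g] pairing_beurling[OF st uv(2) g] V)
    qed (use uv in \<open>simp_all add: gs_beurling_dual_iff\<close>)
  qed
next
  have pos: "0 < s" "0 < t" using st by auto
  fix w :: "(real^'d \<Rightarrow> complex) \<Rightarrow> complex" assume "w \<in> distr_of_dual ` (gs_beurling_dual s t :: ((real^'d \<Rightarrow> complex) \<Rightarrow> complex) set)"
  then obtain u where u: "u \<in> gs_beurling_dual s t" and w: "w = distr_of_dual u" by auto
  obtain h K r where r: "0 < r" and f: "gs_functional s t h K (gs_beurling s t) u" and ac: "atom_control s t h r TYPE('d)"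
    by (rule gs_functional_beurling[OF st u])
  obtain A where A: "\<And>z. cmod (stft u z) \<le> A * exp_weight s t r z"
    by (rule gs_functional.stft_bound_of_atom_control[OF f ac]) blast
  have rr: "r + - (2 * r) < 0" "- (2 * r) \<in> {..<0}" using r by auto
  have "w \<in> modulation_space (exp_weight s t (- (2 * r))) B"
    by (rule modulation_spaceI[OF B pos _ _ rr(1)])
       (use A distr_of_dual_beurling[OF st u] in \<open>simp_all add: w stft_distr_of_dual\<close>)
  with rr(2) show "w \<in> (\<Union>r\<in>{..<0}. modulation_space (exp_weight s t r) B)" by (rule UN_I)
next
  have st': "1 / 2 \<le> s" "1 / 2 \<le> t" and pos: "0 < s" "0 < t" using st by auto
  fix w :: "(real^'d \<Rightarrow> complex) \<Rightarrow> complex" assume "w \<in> (\<Union>r\<in>{..<0}. modulation_space (exp_weight s t r) B)"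
  then obtain r where r: "r < 0" and w: "w \<in> modulation_space (exp_weight s t r) B" by auto
  have wd: "w \<in> S_half_dual" using w by (simp add: modulation_space_def)
  obtain A where A: "\<And>z. cmod (stft w z) \<le> A * exp_weight s t (1 - shifted_rate r) z"
    by (rule stft_bound_of_modulation_space[OF B st' w zero_less_one]) blast
  define q where "q = 2 - shifted_rate r"
  have q: "1 - shifted_rate r < q" by (simp add: q_def)
  obtain h where h: "0 < h" "decay_control s t h q TYPE('d)" using decay_control_beurling[OF st] by blast
  let ?X = "gs_beurling s t :: (real^'d \<Rightarrow> complex) set"
  have "linear_on ?X (extend_dual ?X w)"
  proof (rule linear_on_extend_dual[OF wd pos gs_beurling_smooth gs_beurling_lin])
    fix g assume "g \<in> ?X"
    then have "g \<in> gs_banach s t h" using h by (auto simp: gs_beurling_def)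
    then show "\<exists>h r r1 A. 0 < h \<and> g \<in> gs_banach s t h \<and> decay_control s t h r TYPE('d) \<and> r1 < r \<and>
      (\<forall>z. cmod (stft w z) \<le> A * exp_weight s t r1 z)" using h q A by blast
  qed
  moreover have "bounded_on ?X s t h (extend_dual ?X w)"
    using bounded_on_extend_dual[OF wd pos A q h(2) gs_beurling_smooth] .
  moreover have "extend_dual ?X w \<in> extensional ?X" by (simp add: extend_dual_def)
  ultimately have "extend_dual ?X w \<in> gs_beurling_dual s t" using h(1) unfolding gs_beurling_dual_iff by blast
  with distr_of_dual_extend_dual[OF wd S_half_le_beurling[OF st], symmetric]
  show "w \<in> distr_of_dual ` gs_beurling_dual s t" by (rule image_eqI)
qed

theorem proposition6p5:
  fixes B :: "(ennreal \<times> ((real^'d::finite) \<times> (real^'d)) set) list" and s t :: real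
  assumes "mixed_qnorm_space B"
  shows "(s \<ge> 1/2 \<and> t \<ge> 1/2 \<longrightarrow>
      bij_betw distr_of_fun (gs_roumieu s t) (\<Union>r\<in>{0<..}. modulation_space (exp_weight s t r) B) \<and>
      bij_betw distr_of_dual (gs_roumieu_dual s t) (\<Inter>r\<in>{..<0}. modulation_space (exp_weight s t r) B))
    \<and> (s > 1/2 \<and> t > 1/2 \<longrightarrow>
      bij_betw distr_of_fun (gs_beurling s t) (\<Inter>r\<in>{0<..}. modulation_space (exp_weight s t r) B) \<and>
      bij_betw distr_of_dual (gs_beurling_dual s t) (\<Union>r\<in>{..<0}. modulation_space (exp_weight s t r) B))"
  using gs_roumieu_eq_modulation_spaces[OF assms] gs_roumieu_dual_eq_modulation_spaces[OF assms]
    gs_beurling_eq_modulation_spaces[OF assms] gs_beurling_dual_eq_modulation_spaces[OF assms] by blast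

end
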